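(* Consider the random fibred system of Lasota–Yorke maps described in the context, and the observable $\phi(x)=g(\mathrm{dist}(x,z))$, where $g$ has one of the three types described in the context and $z\in I$ is chosen $m$-almost everywhere. Let $X_k=\phi\circ f_\omega^k$, $k\in\mathbb N_0$, on the probability space $(I,\mathcal B,\mu_\omega)$, and let $u_n=\inf\{u\in\mathbb R:\mu_I(\{x\in I:\phi(x)\le u\})\ge1-\tau/n\}$ for some $\tau>0$. Then, for $\mathbb Q$-almost every $\omega\in\Omega$, the POT and AOT marked rare event point processes $a_nA_n$ both converge in distribution (under $\mu_\omega$), as $n\to\infty$, to a compound Poisson process with intensity $\theta=1$ and multiplicity distribution $$\pi(x)=\begin{cases}1-e^{-x}, & \text{when }g\text{ is of type 1 and }a_n=h(u_n)^{-1},\\ 1-(1+x)^{-\beta}, & \text{when }g\text{ is of type 2 and }a_n=u_n^{-1},\\ 1-(1-x)^{\gamma}, & \text{when }g\text{ is of type 3 and }a_n=(D-u_n)^{-1}.\end{cases}$$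
   Context: **Fibred system.** $I=[0,1]$ with Borel $\sigma$-algebra $\mathcal B$ and Lebesgue measure $m$. $\mathrm{var}(g)$ is the infimum of the total variations over all versions of $g\in L^1(m)$, and $\|h\|_{BV}=\mathrm{var}(h)+\|h\|_1$. Let $Y=\{1,\ldots,r\}$ be a finite alphabet, $\Omega=Y^{\mathbb Z}$, $\sigma$ the bilateral shift, $\mathbb Q$ a (non-atomic) Bernoulli measure on $\Omega$ with weights $p_1,\ldots,p_r$. To each letter is associated a piecewise $C^2$ map of $[0,1]$; $f_\omega=f_{\omega_1}$ is the map associated with the symbol $\omega_1$ and $f_\omega^k=f_{\sigma^{k-1}\omega}\circ\cdots\circ f_\omega=f_{\omega_k}\circ\cdots\circ f_{\omega_1}$, $f_\omega^0=\mathrm{id}$. Assume: $\sup_\omega N(f_\omega)<\infty$ ($N(f)$ = number of intervals of monotonicity), $\inf_\omega\operatorname{ess\,inf}|f_\omega'|>1$, $\sup_\omega|f_\omega''|_\infty<\infty$. Let $\mathcal P_\omega$ be the transfer (Perron–Frobenius) operator of $f_\omega$ with respect to $m$ and $\mathcal P_\omega^{k}=\mathcal P_{\sigma^{k-1}\omega}\circ\cdots\circ\mathcal P_\omega$; $(\omega,x)\mapsto(\mathcal P_\omega H(\omega,\cdot))(x)$ is measurable for every $\mathbb Q\times m$-measurable $H$ with $H(\omega,\cdot)\in L^1(m)$ a.e. Assume further: (i) for every subinterval $J\subset I$ there is $k=k(J)$ with $f_\omega^k(J)=I$ for a.e. $\omega$; (ii) there is $N\in\mathbb N$ such that for each $a>0$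 and any sufficiently large $n\in\mathbb N$ there is $c>0$ with $\operatorname{ess\,inf}\mathcal P_\omega^{Nn}h\ge\frac c2\|h\|_1$ for every $h\in C_a=\{\phi\in BV:\phi\ge0,\ \mathrm{var}(\phi)\le a\int\phi\,dm\}$ and a.e. $\omega$. Under these assumptions there is a unique measurable nonnegative $h:\Omega\times I\to\mathbb R$ such that $h_\omega=h(\omega,\cdot)\in BV$, $\int h_\omega\,dm=1$, $\mathcal P_\omega h_\omega=h_{\sigma\omega}$ for a.e. $\omega$ and $\operatorname{ess\,sup}_\omega\|h_\omega\|_{BV}<\infty$. Put $d\mu_\omega=h_\omega\,dm$ (so the push-forward of $\mu_\omega$ by $f_\omega$ is $\mu_{\sigma\omega}$) and $\mu_I(B)=\int_\Omega\mu_\omega(B)\,d\mathbb Q(\omega)$. **Observable.** $g:[0,+\infty)\to\mathbb R\cup\{+\infty\}$ has a global maximum at $0$ ($g(0)=+\infty$ allowed), is a strictly decreasing bijection (homeomorphism $g:V\to W$) in a neighbourhood $V$ of $0$, and is of one of the types: Type 1: there is a strictly positive $h:W\to\mathbb R$ with $\lim_{s\to g(0)}g^{-1}(s+yh(s))/g^{-1}(s)=e^{-y}$ for all $y\in\mathbb R$; Type 2: $g(0)=+\infty$ and there is $\beta>0$ with $\lim_{s\to+\infty}g^{-1}(sy)/g^{-1}(s)=y^{-\beta}$ for all $y>0$; Type 3: $g(0)=D<+\infty$ and there is $\gamma>0$ with $\lim_{s\to0}g^{-1}(D-sy)/g^{-1}(D-s)=y^\gamma$ for all $y>0$ (in this case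 $\pi(x)=1$ for $x\ge1$). **The processes.** All thresholds are $u_{n,i}=u_n$ and there is no clustering ($q=0$), so every exceedance forms its own cluster and the POT and AOT processes coincide: with $v_n=n/\sum_{i=0}^{n-1}\mu_\omega(X_i>u_n)$ and $J$ a finite union of intervals $[a,b)\subset[0,\infty)$, $$A_n(J)=\sum_{i\in v_nJ\cap\mathbb N_0}(X_i-u_n)_+,\qquad v_nJ=\{v_nt:t\in J\}.$$ **Compound Poisson process of intensity $\theta$ and multiplicity d.f. $\pi$.** $A(J)=\sum_{i\ge1}D_i\mathbf 1_J(E_1+\cdots+E_i)$ with $E_1,E_2,\ldots$ i.i.d. exponential of mean $1/\theta$ and, independently, $D_1,D_2,\ldots$ i.i.d. with d.f. $\pi$. **Convergence.** $a_nA_n\to A$ in distribution means: for every $\varsigma$ and disjoint intervals $I_1,\ldots,I_\varsigma$ of the form $[a,b)\subset[0,\infty)$, $(a_nA_n(I_1),\ldots,a_nA_n(I_\varsigma))$ converges in distribution to $(A(I_1),\ldots,A(I_\varsigma))$.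
   Formalization: The formal statement also assumes that g takes values in W only on V, i.e. levels near the maximum g(0) are attained only near 0; otherwise a second spike of g away from 0 can dominate the exceedances and the claim fails. *)

theory Defs
  imports "HOL-Probability.Probability"
begin

section \<open>Functions of bounded variation on the unit interval\<close>

definition leb :: "real measure" where
  "leb = restrict_space lborel {0..1}"

definition total_variation :: "(real \<Rightarrow> real) \<Rightarrow> ereal" where
  "total_variation \<phi> =
     (SUP xs \<in> {xs. sorted xs \<and> set xs \<subseteq> {0..1}}.
        ereal (\<Sum>i<length xs - 1. \<bar>\<phi> (xs ! Suc i) - \<phi> (xs ! i)\<bar>))"

text \<open>The variation of an \<open>L\<^sup>1\<close> class: infimum over all versions.\<close>

definition var :: "(real \<Rightarrow> real) \<Rightarrow> ereal" where
  "var \<phi> = (INF \<psi> \<in> {\<psi>. AE x in leb. \<psi> x = \<phi> x}. total_variation \<psi>)"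

definition BV :: "(real \<Rightarrow> real) set" where
  "BV = {\<phi>. integrable leb \<phi> \<and> var \<phi> < \<infinity>}"

definition norm_L1 :: "(real \<Rightarrow> real) \<Rightarrow> real" where
  "norm_L1 \<phi> = (LINT x|leb. \<bar>\<phi> x\<bar>)"

definition norm_BV :: "(real \<Rightarrow> real) \<Rightarrow> ereal" where
  "norm_BV \<phi> = var \<phi> + ereal (norm_L1 \<phi>)"

definition BV_cone :: "real \<Rightarrow> (real \<Rightarrow> real) set" where
  "BV_cone a = {\<phi> \<in> BV. (AE x in leb. 0 \<le> \<phi> x) \<and> var \<phi> \<le> ereal (a * (LINT x|leb. \<phi> x))}"

text \<open>Counterpart of the library's \<open>esssup\<close>.\<close>

definition essinf :: "'a measure \<Rightarrow> ('a \<Rightarrow> ereal) \<Rightarrow> ereal" where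
  "essinf M \<phi> = Liminf (ae_filter M) \<phi>"


section \<open>Piecewise smooth interval maps\<close>

definition partition_pts :: "real set \<Rightarrow> bool" where
  "partition_pts P \<longleftrightarrow> finite P \<and> {0, 1} \<subseteq> P \<and> P \<subseteq> {0..1}"

definition cells :: "real set \<Rightarrow> real set set" where
  "cells P = {{a<..<b} | a b. a \<in> P \<and> b \<in> P \<and> a < b \<and> {a<..<b} \<inter> P = {}}"

text \<open>The values at the partition points are unconstrained.\<close>

definition piecewise_C2 :: "(real \<Rightarrow> real) \<Rightarrow> bool" where
  "piecewise_C2 T \<longleftrightarrow> (\<exists>P. partition_pts P \<and> (\<forall>C \<in> cells P. \<exists>T' T''.
      (\<forall>x\<in>C. (T has_real_derivative T' x) (at x) \<and> (T' has_real_derivative T'' x) (at x)) \<and>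
      continuous_on C T''))"

text \<open>The number of intervals of monotonicity: the least number of cells of a partition into
  open intervals on which the map is continuous and monotone (\<open>\<infinity>\<close> if there is no finite one).\<close>

definition num_monotone :: "(real \<Rightarrow> real) \<Rightarrow> enat" where
  "num_monotone T = (INF P \<in> {P. partition_pts P \<and> (\<forall>C \<in> cells P. continuous_on C T \<and>
      (mono_on C T \<or> monotone_on C (\<le>) (\<ge>) T))}. enat (card (cells P)))"

text \<open>The Perron--Frobenius operator w.r.t. Lebesgue measure. The chosen version depends only on
  the \<open>L\<^sup>1\<close> class of the argument, and carries no information beyond its own \<open>L\<^sup>1\<close> class.\<close>

definition transfer_op :: "(real \<Rightarrow> real) \<Rightarrow> (real \<Rightarrow> real) \<Rightarrow> real \<Rightarrow> real" where
  "transfer_op T \<phi> = (SOME \<psi>. integrable leb \<psi> \<and>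
      (\<forall>B \<in> sets leb. (LINT x:B|leb. \<psi> x) = (LINT x:(T -` B \<inter> space leb)|leb. \<phi> x)))"


section \<open>Random compositions driven by a Bernoulli shift\<close>

definition shift :: "(int \<Rightarrow> 'y) \<Rightarrow> int \<Rightarrow> 'y" where
  "shift \<omega> = (\<lambda>k. \<omega> (k + 1))"

definition bernoulli :: "'y pmf \<Rightarrow> (int \<Rightarrow> 'y) measure" where
  "bernoulli p = PiM UNIV (\<lambda>_. measure_pmf p)"

definition nonatomic :: "'a measure \<Rightarrow> bool" where
  "nonatomic M \<longleftrightarrow> (\<forall>A \<in> sets M. 0 < emeasure M A \<longrightarrow>
      (\<exists>B \<in> sets M. B \<subseteq> A \<and> 0 < emeasure M B \<and> emeasure M B < emeasure M A))"

definition fibre_map :: "('y \<Rightarrow> real \<Rightarrow> real) \<Rightarrow> (int \<Rightarrow> 'y) \<Rightarrow> real \<Rightarrow> real" where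
  "fibre_map f \<omega> = f (\<omega> 1)"

primrec fibre_iter :: "('y \<Rightarrow> real \<Rightarrow> real) \<Rightarrow> (int \<Rightarrow> 'y) \<Rightarrow> nat \<Rightarrow> real \<Rightarrow> real" where
  "fibre_iter f \<omega> 0 = id"
| "fibre_iter f \<omega> (Suc k) = fibre_map f ((shift ^^ k) \<omega>) \<circ> fibre_iter f \<omega> k"

primrec transfer_iter ::
  "('y \<Rightarrow> real \<Rightarrow> real) \<Rightarrow> (int \<Rightarrow> 'y) \<Rightarrow> nat \<Rightarrow> (real \<Rightarrow> real) \<Rightarrow> real \<Rightarrow> real" where
  "transfer_iter f \<omega> 0 = id"
| "transfer_iter f \<omega> (Suc k) =
     transfer_op (fibre_map f ((shift ^^ k) \<omega>)) \<circ> transfer_iter f \<omega> k"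

text \<open>Measurability of \<open>(\<omega>, x) \<mapsto> (\<P>\<^sub>\<omega> H(\<omega>, \<cdot>))(x)\<close>. As \<open>\<P>\<^sub>\<omega> H(\<omega>, \<cdot>)\<close> is
  an \<open>L\<^sup>1\<close> class for each \<open>\<omega>\<close>, this asks for a jointly measurable choice of versions.\<close>

definition transfer_measurable :: "(int \<Rightarrow> 'y) measure \<Rightarrow> ('y \<Rightarrow> real \<Rightarrow> real) \<Rightarrow> bool" where
  "transfer_measurable Q f \<longleftrightarrow>
     (\<forall>H. (\<lambda>(\<omega>, x). H \<omega> x) \<in> borel_measurable (Q \<Otimes>\<^sub>M leb) \<and> (AE \<omega> in Q. integrable leb (H \<omega>)) \<longrightarrow>
       (\<exists>K. (\<lambda>(\<omega>, x). K \<omega> x) \<in> borel_measurable (Q \<Otimes>\<^sub>M leb) \<and>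
         (AE \<omega> in Q. AE x in leb. K \<omega> x = transfer_op (fibre_map f \<omega>) (H \<omega>) x)))"

definition covering :: "(int \<Rightarrow> 'y) measure \<Rightarrow> ('y \<Rightarrow> real \<Rightarrow> real) \<Rightarrow> bool" where
  "covering Q f \<longleftrightarrow>
     (\<forall>J. is_interval J \<and> J \<subseteq> {0..1} \<and> interior J \<noteq> {} \<longrightarrow>
       (\<exists>k. AE \<omega> in Q. fibre_iter f \<omega> k ` J = {0..1}))"

definition cone_lower_bound :: "(int \<Rightarrow> 'y) measure \<Rightarrow> ('y \<Rightarrow> real \<Rightarrow> real) \<Rightarrow> bool" where
  "cone_lower_bound Q f \<longleftrightarrow>
     (\<exists>N::nat. \<forall>a>0. \<forall>\<^sub>F n in sequentially. \<exists>c>0. \<forall>\<phi> \<in> BV_cone a. AE \<omega> in Q.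
        essinf leb (\<lambda>x. ereal (transfer_iter f \<omega> (N * n) \<phi> x)) \<ge> ereal (c / 2 * norm_L1 \<phi>))"

definition equivariant_density ::
  "(int \<Rightarrow> 'y) measure \<Rightarrow> ('y \<Rightarrow> real \<Rightarrow> real) \<Rightarrow> ((int \<Rightarrow> 'y) \<Rightarrow> real \<Rightarrow> real) \<Rightarrow> bool" where
  "equivariant_density Q f h \<longleftrightarrow>
     (\<lambda>(\<omega>, x). h \<omega> x) \<in> borel_measurable (Q \<Otimes>\<^sub>M leb) \<and>
     (\<forall>\<omega>. \<forall>x\<in>{0..1}. 0 \<le> h \<omega> x) \<and>
     (AE \<omega> in Q. h \<omega> \<in> BV \<and> (LINT x|leb. h \<omega> x) = 1) \<and>
     (AE \<omega> in Q. AE x in leb. transfer_op (fibre_map f \<omega>) (h \<omega>) x = h (shift \<omega>) x) \<and>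
     (\<exists>C::real. AE \<omega> in Q. norm_BV (h \<omega>) \<le> ereal C)"

definition fibre_measure :: "((int \<Rightarrow> 'y) \<Rightarrow> real \<Rightarrow> real) \<Rightarrow> (int \<Rightarrow> 'y) \<Rightarrow> real measure" where
  "fibre_measure h \<omega> = density leb (\<lambda>x. ennreal (h \<omega> x))"

definition mean_measure ::
  "(int \<Rightarrow> 'y) measure \<Rightarrow> ((int \<Rightarrow> 'y) \<Rightarrow> real \<Rightarrow> real) \<Rightarrow> real set \<Rightarrow> real" where
  "mean_measure Q h B = (LINT \<omega>|Q. measure (fibre_measure h \<omega>) B)"


section \<open>Observables\<close>

text \<open>\<open>g\<close> is only relevant on \<open>[0, \<infinity>)\<close>; \<open>V\<close> is a neighbourhood of 0 there and \<open>W = g(V)\<close>.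
  The last clause says that \<open>g\<^sup>-\<^sup>1(W) = V\<close>, i.e. that values close to the maximum are attained
  near 0 only; without it, the behaviour of \<open>g\<close> near 0 would not govern the exceedances.\<close>

definition observable_shape :: "(real \<Rightarrow> ereal) \<Rightarrow> real set \<Rightarrow> ereal set \<Rightarrow> bool" where
  "observable_shape g V W \<longleftrightarrow>
     (\<forall>x\<ge>0. g x \<noteq> -\<infinity> \<and> g x \<le> g 0) \<and>
     V \<subseteq> {0..} \<and> (\<exists>\<delta>>0. {0..<\<delta>} \<subseteq> V) \<and>
     homeomorphism V W g (inv_into V g) \<and>
     (\<forall>x\<in>V. \<forall>y\<in>V. x < y \<longrightarrow> g y < g x) \<and>
     (\<forall>x\<ge>0. x \<notin> V \<longrightarrow> g x \<notin> W)"

text \<open>In the first type the argument \<open>s + y h(s)\<close> has to lie in the domain \<open>W\<close> of the inverse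
  for the limit to make sense.\<close>

definition obs_type1 :: "(real \<Rightarrow> ereal) \<Rightarrow> real set \<Rightarrow> ereal set \<Rightarrow> (ereal \<Rightarrow> real) \<Rightarrow> bool" where
  "obs_type1 g V W h \<longleftrightarrow>
     (\<forall>s\<in>W. 0 < h s) \<and>
     (\<forall>y::real. (\<forall>\<^sub>F s in at_left (g 0). s + ereal (y * h s) \<in> W) \<and>
        ((\<lambda>s. inv_into V g (s + ereal (y * h s)) / inv_into V g s) \<longlongrightarrow> exp (- y)) (at_left (g 0)))"

definition obs_type2 :: "(real \<Rightarrow> ereal) \<Rightarrow> real set \<Rightarrow> real \<Rightarrow> bool" where
  "obs_type2 g V \<beta> \<longleftrightarrow> g 0 = \<infinity> \<and> 0 < \<beta> \<and>
     (\<forall>y>0. ((\<lambda>s. inv_into V g (ereal (s * y)) / inv_into V g (ereal s)) \<longlongrightarrow> y powr (- \<beta>)) at_top)"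

definition obs_type3 :: "(real \<Rightarrow> ereal) \<Rightarrow> real set \<Rightarrow> real \<Rightarrow> real \<Rightarrow> bool" where
  "obs_type3 g V D \<gamma> \<longleftrightarrow> g 0 = ereal D \<and> 0 < \<gamma> \<and>
     (\<forall>y>0. ((\<lambda>s. inv_into V g (ereal (D - s * y)) / inv_into V g (ereal (D - s))) \<longlongrightarrow> y powr \<gamma>)
        (at_right 0))"


section \<open>Marked rare event point processes\<close>

definition obs_process ::
  "('y \<Rightarrow> real \<Rightarrow> real) \<Rightarrow> (real \<Rightarrow> ereal) \<Rightarrow> real \<Rightarrow> (int \<Rightarrow> 'y) \<Rightarrow> nat \<Rightarrow> real \<Rightarrow> ereal" where
  "obs_process f g z \<omega> k x = g (dist (fibre_iter f \<omega> k x) z)"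

definition threshold ::
  "(int \<Rightarrow> 'y) measure \<Rightarrow> ((int \<Rightarrow> 'y) \<Rightarrow> real \<Rightarrow> real) \<Rightarrow> (real \<Rightarrow> ereal) \<Rightarrow> real \<Rightarrow> real \<Rightarrow> nat \<Rightarrow> real"
  where
  "threshold Q h g \<tau> z n =
     Inf {u::real. mean_measure Q h {x \<in> {0..1}. g (dist x z) \<le> ereal u} \<ge> 1 - \<tau> / real n}"

definition time_scale :: "real measure \<Rightarrow> (nat \<Rightarrow> real \<Rightarrow> ereal) \<Rightarrow> (nat \<Rightarrow> real) \<Rightarrow> nat \<Rightarrow> real" where
  "time_scale M X u n = real n / (\<Sum>i<n. measure M {x \<in> {0..1}. X i x > ereal (u n)})"

text \<open>The common POT/AOT process in the absence of clustering. An infinite excess (a null event)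
  is counted as 0 by \<open>real_of_ereal\<close>.\<close>

definition marked_process ::
  "real measure \<Rightarrow> (nat \<Rightarrow> real \<Rightarrow> ereal) \<Rightarrow> (nat \<Rightarrow> real) \<Rightarrow> nat \<Rightarrow> real set \<Rightarrow> real \<Rightarrow> real" where
  "marked_process M X u n J x =
     (\<Sum>i \<in> {i::nat. real i \<in> (\<lambda>t. time_scale M X u n * t) ` J}.
        real_of_ereal (max 0 (X i x - ereal (u n))))"

text \<open>The compound Poisson process on its canonical space: a point \<open>(e, d)\<close> consists of the i.i.d.
  exponential waiting times and the independent i.i.d. multiplicities with d.f. \<open>\<pi>\<close>, both indexed
  from 0.\<close>

definition cpp_space :: "real \<Rightarrow> (real \<Rightarrow> real) \<Rightarrow> ((nat \<Rightarrow> real) \<times> (nat \<Rightarrow> real)) measure" where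
  "cpp_space \<theta> \<pi> =
     PiM UNIV (\<lambda>_. density lborel (\<lambda>x. ennreal (exponential_density \<theta> x))) \<Otimes>\<^sub>M
     PiM UNIV (\<lambda>_. interval_measure \<pi>)"

definition cpp :: "real set \<Rightarrow> (nat \<Rightarrow> real) \<times> (nat \<Rightarrow> real) \<Rightarrow> real" where
  "cpp J = (\<lambda>(e, d). \<Sum>i. d i * indicator J (\<Sum>k\<le>i. e k))"

definition conv_in_distr ::
  "'a measure \<Rightarrow> (nat \<Rightarrow> 'a \<Rightarrow> 'c::topological_space) \<Rightarrow> 'b measure \<Rightarrow> ('b \<Rightarrow> 'c) \<Rightarrow> bool" where
  "conv_in_distr M X N Y \<longleftrightarrow>
     (\<forall>F :: 'c \<Rightarrow> real. continuous_on UNIV F \<and> bounded (range F) \<longrightarrow>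
        (\<lambda>n. LINT x|M. F (X n x)) \<longlonglongrightarrow> (LINT w|N. F (Y w)))"

text \<open>Vectors in \<open>\<real>\<^sup>k\<close> with varying \<open>k\<close> are functions \<open>nat \<Rightarrow> real\<close> vanishing from \<open>k\<close> on; the product
  topology of \<open>nat \<Rightarrow> real\<close> induces the usual one on them.\<close>

definition process_converges ::
  "'a measure \<Rightarrow> (nat \<Rightarrow> real set \<Rightarrow> 'a \<Rightarrow> real) \<Rightarrow> 'b measure \<Rightarrow> (real set \<Rightarrow> 'b \<Rightarrow> real) \<Rightarrow> bool" where
  "process_converges M A N B \<longleftrightarrow>
     (\<forall>k (a::nat \<Rightarrow> real) b. (\<forall>j<k. 0 \<le> a j \<and> a j < b j) \<and>
        disjoint_family_on (\<lambda>j. {a j..<b j}) {..<k} \<longrightarrow>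
        conv_in_distr M (\<lambda>n x j. if j < k then A n {a j..<b j} x else 0)
                      N (\<lambda>w j. if j < k then B {a j..<b j} w else 0))"

text \<open>Convergence of the rescaled processes \<open>a\<^sub>n A\<^sub>n\<close>, where \<open>a\<^sub>n = sc u\<^sub>n\<close>, for
  \<open>m\<close>-a.e. centre \<open>z\<close> and a.e. \<open>\<omega>\<close>.\<close>

definition MREPP_converges ::
  "(int \<Rightarrow> 'y) measure \<Rightarrow> ('y \<Rightarrow> real \<Rightarrow> real) \<Rightarrow> ((int \<Rightarrow> 'y) \<Rightarrow> real \<Rightarrow> real) \<Rightarrow> (real \<Rightarrow> ereal) \<Rightarrow> real
    \<Rightarrow> (real \<Rightarrow> real) \<Rightarrow> real \<Rightarrow> (real \<Rightarrow> real) \<Rightarrow> bool" where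
  "MREPP_converges Q f h g \<tau> sc \<theta> \<pi> \<longleftrightarrow>
     (AE z in leb. AE \<omega> in Q.
        let u = threshold Q h g \<tau> z;
            A = marked_process (fibre_measure h \<omega>) (obs_process f g z \<omega>) u
        in process_converges (fibre_measure h \<omega>) (\<lambda>n J x. sc (u n) * A n J x)
             (cpp_space \<theta> \<pi>) cpp)"

end

theory Submission
  imports Defs
begin

text \<open>
  For fixed \<open>\<omega>\<close>, the Laplace functional of the rescaled process is the integral of
  \<open>\<Prod>\<^sub>i (1 - \<xi>\<^sub>i \<circ> f\<^sub>\<omega>\<^sup>i)\<close> against \<open>h\<^sub>\<omega>\<close>, where each \<open>\<xi>\<^sub>i\<close> is a function of
  variation at most 4 that lives on a ball around \<open>z\<close> of radius of order \<open>1/n\<close>. A uniform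
  Lasota--Yorke inequality and the cone condition give exponential loss of memory, which replaces
  this integral by \<open>\<Prod>\<^sub>i (1 - \<integral> \<xi>\<^sub>i h\<^sub>i)\<close> with \<open>h\<^sub>i\<close> the density at time \<open>i\<close>; returns after short
  times do not contribute, since almost no \<open>z\<close> is periodic under one of the countably many finite
  words. The densities are uniform limits of \<open>\<P>\<^sup>k 1\<close>, which depends on \<open>k\<close> symbols only and is
  continuous at \<open>z\<close>, so a law of large numbers for the shift yields
  \<open>\<Sum>\<^sub>i \<integral> \<xi>\<^sub>i h\<^sub>i \<approx> n \<rho>(z) \<integral> \<xi>\<close> with \<open>\<rho>\<close> the density of \<open>\<mu>\<^sub>I\<close>; this normalization cancels against
  the threshold and the time scale. The type of \<open>g\<close> enters only through the limit law of the
  rescaled excess, and the resulting limit is the Laplace functional of the compound Poisson process.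
\<close>

section \<open>Total variation\<close>

text \<open>Three obstacles shape the proof. The Laplace factors keep variation of order 1 although
  their integrals are of order \<open>1/n\<close>, so decoupling across a gap \<open>t\<close> costs
  about \<open>\<theta>^t\<close> per factor and the gap must grow with \<open>n\<close>. Inside the
  gap the Lasota--Yorke bound leaves an error \<open>r \<theta>^J\<close> per factor once returns
  before time \<open>J\<close> are excluded; over order \<open>n\<close> factors this does not
  vanish with \<open>n\<close>, so \<open>J\<close> is fixed before \<open>n\<close> and chosen
  large. Next, the cone condition allows an exceptional null set of \<open>\<omega>\<close> for each
  function. But iterates read finitely many symbols and every admissible word has positive
  probability, so the bounds hold for each admissible sequence; the finite alphabet makes constants
  uniform over words of a given length. Last, the law of large numbers must serve bumps that shrink
  with \<open>n\<close>; approximating densities that take finitely many forms give a closeness to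
  the value at \<open>z\<close> that is uniform in time. On the probabilistic side, Laplace
  transforms at integer arguments suffice, since \<open>exp (- x)\<close> turns them into monomials
  on a cube.\<close>

lemma space_leb [simp]: "space leb = {0..1}"
  by (simp add: leb_def space_restrict_space)

lemma sets_leb: "sets leb = sets (restrict_space borel {0..1})"
  unfolding leb_def by (rule sets_restrict_space_cong) simp

lemma emeasure_leb: "A \<in> sets leb \<Longrightarrow> emeasure leb A = emeasure lborel A"
  unfolding leb_def by (subst emeasure_restrict_space) (auto simp: sets_restrict_space)

lemma in_sets_leb: "A \<in> sets borel \<Longrightarrow> A \<subseteq> {0..1} \<Longrightarrow> A \<in> sets leb"
  by (auto simp: sets_leb sets_restrict_space)

lemma prob_space_leb: "prob_space leb"
proof
  show "emeasure leb (space leb) = 1"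
    by (subst emeasure_leb) (auto intro: in_sets_leb)
qed

interpretation leb: prob_space leb
  by (rule prob_space_leb)

lemma borel_measurable_lebI:
  fixes F :: "real \<Rightarrow> 'b::topological_space"
  assumes "F \<in> borel_measurable borel" shows "F \<in> borel_measurable leb"
  using assms unfolding leb_def by (intro measurable_restrict_space1) simp

lemma AE_leb_iff: "(AE x in leb. P x) \<longleftrightarrow> (AE x in lborel. x \<in> {0..1} \<longrightarrow> P x)"
  unfolding leb_def by (subst AE_restrict_space_iff) auto

lemma AE_leb_countable: "countable A \<Longrightarrow> AE x in leb. x \<notin> A"
  unfolding AE_leb_iff using AE_not_in[OF countable_imp_null_set_lborel] by fastforce

lemma abs_integral_diff_le:
  fixes u v w :: "'a \<Rightarrow> real"
  assumes "integrable M u" "integrable M v" "integrable M w" "AE x in M. \<bar>u x - v x\<bar> \<le> w x"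
  shows "\<bar>(LINT x|M. u x) - (LINT x|M. v x)\<bar> \<le> (LINT x|M. w x)"
proof -
  have "\<bar>(LINT x|M. u x) - (LINT x|M. v x)\<bar> = \<bar>LINT x|M. u x - v x\<bar>" using assms by simp
  also have "\<dots> \<le> (LINT x|M. \<bar>u x - v x\<bar>)" by (rule integral_abs_bound)
  also have "\<dots> \<le> (LINT x|M. w x)" using assms by (intro integral_mono_AE) auto
  finally show ?thesis .
qed

text \<open>The majorant \<open>N\<close> plays the role of the variation function; this form of \<open>total_variation \<psi> \<le> V\<close>
  makes sums, products and restrictions immediate.\<close>

definition bvar :: "real \<Rightarrow> (real \<Rightarrow> real) \<Rightarrow> bool" where
  "bvar V \<psi> \<longleftrightarrow> (\<exists>N. (\<forall>x y. 0 \<le> x \<longrightarrow> x \<le> y \<longrightarrow> y \<le> 1 \<longrightarrow> \<bar>\<psi> y - \<psi> x\<bar> \<le> N y - N x) \<and> N 1 - N 0 \<le> V)"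

lemma bvarI:
  assumes "\<And>x y. 0 \<le> x \<Longrightarrow> x \<le> y \<Longrightarrow> y \<le> 1 \<Longrightarrow> \<bar>\<psi> y - \<psi> x\<bar> \<le> N y - N x" "N 1 - N 0 \<le> V"
  shows "bvar V \<psi>"
  using assms unfolding bvar_def by blast

lemma bvarE:
  assumes "bvar V \<psi>"
  obtains N where "\<And>x y. 0 \<le> x \<Longrightarrow> x \<le> y \<Longrightarrow> y \<le> 1 \<Longrightarrow> \<bar>\<psi> y - \<psi> x\<bar> \<le> N y - N x" "N 1 - N 0 \<le> V"
  using assms unfolding bvar_def by blast

lemma bvar_osc:
  assumes "bvar V \<psi>" "x \<in> {0..1}" "y \<in> {0..1}" shows "\<bar>\<psi> x - \<psi> y\<bar> \<le> V"
proof -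
  obtain N where N: "\<And>x y. 0 \<le> x \<Longrightarrow> x \<le> y \<Longrightarrow> y \<le> 1 \<Longrightarrow> \<bar>\<psi> y - \<psi> x\<bar> \<le> N y - N x" "N 1 - N 0 \<le> V"
    using assms(1) by (rule bvarE) blast
  have *: "\<bar>\<psi> y - \<psi> x\<bar> \<le> V" if "0 \<le> x" "x \<le> y" "y \<le> 1" for x y
    using N(1)[OF that] N(1)[of 0 x] N(1)[of y 1] N(2) that by linarith
  show ?thesis using *[of x y] *[of y x] assms by (cases "x \<le> y") auto
qed

lemma bvar_nonneg: "bvar V \<psi> \<Longrightarrow> 0 \<le> V"
  using bvar_osc[of V \<psi> 0 0] by simp

lemma bvar_mono: "bvar V \<psi> \<Longrightarrow> V \<le> V' \<Longrightarrow> bvar V' \<psi>"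
  unfolding bvar_def by (meson order_trans)

lemma bvar_const [simp]: "0 \<le> V \<Longrightarrow> bvar V (\<lambda>x. c)"
  by (rule bvarI[where N = "\<lambda>_. 0"]) auto

lemma bvar_add:
  assumes "bvar V \<phi>" "bvar W \<psi>" shows "bvar (V + W) (\<lambda>x. \<phi> x + \<psi> x)"
proof -
  obtain N where N: "\<And>x y. 0 \<le> x \<Longrightarrow> x \<le> y \<Longrightarrow> y \<le> 1 \<Longrightarrow> \<bar>\<phi> y - \<phi> x\<bar> \<le> N y - N x" "N 1 - N 0 \<le> V"
    using assms(1) by (rule bvarE) blast
  obtain M where M: "\<And>x y. 0 \<le> x \<Longrightarrow> x \<le> y \<Longrightarrow> y \<le> 1 \<Longrightarrow> \<bar>\<psi> y - \<psi> x\<bar> \<le> M y - M x" "M 1 - M 0 \<le> W"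
    using assms(2) by (rule bvarE) blast
  show ?thesis
  proof (rule bvarI[where N = "\<lambda>x. N x + M x"])
    fix x y :: real assume xy: "0 \<le> x" "x \<le> y" "y \<le> 1"
    show "\<bar>\<phi> y + \<psi> y - (\<phi> x + \<psi> x)\<bar> \<le> N y + M y - (N x + M x)"
      using N(1)[OF xy] M(1)[OF xy] by linarith
  qed (use N(2) M(2) in linarith)
qed

lemma bvar_cmult:
  assumes "bvar V \<phi>" shows "bvar (\<bar>c\<bar> * V) (\<lambda>x. c * \<phi> x)"
proof -
  obtain N where N: "\<And>x y. 0 \<le> x \<Longrightarrow> x \<le> y \<Longrightarrow> y \<le> 1 \<Longrightarrow> \<bar>\<phi> y - \<phi> x\<bar> \<le> N y - N x" "N 1 - N 0 \<le> V"
    using assms(1) by (rule bvarE) blast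
  show ?thesis
  proof (rule bvarI[where N = "\<lambda>x. \<bar>c\<bar> * N x"])
    fix x y :: real assume xy: "0 \<le> x" "x \<le> y" "y \<le> 1"
    show "\<bar>c * \<phi> y - c * \<phi> x\<bar> \<le> \<bar>c\<bar> * N y - \<bar>c\<bar> * N x"
      using mult_left_mono[OF N(1)[OF xy], of "\<bar>c\<bar>"] 
      by (simp add: abs_mult[symmetric] right_diff_distrib)
  next
    show "\<bar>c\<bar> * N 1 - \<bar>c\<bar> * N 0 \<le> \<bar>c\<bar> * V" using mult_left_mono[OF N(2), of "\<bar>c\<bar>"]
      by (simp add: right_diff_distrib)
  qed
qed

lemma bvar_diff:
  assumes "bvar V \<phi>" "bvar W \<psi>" shows "bvar (V + W) (\<lambda>x. \<phi> x - \<psi> x)"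
  using bvar_add[OF assms(1) bvar_cmult[OF assms(2), of "-1"]] by simp

lemma bvar_sum:
  assumes "\<And>i. i \<in> I \<Longrightarrow> bvar (V i) (\<phi> i)" "finite I"
  shows "bvar (\<Sum>i\<in>I. V i) (\<lambda>x. \<Sum>i\<in>I. \<phi> i x)"
  using assms(2,1) by (induction I) (auto intro!: bvar_add)

lemma bvar_mult:
  assumes "bvar V \<phi>" "bvar W \<psi>"
    and a: "\<And>x. x \<in> {0..1} \<Longrightarrow> \<bar>\<phi> x\<bar> \<le> a" and b: "\<And>x. x \<in> {0..1} \<Longrightarrow> \<bar>\<psi> x\<bar> \<le> b"
  shows "bvar (b * V + a * W) (\<lambda>x. \<phi> x * \<psi> x)"
proof -
  obtain N where N: "\<And>x y. 0 \<le> x \<Longrightarrow> x \<le> y \<Longrightarrow> y \<le> 1 \<Longrightarrow> \<bar>\<phi> y - \<phi> x\<bar> \<le> N y - N x" "N 1 - N 0 \<le> V"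
    using assms(1) by (rule bvarE) blast
  obtain M where M: "\<And>x y. 0 \<le> x \<Longrightarrow> x \<le> y \<Longrightarrow> y \<le> 1 \<Longrightarrow> \<bar>\<psi> y - \<psi> x\<bar> \<le> M y - M x" "M 1 - M 0 \<le> W"
    using assms(2) by (rule bvarE) blast
  have ab: "0 \<le> a" "0 \<le> b" using a[of 0] b[of 0] by auto
  show ?thesis
  proof (rule bvarI[where N = "\<lambda>x. b * N x + a * M x"])
    fix x y :: real assume xy: "0 \<le> x" "x \<le> y" "y \<le> 1"
    have "\<phi> y * \<psi> y - \<phi> x * \<psi> x = (\<phi> y - \<phi> x) * \<psi> y + \<phi> x * (\<psi> y - \<psi> x)" by algebra
    moreover have "\<bar>(\<phi> y - \<phi> x) * \<psi> y\<bar> \<le> (N y - N x) * b"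
      unfolding abs_mult using N(1)[OF xy] b[of y] xy by (intro mult_mono) auto
    moreover have "\<bar>\<phi> x * (\<psi> y - \<psi> x)\<bar> \<le> a * (M y - M x)"
      unfolding abs_mult using M(1)[OF xy] a[of x] xy by (intro mult_mono) auto
    ultimately show "\<bar>\<phi> y * \<psi> y - \<phi> x * \<psi> x\<bar> \<le> b * N y + a * M y - (b * N x + a * M x)"
      by (simp add: algebra_simps)
  next
    show "b * N 1 + a * M 1 - (b * N 0 + a * M 0) \<le> b * V + a * W"
      using mult_left_mono[OF N(2) ab(2)] mult_left_mono[OF M(2) ab(1)] by (simp add: algebra_simps)
  qed
qed

text \<open>Jordan decomposition: the majorant and its difference from the function are both
  monotone. Measurability and countability of the discontinuities are inherited from the two
  parts.\<close>

lemma bvar_monotone_decomposition: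
  assumes "bvar V \<psi>"
  obtains N M where "mono_on {0..1} N" "mono_on {0..1} M" "\<And>x. \<psi> x = N x - M x"
proof -
  obtain N where N: "\<And>x y. 0 \<le> x \<Longrightarrow> x \<le> y \<Longrightarrow> y \<le> 1 \<Longrightarrow> \<bar>\<psi> y - \<psi> x\<bar> \<le> N y - N x" "N 1 - N 0 \<le> V"
    using assms by (rule bvarE) blast
  show ?thesis
  proof (rule that[of N "\<lambda>x. N x - \<psi> x"])
    show "mono_on {0..1} N" using N(1) by (force simp: mono_on_def)
    show "mono_on {0..1} (\<lambda>x. N x - \<psi> x)" 
    proof (rule mono_onI)
      fix r s :: real assume "r \<in> {0..1}" "s \<in> {0..1}" "r \<le> s"
      then show "N r - \<psi> r \<le> N s - \<psi> s" using N(1)[of r s] by auto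
    qed
  qed simp
qed

lemma borel_measurable_leb_mono_on:
  assumes "mono_on {0..1::real} (N :: real \<Rightarrow> real)" shows "N \<in> borel_measurable leb"
proof -
  have "N \<in> borel_measurable (restrict_space borel {0..1})"
    using assms by (rule borel_measurable_mono_on_fnc)
  then show ?thesis by (subst measurable_cong_sets[OF sets_leb refl])
qed

lemma bvar_measurable:
  assumes "bvar V \<psi>" shows "\<psi> \<in> borel_measurable leb"
proof -
  obtain N M where "mono_on {0..1} N" "mono_on {0..1} M" "\<And>x. \<psi> x = N x - M x"
    using bvar_monotone_decomposition[OF assms] by blast
  moreover from this(3) have "\<psi> = (\<lambda>x. N x - M x)" by auto
  ultimately show ?thesis by (metis borel_measurable_leb_mono_on borel_measurable_diff)
qed

lemma bvar_integrable:
  assumes "bvar V \<psi>" shows "integrable leb \<psi>"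
proof (rule leb.integrable_const_bound[where B = "\<bar>\<psi> 0\<bar> + V"])
  have "norm (\<psi> x) \<le> \<bar>\<psi> 0\<bar> + V" if "x \<in> {0..1}" for x
    using bvar_osc[OF assms that, of 0] by auto
  then show "AE x in leb. norm (\<psi> x) \<le> \<bar>\<psi> 0\<bar> + V" by (intro AE_I2) auto
qed (rule bvar_measurable[OF assms])

text \<open>Any two values differ by at most the variation, so averaging over the probability
  measure \<open>leb\<close> trades a point value for the \<open>L^1\<close> norm. Sup norms are
  read off from Lasota--Yorke bounds in this way.\<close>

lemma bvar_bound:
  assumes "bvar V \<psi>" "x \<in> {0..1}" shows "\<bar>\<psi> x\<bar> \<le> V + (LINT t|leb. \<bar>\<psi> t\<bar>)"
proof -
  have "(LINT t|leb. \<bar>\<psi> x\<bar> - V) \<le> (LINT t|leb. \<bar>\<psi> t\<bar>)"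
  proof (rule integral_mono)
    show "\<bar>\<psi> x\<bar> - V \<le> \<bar>\<psi> t\<bar>" if "t \<in> space leb" for t
      using bvar_osc[OF assms(1) assms(2), of t] that by auto
  qed (auto intro: bvar_integrable[OF assms(1)])
  then show ?thesis using leb.prob_space by simp
qed

lemma bvar_isCont:
  assumes "bvar V \<psi>" shows "countable {x\<in>{0<..<1}. \<not> isCont \<psi> x}"
proof -
  obtain N M where NM: "mono_on {0..1} N" "mono_on {0..1} M" "\<And>x. \<psi> x = N x - M x"
    using bvar_monotone_decomposition[OF assms] by blast
  have "mono_on {0<..<1} N" "mono_on {0<..<1} M"
    using NM by (auto intro: mono_on_subset)
  then have "countable ({x\<in>{0<..<1}. \<not> isCont N x} \<union> {x\<in>{0<..<1}. \<not> isCont M x})"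
    using mono_on_ctble_discont_open[of "{0<..<1}"] by auto
  moreover have "{x\<in>{0<..<1}. \<not> isCont \<psi> x} \<subseteq> {x\<in>{0<..<1}. \<not> isCont N x} \<union> {x\<in>{0<..<1}. \<not> isCont M x}"
  proof -
    have "\<psi> = (\<lambda>x. N x - M x)" using NM(3) by auto
    then show ?thesis by (auto intro: continuous_diff)
  qed
  ultimately show ?thesis by (rule countable_subset[rotated])
qed

text \<open>The value at \<open>z\<close> is not tied to its neighbours, because an infinite excess
  counts as 0 there. The majorant therefore runs in \<open>[0,1]\<close> to the left of
  \<open>z\<close>, equals 2 at \<open>z\<close> and runs in \<open>[3,4]\<close> to the right,
  which leaves room for a jump on each side and gives the constant 4.\<close>

lemma bvar_unimodal:
  assumes \<xi>: "\<And>x. x \<in> {0..1} \<Longrightarrow> 0 \<le> \<xi> x \<and> \<xi> x \<le> (1::real)"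
    and inc: "\<And>x y. 0 \<le> x \<Longrightarrow> x \<le> y \<Longrightarrow> y < z \<Longrightarrow> y \<le> 1 \<Longrightarrow> \<xi> x \<le> \<xi> y"
    and dec: "\<And>x y. z < x \<Longrightarrow> x \<le> y \<Longrightarrow> y \<le> 1 \<Longrightarrow> 0 \<le> x \<Longrightarrow> \<xi> y \<le> \<xi> x"
  shows "bvar 4 \<xi>"
proof -
  define N where "N = (\<lambda>x. if x < z then \<xi> x else if x = z then 2 else 4 - \<xi> x)"
  show ?thesis
  proof (rule bvarI[where N = N])
    show "N 1 - N 0 \<le> 4" unfolding N_def using \<xi>[of 0] \<xi>[of 1] by auto
    fix x y :: real assume "0 \<le> x" "x \<le> y" "y \<le> 1"
    then show "\<bar>\<xi> y - \<xi> x\<bar> \<le> N y - N x"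
      using inc[of x y] dec[of x y] \<xi>[of x] \<xi>[of y] by (auto simp: N_def)
  qed
qed

lemma sum_abs_diff_le_majorant:
  assumes N: "\<And>x y. 0 \<le> x \<Longrightarrow> x \<le> y \<Longrightarrow> y \<le> (1::real) \<Longrightarrow> \<bar>\<psi> y - \<psi> x\<bar> \<le> N y - (N x::real)"
    and xs: "sorted xs" "set xs \<subseteq> {0..1}"
  shows "(\<Sum>i<length xs - 1. \<bar>\<psi> (xs ! Suc i) - \<psi> (xs ! i)\<bar>) \<le> N 1 - N 0"
proof (cases "xs = []")
  case True then show ?thesis using N[of 0 1] by simp
next
  case False
  have m: "xs ! i \<in> {0..1}" if "i < length xs" for i using xs(2) that nth_mem by blast
  have "(\<Sum>i<length xs - 1. \<bar>\<psi> (xs ! Suc i) - \<psi> (xs ! i)\<bar>) \<le> (\<Sum>i<length xs - 1. N (xs ! Suc i) - N (xs ! i))"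
  proof (rule sum_mono)
    fix i assume i: "i \<in> {..<length xs - 1}"
    then have "xs ! i \<le> xs ! Suc i" using xs(1) by (intro sorted_nth_mono) auto
    then show "\<bar>\<psi> (xs ! Suc i) - \<psi> (xs ! i)\<bar> \<le> N (xs ! Suc i) - N (xs ! i)"
      using m[of i] m[of "Suc i"] i by (intro N) auto
  qed
  also have "\<dots> = N (xs ! (length xs - 1)) - N (xs ! 0)" by (rule sum_lessThan_telescope)
  also have "\<dots> \<le> N 1 - N 0"
    using N[of 0 "xs ! 0"] N[of "xs ! (length xs - 1)" 1] m[of 0] m[of "length xs - 1"] False by auto
  finally show ?thesis .
qed

lemma variation_list_snoc:
  fixes \<psi> :: "real \<Rightarrow> real"
  assumes "xs \<noteq> []"
  shows "(\<Sum>i<length (xs @ [y]) - 1. \<bar>\<psi> ((xs @ [y]) ! Suc i) - \<psi> ((xs @ [y]) ! i)\<bar>) =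
    (\<Sum>i<length xs - 1. \<bar>\<psi> (xs ! Suc i) - \<psi> (xs ! i)\<bar>) + \<bar>\<psi> y - \<psi> (last xs)\<bar>"
proof -
  obtain m where m: "length xs = Suc m" using assms by (cases xs) auto
  have "(\<Sum>i<m. \<bar>\<psi> ((xs @ [y]) ! Suc i) - \<psi> ((xs @ [y]) ! i)\<bar>) = (\<Sum>i<m. \<bar>\<psi> (xs ! Suc i) - \<psi> (xs ! i)\<bar>)"
    using m by (intro sum.cong) (auto simp: nth_append)
  then show ?thesis using m assms by (simp add: nth_append last_conv_nth)
qed

lemma total_variation_le_iff:
  "total_variation \<psi> \<le> ereal V \<longleftrightarrow> bvar V \<psi>"
proof
  assume "bvar V \<psi>"
  then obtain N where N: "\<And>x y. 0 \<le> x \<Longrightarrow> x \<le> y \<Longrightarrow> y \<le> 1 \<Longrightarrow> \<bar>\<psi> y - \<psi> x\<bar> \<le> N y - N x" "N 1 - N 0 \<le> V"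
    by (rule bvarE) blast
  show "total_variation \<psi> \<le> ereal V"
    unfolding total_variation_def
  proof (rule SUP_least)
    fix xs :: "real list" assume "xs \<in> {xs. sorted xs \<and> set xs \<subseteq> {0..1}}"
    then show "ereal (\<Sum>i<length xs - 1. \<bar>\<psi> (xs ! Suc i) - \<psi> (xs ! i)\<bar>) \<le> ereal V"
      using sum_abs_diff_le_majorant[OF N(1), where xs = xs] N(2) by force
  qed
next
  assume tv: "total_variation \<psi> \<le> ereal V"
  define S where "S xs = (\<Sum>i<length xs - 1. \<bar>\<psi> (xs ! Suc i) - \<psi> (xs ! i)\<bar>)" for xs
  have S_le: "S xs \<le> V" if "sorted xs" "set xs \<subseteq> {0..1}" for xs
  proof -
    have "ereal (S xs) \<le> total_variation \<psi>"
      unfolding total_variation_def S_def using that by (intro SUP_upper) auto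
    then show ?thesis using tv by (metis ereal_less_eq(3) order_trans)
  qed
  \<comment> \<open>\<open>N x\<close> is the variation over \<open>[0,x]\<close>, taken as a
    supremum over lists. Appending \<open>x\<close> and then \<open>y\<close> to a list in
    \<open>L x\<close> shows that \<open>N\<close> grows by at least the increment of
    \<open>\<psi>\<close>.\<close>
  define L where "L x = {xs. sorted xs \<and> xs \<noteq> [] \<and> set xs \<subseteq> {0..x}}" for x :: real
  define N where "N x = (SUP xs\<in>L x. S xs)" for x
  have bdd: "bdd_above (S ` L x)" if "x \<le> 1" for x
    using S_le that by (intro bdd_aboveI[where M = V]) (fastforce simp: L_def)
  have ne: "L x \<noteq> {}" if "0 \<le> x" for x
  proof -
    have "[0] \<in> L x" using that by (auto simp: L_def)
    then show ?thesis by blast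
  qed
  show "bvar V \<psi>"
  proof (rule bvarI[where N = N])
    fix x y :: real assume xy: "0 \<le> x" "x \<le> y" "y \<le> 1"
    have "N x \<le> N y - \<bar>\<psi> y - \<psi> x\<bar>"
      unfolding N_def[of x]
    proof (rule cSUP_least[OF ne[OF xy(1)]])
      fix xs assume xs: "xs \<in> L x"
      have "S xs + \<bar>\<psi> y - \<psi> x\<bar> \<le> S ((xs @ [x]) @ [y])"
        using xs unfolding S_def by (subst variation_list_snoc, simp, subst variation_list_snoc) (auto simp: L_def)
      also have "\<dots> \<le> N y"
        unfolding N_def using xs xy
        by (intro cSUP_upper bdd) (fastforce simp: L_def sorted_append)+
      finally show "S xs \<le> N y - \<bar>\<psi> y - \<psi> x\<bar>" by simp
    qed
    then show "\<bar>\<psi> y - \<psi> x\<bar> \<le> N y - N x" by simp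
  next
    have "N 1 \<le> V" unfolding N_def
      by (rule cSUP_least[OF ne]) (auto simp: L_def intro: S_le)
    moreover have "0 \<le> N 0"
      unfolding N_def by (rule cSUP_upper2[OF bdd, of _ "[0]"]) (auto simp: L_def S_def)
    ultimately show "N 1 - N 0 \<le> V" by simp
  qed
qed

section \<open>Bounded variation up to null sets\<close>

definition aebv :: "real \<Rightarrow> (real \<Rightarrow> real) \<Rightarrow> bool" where
  "aebv V \<phi> \<longleftrightarrow> (\<exists>\<psi>. bvar V \<psi> \<and> (AE x in leb. \<phi> x = \<psi> x))"

lemma var_le_if_aebv: assumes "aebv V \<phi>" shows "var \<phi> \<le> ereal V"
proof -
  obtain \<psi> where "bvar V \<psi>" "AE x in leb. \<phi> x = \<psi> x" using assms by (auto simp: aebv_def)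
  then show ?thesis unfolding var_def 
    by (intro INF_lower2[of \<psi>]) (auto simp: total_variation_le_iff elim: AE_mp)
qed

text \<open>\<open>var\<close> is an infimum over versions, so only a strict bound hands out a
  version that obeys it.\<close>

lemma aebv_if_var_less: assumes "var \<phi> < ereal V" shows "aebv V \<phi>"
proof -
  obtain \<psi> where "AE x in leb. \<psi> x = \<phi> x" "total_variation \<psi> < ereal V"
    using assms unfolding var_def INF_less_iff by auto
  moreover from this have "bvar V \<psi>" using total_variation_le_iff less_imp_le by blast
  ultimately show ?thesis unfolding aebv_def by (force elim: AE_mp)
qed

section \<open>Transfer operators\<close>

text \<open>\<open>\<psi>\<close> is a version of the transfer of \<open>\<phi>\<close>; stating this by duality avoids the choice made in
  \<open>transfer_op\<close> and makes compositions of maps trivial to handle.\<close>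

definition tr :: "(real \<Rightarrow> real) \<Rightarrow> (real \<Rightarrow> real) \<Rightarrow> (real \<Rightarrow> real) \<Rightarrow> bool" where
  "tr T \<phi> \<psi> \<longleftrightarrow> integrable leb \<phi> \<and> integrable leb \<psi> \<and>
     (\<forall>G b. G \<in> borel_measurable leb \<longrightarrow> (\<forall>x\<in>{0..1}. \<bar>G x\<bar> \<le> b) \<longrightarrow>
        (LINT x|leb. G x * \<psi> x) = (LINT x|leb. G (T x) * \<phi> x))"

lemma trD:
  assumes "tr T \<phi> \<psi>"
  shows "integrable leb \<phi>" "integrable leb \<psi>"
    "\<And>G b. G \<in> borel_measurable leb \<Longrightarrow> (\<And>x. x \<in> {0..1} \<Longrightarrow> \<bar>G x\<bar> \<le> b) \<Longrightarrow>
        (LINT x|leb. G x * \<psi> x) = (LINT x|leb. G (T x) * \<phi> x)"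
  using assms unfolding tr_def by blast+

lemma integrable_bounded_mult:
  fixes G :: "real \<Rightarrow> real"
  assumes "integrable leb \<phi>" "G \<in> borel_measurable leb" "\<And>x. x \<in> {0..1} \<Longrightarrow> \<bar>G x\<bar> \<le> b"
  shows "integrable leb (\<lambda>x. G x * \<phi> x)"
proof (rule Bochner_Integration.integrable_bound[where f = "\<lambda>x. b * \<phi> x"])
  show "AE x in leb. norm (G x * \<phi> x) \<le> norm (b * \<phi> x)"
  proof (rule AE_I2)
    fix x assume "x \<in> space leb"
    then have "\<bar>G x\<bar> \<le> \<bar>b\<bar>" using assms(3)[of x] by auto
    then show "norm (G x * \<phi> x) \<le> norm (b * \<phi> x)" by (simp add: abs_mult mult_right_mono)
  qed
qed (use assms in auto)

lemma tr_lincomb: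
  assumes "tr T \<phi> \<psi>" "tr T \<phi>' \<psi>'" and T: "T \<in> measurable leb leb"
  shows "tr T (\<lambda>x. a * \<phi> x + c * \<phi>' x) (\<lambda>x. a * \<psi> x + c * \<psi>' x)"
  unfolding tr_def
proof (intro conjI allI impI)
  fix G :: "real \<Rightarrow> real" and b assume G: "G \<in> borel_measurable leb" "\<forall>x\<in>{0..1}. \<bar>G x\<bar> \<le> b"
  have GT: "(\<lambda>x. G (T x)) \<in> borel_measurable leb" using T G(1) by measurable
  have GTb: "\<bar>G (T x)\<bar> \<le> b" if "x \<in> {0..1}" for x using measurable_space[OF T, of x] that G(2) by auto
  note I = integrable_bounded_mult[where G = G and b = b, OF _ G(1)] 
    integrable_bounded_mult[where G = "\<lambda>x. G (T x)" and b = b, OF _ GT GTb]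
  have i: "integrable leb (\<lambda>x. G x * \<psi> x)" "integrable leb (\<lambda>x. G x * \<psi>' x)"
     "integrable leb (\<lambda>x. G (T x) * \<phi> x)" "integrable leb (\<lambda>x. G (T x) * \<phi>' x)"
    using I(1)[OF trD(2)[OF assms(1)]] I(1)[OF trD(2)[OF assms(2)]] I(2)[OF trD(1)[OF assms(1)]]
      I(2)[OF trD(1)[OF assms(2)]] G(2) by blast+
  have "(LINT x|leb. G x * (a * \<psi> x + c * \<psi>' x)) = (LINT x|leb. a * (G x * \<psi> x) + c * (G x * \<psi>' x))"
    by (simp add: algebra_simps)
  also have "\<dots> = a * (LINT x|leb. G x * \<psi> x) + c * (LINT x|leb. G x * \<psi>' x)"
    using i by simp
  also have "\<dots> = a * (LINT x|leb. G (T x) * \<phi> x) + c * (LINT x|leb. G (T x) * \<phi>' x)"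
    using trD(3)[OF assms(1) G(1), of b] trD(3)[OF assms(2) G(1), of b] G(2) by simp
  also have "\<dots> = (LINT x|leb. a * (G (T x) * \<phi> x) + c * (G (T x) * \<phi>' x))"
    using i by simp
  also have "\<dots> = (LINT x|leb. G (T x) * (a * \<phi> x + c * \<phi>' x))"
    by (simp add: algebra_simps)
  finally show "(LINT x|leb. G x * (a * \<psi> x + c * \<psi>' x)) = \<dots>" .
qed (use trD(1,2)[OF assms(1)] trD(1,2)[OF assms(2)] in auto)

lemma tr_cong:
  assumes "tr T \<phi> \<psi>" and "AE x in leb. \<phi> x = \<phi>' x" "AE x in leb. \<psi> x = \<psi>' x" 
    and m: "\<phi>' \<in> borel_measurable leb" "\<psi>' \<in> borel_measurable leb"
    and T: "T \<in> measurable leb leb"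
  shows "tr T \<phi>' \<psi>'"
  unfolding tr_def
proof (intro conjI allI impI)
  note mm = borel_measurable_integrable[OF trD(1)[OF assms(1)]] borel_measurable_integrable[OF trD(2)[OF assms(1)]]
  show "integrable leb \<phi>'" using integrable_cong_AE_imp[OF trD(1)[OF assms(1)] m(1)] assms(2) by (auto elim: AE_mp)
  show "integrable leb \<psi>'" using integrable_cong_AE_imp[OF trD(2)[OF assms(1)] m(2)] assms(3) by (auto elim: AE_mp)
  fix G :: "real \<Rightarrow> real" and b assume G: "G \<in> borel_measurable leb" "\<forall>x\<in>{0..1}. \<bar>G x\<bar> \<le> b"
  have GT: "(\<lambda>x. G (T x)) \<in> borel_measurable leb" using T G(1) by measurable
  have "(LINT x|leb. G x * \<psi>' x) = (LINT x|leb. G x * \<psi> x)"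
    using assms(3) m mm G by (intro integral_cong_AE) (auto elim: AE_mp)
  moreover have "(LINT x|leb. G (T x) * \<phi>' x) = (LINT x|leb. G (T x) * \<phi> x)"
    using assms(2) m mm GT by (intro integral_cong_AE) (auto elim: AE_mp)
  ultimately show "(LINT x|leb. G x * \<psi>' x) = (LINT x|leb. G (T x) * \<phi>' x)"
    using trD(3)[OF assms(1) G(1), of b] G(2) by auto
qed

lemma tr_comp:
  assumes "tr T \<phi> \<psi>" "tr S \<psi> \<rho>" and S: "S \<in> measurable leb leb"
  shows "tr (S \<circ> T) \<phi> \<rho>"
  unfolding tr_def
proof (intro conjI allI impI)
  fix G :: "real \<Rightarrow> real" and b assume G: "G \<in> borel_measurable leb" "\<forall>x\<in>{0..1}. \<bar>G x\<bar> \<le> b"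
  have GS: "(\<lambda>x. G (S x)) \<in> borel_measurable leb" using S G(1) by measurable
  have GSb: "\<bar>G (S x)\<bar> \<le> b" if "x \<in> {0..1}" for x using measurable_space[OF S, of x] that G(2) by auto
  show "(LINT x|leb. G x * \<rho> x) = (LINT x|leb. G ((S \<circ> T) x) * \<phi> x)"
    using trD(3)[OF assms(2) G(1), of b] trD(3)[OF assms(1) GS GSb] G(2) by auto
qed (use trD(1)[OF assms(1)] trD(2)[OF assms(2)] in auto)

lemma tr_id: "integrable leb \<phi> \<Longrightarrow> tr id \<phi> \<phi>"
  unfolding tr_def by auto

lemma tr_integral: "tr T \<phi> \<psi> \<Longrightarrow> (LINT x|leb. \<psi> x) = (LINT x|leb. \<phi> x)"
  using trD(3)[of T \<phi> \<psi> "\<lambda>_. 1" 1] by auto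

text \<open>Testing the duality against the sign of \<open>\<psi>\<close> gives the contraction.
  Applied to a difference, it also yields uniqueness of the transfer.\<close>

lemma tr_L1:
  assumes "tr T \<phi> \<psi>" and T: "T \<in> measurable leb leb"
  shows "(LINT x|leb. \<bar>\<psi> x\<bar>) \<le> (LINT x|leb. \<bar>\<phi> x\<bar>)"
proof -
  note mm = borel_measurable_integrable[OF trD(1)[OF assms(1)]] borel_measurable_integrable[OF trD(2)[OF assms(1)]]
  have s: "(\<lambda>x. sgn (\<psi> x)) \<in> borel_measurable leb" using mm by measurable
  have sT: "(\<lambda>x. sgn (\<psi> (T x))) \<in> borel_measurable leb" using T s by measurable
  have b: "\<bar>sgn (y::real)\<bar> \<le> 1" for y by (simp add: sgn_if)
  have "(LINT x|leb. \<bar>\<psi> x\<bar>) = (LINT x|leb. sgn (\<psi> x) * \<psi> x)"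
    by (rule Bochner_Integration.integral_cong) (auto simp: sgn_if)
  also have "\<dots> = (LINT x|leb. sgn (\<psi> (T x)) * \<phi> x)"
    using trD(3)[OF assms(1) s, of 1] b by auto
  also have "\<dots> \<le> (LINT x|leb. \<bar>\<phi> x\<bar>)"
  proof (rule integral_mono)
    show "integrable leb (\<lambda>x. sgn (\<psi> (T x)) * \<phi> x)"
      by (rule integrable_bounded_mult[OF trD(1)[OF assms(1)] sT b])
    show "sgn (\<psi> (T x)) * \<phi> x \<le> \<bar>\<phi> x\<bar>" for x by (auto simp: sgn_if)
  qed (use trD(1)[OF assms(1)] in auto)
  finally show ?thesis .
qed

lemma tr_unique:
  assumes "tr T \<phi> \<psi>" "tr T \<phi> \<psi>'" and T: "T \<in> measurable leb leb"
  shows "AE x in leb. \<psi> x = \<psi>' x"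
proof -
  have t: "tr T (\<lambda>x. 1 * \<phi> x + (-1) * \<phi> x) (\<lambda>x. 1 * \<psi> x + (-1) * \<psi>' x)"
    using assms by (intro tr_lincomb)
  from tr_L1[OF t T] have "(LINT x|leb. \<bar>\<psi> x - \<psi>' x\<bar>) \<le> 0" by simp
  then have "(LINT x|leb. \<bar>\<psi> x - \<psi>' x\<bar>) = 0" by (intro antisym) auto
  moreover have "integrable leb (\<lambda>x. \<bar>\<psi> x - \<psi>' x\<bar>)" using trD(2)[OF assms(1)] trD(2)[OF assms(2)] by auto
  ultimately have "AE x in leb. \<bar>\<psi> x - \<psi>' x\<bar> = 0" by (subst (asm) integral_nonneg_eq_0_iff_AE) auto
  then show ?thesis by auto
qed

section \<open>The contribution of one monotone branch\<close>

text \<open>Made for the image interval of a branch, off which the transferred function is 0.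
  Entering and leaving the interval may each cost a jump of size \<open>s\<close>; in between,
  \<open>K\<close> is the majorant, normalised to range in \<open>[0,D]\<close>.\<close>

lemma bvar_extend_zero:
  fixes I :: "real set"
  assumes I: "\<And>x y t. x \<in> I \<Longrightarrow> y \<in> I \<Longrightarrow> x \<le> t \<Longrightarrow> t \<le> y \<Longrightarrow> t \<in> I"
    and K: "\<And>x y. x \<in> I \<Longrightarrow> y \<in> I \<Longrightarrow> x \<le> y \<Longrightarrow> \<bar>\<rho> y - \<rho> x\<bar> \<le> K y - K x"
    and D: "\<And>x. x \<in> I \<Longrightarrow> 0 \<le> K x \<and> K x \<le> D" and s: "\<And>x. x \<in> I \<Longrightarrow> \<bar>\<rho> x\<bar> \<le> s"
    and nn: "0 \<le> s" "0 \<le> D"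
  shows "bvar (2 * s + D) (\<lambda>y. if y \<in> I then \<rho> y else (0::real))"
proof -
  define N where "N y = (if y \<in> I then s + K y else if \<exists>i\<in>I. i < y then 2 * s + D else 0)" for y
  show ?thesis
  proof (rule bvarI[where N = N])
    show "N 1 - N 0 \<le> 2 * s + D" using nn D[of 0] D[of 1] by (auto simp: N_def)
    fix x y :: real assume xy: "0 \<le> x" "x \<le> y" "y \<le> 1"
    show "\<bar>(if y \<in> I then \<rho> y else 0) - (if x \<in> I then \<rho> x else 0)\<bar> \<le> N y - N x"
    proof (cases "x \<in> I"; cases "y \<in> I")
      assume "x \<in> I" "y \<in> I" then show ?thesis using K[of x y] xy by (auto simp: N_def)
    next
      assume *: "x \<in> I" "y \<notin> I"
      then have "x < y" using xy by (metis order_le_less)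
      then have "N y = 2 * s + D" using * by (auto simp: N_def)
      then show ?thesis using * s[of x] D[of x] by (auto simp: N_def)
    next
      assume *: "x \<notin> I" "y \<in> I"
      then have "\<not> (\<exists>i\<in>I. i < x)" using I[of _ y x] xy by force
      then have "N x = 0" using * by (auto simp: N_def)
      then show ?thesis using * s[of y] D[of y] by (auto simp: N_def)
    next
      assume *: "x \<notin> I" "y \<notin> I"
      then show ?thesis using xy nn by (fastforce simp: N_def)
    qed
  qed
qed

text \<open>A bridge from the Bochner integral over \<open>leb\<close> to the gauge integral, in
  whose terms the change of variables formula is available.\<close>

lemma leb_integral_eq_integral:
  fixes u v :: "real \<Rightarrow> real"
  assumes "integrable leb u" "S \<in> sets borel" "S \<subseteq> {0..1}" "\<And>x. x \<in> {0..1} \<Longrightarrow> u x = (if x \<in> S then v x else 0)"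
  shows "v absolutely_integrable_on S" "(LINT x|leb. u x) = integral S v"
proof -
  have 1: "set_integrable lborel {0..1} u"
    using assms(1) unfolding leb_def by (subst (asm) integrable_restrict_space) (auto simp: set_integrable_def)
  have eq: "(\<lambda>x. indicat_real {0..1} x *\<^sub>R u x) = (\<lambda>x. indicat_real S x *\<^sub>R v x)"
    using assms(3,4) by (auto simp: indicator_def fun_eq_iff)
  have 2: "integrable lborel (\<lambda>x. indicat_real S x *\<^sub>R v x)"
    using 1 unfolding set_integrable_def eq .
  then have 3: "integrable lebesgue (\<lambda>x. indicat_real S x *\<^sub>R v x)"
    by (subst integrable_completion) auto
  then show ai: "v absolutely_integrable_on S" by (simp add: set_integrable_def)
  have "(LINT x|leb. u x) = (LINT x|lborel. indicat_real {0..1} x *\<^sub>R u x)"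
    unfolding leb_def by (subst integral_restrict_space) auto
  also have "\<dots> = (LINT x|lebesgue. indicat_real S x *\<^sub>R v x)"
    unfolding eq using 2 by (subst integral_completion) auto
  also have "\<dots> = integral S v"
    using set_lebesgue_integral_eq_integral(2)[OF ai] by (simp add: set_lebesgue_integral_def)
  finally show "(LINT x|leb. u x) = integral S v" .
qed

lemma deriv_nonzero_sign:
  fixes T' :: "real \<Rightarrow> real"
  assumes "continuous_on {c<..<d} T'" "\<And>x. x \<in> {c<..<d} \<Longrightarrow> T' x \<noteq> 0"
  shows "(\<forall>x\<in>{c<..<d}. 0 < T' x) \<or> (\<forall>x\<in>{c<..<d}. T' x < 0)"
proof (rule ccontr)
  assume "\<not> ?thesis"
  then obtain x y where xy: "x \<in> {c<..<d}" "y \<in> {c<..<d}" "T' x \<le> 0" "0 \<le> T' y"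
    by (meson not_less)
  have "connected (T' ` {c<..<d})" by (intro connected_continuous_image assms) auto
  then have "is_interval (T' ` {c<..<d})" by (simp add: is_interval_connected_1)
  then have "0 \<in> T' ` {c<..<d}" using xy unfolding is_interval_1 by (meson imageI)
  then obtain t where "t \<in> {c<..<d}" "T' t = 0" by auto
  then show False using assms(2) by blast
qed

text \<open>The branch contributes \<open>\<psi> / |T'|\<close>, transported by the inverse branch
  and extended by 0. Its variation consists of two boundary jumps of at most \<open>M / l\<close>,
  the variation of \<open>\<psi>\<close> divided by \<open>l\<close>, and the variation of the
  weight \<open>1 / |T'|\<close>, which has Lipschitz constant \<open>L / l^2\<close>. Change of
  variables gives the duality.\<close>

lemma branch:
  fixes T T' \<psi> N :: "real \<Rightarrow> real"
  assumes cd: "0 \<le> c" "c < d" "d \<le> 1" and T: "T \<in> measurable leb leb" and l0: "0 < l"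
    and der: "\<And>x. x \<in> {c<..<d} \<Longrightarrow> (T has_real_derivative T' x) (at x)"
    and ex: "\<And>x. x \<in> {c<..<d} \<Longrightarrow> l \<le> \<bar>T' x\<bar>"
    and lip: "\<And>x y. x \<in> {c<..<d} \<Longrightarrow> y \<in> {c<..<d} \<Longrightarrow> \<bar>T' x - T' y\<bar> \<le> L * \<bar>x - y\<bar>" "0 \<le> L"
    and N: "\<And>x y. 0 \<le> x \<Longrightarrow> x \<le> y \<Longrightarrow> y \<le> 1 \<Longrightarrow> \<bar>\<psi> y - \<psi> x\<bar> \<le> N y - N x"
    and M: "\<And>x. x \<in> {c<..<d} \<Longrightarrow> \<bar>\<psi> x\<bar> \<le> M"
    and int: "integrable leb \<psi>"
  shows "\<exists>\<rho>. bvar (2 * (M / l) + ((N d - N c) / l + M * (L / l\<^sup>2) * (d - c))) \<rho> \<and>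
     (\<forall>G b. G \<in> borel_measurable leb \<longrightarrow> (\<forall>x\<in>{0..1}. \<bar>G x\<bar> \<le> b) \<longrightarrow>
        (LINT x|leb. G x * \<rho> x) = (LINT x|leb. indicator {c<..<d} x * (G (T x) * \<psi> x)))"
proof -
  let ?C = "{c<..<d}"
  have C01: "?C \<subseteq> {0..1}" using cd by auto
  have nz: "T' x \<noteq> 0" if "x \<in> ?C" for x using ex[OF that] l0 by auto
  have M0: "0 \<le> M" using M[of "(c+d)/2"] cd by auto
  have contT': "continuous_on ?C T'"
  proof (rule lipschitz_on_continuous_on)
    show "L-lipschitz_on ?C T'" using lip by (intro lipschitz_onI) (auto simp: dist_real_def)
  qed
  have contT: "continuous_on ?C T"
    using der by (meson DERIV_isCont continuous_at_imp_continuous_on)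
  have sgn: "(\<forall>x\<in>?C. 0 < T' x) \<or> (\<forall>x\<in>?C. T' x < 0)"
    by (rule deriv_nonzero_sign[OF contT' nz])
  have mono: "(\<forall>x\<in>?C. \<forall>y\<in>?C. x < y \<longrightarrow> T x < T y) \<or> (\<forall>x\<in>?C. \<forall>y\<in>?C. x < y \<longrightarrow> T y < T x)"
    using sgn
  proof
    assume p: "\<forall>x\<in>?C. 0 < T' x"
    have "T x < T y" if "x \<in> ?C" "y \<in> ?C" "x < y" for x y
    proof (rule DERIV_pos_imp_increasing[OF that(3)])
      fix t assume "x \<le> t" "t \<le> y" then show "\<exists>y. (T has_real_derivative y) (at t) \<and> 0 < y"
        using der[of t] p that by (intro exI[of _ "T' t"]) auto
    qed
    then show ?thesis by blast
  next
    assume p: "\<forall>x\<in>?C. T' x < 0"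
    have "T y < T x" if "x \<in> ?C" "y \<in> ?C" "x < y" for x y
    proof (rule DERIV_neg_imp_decreasing[OF that(3)])
      fix t assume "x \<le> t" "t \<le> y" then show "\<exists>y. (T has_real_derivative y) (at t) \<and> y < 0"
        using der[of t] p that by (intro exI[of _ "T' t"]) auto
    qed
    then show ?thesis by blast
  qed
  have inj: "inj_on T ?C"
  proof (rule inj_onI)
    fix x y assume "x \<in> ?C" "y \<in> ?C" "T x = T y"
    then show "x = y" using mono by (cases x y rule: linorder_cases) force+
  qed
  define S where "S = the_inv_into ?C T"
  have ST: "S (T x) = x" if "x \<in> ?C" for x unfolding S_def by (rule the_inv_into_f_f[OF inj that])
  define I where "I = T ` ?C"
  have SI: "S y \<in> ?C" "T (S y) = y" if "y \<in> I" for y using that ST by (auto simp: I_def)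
  define w where "w x = 1 / \<bar>T' x\<bar>" for x
  have wb: "0 < w x" "w x \<le> 1 / l" if "x \<in> ?C" for x
    using ex[OF that] l0 nz[OF that] by (auto simp: w_def intro!: divide_left_mono)
  have wl: "\<bar>w x - w y\<bar> \<le> L / l\<^sup>2 * \<bar>x - y\<bar>" if "x \<in> ?C" "y \<in> ?C" for x y
  proof -
    have p: "0 < \<bar>T' x\<bar>" "0 < \<bar>T' y\<bar>" using nz that by auto
    have "\<bar>w x - w y\<bar> = \<bar>\<bar>T' y\<bar> - \<bar>T' x\<bar>\<bar> / (\<bar>T' x\<bar> * \<bar>T' y\<bar>)"
      using p by (simp add: w_def diff_frac_eq abs_mult abs_divide)
    also have "\<dots> \<le> (L * \<bar>x - y\<bar>) / (l * l)"
    proof (rule frac_le)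
      show "\<bar>\<bar>T' y\<bar> - \<bar>T' x\<bar>\<bar> \<le> L * \<bar>x - y\<bar>" using lip(1)[OF that] by linarith
      show "l * l \<le> \<bar>T' x\<bar> * \<bar>T' y\<bar>" using ex that l0 by (intro mult_mono) auto
    qed (use lip(2) l0 in auto)
    finally show ?thesis by (simp add: power2_eq_square)
  qed
  \<comment> \<open>A majorant for \<open>\<psi> * w\<close> before transport: the product rule with
    \<open>w \<le> 1 / l\<close> and \<open>|\<psi>| \<le> M\<close>.\<close>
  define A where "A x = N x / l + M * (L / l\<^sup>2) * x" for x
  have Ab: "\<bar>\<psi> y * w y - \<psi> x * w x\<bar> \<le> A y - A x" if "x \<in> ?C" "y \<in> ?C" "x \<le> y" for x y
  proof -
    have n: "\<bar>\<psi> y - \<psi> x\<bar> \<le> N y - N x" using N that cd by auto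
    have "\<psi> y * w y - \<psi> x * w x = (\<psi> y - \<psi> x) * w y + \<psi> x * (w y - w x)" by algebra
    moreover have "\<bar>(\<psi> y - \<psi> x) * w y\<bar> \<le> (N y - N x) * (1 / l)"
      unfolding abs_mult using n wb[OF that(2)] by (intro mult_mono) auto
    moreover have "\<bar>\<psi> x * (w y - w x)\<bar> \<le> M * (L / l\<^sup>2 * (y - x))"
      unfolding abs_mult using M[OF that(1)] wl[OF that(2,1)] M0 that(3) by (intro mult_mono) auto
    ultimately show ?thesis by (simp add: A_def algebra_simps diff_divide_distrib)
  qed
  have Amono: "A x \<le> A y" if "c \<le> x" "x \<le> y" "y \<le> d" for x y
  proof -
    have "N x \<le> N y" using N[of x y] that cd by auto
    moreover have "M * (L / l\<^sup>2) * x \<le> M * (L / l\<^sup>2) * y" using that M0 lip(2) by (intro mult_left_mono) auto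
    ultimately show ?thesis using l0 by (auto simp: A_def intro!: add_mono divide_right_mono)
  qed
  define D where "D = A d - A c"
  have D0: "0 \<le> D" using Amono[of c d] cd by (simp add: D_def)
  have sb: "\<bar>\<psi> x * w x\<bar> \<le> M / l" if "x \<in> ?C" for x
    unfolding abs_mult using mult_mono[OF M[OF that], of "\<bar>w x\<bar>" "1/l"] wb[OF that] M0 by auto
  \<comment> \<open>An increasing branch keeps the order of points and a decreasing one reverses it,
    so \<open>A\<close> is measured from the left end \<open>c\<close> in one case and from the
    right end \<open>d\<close> in the other.\<close>
  obtain K where K1: "\<And>x y. x \<in> I \<Longrightarrow> y \<in> I \<Longrightarrow> x \<le> y \<Longrightarrow> \<bar>\<psi> (S y) * w (S y) - \<psi> (S x) * w (S x)\<bar> \<le> K y - K x"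
    and K2: "\<And>x. x \<in> I \<Longrightarrow> 0 \<le> K x \<and> K x \<le> D"
  proof -
    from mono show ?thesis
    proof
      assume m: "\<forall>x\<in>?C. \<forall>y\<in>?C. x < y \<longrightarrow> T x < T y"
      have Sm: "S x \<le> S y" if "x \<in> I" "y \<in> I" "x \<le> y" for x y
        using m SI[OF that(1)] SI[OF that(2)] that(3) by (metis not_le)
      show ?thesis
      proof (rule that[of "\<lambda>y. A (S y) - A c"])
        fix x y assume *: "x \<in> I" "y \<in> I" "x \<le> y"
        show "\<bar>\<psi> (S y) * w (S y) - \<psi> (S x) * w (S x)\<bar> \<le> A (S y) - A c - (A (S x) - A c)"
          using Ab[OF SI(1)[OF *(1)] SI(1)[OF *(2)] Sm[OF *]] by simp
      next
        fix x assume "x \<in> I" then show "0 \<le> A (S x) - A c \<and> A (S x) - A c \<le> D"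
          using SI(1)[of x] Amono[of c "S x"] Amono[of "S x" d] by (auto simp: D_def)
      qed
    next
      assume m: "\<forall>x\<in>?C. \<forall>y\<in>?C. x < y \<longrightarrow> T y < T x"
      have Sm: "S y \<le> S x" if "x \<in> I" "y \<in> I" "x \<le> y" for x y
        using m SI[OF that(1)] SI[OF that(2)] that(3) by (metis not_le)
      show ?thesis
      proof (rule that[of "\<lambda>y. A d - A (S y)"])
        fix x y assume *: "x \<in> I" "y \<in> I" "x \<le> y"
        show "\<bar>\<psi> (S y) * w (S y) - \<psi> (S x) * w (S x)\<bar> \<le> A d - A (S y) - (A d - A (S x))"
          using Ab[OF SI(1)[OF *(2)] SI(1)[OF *(1)] Sm[OF *]] by simp
      next
        fix x assume "x \<in> I" then show "0 \<le> A d - A (S x) \<and> A d - A (S x) \<le> D"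
          using SI(1)[of x] Amono[of c "S x"] Amono[of "S x" d] by (auto simp: D_def)
      qed
    qed
  qed
  define \<rho> where "\<rho> y = (if y \<in> I then \<psi> (S y) * w (S y) else 0)" for y
  have "connected I" unfolding I_def by (intro connected_continuous_image contT) auto
  then have Ii: "is_interval I" by (simp add: is_interval_connected_1)
  then have conv: "t \<in> I" if "x \<in> I" "y \<in> I" "x \<le> t" "t \<le> y" for x y t
    using that unfolding is_interval_1 by blast
  have bv: "bvar (2 * (M / l) + D) \<rho>"
    unfolding \<rho>_def
  proof (rule bvar_extend_zero[where K = K])
    show "0 \<le> M / l" using M0 l0 by simp
    show "\<bar>\<psi> (S x) * w (S x)\<bar> \<le> M / l" if "x \<in> I" for x using sb[OF SI(1)[OF that]] .
  qed (fact conv K1 K2 D0)+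
  have I01: "I \<subseteq> {0..1}" using measurable_space[OF T] C01 by (force simp: I_def)
  have Ib: "I \<in> sets borel" using Ii by (rule real_interval_borel_measurable)
  show ?thesis
  proof (intro exI conjI allI impI)
    show "bvar (2 * (M / l) + ((N d - N c) / l + M * (L / l\<^sup>2) * (d - c))) \<rho>"
      using bv by (simp add: D_def A_def algebra_simps diff_divide_distrib)
    fix G :: "real \<Rightarrow> real" and b assume G: "G \<in> borel_measurable leb" "\<forall>x\<in>{0..1}. \<bar>G x\<bar> \<le> b"
    have GT: "(\<lambda>x. G (T x)) \<in> borel_measurable leb" using T G(1) by measurable
    have GTb: "\<bar>G (T x)\<bar> \<le> b" if "x \<in> {0..1}" for x using measurable_space[OF T, of x] that G(2) by auto
    have ind: "(\<lambda>x. indicator ?C x :: real) \<in> borel_measurable leb"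
      by (intro borel_measurable_lebI) auto
    have i0: "integrable leb (\<lambda>x. G (T x) * \<psi> x)" by (rule integrable_bounded_mult[OF int GT GTb])
    have i1: "integrable leb (\<lambda>x. indicator ?C x * (G (T x) * \<psi> x))"
      by (rule integrable_bounded_mult[OF i0 ind, where b = 1]) (simp add: indicator_def)
    note L = leb_integral_eq_integral[where S = ?C and v = "\<lambda>x. G (T x) * \<psi> x", OF i1 _ C01]
    have L1: "(\<lambda>x. G (T x) * \<psi> x) absolutely_integrable_on ?C"
      by (rule L(1)) (auto simp: indicator_def)
    have eqC: "\<bar>T' x\<bar> * (G (T x) * \<rho> (T x)) = G (T x) * \<psi> x" if "x \<in> ?C" for x
      using ST[OF that] nz[OF that] that by (auto simp: \<rho>_def I_def w_def)
    have ai: "(\<lambda>x. \<bar>T' x\<bar> * (G (T x) * \<rho> (T x))) absolutely_integrable_on ?C"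
      using L1 by (subst set_integrable_cong[OF refl refl eqC])
    have cov: "(\<lambda>y. G y * \<rho> y) absolutely_integrable_on I \<and>
        integral I (\<lambda>y. G y * \<rho> y) = integral ?C (\<lambda>x. \<bar>T' x\<bar> * (G (T x) * \<rho> (T x)))"
      unfolding I_def
    proof (subst has_absolute_integral_change_of_variables_1'[symmetric, where g' = T'])
      show "(T has_real_derivative T' x) (at x within ?C)" if "x \<in> ?C" for x
        using der[OF that] by (rule has_field_derivative_at_within)
    qed (use inj ai in auto)
    have i2: "integrable leb (\<lambda>y. G y * \<rho> y)"
      using integrable_bounded_mult[OF bvar_integrable[OF bv] G(1), of b] G(2) by auto
    have "(LINT x|leb. G x * \<rho> x) = integral I (\<lambda>y. G y * \<rho> y)"
      by (rule leb_integral_eq_integral(2)[OF i2 Ib I01]) (auto simp: \<rho>_def)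
    also have "\<dots> = integral ?C (\<lambda>x. G (T x) * \<psi> x)"
      using cov integral_cong[of ?C, OF eqC] by simp
    also have "\<dots> = (LINT x|leb. indicator ?C x * (G (T x) * \<psi> x))"
      by (rule L(2)[symmetric]) (auto simp: indicator_def)
    finally show "(LINT x|leb. G x * \<rho> x) = (LINT x|leb. indicator ?C x * (G (T x) * \<psi> x))" .
  qed
qed

section \<open>The Lasota--Yorke inequality\<close>

text \<open>A derivative that is Lipschitz on each gap of \<open>P\<close> replaces the second
  derivative: this controls the variation of \<open>1 / |T'|\<close> and passes easily through
  compositions. The upper bound \<open>B\<close> enters the Lipschitz constant of a
  composition.\<close>

definition pwx :: "real \<Rightarrow> (real \<Rightarrow> real) \<Rightarrow> bool" where
  "pwx l T \<longleftrightarrow> (\<exists>P T' B L. finite P \<and> 0 \<in> P \<and> 1 \<in> P \<and> P \<subseteq> {0..1} \<and> T ` {0..1} \<subseteq> {0..1} \<and> 0 \<le> L \<and>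
     (\<forall>x\<in>{0..1} - P. (T has_real_derivative T' x) (at x) \<and> l \<le> \<bar>T' x\<bar> \<and> \<bar>T' x\<bar> \<le> B) \<and>
     (\<forall>x y. 0 \<le> x \<longrightarrow> x \<le> y \<longrightarrow> y \<le> 1 \<longrightarrow> {x..y} \<inter> P = {} \<longrightarrow> \<bar>T' x - T' y\<bar> \<le> L * (y - x)))"

lemma measurable_leb_continuous_off_finite:
  assumes "finite P" "0 \<in> P" "1 \<in> P" "\<And>x. x \<in> {0..1} - P \<Longrightarrow> isCont T x" "T ` {0..1} \<subseteq> {0..1::real}"
  shows "T \<in> measurable leb leb"
proof -
  define F where "F x = (if x \<in> {0..1} then T x else 0)" for x
  have "F \<in> borel_measurable borel"
  proof (rule borel_measurable_continuous_countable_exceptions)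
    show "countable P" using assms(1) by (rule countable_finite)
    have "isCont F x" if x: "x \<notin> P" for x
    proof (cases "x \<in> {0<..<1}")
      case True
      then have "isCont T x" using assms(4) x by auto
      moreover have "\<forall>\<^sub>F y in nhds x. F y = T y"
        by (rule eventually_nhds_in_open[of "{0<..<1}", THEN eventually_mono]) (use True in \<open>auto simp: F_def\<close>)
      ultimately show ?thesis using isCont_cong by blast
    next
      case False
      then have "x \<in> - {0..1}" using x assms(2,3) by (cases "x = 0"; cases "x = 1") auto
      then have "\<forall>\<^sub>F y in nhds x. F y = 0"
        by (intro eventually_nhds_in_open[of "-{0..1}", THEN eventually_mono]) (auto simp: F_def)
      then show ?thesis using isCont_cong[of F "\<lambda>_. 0"] by auto
    qed
    then show "continuous_on (- P) F" by (intro continuous_at_imp_continuous_on) auto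
  qed
  then have 1: "F \<in> borel_measurable leb" by (rule borel_measurable_lebI)
  have 2: "T \<in> borel_measurable leb"
    by (rule measurable_cong[THEN iffD1, OF _ 1]) (auto simp: F_def)
  have "T \<in> measurable leb (restrict_space borel {0..1})"
    using 2 assms(5) by (intro measurable_restrict_space2) auto
  then show ?thesis by (subst measurable_cong_sets[OF refl sets_leb])
qed

lemma pwx_measurable: "pwx l T \<Longrightarrow> T \<in> measurable leb leb"
  unfolding pwx_def by (elim exE conjE, rule measurable_leb_continuous_off_finite) (auto intro: DERIV_isCont)

lemma finite_partition_enum:
  fixes P :: "real set"
  assumes "finite P" "0 \<in> P" "1 \<in> P" "P \<subseteq> {0..1}"
  obtains p :: "nat \<Rightarrow> real" and m where "p 0 = 0" "p m = 1" "\<And>i. i < m \<Longrightarrow> p i < p (Suc i)"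
     "\<And>i. i < m \<Longrightarrow> {p i<..<p (Suc i)} \<inter> P = {}" "\<And>i. i \<le> m \<Longrightarrow> p i \<in> P"
proof -
  define xs where "xs = sorted_list_of_set P"
  have set: "set xs = P" using assms(1) by (simp add: xs_def)
  have ss: "sorted_wrt (<) xs" by (simp add: xs_def)
  have lt: "xs ! i < xs ! j" if "i < j" "j < length xs" for i j
    using ss that by (simp add: sorted_wrt_iff_nth_less)
  have le: "xs ! i \<le> xs ! j" if "i \<le> j" "j < length xs" for i j
    using lt[of i j] that by (cases "i = j") auto
  have ne: "xs \<noteq> []" using set assms(2) by auto
  have mem: "xs ! i \<in> P" if "i < length xs" for i using set that nth_mem by blast
  have idx: "\<exists>i<length xs. xs ! i = x" if "x \<in> P" for x using set that by (metis in_set_conv_nth)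
  show ?thesis
  proof (rule that[of "\<lambda>i. xs ! i" "length xs - 1"])
    obtain i where "i < length xs" "xs ! i = 0" using idx[OF assms(2)] by auto
    then show "xs ! 0 = 0" using le[of 0 i] mem[of 0] ne assms(4) by fastforce
    obtain i where "i < length xs" "xs ! i = 1" using idx[OF assms(3)] by auto
    then show "xs ! (length xs - 1) = 1" using le[of i "length xs - 1"] mem[of "length xs - 1"] ne assms(4) by fastforce
    fix i assume i: "i < length xs - 1"
    then show "xs ! i < xs ! Suc i" by (intro lt) auto
    show "{xs ! i<..<xs ! Suc i} \<inter> P = {}"
    proof (rule ccontr)
      assume "{xs ! i<..<xs ! Suc i} \<inter> P \<noteq> {}"
      then obtain j where j: "j < length xs" "xs ! i < xs ! j" "xs ! j < xs ! Suc i" using idx by fastforce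
      have "i < j" using le[of j i] i j by (meson not_le less_le_trans diff_le_self)
      moreover have "j < Suc i" using le[of "Suc i" j] j by (meson not_le)
      ultimately show False by simp
    qed
  next
    fix i assume "i \<le> length xs - 1" 
    then have "i < length xs" using ne by (cases xs) auto
    then show "xs ! i \<in> P" by (rule mem)
  qed
qed

lemma sum_gap_indicators:
  fixes p :: "nat \<Rightarrow> real"
  assumes "\<And>i. i < m \<Longrightarrow> p i < p (Suc i)" "p 0 < x" "\<And>i. i \<le> m \<Longrightarrow> x \<noteq> p i"
  shows "(\<Sum>i<m. indicator {p i<..<p (Suc i)} x) = (if x < p m then 1 else 0 :: real)"
  using assms
proof (induction m)
  case (Suc m)
  have "(\<Sum>i<m. indicator {p i<..<p (Suc i)} x) = (if x < p m then 1 else 0 :: real)"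
    using Suc by auto
  then show ?case using Suc.prems(1)[of m] Suc.prems(3)[of m] by (auto simp: indicator_def)
qed auto

text \<open>Sum \<open>branch\<close> over the gaps of a refined partition. On a gap,
  \<open>|\<phi>|\<close> is at most \<open>M\<close>, its variation there plus its mean. The two
  boundary jumps cost \<open>2 M / l\<close>, the distortion another \<open>M / l\<close> if the gap
  is short, and the variation of \<open>\<phi>\<close> itself is divided by \<open>l\<close>;
  together this produces the factor \<open>4 / l\<close>.\<close>

theorem lasota_yorke:
  assumes "pwx l T" "0 < l"
  shows "\<exists>B\<ge>0. \<forall>\<phi> V. bvar V \<phi> \<longrightarrow> (\<exists>\<psi>. tr T \<phi> \<psi> \<and> bvar (4 / l * V + B * (LINT x|leb. \<bar>\<phi> x\<bar>)) \<psi>)"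
proof -
  have T: "T \<in> measurable leb leb" by (rule pwx_measurable[OF assms(1)])
  obtain P T' B L where P: "finite P" "0 \<in> P" "1 \<in> P" "P \<subseteq> {0..1}" and L0: "0 \<le> L"
    and der: "\<And>x. x \<in> {0..1} - P \<Longrightarrow> (T has_real_derivative T' x) (at x) \<and> l \<le> \<bar>T' x\<bar> \<and> \<bar>T' x\<bar> \<le> B"
    and lip: "\<And>x y. 0 \<le> x \<Longrightarrow> x \<le> y \<Longrightarrow> y \<le> 1 \<Longrightarrow> {x..y} \<inter> P = {} \<Longrightarrow> \<bar>T' x - T' y\<bar> \<le> L * (y - x)"
    using assms(1) unfolding pwx_def by (elim exE conjE) blast
  \<comment> \<open>A grid of mesh \<open>1 / K\<close> makes the distortion over one gap,
    \<open>(L / l^2) / K\<close>, at most \<open>1 / l\<close>.\<close>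
  define K where "K = nat \<lceil>L / l\<rceil> + 1"
  have K0: "0 < real K" by (simp add: K_def)
  have Kge: "L / l \<le> real K" by (simp add: K_def) linarith
  have LK: "L / l\<^sup>2 * (1 / real K) \<le> 1 / l"
  proof -
    have "L / l\<^sup>2 * (1 / real K) = (L / l) / real K * (1 / l)" by (simp add: power2_eq_square)
    also have "\<dots> \<le> 1 * (1 / l)"
    proof (rule mult_right_mono)
      show "L / l / real K \<le> 1" using Kge K0 by (subst divide_le_eq_1_pos)
    qed (use assms(2) in simp)
    finally show ?thesis by simp
  qed
  define P' where "P' = P \<union> (\<lambda>j. real j / real K) ` {..K}"
  have P': "finite P'" "0 \<in> P'" "1 \<in> P'" "P' \<subseteq> {0..1}"
    using P K0 by (auto simp: P'_def)
  obtain p m where p: "p 0 = 0" "p m = 1" "\<And>i. i < m \<Longrightarrow> p i < p (Suc i)"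
     "\<And>i. i < m \<Longrightarrow> {p i<..<p (Suc i)} \<inter> P' = {}" "\<And>i. i \<le> m \<Longrightarrow> p i \<in> P'"
    using finite_partition_enum[OF P'] by blast
  have p01: "p i \<in> {0..1}" if "i \<le> m" for i using p(5)[OF that] P'(4) by auto
  have small: "p (Suc i) - p i \<le> 1 / real K" if i: "i < m" for i
  proof (rule ccontr)
    assume "\<not> ?thesis"
    then have g: "p i + 1 / real K < p (Suc i)" by simp
    \<comment> \<open>\<open>j / K\<close> is the first grid point strictly to the right of
      \<open>p i\<close>; a gap longer than \<open>1 / K\<close> would contain it.\<close>
    define j where "j = nat \<lfloor>p i * real K\<rfloor> + 1"
    have pi: "0 \<le> p i" "p (Suc i) \<le> 1" using p01[of i] p01[of "Suc i"] i by auto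
    have fl: "0 \<le> \<lfloor>p i * real K\<rfloor>" using pi K0 by simp
    then have jr: "real j = of_int \<lfloor>p i * real K\<rfloor> + 1" by (simp add: j_def)
    have j1: "p i * real K < real j" unfolding jr by linarith
    have j2: "real j \<le> p i * real K + 1" unfolding jr by linarith
    have a: "p i < real j / real K" using j1 K0 by (simp add: field_simps)
    have b: "real j / real K \<le> p i + 1 / real K" using j2 K0 by (simp add: field_simps)
    have "real j / real K < 1" using b g pi by linarith
    then have "real j < real K" using K0 by (simp add: field_simps)
    then have "real j / real K \<in> P'" unfolding P'_def by auto
    moreover have "real j / real K \<in> {p i<..<p (Suc i)}" using a b g by simp
    ultimately show False using p(4)[OF i] by blast
  qed
  \<comment> \<open>The shortest gap: dividing by it turns the integral of \<open>|\<phi>|\<close>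
    over a gap into a bound for the mean, which is the origin of the constant
    \<open>3 / (l * e)\<close>.\<close>
  define e where "e = Min ((\<lambda>i. p (Suc i) - p i) ` {..<m})"
  have m0: "0 < m" using p(1,2) by (cases m) auto
  have e0: "0 < e" unfolding e_def using m0 p(3) by (subst Min_gr_iff) auto
  have ele: "e \<le> p (Suc i) - p i" if "i < m" for i unfolding e_def using that by (intro Min_le) auto
  have gapP: "x \<in> {0..1} - P" if "x \<in> {p i<..<p (Suc i)}" "i < m" for x i
    using that p(4)[OF that(2)] p01[of i] p01[of "Suc i"] by (force simp: P'_def)
  let ?gap = "\<lambda>i. {p i<..<p (Suc i)}"
  have one: "AE x in leb. (\<Sum>i<m. indicator (?gap i) x) = (1::real)"
  proof -
    have "AE x in leb. x \<notin> P'" by (rule AE_leb_countable[OF countable_finite[OF P'(1)]])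
    then show ?thesis
    proof (rule AE_mp, intro AE_I2 impI)
      fix x assume x: "x \<in> space leb" "x \<notin> P'"
      have "(\<Sum>i<m. indicator (?gap i) x) = (if x < p m then 1 else 0 :: real)"
        by (rule sum_gap_indicators) (use x p P' in \<open>auto simp: order_less_le\<close>)
      moreover have "x < p m" using x p P' by (auto simp: order_less_le)
      ultimately show "(\<Sum>i<m. indicator (?gap i) x) = (1::real)" by simp
    qed
  qed
  have ind: "(\<lambda>x. indicator (?gap i) x :: real) \<in> borel_measurable leb" for i
    by (intro borel_measurable_lebI) auto
  have split: "(LINT x|leb. u x) = (\<Sum>i<m. LINT x|leb. indicator (?gap i) x * u x)" if u: "integrable leb u" for u :: "real \<Rightarrow> real"
  proof -
    have iu: "integrable leb (\<lambda>x. indicator (?gap i) x * u x)" for i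
      by (rule integrable_bounded_mult[OF u ind, where b = 1]) (simp add: indicator_def)
    have "(\<Sum>i<m. LINT x|leb. indicator (?gap i) x * u x) = (LINT x|leb. (\<Sum>i<m. indicator (?gap i) x * u x))"
      using iu by (subst Bochner_Integration.integral_sum) auto
    also have "\<dots> = (LINT x|leb. u x)"
    proof (rule integral_cong_AE)
      show "AE x in leb. (\<Sum>i<m. indicator (?gap i) x * u x) = u x"
        using one by (rule AE_mp) (auto simp: sum_distrib_right[symmetric])
      show "(\<lambda>x. \<Sum>i<m. indicator (?gap i) x * u x) \<in> borel_measurable leb"
        by (intro borel_measurable_integrable Bochner_Integration.integrable_sum iu)
      show "u \<in> borel_measurable leb" using u by (rule borel_measurable_integrable)
    qed
    finally show ?thesis by (rule sym)
  qed
  show ?thesis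
  proof (rule exI[of _ "3 / (l * e)"], intro conjI allI impI)
    show "0 \<le> 3 / (l * e)" using assms(2) e0 by simp
    fix \<phi> V assume bv: "bvar V \<phi>"
    obtain N where N: "\<And>x y. 0 \<le> x \<Longrightarrow> x \<le> y \<Longrightarrow> y \<le> 1 \<Longrightarrow> \<bar>\<phi> y - \<phi> x\<bar> \<le> N y - N x" "N 1 - N 0 \<le> V"
      using bv by (rule bvarE) blast
    have int: "integrable leb \<phi>" by (rule bvar_integrable[OF bv])
    define A where "A i = (LINT x|leb. indicator (?gap i) x * \<bar>\<phi> x\<bar>)" for i
    have A0: "0 \<le> A i" for i unfolding A_def by (intro integral_nonneg_AE) auto
    define M where "M i = N (p (Suc i)) - N (p i) + A i / e" for i
    have Mb: "\<bar>\<phi> x\<bar> \<le> M i" if x: "x \<in> ?gap i" and i: "i < m" for x i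
    proof -
      let ?D = "N (p (Suc i)) - N (p i)"
      let ?g = "p (Suc i) - p i"
      have g0: "0 < ?g" using p(3)[OF i] by simp
      have pp: "0 \<le> p i" "p (Suc i) \<le> 1" using p01[of i] p01[of "Suc i"] i by auto
      have osc: "\<bar>\<phi> x\<bar> - ?D \<le> \<bar>\<phi> t\<bar>" if t: "t \<in> ?gap i" for t
      proof (cases "x \<le> t")
        case True
        then show ?thesis using N(1)[of x t] N(1)[of "p i" x] N(1)[of t "p (Suc i)"] x t pp by auto
      next
        case False
        then show ?thesis using N(1)[of t x] N(1)[of "p i" t] N(1)[of x "p (Suc i)"] x t pp by auto
      qed
      have meas: "(LINT t|leb. indicator (?gap i) t :: real) = ?g"
      proof -
        have g: "?gap i \<in> sets leb" using pp by (intro in_sets_leb) auto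
        have "emeasure leb (?gap i) = ennreal ?g" using g g0 by (simp add: emeasure_leb)
        then have "measure leb (?gap i) = ?g" using g0 by (simp add: measure_def)
        moreover have "?gap i \<inter> space leb = ?gap i" using pp by auto
        ultimately show ?thesis by simp
      qed
      have "(\<bar>\<phi> x\<bar> - ?D) * ?g = (LINT t|leb. (\<bar>\<phi> x\<bar> - ?D) * indicator (?gap i) t)"
        using meas by simp
      also have "\<dots> \<le> A i" unfolding A_def
      proof (rule integral_mono)
        show "integrable leb (\<lambda>t. (\<bar>\<phi> x\<bar> - ?D) * indicator (?gap i) t)"
          using ind by (intro integrable_mult_right leb.integrable_const_bound[where B = 1]) (auto simp: indicator_def)
        show "integrable leb (\<lambda>t. indicator (?gap i) t * \<bar>\<phi> t\<bar>)"
          by (rule integrable_bounded_mult[OF _ ind, where b = 1]) (use int in \<open>auto simp: indicator_def\<close>)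
        show "(\<bar>\<phi> x\<bar> - ?D) * indicator (?gap i) t \<le> indicator (?gap i) t * \<bar>\<phi> t\<bar>" for t
          using osc[of t] by (simp add: indicator_def)
      qed
      finally have "\<bar>\<phi> x\<bar> - ?D \<le> A i / ?g" using g0 by (simp add: field_simps)
      also have "\<dots> \<le> A i / e" using A0 ele[OF i] e0 by (intro divide_left_mono) auto
      finally show ?thesis by (simp add: M_def)
    qed
    define Br where "Br i \<rho> \<longleftrightarrow> bvar (2 * (M i / l) + ((N (p (Suc i)) - N (p i)) / l + M i * (L / l\<^sup>2) * (p (Suc i) - p i))) \<rho> \<and>
     (\<forall>G b. G \<in> borel_measurable leb \<longrightarrow> (\<forall>x\<in>{0..1}. \<bar>G x\<bar> \<le> b) \<longrightarrow>
        (LINT x|leb. G x * \<rho> x) = (LINT x|leb. indicator {p i<..<p (Suc i)} x * (G (T x) * \<phi> x)))" for i \<rho>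
    have ex: "\<exists>\<rho>. Br i \<rho>"
      if i: "i < m" for i
      unfolding Br_def
    proof (rule branch[where T' = T'])
      have pp: "0 \<le> p i" "p (Suc i) \<le> 1" using p01[of i] p01[of "Suc i"] i by auto
      show "\<bar>T' x - T' y\<bar> \<le> L * \<bar>x - y\<bar>" if xy: "x \<in> ?gap i" "y \<in> ?gap i" for x y
      proof -
        have "{u..v} \<inter> P = {}" if "p i < u" "v < p (Suc i)" for u v
        proof -
          have "{u..v} \<subseteq> ?gap i" using that by auto
          then show ?thesis using p(4)[OF i] unfolding P'_def by blast
        qed
        then show ?thesis using lip[of x y] lip[of y x] xy pp by (cases "x \<le> y") auto
      qed
      show "(T has_real_derivative T' x) (at x)" "l \<le> \<bar>T' x\<bar>" if "x \<in> ?gap i" for x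
        using der[OF gapP[OF that i]] by auto
      show "\<bar>\<phi> x\<bar> \<le> M i" if "x \<in> ?gap i" for x by (rule Mb[OF that i])
      show "0 \<le> p i" "p (Suc i) \<le> 1" by (fact pp)+
      show "p i < p (Suc i)" by (rule p(3)[OF i])
    qed (fact T assms(2) L0 N(1) int)+
    define \<rho> where "\<rho> i = (SOME \<rho>. Br i \<rho>)" for i
    have Br: "Br i (\<rho> i)" if "i < m" for i unfolding \<rho>_def by (rule someI_ex[OF ex[OF that]])
    have \<rho>1: "bvar (2 * (M i / l) + ((N (p (Suc i)) - N (p i)) / l + M i * (L / l\<^sup>2) * (p (Suc i) - p i))) (\<rho> i)"
      if "i < m" for i using Br[OF that] unfolding Br_def by blast
    have \<rho>2: "(LINT x|leb. G x * \<rho> i x) = (LINT x|leb. indicator {p i<..<p (Suc i)} x * (G (T x) * \<phi> x))"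
      if "i < m" "G \<in> borel_measurable leb" "\<forall>x\<in>{0..1}. \<bar>G x\<bar> \<le> b" for i G b
      using Br[OF that(1)] that(2,3) unfolding Br_def by blast
    define \<psi> where "\<psi> x = (\<Sum>i<m. \<rho> i x)" for x
    have M0: "0 \<le> M i" if "i < m" for i
      using Mb[of "(p i + p (Suc i)) / 2" i] p(3)[OF that] that by force
    have \<rho>3: "bvar (4 / l * (N (p (Suc i)) - N (p i)) + 3 / (l * e) * A i) (\<rho> i)" if i: "i < m" for i
    proof (rule bvar_mono[OF \<rho>1[OF i]])
      have "M i * (L / l\<^sup>2) * (p (Suc i) - p i) \<le> M i * (L / l\<^sup>2) * (1 / real K)"
        using M0[OF i] L0 small[OF i] by (intro mult_left_mono) auto
      also have "\<dots> \<le> M i * (1 / l)"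
        using M0[OF i] LK mult_left_mono[of "L / l\<^sup>2 * (1 / real K)" "1 / l" "M i"] by (simp add: mult.assoc)
      finally have "M i * (L / l\<^sup>2) * (p (Suc i) - p i) \<le> M i / l" by simp
      then have "2 * (M i / l) + ((N (p (Suc i)) - N (p i)) / l + M i * (L / l\<^sup>2) * (p (Suc i) - p i))
        \<le> 3 * (M i / l) + (N (p (Suc i)) - N (p i)) / l" by linarith
      also have "\<dots> = 4 / l * (N (p (Suc i)) - N (p i)) + 3 / (l * e) * A i"
        using assms(2) e0 by (simp add: M_def field_simps)
      finally show "2 * (M i / l) + ((N (p (Suc i)) - N (p i)) / l + M i * (L / l\<^sup>2) * (p (Suc i) - p i))
        \<le> 4 / l * (N (p (Suc i)) - N (p i)) + 3 / (l * e) * A i" .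
    qed
    have "bvar (\<Sum>i<m. 4 / l * (N (p (Suc i)) - N (p i)) + 3 / (l * e) * A i) \<psi>"
      unfolding \<psi>_def by (rule bvar_sum[OF \<rho>3]) auto
    moreover have "(\<Sum>i<m. 4 / l * (N (p (Suc i)) - N (p i)) + 3 / (l * e) * A i) =
       4 / l * (N 1 - N 0) + 3 / (l * e) * (LINT x|leb. \<bar>\<phi> x\<bar>)"
    proof -
      have "(\<Sum>i<m. N (p (Suc i)) - N (p i)) = N 1 - N 0"
        using sum_lessThan_telescope[of "\<lambda>i. N (p i)" m] p(1,2) by simp
      moreover have "(\<Sum>i<m. A i) = (LINT x|leb. \<bar>\<phi> x\<bar>)"
        using split[of "\<lambda>x. \<bar>\<phi> x\<bar>"] int by (simp add: A_def)
      ultimately show ?thesis unfolding sum.distrib sum_distrib_left[symmetric] by simp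
    qed
    moreover have "4 / l * (N 1 - N 0) \<le> 4 / l * V" using N(2) assms(2) by (intro mult_left_mono) auto
    ultimately have bv\<psi>: "bvar (4 / l * V + 3 / (l * e) * (LINT x|leb. \<bar>\<phi> x\<bar>)) \<psi>"
      by (elim bvar_mono) simp
    have "tr T \<phi> \<psi>" unfolding tr_def
    proof (intro conjI allI impI)
      show "integrable leb \<phi>" "integrable leb \<psi>" using int bvar_integrable[OF bv\<psi>] by auto
      fix G :: "real \<Rightarrow> real" and b assume G: "G \<in> borel_measurable leb" "\<forall>x\<in>{0..1}. \<bar>G x\<bar> \<le> b"
      have GT: "(\<lambda>x. G (T x)) \<in> borel_measurable leb" using T G(1) by measurable
      have GTb: "\<bar>G (T x)\<bar> \<le> b" if "x \<in> {0..1}" for x using measurable_space[OF T, of x] that G(2) by auto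
      have i: "integrable leb (\<lambda>x. G x * \<rho> i x)" if "i < m" for i
        using integrable_bounded_mult[OF bvar_integrable[OF \<rho>1[OF that]] G(1), of b] G(2) by auto
      have "(LINT x|leb. G x * \<psi> x) = (\<Sum>i<m. LINT x|leb. G x * \<rho> i x)"
        unfolding \<psi>_def sum_distrib_left using i by (subst Bochner_Integration.integral_sum) auto
      also have "\<dots> = (\<Sum>i<m. LINT x|leb. indicator {p i<..<p (Suc i)} x * (G (T x) * \<phi> x))"
        using \<rho>2[OF _ G] by (intro sum.cong) auto
      also have "\<dots> = (LINT x|leb. G (T x) * \<phi> x)"
        by (rule split[symmetric, OF integrable_bounded_mult[OF int GT GTb]])
      finally show "(LINT x|leb. G x * \<psi> x) = (LINT x|leb. G (T x) * \<phi> x)" .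
    qed
    with bv\<psi> show "\<exists>\<psi>. tr T \<phi> \<psi> \<and> bvar (4 / l * V + 3 / (l * e) * (LINT x|leb. \<bar>\<phi> x\<bar>)) \<psi>" by blast
  qed
qed

section \<open>Compositions of piecewise expanding maps\<close>

text \<open>By the mean value theorem the map is injective between consecutive points of
  \<open>P\<close>. Hence sending a solution to the last point of \<open>P\<close> before it is
  injective, and \<open>P\<close> is finite.\<close>

lemma finite_level_set:
  fixes T :: "real \<Rightarrow> real"
  assumes P: "finite P" "0 \<in> P" "1 \<in> P" "P \<subseteq> {0..1}"
    and der: "\<And>x. x \<in> {0..1} - P \<Longrightarrow> (T has_real_derivative S' x) (at x) \<and> S' x \<noteq> 0"
  shows "finite {x\<in>{0..1}. T x = r}"
proof -
  have inj: "T x \<noteq> T y" if xy: "0 \<le> x" "x < y" "y \<le> 1" "{x..y} \<inter> P = {}" for x y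
  proof
    assume eq: "T x = T y"
    have "\<exists>t. x < t \<and> t < y \<and> T y - T x = (y - x) * S' t"
    proof (rule MVT2[OF xy(2)])
      fix t assume "x \<le> t" "t \<le> y" then have "t \<in> {0..1} - P" using xy by auto
      then show "(T has_real_derivative S' t) (at t)" using der by blast
    qed
    then obtain t where t: "x < t" "t < y" "S' t = 0" using eq xy by auto
    then have "t \<in> {x..y}" by auto
    then have "t \<in> {0..1} - P" using xy by auto
    then show False using der t(3) by blast
  qed
  let ?X = "{x\<in>{0..1}. T x = r}"
  let ?q = "\<lambda>x. Max {q\<in>P. q \<le> x}"
  have q: "?q x \<in> P" "?q x \<le> x" "\<And>s. s \<in> P \<Longrightarrow> s \<le> x \<Longrightarrow> s \<le> ?q x" if "x \<in> {0..1}" for x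
  proof -
    have "finite {q\<in>P. q \<le> x}" "{q\<in>P. q \<le> x} \<noteq> {}" using P that by auto
    then show "?q x \<in> P" "?q x \<le> x" "\<And>s. s \<in> P \<Longrightarrow> s \<le> x \<Longrightarrow> s \<le> ?q x" using Max_in[of "{q\<in>P. q \<le> x}"] by auto
  qed
  have "inj_on ?q (?X - P)"
  proof (rule linorder_inj_onI)
    fix x y assume xy: "x < y" "x \<in> ?X - P" "y \<in> ?X - P"
    show "?q x \<noteq> ?q y"
    proof
      assume eq: "?q x = ?q y"
      have "{x..y} \<inter> P = {}"
      proof (rule ccontr)
        assume "{x..y} \<inter> P \<noteq> {}"
        then obtain s where s: "s \<in> P" "x \<le> s" "s \<le> y" by auto
        then have "s \<le> ?q y" using q(3)[of y s] xy by auto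
        then have "s \<le> x" using eq q(2)[of x] xy by auto
        then show False using s xy by auto
      qed
      then show False using inj[of x y] xy by auto
    qed
  qed auto
  moreover have "?q ` (?X - P) \<subseteq> P" using q(1) by auto
  ultimately have "finite (?X - P)" using P(1) by (meson finite_imageD finite_subset)
  then show ?thesis using P(1) by (metis finite_Diff2)
qed

text \<open>The new partition adds to \<open>P\<close> the preimages of \<open>R\<close>, which are
  finite because level sets of \<open>T\<close> are. The derivative is a product, and its Lipschitz
  constant comes from the product rule, \<open>T\<close> being \<open>B\<close>-Lipschitz on a
  gap.\<close>

lemma pwx_comp:
  assumes "pwx k S" "pwx l T" "0 < k" "0 < l"
  shows "pwx (k * l) (S \<circ> T)"
proof -
  obtain P T' B L where P: "finite P" "0 \<in> P" "1 \<in> P" "P \<subseteq> {0..1}" and L0: "0 \<le> L" and T01: "T ` {0..1} \<subseteq> {0..1}"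
    and der: "\<And>x. x \<in> {0..1} - P \<Longrightarrow> (T has_real_derivative T' x) (at x) \<and> l \<le> \<bar>T' x\<bar> \<and> \<bar>T' x\<bar> \<le> B"
    and lip: "\<And>x y. 0 \<le> x \<Longrightarrow> x \<le> y \<Longrightarrow> y \<le> 1 \<Longrightarrow> {x..y} \<inter> P = {} \<Longrightarrow> \<bar>T' x - T' y\<bar> \<le> L * (y - x)"
    using assms(2) unfolding pwx_def by (elim exE conjE) blast
  obtain R S' C M where R: "finite R" "0 \<in> R" "1 \<in> R" "R \<subseteq> {0..1}" and M0: "0 \<le> M" and S01: "S ` {0..1} \<subseteq> {0..1}"
    and derS: "\<And>x. x \<in> {0..1} - R \<Longrightarrow> (S has_real_derivative S' x) (at x) \<and> k \<le> \<bar>S' x\<bar> \<and> \<bar>S' x\<bar> \<le> C"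
    and lipS: "\<And>x y. 0 \<le> x \<Longrightarrow> x \<le> y \<Longrightarrow> y \<le> 1 \<Longrightarrow> {x..y} \<inter> R = {} \<Longrightarrow> \<bar>S' x - S' y\<bar> \<le> M * (y - x)"
    using assms(1) unfolding pwx_def by (elim exE conjE) blast
  have Tm: "T x \<in> {0..1}" if "x \<in> {0..1}" for x using T01 that by blast
  define U where "U = P \<union> {x\<in>{0..1}. T x \<in> R}"
  have contT: "continuous_on {x..y} T" if "0 \<le> x" "y \<le> 1" "{x..y} \<inter> P = {}" for x y
  proof (rule continuous_at_imp_continuous_on, rule ballI)
    fix t assume "t \<in> {x..y}" then have "t \<in> {0..1} - P" using that by auto
    then show "isCont T t" using der DERIV_isCont by blast
  qed
  have finpre: "finite {x\<in>{0..1}. T x = r}" for r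
    by (rule finite_level_set[OF P, where S' = T']) (use der assms(4) in force)
  have "{x\<in>{0..1}. T x \<in> R} = (\<Union>r\<in>R. {x\<in>{0..1}. T x = r})" by auto
  then have finU: "finite U" using P(1) R(1) finpre by (simp add: U_def)
  show ?thesis unfolding pwx_def
  proof (rule exI[of _ U], rule exI[of _ "\<lambda>x. S' (T x) * T' x"], rule exI[of _ "C * B"],
      rule exI[of _ "\<bar>M * B * B + C * L\<bar>"], intro conjI ballI allI impI)
    show "finite U" by (rule finU)
    show "0 \<in> U" "1 \<in> U" "U \<subseteq> {0..1}" using P by (auto simp: U_def)
    show "(S \<circ> T) ` {0..1} \<subseteq> {0..1}" unfolding image_comp[symmetric] using image_mono[OF T01] S01 by (rule order_trans)
    \<comment> \<open>The absolute value in the Lipschitz constant spares a separate proof that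
      \<open>B\<close> and \<open>C\<close> are nonnegative.\<close>
    show "0 \<le> \<bar>M * B * B + C * L\<bar>" by simp
  next
    fix x assume x: "x \<in> {0..1} - U"
    then have a: "x \<in> {0..1} - P" "T x \<in> {0..1} - R" using Tm[of x] by (auto simp: U_def)
    note d = der[OF a(1)] derS[OF a(2)]
    show "(S \<circ> T has_real_derivative S' (T x) * T' x) (at x)" using d by (auto intro: DERIV_chain)
    show "k * l \<le> \<bar>S' (T x) * T' x\<bar>" unfolding abs_mult using d assms by (intro mult_mono) auto
    show "\<bar>S' (T x) * T' x\<bar> \<le> C * B" unfolding abs_mult using d by (intro mult_mono) auto
  next
    fix x y :: real assume xy: "0 \<le> x" "x \<le> y" "y \<le> 1" "{x..y} \<inter> U = {}"
    then have XP: "{x..y} \<inter> P = {}" by (auto simp: U_def)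
    have a: "t \<in> {0..1} - P" "T t \<in> {0..1} - R" if "t \<in> {x..y}" for t
    proof -
      have "t \<in> {0..1}" "t \<notin> U" using xy that by auto
      then show "t \<in> {0..1} - P" "T t \<in> {0..1} - R" using Tm[of t] by (auto simp: U_def)
    qed
    have B0: "0 \<le> B" using der[OF a(1)[of x]] xy by auto
    have C0: "0 \<le> C" using derS[OF a(2)[of x]] xy by auto
    \<comment> \<open>The image of the segment is connected and misses \<open>R\<close>, so it stays
      inside one gap of \<open>S\<close>, where the Lipschitz bound on \<open>S'\<close>
      applies.\<close>
    have noR: "T x \<notin> R" "{min (T x) (T y)..max (T x) (T y)} \<inter> R = {}"
    proof -
      show "T x \<notin> R" using a(2)[of x] xy by auto
      define J where "J = T ` {x..y}"
      have "connected J" unfolding J_def by (intro connected_continuous_image contT xy XP) auto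
      then have iv: "is_interval J" by (simp add: is_interval_connected_1)
      have "T x \<in> J" "T y \<in> J" using xy by (auto simp: J_def)
      then have mm: "min (T x) (T y) \<in> J" "max (T x) (T y) \<in> J" by (simp_all add: min_def max_def)
      have "t \<notin> R" if t: "t \<in> {min (T x) (T y)..max (T x) (T y)}" for t
      proof -
        have "t \<in> J" using t by (intro mem_is_interval_1_I[OF iv mm]) auto
        then show ?thesis using a(2) by (auto simp: J_def)
      qed
      then show "{min (T x) (T y)..max (T x) (T y)} \<inter> R = {}" by blast
    qed
    have Tl: "\<bar>T y - T x\<bar> \<le> B * (y - x)"
    proof (cases "x = y")
      case False
      then have "x < y" using xy by simp
      have "\<exists>t. x < t \<and> t < y \<and> T y - T x = (y - x) * T' t"
      proof (rule MVT2[OF \<open>x < y\<close>])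
        show "(T has_real_derivative T' t) (at t)" if "x \<le> t" "t \<le> y" for t using der[OF a(1)[of t]] that by simp
      qed
      then obtain t where t: "x < t" "t < y" "T y - T x = (y - x) * T' t" by auto
      then have "\<bar>T' t\<bar> \<le> B" using der a(1)[of t] by auto
      then show ?thesis using t \<open>x < y\<close> by (simp add: abs_mult mult.commute mult_left_mono)
    qed simp
    have Sl: "\<bar>S' (T x) - S' (T y)\<bar> \<le> M * \<bar>T y - T x\<bar>"
      using lipS[of "T x" "T y"] lipS[of "T y" "T x"] noR(2) a(2)[of x] a(2)[of y] xy
      by (cases "T x \<le> T y") (auto simp: min_def max_def abs_minus_commute)
    have "S' (T x) * T' x - S' (T y) * T' y = (S' (T x) - S' (T y)) * T' x + S' (T y) * (T' x - T' y)" by algebra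
    moreover have "\<bar>(S' (T x) - S' (T y)) * T' x\<bar> \<le> (M * (B * (y - x))) * B"
    proof -
      have "\<bar>S' (T x) - S' (T y)\<bar> \<le> M * (B * (y - x))" using Sl mult_left_mono[OF Tl M0] by linarith
      then show ?thesis unfolding abs_mult using der[OF a(1)[of x]] xy M0 B0 by (intro mult_mono) auto
    qed
    moreover have "\<bar>S' (T y) * (T' x - T' y)\<bar> \<le> C * (L * (y - x))"
      unfolding abs_mult using derS[OF a(2)[of y]] lip[of x y] xy XP C0 by (intro mult_mono) auto
    ultimately have "\<bar>S' (T x) * T' x - S' (T y) * T' y\<bar> \<le> (M * B * B + C * L) * (y - x)"
      by (simp add: algebra_simps)
    also have "\<dots> \<le> \<bar>M * B * B + C * L\<bar> * (y - x)" using xy by (intro mult_right_mono) auto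
    finally show "\<bar>S' (T x) * T' x - S' (T y) * T' y\<bar> \<le> \<bar>M * B * B + C * L\<bar> * (y - x)" .
  qed
qed

section \<open>Random compositions of expanding maps\<close>

text \<open>A violation at a point of continuity persists on a whole interval, which has positive
  measure. Thus the essential bounds on the derivatives hold at every point of a cell.\<close>

lemma AE_leb_le_open:
  fixes F :: "real \<Rightarrow> real"
  assumes AE: "AE x in leb. F x \<le> c" and U: "open U" "U \<subseteq> {0..1}" "continuous_on U F" and x: "x \<in> U"
  shows "F x \<le> c"
proof (rule ccontr)
  assume "\<not> F x \<le> c"
  define O' where "O' = U \<inter> F -` {c<..}"
  have "open O'" unfolding O'_def using U by (simp add: continuous_open_preimage)
  moreover have "x \<in> O'" using x \<open>\<not> F x \<le> c\<close> by (simp add: O'_def)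
  ultimately obtain e where e: "0 < e" "ball x e \<subseteq> O'" using open_contains_ball by blast
  have "AE y in lborel. y \<notin> {x - e<..<x + e}"
    using AE unfolding AE_leb_iff
  proof (rule AE_mp, intro AE_I2 impI)
    fix y assume y: "y \<in> {0..1} \<longrightarrow> F y \<le> c"
    have "y \<in> O'" if "y \<in> {x - e<..<x + e}" using e(2) that by (auto simp: ball_def dist_real_def)
    then show "y \<notin> {x - e<..<x + e}" using y U(2) by (auto simp: O'_def)
  qed
  then have "emeasure lborel {x - e<..<x + e} = 0"
    by (subst (asm) AE_iff_measurable[where N = "{x - e<..<x + e}"]) auto
  then show False using e(1) by simp
qed

lemma pwx_of_piecewise_C2:
  assumes C2: "piecewise_C2 T" and T01: "T ` {0..1} \<subseteq> {0..1}"
    and lo: "AE x in leb. l \<le> \<bar>deriv T x\<bar>" and hi: "AE x in leb. \<bar>deriv (deriv T) x\<bar> \<le> K"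
  shows "pwx l T"
proof -
  obtain P where P: "partition_pts P" and Cs: "\<And>C. C \<in> cells P \<Longrightarrow> \<exists>T' T''.
      (\<forall>x\<in>C. (T has_real_derivative T' x) (at x) \<and> (T' has_real_derivative T'' x) (at x)) \<and>
      continuous_on C T''"
    using C2 unfolding piecewise_C2_def by blast
  have P': "finite P" "0 \<in> P" "1 \<in> P" "P \<subseteq> {0..1}" using P by (auto simp: partition_pts_def)
  have cell: "\<And>x. x \<in> C \<Longrightarrow> (T has_real_derivative deriv T x) (at x) \<and> (deriv T has_real_derivative deriv (deriv T) x) (at x)
      \<and> l \<le> \<bar>deriv T x\<bar> \<and> \<bar>deriv (deriv T) x\<bar> \<le> K"
    and C01: "C \<subseteq> {0..1}" if C: "C \<in> cells P" for C
  proof -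
    obtain T' T'' where T: "\<And>x. x \<in> C \<Longrightarrow> (T has_real_derivative T' x) (at x)"
      "\<And>x. x \<in> C \<Longrightarrow> (T' has_real_derivative T'' x) (at x)" "continuous_on C T''"
      using Cs[OF C] by blast
    obtain a b where ab: "C = {a<..<b}" "a \<in> P" "b \<in> P" using C by (auto simp: cells_def)
    show C01: "C \<subseteq> {0..1}" using ab P'(4) by force
    have opC: "open C" using ab by simp
    have d1: "deriv T x = T' x" if "x \<in> C" for x using T(1)[OF that] by (rule DERIV_imp_deriv)
    have d2: "(deriv T has_real_derivative T'' x) (at x)" if "x \<in> C" for x
      by (rule has_field_derivative_transform_within_open[OF T(2)[OF that] opC that]) (simp add: d1)
    have d3: "deriv (deriv T) x = T'' x" if "x \<in> C" for x using d2[OF that] by (rule DERIV_imp_deriv)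
    have c1: "continuous_on C (deriv T)"
      using d2 by (meson DERIV_isCont continuous_at_imp_continuous_on)
    have c2: "continuous_on C (deriv (deriv T))" using T(3) d3 by (simp cong: continuous_on_cong)
    fix x assume x: "x \<in> C"
    have "- \<bar>deriv T x\<bar> \<le> - l"
      by (rule AE_leb_le_open[OF _ opC C01 _ x]) (use lo c1 in \<open>auto intro!: continuous_intros\<close>)
    moreover have "\<bar>deriv (deriv T) x\<bar> \<le> K"
      by (rule AE_leb_le_open[OF _ opC C01 _ x]) (use hi c2 in \<open>auto intro!: continuous_intros\<close>)
    ultimately show "(T has_real_derivative deriv T x) (at x) \<and> (deriv T has_real_derivative deriv (deriv T) x) (at x)
      \<and> l \<le> \<bar>deriv T x\<bar> \<and> \<bar>deriv (deriv T) x\<bar> \<le> K"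
      using T(1)[OF x] d1[OF x] d2[OF x] d3[OF x] by simp
  qed
  obtain p m where p: "p 0 = 0" "p m = 1" "\<And>i. i < m \<Longrightarrow> p i < p (Suc i)"
     "\<And>i. i < m \<Longrightarrow> {p i<..<p (Suc i)} \<inter> P = {}" "\<And>i. i \<le> m \<Longrightarrow> p i \<in> P"
    using finite_partition_enum[OF P'] by blast
  have gapcell: "{p i<..<p (Suc i)} \<in> cells P" if "i < m" for i
    unfolding cells_def using p(3,4)[OF that] p(5)[of i] p(5)[of "Suc i"] that by (intro CollectI exI[of _ "p i"] exI[of _ "p (Suc i)"]) auto
  have ingap: "\<exists>i<m. x \<in> {p i<..<p (Suc i)}" if x: "x \<in> {0..1} - P" for x
  proof (rule ccontr)
    assume no: "\<not> ?thesis"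
    have x01: "0 < x" "x < 1" using x P' by (auto simp: order_less_le)
    have "(\<Sum>i<m. indicator {p i<..<p (Suc i)} x) = (if x < p m then 1 else 0 :: real)"
      by (rule sum_gap_indicators) (use x x01 p in auto)
    moreover have "(\<Sum>i<m. indicator {p i<..<p (Suc i)} x) = (0::real)"
      using no by (intro sum.neutral) (auto simp: indicator_def)
    ultimately show False using x01 p(2) by simp
  qed
  have all: "(T has_real_derivative deriv T x) (at x) \<and> (deriv T has_real_derivative deriv (deriv T) x) (at x)
      \<and> l \<le> \<bar>deriv T x\<bar> \<and> \<bar>deriv (deriv T) x\<bar> \<le> K" if "x \<in> {0..1} - P" for x
    using ingap[OF that] cell(1)[OF gapcell] by blast
  have lip: "\<bar>deriv T x - deriv T y\<bar> \<le> K * (y - x)" if xy: "0 \<le> x" "x \<le> y" "y \<le> 1" "{x..y} \<inter> P = {}" for x y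
  proof (cases "x = y")
    case False
    then have "x < y" using xy by simp
    have dom: "t \<in> {0..1} - P" if "x \<le> t" "t \<le> y" for t
    proof -
      have "t \<in> {x..y}" using that by simp
      then show ?thesis using xy by (auto simp del: atLeastAtMost_iff) (simp_all)
    qed
    have "\<exists>t. x < t \<and> t < y \<and> deriv T y - deriv T x = (y - x) * deriv (deriv T) t"
      by (rule MVT2[OF \<open>x < y\<close>]) (use all[OF dom] in blast)
    then obtain t where t: "x < t" "t < y" "deriv T y - deriv T x = (y - x) * deriv (deriv T) t" by auto
    then have "\<bar>deriv (deriv T) t\<bar> \<le> K" using all[OF dom[of t]] by simp
    moreover have "\<bar>deriv T x - deriv T y\<bar> = (y - x) * \<bar>deriv (deriv T) t\<bar>"
      using t \<open>x < y\<close> by (metis abs_minus_commute abs_mult abs_of_pos diff_gt_0_iff_gt)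
    ultimately show ?thesis using \<open>x < y\<close> by (simp add: mult.commute mult_left_mono)
  qed simp
  have K0: "0 \<le> K"
  proof -
    have "m \<noteq> 0" using p by (cases m) auto
    then have "(p 0 + p (Suc 0)) / 2 \<in> {p 0<..<p (Suc 0)}" using p(3)[of 0] by auto
    then have "\<bar>deriv (deriv T) ((p 0 + p (Suc 0)) / 2)\<bar> \<le> K" using cell(1)[OF gapcell[of 0]] \<open>m \<noteq> 0\<close> by blast
    then show ?thesis by linarith
  qed
  \<comment> \<open>The derivative is \<open>K\<close>-Lipschitz on a gap of length at most 1, so
    its value at the midpoint plus \<open>K\<close> bounds it there; summing over the finitely many
    gaps gives one bound.\<close>
  define mid where "mid i = (p i + p (Suc i)) / 2" for i
  define B where "B = (\<Sum>i<m. \<bar>deriv T (mid i)\<bar>) + K"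
  have bd: "\<bar>deriv T x\<bar> \<le> B" if x: "x \<in> {0..1} - P" for x
  proof -
    obtain i where i: "i < m" "x \<in> {p i<..<p (Suc i)}" using ingap[OF x] by blast
    have mi: "mid i \<in> {p i<..<p (Suc i)}" using p(3)[OF i(1)] by (auto simp: mid_def)
    have sub: "{u..v} \<inter> P = {}" if "p i < u" "v < p (Suc i)" for u v
    proof -
      have "{u..v} \<subseteq> {p i<..<p (Suc i)}" using that by auto
      then show ?thesis using p(4)[OF i(1)] by blast
    qed
    have m01: "mid i \<in> {0..1}" using C01[OF gapcell[OF i(1)]] mi by blast
    have "\<bar>deriv T x - deriv T (mid i)\<bar> \<le> K * \<bar>x - mid i\<bar>"
      using lip[of x "mid i"] lip[of "mid i" x] sub[of x "mid i"] sub[of "mid i" x] i(2) mi x m01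
      by (cases "x \<le> mid i") (auto simp: abs_minus_commute)
    also have "\<dots> \<le> K * 1" using K0 x m01 by (intro mult_left_mono) auto
    finally have "\<bar>deriv T x\<bar> \<le> \<bar>deriv T (mid i)\<bar> + K" by linarith
    also have "\<bar>deriv T (mid i)\<bar> \<le> (\<Sum>i<m. \<bar>deriv T (mid i)\<bar>)"
      by (rule member_le_sum) (use i in auto)
    finally show ?thesis by (simp add: B_def)
  qed
  show ?thesis unfolding pwx_def
    by (rule exI[of _ P], rule exI[of _ "deriv T"], rule exI[of _ B], rule exI[of _ K])
       (intro conjI P' T01 K0 ballI allI impI lip; use all bd in blast)
qed

text \<open>Lasota--Yorke supplies a function with the property that \<open>transfer_op\<close>
  chooses by. The chosen one has the same integral over each measurable set, hence is another
  version of it, and so inherits the duality with bounded test functions.\<close>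

lemma transfer_op_tr:
  assumes T: "pwx l T" "0 < l" and \<phi>: "aebv V \<phi>" "\<phi> \<in> borel_measurable leb"
  shows "tr T \<phi> (transfer_op T \<phi>)"
proof -
  note Tm = pwx_measurable[OF T(1)]
  obtain \<phi>0 where \<phi>0: "bvar V \<phi>0" "AE x in leb. \<phi> x = \<phi>0 x" using \<phi>(1) by (auto simp: aebv_def)
  obtain \<psi>0 where "tr T \<phi>0 \<psi>0" using lasota_yorke[OF T] \<phi>0(1) by blast
  then have t: "tr T \<phi> \<psi>0"
    by (rule tr_cong) (use \<phi>0 \<phi> Tm trD(2)[of T \<phi>0 \<psi>0] \<open>tr T \<phi>0 \<psi>0\<close> in auto)
  define R where "R \<psi> \<longleftrightarrow> integrable leb \<psi> \<and>
      (\<forall>B \<in> sets leb. (LINT x:B|leb. \<psi> x) = (LINT x:(T -` B \<inter> space leb)|leb. \<phi> x))" for \<psi>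
  have R0: "R \<psi>0" unfolding R_def
  proof (intro conjI ballI)
    show "integrable leb \<psi>0" using trD(2)[OF t] .
    fix B assume B: "B \<in> sets leb"
    have "(LINT x:B|leb. \<psi>0 x) = (LINT x|leb. indicator B x * \<psi>0 x)" by (simp add: set_lebesgue_integral_def)
    also have "\<dots> = (LINT x|leb. indicator B (T x) * \<phi> x)"
      using B by (intro trD(3)[OF t, of "indicator B" 1]) (auto simp: indicator_def)
    also have "\<dots> = (LINT x:(T -` B \<inter> space leb)|leb. \<phi> x)"
      unfolding set_lebesgue_integral_def by (intro Bochner_Integration.integral_cong) (auto simp: indicator_def)
    finally show "(LINT x:B|leb. \<psi>0 x) = (LINT x:(T -` B \<inter> space leb)|leb. \<phi> x)" .
  qed
  have "R (transfer_op T \<phi>)" unfolding transfer_op_def R_def[symmetric] by (rule someI[of R, OF R0])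
  then have "AE x in leb. \<psi>0 x = transfer_op T \<phi> x" "integrable leb (transfer_op T \<phi>)"
    using R0 unfolding R_def by (auto intro!: density_unique_real)
  then show ?thesis using t Tm \<phi>(2) by (intro tr_cong[OF t]) auto
qed

section \<open>Words, shifts and iterates\<close>

lemma shift_funpow: "(shift ^^ k) \<omega> i = \<omega> (i + int k)"
  by (induction k arbitrary: i \<omega>) (auto simp: shift_def algebra_simps)

lemma shift_funpow_add: "(shift ^^ j) ((shift ^^ k) \<omega>) = (shift ^^ (k + j)) \<omega>"
  by (simp add: funpow_add add.commute)

lemma fibre_iter_add: "fibre_iter f \<omega> (k + j) = fibre_iter f ((shift ^^ k) \<omega>) j \<circ> fibre_iter f \<omega> k"
  by (induction j) (auto simp: shift_funpow_add comp_assoc)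

text \<open>This locality is what allows a statement for almost every \<open>\<omega>\<close> to be
  transferred to every admissible \<open>\<omega>\<close>.\<close>

lemma transfer_iter_cong:
  "(\<And>i. 1 \<le> i \<Longrightarrow> i \<le> int k \<Longrightarrow> \<omega> i = \<omega>' i) \<Longrightarrow> transfer_iter f \<omega> k = transfer_iter f \<omega>' k"
  by (induction k) (auto simp: fibre_map_def shift_funpow)

lemma fibre_iter_cong:
  "(\<And>i. 1 \<le> i \<Longrightarrow> i \<le> int k \<Longrightarrow> \<omega> i = \<omega>' i) \<Longrightarrow> fibre_iter f \<omega> k = fibre_iter f \<omega>' k"
  by (induction k) (auto simp: fibre_map_def shift_funpow)

lemma finite_fibre_iters:
  fixes f :: "'y::finite \<Rightarrow> real \<Rightarrow> real"
  shows "finite (range (\<lambda>\<omega>. fibre_iter f \<omega> k))"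
proof (induction k)
  case (Suc k)
  have "range (\<lambda>\<omega>. fibre_iter f \<omega> (Suc k)) \<subseteq> (\<lambda>(g, y). f y \<circ> g) ` (range (\<lambda>\<omega>. fibre_iter f \<omega> k) \<times> UNIV)"
    by (auto simp: fibre_map_def)
  then show ?case using Suc by (meson finite_SigmaI finite_code finite_imageI finite_subset)
qed auto

text \<open>Since there are finitely many words of a given length, a constant found for each map
  separately can be taken uniform in \<open>\<omega>\<close>.\<close>

lemma finite_uniform_bound:
  assumes "finite X" "\<And>x. x \<in> X \<Longrightarrow> \<exists>B\<ge>0. R x (B::real)" "\<And>x B B'. R x B \<Longrightarrow> B \<le> B' \<Longrightarrow> R x B'"
  shows "\<exists>B\<ge>0. \<forall>x\<in>X. R x B"
  using assms(1,2)
proof (induction X)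
  case (insert x X)
  obtain B where B: "B \<ge> 0" "\<forall>x\<in>X. R x B" using insert by auto
  obtain C where C: "C \<ge> 0" "R x C" using insert.prems by auto
  then show ?case using B assms(3) by (intro exI[of _ "max B C"]) (auto simp: le_max_iff_disj intro: assms(3)[OF _ max.cobounded1] assms(3)[OF _ max.cobounded2])
qed auto

text \<open>Turns a contraction once per \<open>K\<close> steps into an exponential rate:
  \<open>\<theta>\<close> is the \<open>K\<close>-th root of \<open>r\<close>, and the constant
  \<open>\<theta>^(-K)\<close> absorbs the incomplete last block.\<close>

lemma power_div_le_geometric:
  fixes r :: real
  assumes "0 < r" "r < 1" "0 < K"
  shows "\<exists>C>0. \<exists>\<theta>>0. \<theta> < 1 \<and> (\<forall>k. r ^ (k div K) \<le> C * \<theta> ^ k)"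
proof -
  define \<theta> where "\<theta> = root K r"
  have th: "0 < \<theta>" "\<theta> < 1" "\<theta> ^ K = r"
    using assms by (auto simp: \<theta>_def real_root_lt_1_iff)
  have "r ^ (k div K) \<le> inverse (\<theta> ^ K) * \<theta> ^ k" for k
  proof -
    have "r ^ (k div K) * \<theta> ^ K = \<theta> ^ (K * (k div K) + K)"
      using th(3) by (simp add: power_add power_mult)
    also have "\<dots> \<le> \<theta> ^ k"
    proof (rule power_decreasing)
      have "k = K * (k div K) + k mod K" by simp
      then show "k \<le> K * (k div K) + K" using mod_less_divisor[OF assms(3), of k] by linarith
    qed (use th in auto)
    finally show ?thesis using th assms by (simp add: field_simps)
  qed
  then show ?thesis using th by (intro exI[of _ "inverse (\<theta> ^ K)"]) (auto intro!: exI[of _ \<theta>])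
qed

locale expanding =
  fixes f :: "'y::finite \<Rightarrow> real \<Rightarrow> real" and l :: real
  assumes pw: "\<And>y. pwx l (f y)" and l1: "1 < l"
begin

abbreviation fi :: "(int \<Rightarrow> 'y) \<Rightarrow> nat \<Rightarrow> real \<Rightarrow> real" where "fi \<equiv> fibre_iter f"

lemma f_measurable: "f y \<in> measurable leb leb"
  by (rule pwx_measurable[OF pw])

lemma fi_measurable: "fi \<omega> k \<in> measurable leb leb"
proof (induction k)
  case (Suc k)
  then show ?case using measurable_comp[OF Suc f_measurable] by (simp add: fibre_map_def o_def)
qed (simp add: id_def)

lemma fi_range: "x \<in> {0..1} \<Longrightarrow> fi \<omega> k x \<in> {0..1}"
  using measurable_space[OF fi_measurable, of x] by simp

lemma fi_pwx: "0 < k \<Longrightarrow> pwx (l ^ k) (fi \<omega> k)"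
proof (induction k)
  case (Suc k)
  show ?case
  proof (cases "k = 0")
    case True then show ?thesis using pw by (simp add: fibre_map_def)
  next
    case False
    then have "pwx (l * l ^ k) (f ((shift ^^ k) \<omega> 1) \<circ> fi \<omega> k)" using Suc l1 by (intro pwx_comp pw) auto
    then show ?thesis by (simp add: fibre_map_def o_def)
  qed
qed auto

lemma tr_measurable_L1: "tr (fi \<omega> k) \<phi> \<psi> \<Longrightarrow> (LINT x|leb. \<bar>\<psi> x\<bar>) \<le> (LINT x|leb. \<bar>\<phi> x\<bar>)"
  by (rule tr_L1[OF _ fi_measurable])

lemma ly_single:
  "\<exists>B\<ge>0. \<forall>\<omega> \<phi> V. bvar V \<phi> \<longrightarrow>
     (\<exists>\<psi>. tr (fi \<omega> k) \<phi> \<psi> \<and> bvar (4 / l ^ k * V + B * (LINT x|leb. \<bar>\<phi> x\<bar>)) \<psi>)"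
proof (cases "k = 0")
  case True
  then show ?thesis
  proof (intro exI[of _ 0] conjI allI impI)
    fix \<omega> \<phi> V assume bv: "bvar V \<phi>"
    then have "bvar (4 * V) \<phi>" using bvar_nonneg[OF bv] by (elim bvar_mono) simp
    then show "\<exists>\<psi>. tr (fi \<omega> k) \<phi> \<psi> \<and> bvar (4 / l ^ k * V + 0 * (LINT x|leb. \<bar>\<phi> x\<bar>)) \<psi>"
      using True tr_id[OF bvar_integrable[OF bv]] by (intro exI[of _ \<phi>]) simp
  qed simp
next
  case False
  define R where "R T B \<longleftrightarrow> (\<forall>\<phi> V. bvar V \<phi> \<longrightarrow> (\<exists>\<psi>. tr T \<phi> \<psi> \<and> bvar (4 / l ^ k * V + B * (LINT x|leb. \<bar>\<phi> x\<bar>)) \<psi>))" for T B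
  have "\<exists>B\<ge>0. \<forall>T\<in>range (\<lambda>\<omega>. fi \<omega> k). R T B"
  proof (rule finite_uniform_bound[OF finite_fibre_iters])
    fix T assume "T \<in> range (\<lambda>\<omega>. fi \<omega> k)"
    then have "pwx (l ^ k) T" using fi_pwx False by auto
    then show "\<exists>B\<ge>0. R T B" unfolding R_def using lasota_yorke[of "l ^ k" T] l1 by simp
  next
    fix T and B B' :: real assume R: "R T B" "B \<le> B'"
    show "R T B'" unfolding R_def
    proof (intro allI impI)
      fix \<phi> V assume "bvar V \<phi>"
      then obtain \<psi> where "tr T \<phi> \<psi>" "bvar (4 / l ^ k * V + B * (LINT x|leb. \<bar>\<phi> x\<bar>)) \<psi>" using R(1) unfolding R_def by blast
      moreover have "B * (LINT x|leb. \<bar>\<phi> x\<bar>) \<le> B' * (LINT x|leb. \<bar>\<phi> x\<bar>)" by (intro mult_right_mono R(2) integral_nonneg_AE) auto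
      ultimately show "\<exists>\<psi>. tr T \<phi> \<psi> \<and> bvar (4 / l ^ k * V + B' * (LINT x|leb. \<bar>\<phi> x\<bar>)) \<psi>"
        by (intro exI[of _ \<psi>]) (auto elim!: bvar_mono)
    qed
  qed
  then show ?thesis unfolding R_def by blast
qed

text \<open>The factor \<open>4 / l\<close> of one step need not be below 1. Blocks of length
  \<open>K\<close> with \<open>l^K > 8\<close> halve the variation, while the \<open>L^1\<close>
  norm does not grow; the additive terms then form a geometric series bounded by
  \<open>2 B\<close>.\<close>

theorem ly_uniform:
  "\<exists>A>0. \<exists>B>0. \<exists>\<theta>>0. \<theta> < 1 \<and> (\<forall>k \<omega> \<phi> V. bvar V \<phi> \<longrightarrow>
     (\<exists>\<psi>. tr (fi \<omega> k) \<phi> \<psi> \<and> bvar (A * \<theta> ^ k * V + B * (LINT x|leb. \<bar>\<phi> x\<bar>)) \<psi>))"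
proof -
  let ?n = "\<lambda>\<phi>. LINT x|leb. \<bar>\<phi> x\<bar> :: real"
  obtain K where K: "8 < l ^ K" using real_arch_pow[OF l1] by blast
  then have K0: "0 < K" by (cases K) auto
  have lK: "4 / l ^ K \<le> 1 / 2" using K by (simp add: field_simps)
  have "\<exists>B\<ge>0. \<forall>k\<in>{..K}. \<forall>\<omega> \<phi> V. bvar V \<phi> \<longrightarrow> (\<exists>\<psi>. tr (fi \<omega> k) \<phi> \<psi> \<and> bvar (4 / l ^ k * V + B * ?n \<phi>) \<psi>)"
  proof (rule finite_uniform_bound)
    show "\<exists>B\<ge>0. \<forall>\<omega> \<phi> V. bvar V \<phi> \<longrightarrow> (\<exists>\<psi>. tr (fi \<omega> k) \<phi> \<psi> \<and> bvar (4 / l ^ k * V + B * ?n \<phi>) \<psi>)" for k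
      by (rule ly_single)
    fix k and B B' :: real
    assume R: "\<forall>\<omega> \<phi> V. bvar V \<phi> \<longrightarrow> (\<exists>\<psi>. tr (fi \<omega> k) \<phi> \<psi> \<and> bvar (4 / l ^ k * V + B * ?n \<phi>) \<psi>)" "B \<le> B'"
    show "\<forall>\<omega> \<phi> V. bvar V \<phi> \<longrightarrow> (\<exists>\<psi>. tr (fi \<omega> k) \<phi> \<psi> \<and> bvar (4 / l ^ k * V + B' * ?n \<phi>) \<psi>)"
    proof (intro allI impI)
      fix \<omega> \<phi> V assume "bvar V \<phi>"
      then obtain \<psi> where "tr (fi \<omega> k) \<phi> \<psi>" "bvar (4 / l ^ k * V + B * ?n \<phi>) \<psi>" using R(1) by blast
      moreover have "B * ?n \<phi> \<le> B' * ?n \<phi>" by (intro mult_right_mono R(2) integral_nonneg_AE) auto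
      ultimately show "\<exists>\<psi>. tr (fi \<omega> k) \<phi> \<psi> \<and> bvar (4 / l ^ k * V + B' * ?n \<phi>) \<psi>"
        by (intro exI[of _ \<psi>]) (auto elim!: bvar_mono)
    qed
  qed auto
  then obtain B where B0: "B \<ge> 0" and B: "\<And>k \<omega> \<phi> V. k \<le> K \<Longrightarrow> bvar V \<phi> \<Longrightarrow>
      \<exists>\<psi>. tr (fi \<omega> k) \<phi> \<psi> \<and> bvar (4 / l ^ k * V + B * ?n \<phi>) \<psi>" by auto
  have blocks: "\<exists>\<psi>. tr (fi \<omega> (q * K)) \<phi> \<psi> \<and> bvar ((1/2) ^ q * V + 2 * B * ?n \<phi>) \<psi>" if "bvar V \<phi>" for q \<omega> \<phi> V
  proof (induction q)
    case 0
    have "0 \<le> B * ?n \<phi>" using B0 by (intro mult_nonneg_nonneg integral_nonneg_AE) auto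
    then have "bvar (V + 2 * B * ?n \<phi>) \<phi>" using that by (elim bvar_mono) simp
    then show ?case using tr_id[OF bvar_integrable[OF that]] by (intro exI[of _ \<phi>]) (simp add: id_def)
  next
    case (Suc q)
    then obtain \<psi>1 where 1: "tr (fi \<omega> (q * K)) \<phi> \<psi>1" "bvar ((1/2) ^ q * V + 2 * B * ?n \<phi>) \<psi>1" by blast
    obtain \<psi>2 where 2: "tr (fi ((shift ^^ (q * K)) \<omega>) K) \<psi>1 \<psi>2"
      "bvar (4 / l ^ K * ((1/2) ^ q * V + 2 * B * ?n \<phi>) + B * ?n \<psi>1) \<psi>2" using B[OF order.refl 1(2)] by blast
    have t: "tr (fi \<omega> (q * K + K)) \<phi> \<psi>2" unfolding fibre_iter_add by (rule tr_comp[OF 1(1) 2(1) fi_measurable])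
    have "4 / l ^ K * ((1/2) ^ q * V + 2 * B * ?n \<phi>) \<le> 1 / 2 * ((1/2) ^ q * V + 2 * B * ?n \<phi>)"
      using bvar_nonneg[OF 1(2)] lK by (intro mult_right_mono) auto
    moreover have "B * ?n \<psi>1 \<le> B * ?n \<phi>" by (intro mult_left_mono tr_measurable_L1[OF 1(1)] B0)
    ultimately have "bvar ((1/2) ^ Suc q * V + 2 * B * ?n \<phi>) \<psi>2" by (intro bvar_mono[OF 2(2)]) (simp add: algebra_simps)
    then show ?case using t by (auto simp: add.commute)
  qed
  obtain C \<theta> where C: "C > 0" "0 < \<theta>" "\<theta> < 1" "\<And>k. (1/2::real) ^ (k div K) \<le> C * \<theta> ^ k"
    using power_div_le_geometric[of "1/2" K] K0 by auto
  have main: "\<exists>\<psi>. tr (fi \<omega> k) \<phi> \<psi> \<and> bvar (4 * C * \<theta> ^ k * V + (3 * B + 1) * ?n \<phi>) \<psi>"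
    if bv: "bvar V \<phi>" for k \<omega> \<phi> V
  proof -
    \<comment> \<open>The incomplete block of length \<open>r\<close> is run first; its factor 4 is
      then damped by the \<open>q\<close> halving blocks that follow.\<close>
    define r q where "r = k mod K" and "q = k div K"
    have r: "r \<le> K" using K0 by (simp add: r_def less_imp_le)
    obtain \<psi>1 where 1: "tr (fi \<omega> r) \<phi> \<psi>1" "bvar (4 / l ^ r * V + B * ?n \<phi>) \<psi>1" using B[OF r bv] by blast
    have V0: "0 \<le> V" by (rule bvar_nonneg[OF bv])
    have n0: "0 \<le> ?n \<phi>" by (intro integral_nonneg_AE) auto
    have "4 / l ^ r * V \<le> 4 * V" using V0 l1 by (intro mult_right_mono) (auto simp: field_simps)
    then have bv1: "bvar (4 * V + B * ?n \<phi>) \<psi>1" by (intro bvar_mono[OF 1(2)]) simp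
    obtain \<psi>2 where 2: "tr (fi ((shift ^^ r) \<omega>) (q * K)) \<psi>1 \<psi>2"
      "bvar ((1/2) ^ q * (4 * V + B * ?n \<phi>) + 2 * B * ?n \<psi>1) \<psi>2" using blocks[OF bv1] by blast
    have "tr (fi \<omega> (r + q * K)) \<phi> \<psi>2" unfolding fibre_iter_add by (rule tr_comp[OF 1(1) 2(1) fi_measurable])
    moreover have "r + q * K = k" by (simp add: r_def q_def)
    ultimately have t: "tr (fi \<omega> k) \<phi> \<psi>2" by simp
    have "(1/2) ^ q * (4 * V + B * ?n \<phi>) = 4 * ((1/2) ^ q * V) + (1/2) ^ q * (B * ?n \<phi>)" by (simp add: algebra_simps)
    moreover have "(1/2) ^ q * V \<le> C * \<theta> ^ k * V" using C(4)[of k] V0 by (intro mult_right_mono) (simp_all add: q_def)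
    moreover have "(1/2) ^ q * (B * ?n \<phi>) \<le> 1 * (B * ?n \<phi>)" using B0 n0 by (intro mult_right_mono) (auto simp: power_le_one)
    moreover have "B * ?n \<psi>1 \<le> B * ?n \<phi>" by (intro mult_left_mono tr_measurable_L1[OF 1(1)] B0)
    moreover have "4 * C * \<theta> ^ k * V + (3 * B + 1) * ?n \<phi> = 4 * (C * \<theta> ^ k * V) + 3 * (B * ?n \<phi>) + ?n \<phi>"
      by (simp add: algebra_simps)
    ultimately have "(1/2) ^ q * (4 * V + B * ?n \<phi>) + 2 * B * ?n \<psi>1 \<le> 4 * C * \<theta> ^ k * V + (3 * B + 1) * ?n \<phi>"
      using n0 by linarith
    then have "bvar (4 * C * \<theta> ^ k * V + (3 * B + 1) * ?n \<phi>) \<psi>2" by (rule bvar_mono[OF 2(2)])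
    with t show "\<exists>\<psi>. tr (fi \<omega> k) \<phi> \<psi> \<and> bvar (4 * C * \<theta> ^ k * V + (3 * B + 1) * ?n \<phi>) \<psi>" by blast
  qed
  have "0 < 4 * C" "0 < 3 * B + 1" using B0 C by auto
  with main C(2,3) show ?thesis by blast
qed

lemma fi_tr_unique: "tr (fi \<omega> k) \<phi> \<psi> \<Longrightarrow> tr (fi \<omega> k) \<phi> \<psi>' \<Longrightarrow> AE x in leb. \<psi> x = \<psi>' x"
  by (rule tr_unique[OF _ _ fi_measurable])

text \<open>\<open>transfer_op\<close> is controlled only on classes of bounded variation, so each
  stage needs a representative of that kind. Uniqueness identifies the iterate with the transfer
  from \<open>ly_single\<close>, which has one.\<close>

lemma transfer_iter_tr:
  assumes "aebv V \<phi>" "\<phi> \<in> borel_measurable leb"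
  shows "tr (fi \<omega> k) \<phi> (transfer_iter f \<omega> k \<phi>)"
proof (induction k)
  case 0
  obtain \<phi>0 where \<phi>0: "bvar V \<phi>0" "AE x in leb. \<phi> x = \<phi>0 x" using assms(1) by (auto simp: aebv_def)
  have "integrable leb \<phi> \<longleftrightarrow> integrable leb \<phi>0"
    by (rule integrable_cong_AE[OF assms(2) bvar_measurable[OF \<phi>0(1)] \<phi>0(2)])
  then have "integrable leb \<phi>" using bvar_integrable[OF \<phi>0(1)] by simp
  then show ?case using tr_id[of \<phi>] by (simp add: id_def)
next
  case (Suc k)
  obtain \<phi>0 where \<phi>0: "bvar V \<phi>0" "AE x in leb. \<phi> x = \<phi>0 x" using assms(1) by (auto simp: aebv_def)
  obtain V1 \<psi>0 where \<psi>0: "tr (fi \<omega> k) \<phi>0 \<psi>0" "bvar V1 \<psi>0" using ly_single[of k] \<phi>0(1) by blast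
  have "tr (fi \<omega> k) \<phi> \<psi>0"
    by (rule tr_cong[OF \<psi>0(1)]) (use \<phi>0(2) assms(2) fi_measurable trD(2)[OF \<psi>0(1)] in auto)
  then have "AE x in leb. transfer_iter f \<omega> k \<phi> x = \<psi>0 x" by (rule fi_tr_unique[OF Suc])
  then have "aebv V1 (transfer_iter f \<omega> k \<phi>)" using \<psi>0(2) by (auto simp: aebv_def)
  moreover have "transfer_iter f \<omega> k \<phi> \<in> borel_measurable leb" using trD(2)[OF Suc] by auto
  ultimately have "tr (f ((shift ^^ k) \<omega> 1)) (transfer_iter f \<omega> k \<phi>) (transfer_op (f ((shift ^^ k) \<omega> 1)) (transfer_iter f \<omega> k \<phi>))"
    using pw l1 by (intro transfer_op_tr[of l]) auto
  then show ?case using tr_comp[OF Suc _ f_measurable] by (simp add: fibre_map_def o_def)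
qed

end

section \<open>Decay of correlations\<close>

locale mixing = expanding f l for f :: "'y::finite \<Rightarrow> real \<Rightarrow> real" and l +
  fixes p :: "'y pmf" and Q :: "(int \<Rightarrow> 'y) measure"
  assumes Q: "Q = bernoulli p" and cone: "cone_lower_bound Q f"
begin

text \<open>Only positive indices count, as the maps read the symbols \<open>1, 2, ...\<close>. The
  sequences are those all of whose initial words have positive probability.\<close>

definition adm :: "(int \<Rightarrow> 'y) \<Rightarrow> bool" where "adm \<omega> \<longleftrightarrow> (\<forall>i\<ge>1. \<omega> i \<in> set_pmf p)"

lemma adm_shift: "adm \<omega> \<Longrightarrow> adm ((shift ^^ k) \<omega>)"
  by (auto simp: adm_def shift_funpow)

sublocale PP: product_prob_space "\<lambda>_::int. measure_pmf p" UNIV ..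

lemma space_Q [simp]: "space Q = UNIV"
  by (simp add: Q bernoulli_def space_PiM)

lemma prob_space_Q: "prob_space Q"
  unfolding Q bernoulli_def by (rule prob_space_PiM) (rule measure_pmf.prob_space_axioms)

sublocale Q: prob_space Q by (rule prob_space_Q)

lemma AE_adm: "AE \<omega> in Q. adm \<omega>"
proof -
  have "AE \<omega> in Q. \<omega> i \<in> set_pmf p" for i
  proof (rule AE_I2[THEN AE_mp[rotated]])
    have m: "(\<lambda>\<omega>. \<omega> i) \<in> measurable Q (measure_pmf p)"
      unfolding Q bernoulli_def by (rule measurable_component_singleton) simp
    have "AE y in distr Q (measure_pmf p) (\<lambda>\<omega>. \<omega> i). y \<in> set_pmf p"
      unfolding Q bernoulli_def by (subst PP.PiM_component) (auto intro: AE_measure_pmf)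
    then show "AE \<omega> in Q. \<omega> i \<in> set_pmf p" using m by (subst (asm) AE_distr_iff) auto
  qed auto
  then show ?thesis unfolding adm_def by (simp add: AE_all_countable)
qed

text \<open>The cylinder of the first \<open>k\<close> symbols has as probability a finite product
  of positive weights, so it meets every set of full measure. This removes exceptional sets that
  depend on the function under study.\<close>

lemma AE_cylinder:
  assumes "AE \<omega> in Q. R \<omega>" "adm \<omega>0"
  obtains \<omega> where "R \<omega>" "\<And>i. 1 \<le> i \<Longrightarrow> i \<le> int k \<Longrightarrow> \<omega> i = \<omega>0 i"
proof -
  define Z where "Z = {\<omega> \<in> space (Pi\<^sub>M UNIV (\<lambda>_::int. measure_pmf p)). \<forall>i\<in>{1..int k}. \<omega> i \<in> {\<omega>0 i}}"
  have "emeasure (Pi\<^sub>M UNIV (\<lambda>_::int. measure_pmf p)) Z = (\<Prod>i\<in>{1..int k}. emeasure (measure_pmf p) {\<omega>0 i})"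
    unfolding Z_def by (rule PP.emeasure_PiM_Collect) auto
  also have "(\<Prod>i\<in>{1..int k}. emeasure (measure_pmf p) {\<omega>0 i}) > 0"
  proof -
    have "(\<Prod>i\<in>{1..int k}. emeasure (measure_pmf p) {\<omega>0 i}) \<noteq> 0"
      using assms(2) by (auto simp: adm_def emeasure_pmf_single set_pmf_iff pmf_nonneg order_less_le)
    then show ?thesis by (simp add: zero_less_iff_neq_zero)
  qed
  finally have pos: "emeasure Q Z > 0" by (simp add: Q bernoulli_def)
  have "\<exists>\<omega>\<in>Z. R \<omega>"
  proof (rule ccontr)
    assume "\<not> ?thesis"
    then have "AE \<omega> in Q. \<omega> \<notin> Z" using assms(1) by (auto elim: AE_mp)
    moreover have "Z \<in> sets Q" using pos by (cases "Z \<in> sets Q") (auto simp: emeasure_notin_sets)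
    ultimately have "emeasure Q Z = 0" by (subst (asm) AE_iff_measurable[where N = Z]) auto
    then show False using pos by simp
  qed
  then show ?thesis using that by (auto simp: Z_def)
qed

lemma cone_memI:
  assumes "bvar a \<phi>" "AE x in leb. 0 \<le> \<phi> x" "(LINT x|leb. \<phi> x) = 1"
  shows "\<phi> \<in> BV_cone a"
proof -
  have "var \<phi> \<le> ereal a" by (rule var_le_if_aebv) (use assms(1) in \<open>auto simp: aebv_def\<close>)
  then show ?thesis using assms bvar_integrable[OF assms(1)] by (auto simp: BV_cone_def BV_def)
qed

text \<open>A density that vanishes on half of the interval, kept as the counterexample that rules
  out \<open>N = 0\<close> in the cone condition.\<close>

lemma bvar_half: "bvar 4 (\<lambda>x. if x \<le> 1/2 then 2 else 0)"
proof -
  have "bvar (\<bar>2\<bar> * 2) (\<lambda>x. 2 * (if x \<le> 1/2 then 1 else (0::real)))"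
    by (intro bvar_cmult bvarI[where N = "\<lambda>x. 2 * (if x \<le> 1/2 then 0 else 1)"]) auto
  then show ?thesis by (simp add: if_distrib cong: if_cong)
qed

text \<open>In the cone condition the null set of \<open>\<omega>\<close> depends on the function.
  The iterate depends on a finite word, and that word occurs outside the null set, so the bound
  holds for all admissible \<open>\<omega>\<close>. The time \<open>K\<close> is at the same time
  large enough for \<open>A * \<theta> ^ K \<le> \<epsilon>\<close>.\<close>

lemma lower_bound_words:
  fixes a \<epsilon> \<theta> A :: real
  assumes "0 < a" "0 < \<epsilon>" "\<theta> < 1" "0 < \<theta>" "0 < A"
  shows "\<exists>K c. 0 < K \<and> A * \<theta> ^ K \<le> \<epsilon> \<and> 0 < c \<and> c \<le> 1 \<and>
    (\<forall>\<omega> \<phi>. adm \<omega> \<longrightarrow> bvar a \<phi> \<longrightarrow> (AE x in leb. 0 \<le> \<phi> x) \<longrightarrow> (LINT x|leb. \<phi> x) = 1 \<longrightarrow>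
        (AE x in leb. c / 2 \<le> transfer_iter f \<omega> K \<phi> x))"
proof -
  obtain N where N: "\<And>a. 0 < a \<Longrightarrow> \<forall>\<^sub>F n in sequentially. \<exists>c>0. \<forall>\<phi> \<in> BV_cone a. AE \<omega> in Q.
        essinf leb (\<lambda>x. ereal (transfer_iter f \<omega> (N * n) \<phi> x)) \<ge> ereal (c / 2 * norm_L1 \<phi>)"
    using cone unfolding cone_lower_bound_def by blast
  have N': "\<forall>\<^sub>F n in sequentially. \<exists>c>0. \<forall>\<omega> \<phi>. adm \<omega> \<longrightarrow> bvar a \<phi> \<longrightarrow> (AE x in leb. 0 \<le> \<phi> x) \<longrightarrow> (LINT x|leb. \<phi> x) = 1 \<longrightarrow>
        (AE x in leb. c < transfer_iter f \<omega> (N * n) \<phi> x)" if a0: "0 < a" for a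
    using N[OF a0]
  proof (rule eventually_mono)
    fix n assume "\<exists>c>0. \<forall>\<phi> \<in> BV_cone a. AE \<omega> in Q.
        essinf leb (\<lambda>x. ereal (transfer_iter f \<omega> (N * n) \<phi> x)) \<ge> ereal (c / 2 * norm_L1 \<phi>)"
    then obtain c where c: "0 < c" "\<And>\<phi>. \<phi> \<in> BV_cone a \<Longrightarrow> AE \<omega> in Q.
        essinf leb (\<lambda>x. ereal (transfer_iter f \<omega> (N * n) \<phi> x)) \<ge> ereal (c / 2 * norm_L1 \<phi>)" by blast
    show "\<exists>c>0. \<forall>\<omega> \<phi>. adm \<omega> \<longrightarrow> bvar a \<phi> \<longrightarrow> (AE x in leb. 0 \<le> \<phi> x) \<longrightarrow> (LINT x|leb. \<phi> x) = 1 \<longrightarrow>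
        (AE x in leb. c < transfer_iter f \<omega> (N * n) \<phi> x)"
    \<comment> \<open>Half of the given bound \<open>c / 2\<close>: the passage from the
      \<open>Liminf\<close> to an almost everywhere bound needs a strict inequality.\<close>
    proof (intro exI[of _ "c / 4"] conjI allI impI)
      fix \<omega> \<phi> assume *: "adm \<omega>" "bvar a \<phi>" "AE x in leb. 0 \<le> \<phi> x" "(LINT x|leb. \<phi> x) = 1"
      obtain \<omega>' where w: "essinf leb (\<lambda>x. ereal (transfer_iter f \<omega>' (N * n) \<phi> x)) \<ge> ereal (c / 2 * norm_L1 \<phi>)"
         "\<And>i. 1 \<le> i \<Longrightarrow> i \<le> int (N * n) \<Longrightarrow> \<omega>' i = \<omega> i"
        by (rule AE_cylinder[OF c(2)[OF cone_memI[OF *(2-4)]] *(1), where k = "N * n"]) blast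
      have eq: "transfer_iter f \<omega>' (N * n) = transfer_iter f \<omega> (N * n)" by (rule transfer_iter_cong[OF w(2)])
      have "norm_L1 \<phi> = (LINT x|leb. \<phi> x)" unfolding norm_L1_def
        using *(3) bvar_measurable[OF *(2)] by (intro integral_cong_AE) auto
      then have "ereal (c / 4) < essinf leb (\<lambda>x. ereal (transfer_iter f \<omega> (N * n) \<phi> x))"
        using w(1) *(4) c(1) by (intro less_le_trans[OF _ w(1)[unfolded eq]]) auto
      then show "AE x in leb. c / 4 < transfer_iter f \<omega> (N * n) \<phi> x"
        unfolding essinf_def by (auto dest: less_LiminfD)
    qed (use c in auto)
  qed
  \<comment> \<open>With \<open>N = 0\<close> the condition would bound the function itself from
    below, which fails for the density vanishing on the right half. Positivity of \<open>N\<close>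
    makes \<open>N * n\<close> arbitrarily large.\<close>
  have N0: "0 < N"
  proof (rule ccontr)
    assume "\<not> 0 < N"
    then have N0: "N = 0" by simp
    define \<phi> where "\<phi> = (\<lambda>x::real. if x \<le> 1/2 then 2 else 0 :: real)"
    have bv: "bvar 4 \<phi>" unfolding \<phi>_def by (rule bvar_half)
    have "(LINT x|leb. \<phi> x) = (LINT x|leb. 2 * indicator {0..1/2} x)"
      by (intro Bochner_Integration.integral_cong) (auto simp: \<phi>_def indicator_def)
    also have "\<dots> = 2 * measure leb {0..1/2}" by (simp add: Int_absorb2 atLeastAtMost_subseteq_atLeastLessThan_iff)
    also have "measure leb {0..1/2} = 1/2" 
    proof -
      have "measure leb {0..1/2} = measure lborel {0..1/2::real}"
        unfolding measure_def by (subst emeasure_leb) (auto intro: in_sets_leb)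
      then show ?thesis by simp
    qed
    finally have int: "(LINT x|leb. \<phi> x) = 1" by simp
    obtain y where "y \<in> set_pmf p" using set_pmf_not_empty[of p] by blast
    then have w: "adm (\<lambda>_. y)" by (simp add: adm_def)
    obtain c where c: "0 < c" "AE x in leb. c < \<phi> x"
    proof -
      obtain n where "\<exists>c>0. \<forall>\<omega> \<phi>. adm \<omega> \<longrightarrow> bvar 4 \<phi> \<longrightarrow> (AE x in leb. 0 \<le> \<phi> x) \<longrightarrow> (LINT x|leb. \<phi> x) = 1 \<longrightarrow>
        (AE x in leb. c < transfer_iter f \<omega> (N * n) \<phi> x)"
        using eventually_happens'[OF _ N'[of 4]] by auto
      then obtain c where c: "0 < c" "\<And>\<omega> \<phi>. adm \<omega> \<Longrightarrow> bvar 4 \<phi> \<Longrightarrow> (AE x in leb. 0 \<le> \<phi> x) \<Longrightarrow> (LINT x|leb. \<phi> x) = 1 \<Longrightarrow>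
        (AE x in leb. c < transfer_iter f \<omega> (N * n) \<phi> x)" by blast
      have "AE x in leb. 0 \<le> \<phi> x" by (simp add: \<phi>_def)
      from c(2)[OF w bv this int] c(1) show ?thesis using that N0 by simp
    qed
    have "AE x in leb. \<not> x \<in> {1/2<..1}"
      using c(2) by (rule AE_mp) (use c(1) in \<open>auto simp: \<phi>_def intro!: AE_I2\<close>)
    then have "emeasure leb {1/2<..1} = 0"
      by (subst (asm) AE_iff_measurable[where N = "{1/2<..1}"]) (auto intro: in_sets_leb)
    then have "emeasure lborel {1/2<..1::real} = 0"
      by (subst (asm) emeasure_leb) (auto intro: in_sets_leb)
    then have "measure lborel {1/2<..1::real} = 0" by (simp only: measure_def enn2real_0)
    then show False by simp
  qed
  have "\<forall>\<^sub>F n in sequentially. A * \<theta> ^ n < \<epsilon>"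
  proof (rule order_tendstoD(2))
    show "(\<lambda>n. A * \<theta> ^ n) \<longlonglongrightarrow> 0" using assms by (intro tendsto_mult_right_zero LIMSEQ_realpow_zero) auto
  qed (rule assms)
  then obtain n0 where n0: "\<And>n. n0 \<le> n \<Longrightarrow> A * \<theta> ^ n < \<epsilon>" unfolding eventually_sequentially by blast
  obtain n where n: "n \<ge> n0" "n \<ge> 1" "\<exists>c>0. \<forall>\<omega> \<phi>. adm \<omega> \<longrightarrow> bvar a \<phi> \<longrightarrow> (AE x in leb. 0 \<le> \<phi> x) \<longrightarrow> (LINT x|leb. \<phi> x) = 1 \<longrightarrow>
        (AE x in leb. c < transfer_iter f \<omega> (N * n) \<phi> x)"
    using eventually_happens'[OF _ eventually_conj[OF eventually_ge_at_top[of n0] eventually_conj[OF eventually_ge_at_top[of 1] N'[OF assms(1)]]]]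
    by auto
  then obtain c where c: "0 < c" "\<And>\<omega> \<phi>. adm \<omega> \<Longrightarrow> bvar a \<phi> \<Longrightarrow> (AE x in leb. 0 \<le> \<phi> x) \<Longrightarrow> (LINT x|leb. \<phi> x) = 1 \<Longrightarrow>
        (AE x in leb. c < transfer_iter f \<omega> (N * n) \<phi> x)" by blast
  show ?thesis
  proof (intro exI[of _ "N * n"] exI[of _ "min 1 c"] conjI allI impI)
    have "n0 \<le> N * n" using n(1) N0 by (cases N) auto
    then show "A * \<theta> ^ (N * n) \<le> \<epsilon>" using n0 less_imp_le by blast
    show "0 < N * n" using N0 n(2) by simp
    fix \<omega> \<phi> assume "adm \<omega>" "bvar a \<phi>" "(AE x in leb. 0 \<le> \<phi> x)" "(LINT x|leb. \<phi> x) = 1"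
    from c(2)[OF this] have "AE x in leb. c < transfer_iter f \<omega> (N * n) \<phi> x" .
    then show "AE x in leb. min 1 c / 2 \<le> transfer_iter f \<omega> (N * n) \<phi> x"
      by (rule AE_mp) (use c(1) in \<open>auto intro!: AE_I2\<close>)
  qed (use c in auto)
qed

definition dens :: "real \<Rightarrow> (real \<Rightarrow> real) \<Rightarrow> bool" where
  "dens a \<phi> \<longleftrightarrow> bvar a \<phi> \<and> (AE x in leb. 0 \<le> \<phi> x) \<and> (LINT x|leb. \<phi> x) = 1"

lemma dens_L1: "dens a \<phi> \<Longrightarrow> (LINT x|leb. \<bar>\<phi> x\<bar>) = 1"
proof -
  assume d: "dens a \<phi>"
  then have "(LINT x|leb. \<bar>\<phi> x\<bar>) = (LINT x|leb. \<phi> x)"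
    using bvar_measurable[of a \<phi>] unfolding dens_def by (intro integral_cong_AE) auto
  then show ?thesis using d by (simp add: dens_def)
qed

text \<open>Doeblin minorisation: after \<open>K\<close> steps a mass \<open>c / 2\<close> is
  uniformly distributed, and the normalised rest is a density of the same class. With
  \<open>a = 4 * B\<close> the image has variation at most \<open>a / 2\<close>, and dividing by
  \<open>1 - c / 2 \<ge> 1 / 2\<close> restores \<open>a\<close>.\<close>

lemma doeblin:
  "\<exists>a>0. \<exists>K>0. \<exists>c>0. c \<le> 1 \<and> (\<forall>\<omega> \<phi>. adm \<omega> \<longrightarrow> dens a \<phi> \<longrightarrow>
     (\<exists>\<phi>'. dens a \<phi>' \<and> tr (fi \<omega> K) \<phi> (\<lambda>x. (c / 2) * 1 + (1 - c / 2) * \<phi>' x)))"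
proof -
  obtain A B \<theta> where AB: "0 < A" "0 < B" "0 < \<theta>" "\<theta> < 1" and ly: "\<And>k \<omega> \<phi> V. bvar V \<phi> \<Longrightarrow>
     (\<exists>\<psi>. tr (fi \<omega> k) \<phi> \<psi> \<and> bvar (A * \<theta> ^ k * V + B * (LINT x|leb. \<bar>\<phi> x\<bar>)) \<psi>)"
    using ly_uniform by blast
  define a where "a = 4 * B"
  have a0: "0 < a" using AB by (simp add: a_def)
  obtain K c where K: "0 < K" "A * \<theta> ^ K \<le> 1/4" "0 < c" "c \<le> 1" and lb: "\<And>\<omega> \<phi>. adm \<omega> \<Longrightarrow> bvar a \<phi> \<Longrightarrow> (AE x in leb. 0 \<le> \<phi> x) \<Longrightarrow> (LINT x|leb. \<phi> x) = 1 \<Longrightarrow>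
        (AE x in leb. c / 2 \<le> transfer_iter f \<omega> K \<phi> x)"
    using lower_bound_words[OF a0, of "1/4" \<theta> A] AB by auto
  have "\<exists>\<phi>'. dens a \<phi>' \<and> tr (fi \<omega> K) \<phi> (\<lambda>x. (c / 2) * 1 + (1 - c / 2) * \<phi>' x)" if w: "adm \<omega>" "dens a \<phi>" for \<omega> \<phi>
  proof -
    have d: "bvar a \<phi>" "AE x in leb. 0 \<le> \<phi> x" "(LINT x|leb. \<phi> x) = 1" using w(2) by (auto simp: dens_def)
    obtain \<psi> where \<psi>: "tr (fi \<omega> K) \<phi> \<psi>" "bvar (A * \<theta> ^ K * a + B * (LINT x|leb. \<bar>\<phi> x\<bar>)) \<psi>"
      using ly[OF d(1)] by blast
    have bv: "bvar (a / 2) \<psi>"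
    proof (rule bvar_mono[OF \<psi>(2)])
      have "A * \<theta> ^ K * a \<le> 1/4 * a" using K(2) a0 by (intro mult_right_mono) auto
      then show "A * \<theta> ^ K * a + B * (LINT x|leb. \<bar>\<phi> x\<bar>) \<le> a / 2" using dens_L1[OF w(2)] by (simp add: a_def)
    qed
    have "AE x in leb. transfer_iter f \<omega> K \<phi> x = \<psi> x"
      by (rule fi_tr_unique[OF transfer_iter_tr \<psi>(1), of a]) (use d bvar_measurable[OF d(1)] in \<open>auto simp: aebv_def\<close>)
    then have lo: "AE x in leb. c / 2 \<le> \<psi> x" using lb[OF w(1) d] by (auto elim: AE_mp)
    define \<phi>' where "\<phi>' x = (1 / (1 - c / 2)) * (\<psi> x - c / 2)" for x
    have c2: "1 / 2 \<le> 1 - c / 2" using K by simp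
    have eq: "(c / 2) * 1 + (1 - c / 2) * \<phi>' x = \<psi> x" for x using c2 by (simp add: \<phi>'_def)
    have "bvar (\<bar>1 / (1 - c / 2)\<bar> * (a / 2 + 0)) \<phi>'" unfolding \<phi>'_def by (intro bvar_cmult bvar_diff bv) simp
    then have "bvar a \<phi>'"
    proof (rule bvar_mono)
      have "\<bar>1 / (1 - c / 2)\<bar> \<le> 2" using c2 by (simp add: field_simps)
      then show "\<bar>1 / (1 - c / 2)\<bar> * (a / 2 + 0) \<le> a" using mult_right_mono[of "\<bar>1 / (1 - c / 2)\<bar>" 2 "a / 2"] a0 by simp
    qed
    moreover have "AE x in leb. 0 \<le> \<phi>' x" using lo c2 by (auto simp: \<phi>'_def elim!: AE_mp)
    moreover have "(LINT x|leb. \<phi>' x) = 1"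
      using tr_integral[OF \<psi>(1)] d(3) bvar_integrable[OF bv] c2 leb.prob_space by (simp add: \<phi>'_def)
    ultimately have "dens a \<phi>'" by (simp add: dens_def)
    moreover have "(\<lambda>x. (c / 2) * 1 + (1 - c / 2) * \<phi>' x) = \<psi>" by (rule ext) (rule eq)
    ultimately show ?thesis using \<psi>(1) by (intro exI[of _ \<phi>'] conjI) (simp_all only:)
  qed
  then show ?thesis using a0 K by blast
qed

lemma tr_exists: "bvar V \<phi> \<Longrightarrow> \<exists>\<psi> V'. tr (fi \<omega> k) \<phi> \<psi> \<and> bvar V' \<psi>"
  using ly_single[of k] by blast

text \<open>In every block both densities shed the same multiple of the constant 1. The shed parts
  evolve identically and cancel in the difference, so each block leaves a factor
  \<open>1 - c / 2\<close>.\<close>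

lemma coupling:
  assumes step: "\<And>\<omega> \<phi>. adm \<omega> \<Longrightarrow> dens a \<phi> \<Longrightarrow>
     (\<exists>\<phi>'. dens a \<phi>' \<and> tr (fi \<omega> K) \<phi> (\<lambda>x. (c / 2) * 1 + (1 - c / 2) * \<phi>' x))" and c: "0 < c" "c \<le> 1"
  shows "adm \<omega> \<Longrightarrow> dens a \<phi>1 \<Longrightarrow> dens a \<phi>2 \<Longrightarrow> \<exists>\<psi>1 \<psi>2. tr (fi \<omega> (j * K)) \<phi>1 \<psi>1 \<and> tr (fi \<omega> (j * K)) \<phi>2 \<psi>2 \<and>
     (LINT x|leb. \<bar>\<psi>1 x - \<psi>2 x\<bar>) \<le> 2 * (1 - c / 2) ^ j"
proof (induction j arbitrary: \<omega> \<phi>1 \<phi>2)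
  case 0
  have i: "integrable leb \<phi>1" "integrable leb \<phi>2" using 0 by (auto simp: dens_def intro: bvar_integrable)
  have "(LINT x|leb. \<bar>\<phi>1 x - \<phi>2 x\<bar>) \<le> (LINT x|leb. \<bar>\<phi>1 x\<bar> + \<bar>\<phi>2 x\<bar>)"
    using i by (intro integral_mono) auto
  also have "\<dots> = 2" using i dens_L1[OF 0(2)] dens_L1[OF 0(3)] by simp
  finally show ?case using tr_id[OF i(1)] tr_id[OF i(2)]
    by (intro exI[of _ \<phi>1] exI[of _ \<phi>2]) (simp add: id_def)
next
  case (Suc j)
  obtain \<phi>1' where 1: "dens a \<phi>1'" "tr (fi \<omega> K) \<phi>1 (\<lambda>x. (c / 2) * 1 + (1 - c / 2) * \<phi>1' x)" using step[OF Suc.prems(1,2)] by blast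
  obtain \<phi>2' where 2: "dens a \<phi>2'" "tr (fi \<omega> K) \<phi>2 (\<lambda>x. (c / 2) * 1 + (1 - c / 2) * \<phi>2' x)" using step[OF Suc.prems(1,3)] by blast
  let ?w = "(shift ^^ K) \<omega>"
  obtain \<psi>1 \<psi>2 where \<psi>: "tr (fi ?w (j * K)) \<phi>1' \<psi>1" "tr (fi ?w (j * K)) \<phi>2' \<psi>2"
     "(LINT x|leb. \<bar>\<psi>1 x - \<psi>2 x\<bar>) \<le> 2 * (1 - c / 2) ^ j" using Suc.IH[OF adm_shift[OF Suc.prems(1)] 1(1) 2(1)] by blast
  obtain \<rho> where \<rho>: "tr (fi ?w (j * K)) (\<lambda>_. 1) \<rho>" using tr_exists[OF bvar_const[of 1 1]] by force
  define \<xi>1 where "\<xi>1 x = (c / 2) * \<rho> x + (1 - c / 2) * \<psi>1 x" for x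
  define \<xi>2 where "\<xi>2 x = (c / 2) * \<rho> x + (1 - c / 2) * \<psi>2 x" for x
  have t: "tr (fi \<omega> (K + j * K)) \<phi>1 \<xi>1" "tr (fi \<omega> (K + j * K)) \<phi>2 \<xi>2"
    unfolding fibre_iter_add \<xi>1_def[abs_def] \<xi>2_def[abs_def]
    by (rule tr_comp[OF 1(2) tr_lincomb[OF \<rho> \<psi>(1) fi_measurable] fi_measurable],
        rule tr_comp[OF 2(2) tr_lincomb[OF \<rho> \<psi>(2) fi_measurable] fi_measurable])
  have "\<bar>\<xi>1 x - \<xi>2 x\<bar> = (1 - c / 2) * \<bar>\<psi>1 x - \<psi>2 x\<bar>" for x
  proof -
    have "\<xi>1 x - \<xi>2 x = (1 - c / 2) * (\<psi>1 x - \<psi>2 x)" by (simp add: \<xi>1_def \<xi>2_def field_simps)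
    then show ?thesis using c by (simp add: abs_mult)
  qed
  then have "(LINT x|leb. \<bar>\<xi>1 x - \<xi>2 x\<bar>) = (1 - c / 2) * (LINT x|leb. \<bar>\<psi>1 x - \<psi>2 x\<bar>)" by simp
  also have "\<dots> \<le> (1 - c / 2) * (2 * (1 - c / 2) ^ j)" using \<psi>(3) c by (intro mult_left_mono) auto
  finally have "(LINT x|leb. \<bar>\<xi>1 x - \<xi>2 x\<bar>) \<le> 2 * (1 - c / 2) ^ Suc j" by simp
  then show ?case using t by (intro exI[of _ \<xi>1] exI[of _ \<xi>2]) simp
qed

lemma bvar_mean_zero_bound:
  assumes "bvar V \<phi>" "(LINT x|leb. \<phi> x) = 0" "x \<in> {0..1}" shows "\<bar>\<phi> x\<bar> \<le> V"
proof -
  note i = bvar_integrable[OF assms(1)]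
  have "(LINT t|leb. \<phi> x - \<phi> t) \<le> (LINT t|leb. V)"
    using i bvar_osc[OF assms(1,3)] by (intro integral_mono) (auto simp: abs_le_iff)
  moreover have "(LINT t|leb. \<phi> t - \<phi> x) \<le> (LINT t|leb. V)"
    using i bvar_osc[OF assms(1) _ assms(3)] by (intro integral_mono) (auto simp: abs_le_iff)
  ultimately show ?thesis using i assms(2) leb.prob_space by simp
qed

text \<open>A function of mean 0 is a multiple \<open>s\<close> of the difference between the
  densities \<open>\<phi> / s + 1\<close> and 1, to which \<open>coupling\<close> applies.\<close>

lemma decay_L1:
  "\<exists>C>0. \<exists>\<theta>>0. \<theta> < 1 \<and> (\<forall>k \<omega> \<phi> V \<psi>. adm \<omega> \<longrightarrow> bvar V \<phi> \<longrightarrow> (LINT x|leb. \<phi> x) = 0 \<longrightarrow> tr (fi \<omega> k) \<phi> \<psi> \<longrightarrow>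
      (LINT x|leb. \<bar>\<psi> x\<bar>) \<le> C * \<theta> ^ k * V)"
proof -
  obtain a K c where a: "0 < a" "0 < K" "0 < c" "c \<le> 1" and step: "\<And>\<omega> \<phi>. adm \<omega> \<Longrightarrow> dens a \<phi> \<Longrightarrow>
     (\<exists>\<phi>'. dens a \<phi>' \<and> tr (fi \<omega> K) \<phi> (\<lambda>x. (c / 2) * 1 + (1 - c / 2) * \<phi>' x))"
    using doeblin by blast
  obtain D \<theta> where D: "0 < D" "0 < \<theta>" "\<theta> < 1" "\<And>k. (1 - c / 2) ^ (k div K) \<le> D * \<theta> ^ k"
    using power_div_le_geometric[of "1 - c / 2" K] a by auto
  \<comment> \<open>With \<open>s = s0 * V\<close>, the part \<open>1\<close> of the maximum makes
    \<open>\<phi> / s + 1\<close> nonnegative, since \<open>|\<phi>| \<le> V\<close>, and the part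
    \<open>1 / a\<close> makes its variation at most \<open>a\<close>.\<close>
  define s0 where "s0 = max 1 (1 / a)"
  have s0: "1 \<le> s0" "1 / a \<le> s0" by (auto simp: s0_def)
  have "(LINT x|leb. \<bar>\<psi> x\<bar>) \<le> (2 * s0 * D) * \<theta> ^ k * V"
    if w: "adm \<omega>" "bvar V \<phi>" "(LINT x|leb. \<phi> x) = 0" "tr (fi \<omega> k) \<phi> \<psi>" for k \<omega> \<phi> V \<psi>
  proof -
    have i: "integrable leb \<phi>" by (rule bvar_integrable[OF w(2)])
    have V0: "0 \<le> V" by (rule bvar_nonneg[OF w(2)])
    have \<phi>V: "\<bar>\<phi> x\<bar> \<le> V" if "x \<in> {0..1}" for x by (rule bvar_mean_zero_bound[OF w(2,3) that])
    show ?thesis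
    proof (cases "V = 0")
      case True
      have "(LINT x|leb. \<bar>\<phi> x\<bar>) \<le> (LINT x|leb. 0)"
        using i \<phi>V True by (intro integral_mono) auto
      then show ?thesis using tr_measurable_L1[OF w(4)] True by simp
    next
      case False
      then have Vp: "0 < V" using V0 by simp
      define s where "s = s0 * V"
      have s: "0 < s" "V \<le> s" using s0(1) Vp by (auto simp: s_def)
      have sa: "V / s \<le> a" using s0 a(1) Vp by (simp add: s_def field_simps)
      define \<phi>1 where "\<phi>1 x = (1 / s) * \<phi> x + 1" for x
      have "bvar (\<bar>1 / s\<bar> * V + 0) \<phi>1" unfolding \<phi>1_def by (intro bvar_add bvar_cmult w bvar_const) simp
      then have bv1: "bvar a \<phi>1" using sa s by (elim bvar_mono) simp
      have pos1: "0 \<le> \<phi>1 x" if "x \<in> {0..1}" for x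
        using \<phi>V[OF that] s by (simp add: \<phi>1_def field_simps)
      have int1: "(LINT x|leb. \<phi>1 x) = 1" using i w(3) leb.prob_space by (simp add: \<phi>1_def)
      have d1: "dens a \<phi>1" using bv1 int1 pos1 by (auto simp: dens_def)
      have d2: "dens a (\<lambda>_. 1)" using a leb.prob_space by (auto simp: dens_def)
      define j r where "j = k div K" and "r = k mod K"
      have k: "k = j * K + r" by (simp add: j_def r_def)
      obtain \<psi>1 \<psi>2 where \<psi>: "tr (fi \<omega> (j * K)) \<phi>1 \<psi>1" "tr (fi \<omega> (j * K)) (\<lambda>_. 1) \<psi>2"
         "(LINT x|leb. \<bar>\<psi>1 x - \<psi>2 x\<bar>) \<le> 2 * (1 - c / 2) ^ j"
        using coupling[OF step a(3,4) w(1) d1 d2] by blast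
      have t: "tr (fi \<omega> (j * K)) (\<lambda>x. s * \<phi>1 x + (- s) * 1) (\<lambda>x. s * \<psi>1 x + (- s) * \<psi>2 x)"
        by (rule tr_lincomb[OF \<psi>(1,2) fi_measurable])
      have eq: "(\<lambda>x. s * \<phi>1 x + (- s) * 1) = \<phi>" using s by (auto simp: \<phi>1_def algebra_simps)
      obtain \<psi>a V' where \<psi>a: "tr (fi \<omega> (j * K)) \<phi> \<psi>a" "bvar V' \<psi>a" using tr_exists[OF w(2)] by blast
      obtain \<psi>b where \<psi>b: "tr (fi ((shift ^^ (j * K)) \<omega>) r) \<psi>a \<psi>b" using tr_exists[OF \<psi>a(2)] by blast
      have "tr (fi \<omega> k) \<phi> \<psi>b" unfolding k fibre_iter_add by (rule tr_comp[OF \<psi>a(1) \<psi>b fi_measurable])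
      then have "AE x in leb. \<psi> x = \<psi>b x" by (rule fi_tr_unique[OF w(4)])
      then have "(LINT x|leb. \<bar>\<psi> x\<bar>) = (LINT x|leb. \<bar>\<psi>b x\<bar>)"
        using trD(2)[OF w(4)] trD(2)[OF \<psi>b] by (intro integral_cong_AE) auto
      also have "\<dots> \<le> (LINT x|leb. \<bar>\<psi>a x\<bar>)" by (rule tr_measurable_L1[OF \<psi>b])
      also have "\<dots> = (LINT x|leb. \<bar>s * \<psi>1 x + (- s) * \<psi>2 x\<bar>)"
        using fi_tr_unique[OF \<psi>a(1) t[unfolded eq]] trD(2)[OF \<psi>a(1)] trD(2)[OF t] by (intro integral_cong_AE) auto
      also have "\<dots> = (LINT x|leb. s * \<bar>\<psi>1 x - \<psi>2 x\<bar>)"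
      proof (intro Bochner_Integration.integral_cong refl)
        fix x
        have "s * \<psi>1 x + (- s) * \<psi>2 x = s * (\<psi>1 x - \<psi>2 x)" by (simp add: algebra_simps)
        then show "\<bar>s * \<psi>1 x + (- s) * \<psi>2 x\<bar> = s * \<bar>\<psi>1 x - \<psi>2 x\<bar>" using s by (simp add: abs_mult)
      qed
      also have "\<dots> = s * (LINT x|leb. \<bar>\<psi>1 x - \<psi>2 x\<bar>)" by simp
      also have "\<dots> \<le> s * (2 * (D * \<theta> ^ k))" using \<psi>(3) D(4)[of k] s by (intro mult_left_mono) (auto simp: j_def)
      also have "\<dots> = (2 * s0 * D) * \<theta> ^ k * V" by (simp add: s_def)
      finally show ?thesis .
    qed
  qed
  then show ?thesis using D s0 by (intro exI[of _ "2 * s0 * D"]) auto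
qed

text \<open>The first half of the time makes the \<open>L^1\<close> norm small; in the second half
  Lasota--Yorke converts this into small variation. As the mean remains 0, the variation also bounds
  the supremum.\<close>

theorem decay:
  "\<exists>C>0. \<exists>\<theta>>0. \<theta> < 1 \<and> (\<forall>k \<omega> \<phi> V. adm \<omega> \<longrightarrow> bvar V \<phi> \<longrightarrow> (LINT x|leb. \<phi> x) = 0 \<longrightarrow>
      (\<exists>\<psi>. tr (fi \<omega> k) \<phi> \<psi> \<and> bvar (C * \<theta> ^ k * V) \<psi> \<and> (\<forall>x\<in>{0..1}. \<bar>\<psi> x\<bar> \<le> C * \<theta> ^ k * V)))"
proof -
  obtain A B t where AB: "0 < A" "0 < B" "0 < t" "t < 1" and ly: "\<And>k \<omega> \<phi> V. bvar V \<phi> \<Longrightarrow>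
     (\<exists>\<psi>. tr (fi \<omega> k) \<phi> \<psi> \<and> bvar (A * t ^ k * V + B * (LINT x|leb. \<bar>\<phi> x\<bar>)) \<psi>)"
    using ly_uniform by blast
  obtain C u where C: "0 < C" "0 < u" "u < 1" and L1: "\<And>k \<omega> \<phi> V \<psi>. adm \<omega> \<Longrightarrow> bvar V \<phi> \<Longrightarrow> (LINT x|leb. \<phi> x) = 0 \<Longrightarrow> tr (fi \<omega> k) \<phi> \<psi> \<Longrightarrow>
      (LINT x|leb. \<bar>\<psi> x\<bar>) \<le> C * u ^ k * V"
    using decay_L1 by blast
  define q where "q = max t u"
  have q: "0 < q" "q < 1" "t \<le> q" "u \<le> q" using AB C by (auto simp: q_def)
  obtain E \<theta> where E: "0 < E" "0 < \<theta>" "\<theta> < 1" "\<And>k. q ^ (k div 2) \<le> E * \<theta> ^ k"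
    using power_div_le_geometric[OF q(1,2), of 2] by auto
  define F where "F = (A * (A + B) + B * C) * E"
  have "\<exists>\<psi>. tr (fi \<omega> k) \<phi> \<psi> \<and> bvar (F * \<theta> ^ k * V) \<psi> \<and> (\<forall>x\<in>{0..1}. \<bar>\<psi> x\<bar> \<le> F * \<theta> ^ k * V)"
    if w: "adm \<omega>" "bvar V \<phi>" "(LINT x|leb. \<phi> x) = 0" for k \<omega> \<phi> V
  proof -
    define m r where "m = k div 2" and "r = k - k div 2"
    have k: "k = m + r" "m \<le> r" by (auto simp: m_def r_def)
    have V0: "0 \<le> V" by (rule bvar_nonneg[OF w(2)])
    have "(LINT x|leb. \<bar>\<phi> x\<bar>) \<le> (LINT x|leb. V)"
      using bvar_mean_zero_bound[OF w(2,3)] bvar_integrable[OF w(2)] by (intro integral_mono) auto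
    then have nV: "(LINT x|leb. \<bar>\<phi> x\<bar>) \<le> V" using leb.prob_space by simp
    obtain \<psi>1 where 1: "tr (fi \<omega> m) \<phi> \<psi>1" "bvar (A * t ^ m * V + B * (LINT x|leb. \<bar>\<phi> x\<bar>)) \<psi>1" using ly[OF w(2)] by blast
    have "A * t ^ m * V \<le> A * 1 * V" using AB V0 by (intro mult_right_mono mult_left_mono) (auto simp: power_le_one)
    moreover have "B * (LINT x|leb. \<bar>\<phi> x\<bar>) \<le> B * V" using nV AB by (intro mult_left_mono) auto
    ultimately have bv1: "bvar ((A + B) * V) \<psi>1" by (intro bvar_mono[OF 1(2)]) (simp add: algebra_simps)
    obtain \<psi> where 2: "tr (fi ((shift ^^ m) \<omega>) r) \<psi>1 \<psi>"
      "bvar (A * t ^ r * ((A + B) * V) + B * (LINT x|leb. \<bar>\<psi>1 x\<bar>)) \<psi>" using ly[OF bv1] by blast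
    have tr: "tr (fi \<omega> k) \<phi> \<psi>" unfolding k fibre_iter_add by (rule tr_comp[OF 1(1) 2(1) fi_measurable])
    have "t ^ r \<le> q ^ r" using q AB by (intro power_mono) auto
    also have "\<dots> \<le> q ^ m" using k(2) q by (intro power_decreasing) auto
    finally have tq: "t ^ r \<le> q ^ m" .
    have uq: "u ^ m \<le> q ^ m" using q C by (intro power_mono) auto
    have "(LINT x|leb. \<bar>\<psi>1 x\<bar>) \<le> C * u ^ m * V" by (rule L1[OF w 1(1)])
    also have "\<dots> \<le> C * q ^ m * V" using uq C V0 by (intro mult_right_mono mult_left_mono) auto
    finally have n1: "(LINT x|leb. \<bar>\<psi>1 x\<bar>) \<le> C * q ^ m * V" .
    have "A * t ^ r * ((A + B) * V) \<le> A * q ^ m * ((A + B) * V)" using tq AB V0 by (intro mult_right_mono mult_left_mono) auto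
    moreover have "B * (LINT x|leb. \<bar>\<psi>1 x\<bar>) \<le> B * (C * q ^ m * V)" using n1 AB by (intro mult_left_mono) auto
    ultimately have "A * t ^ r * ((A + B) * V) + B * (LINT x|leb. \<bar>\<psi>1 x\<bar>) \<le> (A * (A + B) + B * C) * V * q ^ m"
      by (simp add: algebra_simps)
    also have "\<dots> \<le> (A * (A + B) + B * C) * V * (E * \<theta> ^ k)" using E(4)[of k] AB C V0 by (intro mult_left_mono) (auto simp: m_def)
    finally have bv: "bvar (F * \<theta> ^ k * V) \<psi>" by (intro bvar_mono[OF 2(2)]) (simp add: F_def algebra_simps)
    have int0: "(LINT x|leb. \<psi> x) = 0" using tr_integral[OF tr] w(3) by simp
    show ?thesis using tr bv bvar_mean_zero_bound[OF bv int0] by blast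
  qed
  moreover have "0 < F" using AB C E by (auto simp: F_def intro!: mult_pos_pos add_pos_pos)
  ultimately show ?thesis using E by blast
qed

end

section \<open>A law of large numbers for the shift\<close>

context prob_space begin

text \<open>In the expanded square only pairs of indices closer than \<open>k\<close> contribute, at
  most \<open>2 k\<close> for each index, so the second moment grows linearly in
  \<open>n\<close>.\<close>

lemma weakly_dependent_second_moment:
  fixes X :: "nat \<Rightarrow> 'a \<Rightarrow> real"
  assumes X[measurable]: "\<And>i. X i \<in> borel_measurable M"
    and b: "\<And>i \<omega>. \<omega> \<in> space M \<Longrightarrow> \<bar>X i \<omega>\<bar> \<le> b"
    and z: "\<And>i j. i + k \<le> j \<Longrightarrow> expectation (\<lambda>\<omega>. X i \<omega> * X j \<omega>) = 0"
  shows "integrable M (\<lambda>\<omega>. (\<Sum>i<n. X i \<omega>)\<^sup>2)" "expectation (\<lambda>\<omega>. (\<Sum>i<n. X i \<omega>)\<^sup>2) \<le> real n * (2 * real k * b\<^sup>2)"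
proof -
  have b2: "\<bar>X i \<omega> * X j \<omega>\<bar> \<le> b\<^sup>2" if "\<omega> \<in> space M" for i j \<omega>
  proof -
    have "\<bar>X i \<omega>\<bar> * \<bar>X j \<omega>\<bar> \<le> b * b" using b[OF that, of i] b[OF that, of j] by (intro mult_mono) auto
    then show ?thesis by (simp add: abs_mult power2_eq_square)
  qed
  have i: "integrable M (\<lambda>\<omega>. X i \<omega> * X j \<omega>)" for i j
    by (rule integrable_const_bound[where B = "b\<^sup>2"]) (use b2 in auto)
  have eq: "(\<Sum>i<n. X i \<omega>)\<^sup>2 = (\<Sum>i<n. \<Sum>j<n. X i \<omega> * X j \<omega>)" for \<omega>
    by (simp add: power2_eq_square sum_product)
  show "integrable M (\<lambda>\<omega>. (\<Sum>i<n. X i \<omega>)\<^sup>2)" unfolding eq using i by auto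
  have e: "expectation (\<lambda>\<omega>. X i \<omega> * X j \<omega>) \<le> (if i < j + k \<and> j < i + k then b\<^sup>2 else 0)" for i j
  proof (cases "i < j + k \<and> j < i + k")
    case True
    have "expectation (\<lambda>\<omega>. X i \<omega> * X j \<omega>) \<le> expectation (\<lambda>\<omega>. b\<^sup>2)"
      using b2 i by (intro integral_mono) (auto simp: abs_le_iff)
    then show ?thesis using True prob_space by simp
  next
    case False
    then show ?thesis using z[of i j] z[of j i] by (auto simp: mult.commute not_less)
  qed
  have c: "(\<Sum>j<n. if i < j + k \<and> j < i + k then b\<^sup>2 else 0) \<le> 2 * real k * b\<^sup>2" for i
  proof -
    have "card ({..<n} \<inter> {j. i < j + k \<and> j < i + k}) \<le> card {i + 1 - k..<i + k}"
      by (intro card_mono) auto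
    then have "card ({..<n} \<inter> {j. i < j + k \<and> j < i + k}) \<le> 2 * k" by simp
    then have "real (card ({..<n} \<inter> {j. i < j + k \<and> j < i + k})) \<le> 2 * real k" by linarith
    then show ?thesis by (simp add: sum.If_cases mult_right_mono)
  qed
  have "expectation (\<lambda>\<omega>. (\<Sum>i<n. X i \<omega>)\<^sup>2) = (\<Sum>i<n. \<Sum>j<n. expectation (\<lambda>\<omega>. X i \<omega> * X j \<omega>))"
    unfolding eq using i by (subst Bochner_Integration.integral_sum; (intro sum.cong refl)?) auto
  also have "\<dots> \<le> (\<Sum>i<n. \<Sum>j<n. if i < j + k \<and> j < i + k then b\<^sup>2 else 0)" by (intro sum_mono e)
  also have "\<dots> \<le> (\<Sum>i<n. 2 * real k * b\<^sup>2)" by (intro sum_mono c)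
  finally show "expectation (\<lambda>\<omega>. (\<Sum>i<n. X i \<omega>)\<^sup>2) \<le> real n * (2 * real k * b\<^sup>2)" by simp
qed

text \<open>Linear second moments make the squared averages along the times \<open>n^2\<close>
  summable, so these averages tend to 0 almost surely; boundedness interpolates between consecutive
  squares.\<close>

theorem weakly_dependent_slln:
  fixes X :: "nat \<Rightarrow> 'a \<Rightarrow> real"
  assumes X[measurable]: "\<And>i. X i \<in> borel_measurable M"
    and b: "\<And>i \<omega>. \<omega> \<in> space M \<Longrightarrow> \<bar>X i \<omega>\<bar> \<le> b"
    and z: "\<And>i j. i + k \<le> j \<Longrightarrow> expectation (\<lambda>\<omega>. X i \<omega> * X j \<omega>) = 0"
  shows "AE \<omega> in M. (\<lambda>n. (\<Sum>i<n. X i \<omega>) / real n) \<longlonglongrightarrow> 0"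
proof -
  define S where "S n \<omega> = (\<Sum>i<n. X i \<omega>)" for n \<omega>
  have S[measurable]: "S n \<in> borel_measurable M" for n unfolding S_def by measurable
  \<comment> \<open>Squared averages along the squares; their expectations are of order
    \<open>1 / (Suc n)^2\<close>, hence summable.\<close>
  define Y where "Y n \<omega> = (S (Suc n ^ 2) \<omega> / real (Suc n ^ 2))\<^sup>2" for n \<omega>
  have Y[measurable]: "Y n \<in> borel_measurable M" for n unfolding Y_def by measurable
  have Yi: "integrable M (Y n)" "expectation (Y n) \<le> (2 * real k * b\<^sup>2) * (1 / real (Suc n) ^ 2)" for n
  proof -
    let ?q = "real (Suc n) ^ 2"
    have q: "0 < ?q" by simp
    have eq: "Y n = (\<lambda>\<omega>. (S (Suc n ^ 2) \<omega>)\<^sup>2 / (?q * ?q))"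
      unfolding Y_def power_divide of_nat_power by (simp only: power2_eq_square[of "real (Suc n) ^ 2"])
    have w: "integrable M (\<lambda>\<omega>. (S (Suc n ^ 2) \<omega>)\<^sup>2)"
      "expectation (\<lambda>\<omega>. (S (Suc n ^ 2) \<omega>)\<^sup>2) \<le> real (Suc n ^ 2) * (2 * real k * b\<^sup>2)"
      unfolding S_def by (rule weakly_dependent_second_moment[where k = k and b = b]; fact X b z)+
    show "integrable M (Y n)" unfolding eq using w(1) by auto
    have "expectation (Y n) = expectation (\<lambda>\<omega>. (S (Suc n ^ 2) \<omega>)\<^sup>2) / (?q * ?q)" unfolding eq by simp
    also have "\<dots> \<le> (?q * (2 * real k * b\<^sup>2)) / (?q * ?q)"
      using w(2) unfolding of_nat_power by (rule divide_right_mono) simp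
    also have "\<dots> = (2 * real k * b\<^sup>2) * (1 / ?q)" using q by (simp add: field_simps)
    finally show "expectation (Y n) \<le> (2 * real k * b\<^sup>2) * (1 / ?q)" .
  qed
  have "(\<integral>\<^sup>+\<omega>. (\<Sum>n. ennreal (Y n \<omega>)) \<partial>M) = (\<Sum>n. \<integral>\<^sup>+\<omega>. ennreal (Y n \<omega>) \<partial>M)" by (rule nn_integral_suminf) auto
  also have "\<dots> = (\<Sum>n. ennreal (expectation (Y n)))"
    by (intro suminf_cong nn_integral_eq_integral Yi(1)) (simp add: Y_def)
  also have "\<dots> \<le> (\<Sum>n. ennreal ((2 * real k * b\<^sup>2) * (1 / real (Suc n) ^ 2)))"
    by (intro suminf_le ennreal_leI Yi) auto
  also have "\<dots> < \<infinity>"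
  proof -
    have "summable (\<lambda>n. (2 * real k * b\<^sup>2) * (1 / real (Suc n) ^ 2))"
      using inverse_power_summable[of 2, where 'a = real] 
      by (intro summable_mult) (subst summable_Suc_iff, simp add: inverse_eq_divide)
    then show ?thesis using suminf_ennreal2[of "\<lambda>n. (2 * real k * b\<^sup>2) * (1 / real (Suc n) ^ 2)"]
      by (simp add: ennreal_suminf_neq_top less_top)
  qed
  finally have fin: "AE \<omega> in M. (\<Sum>n. ennreal (Y n \<omega>)) \<noteq> \<infinity>" by (intro nn_integral_PInf_AE) auto
  have b0: "0 \<le> b" using b not_empty by (metis abs_ge_zero all_not_in_conv order_trans)
  have det: "(\<lambda>n. S n \<omega> / real n) \<longlonglongrightarrow> 0" if w: "\<omega> \<in> space M" and f: "(\<Sum>n. ennreal (Y n \<omega>)) \<noteq> \<infinity>" for \<omega>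
  proof -
    have "summable (\<lambda>n. Y n \<omega>)" using f by (intro summable_suminf_not_top) (auto simp: Y_def)
    then have "(\<lambda>n. Y n \<omega>) \<longlonglongrightarrow> 0" by (rule summable_LIMSEQ_zero)
    then have "(\<lambda>n. sqrt (Y n \<omega>)) \<longlonglongrightarrow> sqrt 0" by (rule tendsto_real_sqrt)
    then have "(\<lambda>n. \<bar>S (Suc n ^ 2) \<omega>\<bar> / real (Suc n ^ 2)) \<longlonglongrightarrow> 0" by (simp add: Y_def real_sqrt_abs)
    then have sq: "(\<lambda>n. \<bar>S (n ^ 2) \<omega>\<bar> / real (n ^ 2)) \<longlonglongrightarrow> 0" by (subst (asm) filterlim_sequentially_Suc)
    \<comment> \<open>\<open>(q n)^2\<close> is the last square not above \<open>n\<close>, so at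
      most \<open>2 * q n + 1\<close> terms are left over, which is negligible against
      \<open>(q n)^2\<close>.\<close>
    define q where "q n = nat \<lfloor>sqrt (real n)\<rfloor>" for n
    have q1: "real (q n) \<le> sqrt (real n)" "sqrt (real n) < real (q n) + 1" for n
      unfolding q_def by (auto simp: of_nat_nat)
    have q2: "q n ^ 2 \<le> n" "n \<le> q n ^ 2 + 2 * q n + 1" for n
    proof -
      have "real (q n) ^ 2 \<le> sqrt (real n) ^ 2" using q1[of n] by (intro power_mono) auto
      then have "real (q n ^ 2) \<le> real n" by simp
      then show "q n ^ 2 \<le> n" by (simp only: of_nat_le_iff)
      have "sqrt (real n) ^ 2 \<le> (real (q n) + 1) ^ 2" using q1[of n] by (intro power_mono) auto
      then have "real n \<le> real (q n ^ 2 + 2 * q n + 1)" by (simp add: power2_eq_square algebra_simps)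
      then show "n \<le> q n ^ 2 + 2 * q n + 1" by (simp only: of_nat_le_iff)
    qed
    have qlim: "filterlim q at_top sequentially"
    proof (rule filterlim_at_top[THEN iffD2], rule allI)
      fix Z
      show "\<forall>\<^sub>F n in sequentially. Z \<le> q n"
        unfolding eventually_sequentially
      proof (intro exI allI impI)
        fix n assume "(Z + 1) ^ 2 \<le> n"
        then have "real (Z + 1) ^ 2 \<le> real n" by (metis of_nat_le_iff of_nat_power)
        then have "real (Z + 1) \<le> sqrt (real n)" by (rule real_le_rsqrt)
        then show "Z \<le> q n" using q1(2)[of n] by simp
      qed
    qed
    have lim1: "(\<lambda>n. \<bar>S (q n ^ 2) \<omega>\<bar> / real (q n ^ 2)) \<longlonglongrightarrow> 0" by (rule filterlim_compose[OF sq qlim])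
    have "(\<lambda>n. b * ((2 * real n + 1) / real n ^ 2)) \<longlonglongrightarrow> 0" by real_asymp
    then have lim2: "(\<lambda>n. b * ((2 * real (q n) + 1) / real (q n) ^ 2)) \<longlonglongrightarrow> 0" by (rule filterlim_compose[OF _ qlim])
    have "(\<lambda>n. \<bar>S (q n ^ 2) \<omega>\<bar> / real (q n ^ 2) + b * ((2 * real (q n) + 1) / real (q n) ^ 2)) \<longlonglongrightarrow> 0"
      using tendsto_add[OF lim1 lim2] by simp
    then show ?thesis
    proof (rule Lim_null_comparison[rotated])
      have "\<forall>\<^sub>F n in sequentially. 1 \<le> q n" using qlim by (simp add: filterlim_at_top)
      then show "\<forall>\<^sub>F n in sequentially. norm (S n \<omega> / real n) \<le>
          \<bar>S (q n ^ 2) \<omega>\<bar> / real (q n ^ 2) + b * ((2 * real (q n) + 1) / real (q n) ^ 2)"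
      proof (rule eventually_mono)
        fix n assume q: "1 \<le> q n"
        have qp: "0 < real (q n ^ 2)" using q by simp
        have "S n \<omega> = S (q n ^ 2) \<omega> + (\<Sum>i\<in>{q n ^ 2..<n}. X i \<omega>)"
          unfolding S_def using q2(1)[of n] by (metis atLeast0LessThan sum.atLeastLessThan_concat le0)
        moreover have "\<bar>\<Sum>i\<in>{q n ^ 2..<n}. X i \<omega>\<bar> \<le> b * (2 * real (q n) + 1)"
        proof -
          have "\<bar>\<Sum>i\<in>{q n ^ 2..<n}. X i \<omega>\<bar> \<le> (\<Sum>i\<in>{q n ^ 2..<n}. b)"
            using b[OF w] by (intro order_trans[OF sum_abs] sum_mono) auto
          also have "\<dots> = b * real (n - q n ^ 2)" by simp
          also have "\<dots> \<le> b * (2 * real (q n) + 1)"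
          proof (rule mult_left_mono[OF _ b0])
            have "n - q n ^ 2 \<le> 2 * q n + 1" using q2[of n] by simp
            then show "real (n - q n ^ 2) \<le> 2 * real (q n) + 1" by linarith
          qed
          finally show ?thesis .
        qed
        ultimately have *: "\<bar>S n \<omega>\<bar> \<le> \<bar>S (q n ^ 2) \<omega>\<bar> + b * (2 * real (q n) + 1)" by linarith
        have "norm (S n \<omega> / real n) = \<bar>S n \<omega>\<bar> / real n" by simp
        also have "\<dots> \<le> \<bar>S n \<omega>\<bar> / real (q n ^ 2)"
        proof (rule divide_left_mono)
          have "0 < n" using q q2(1)[of n] by (cases n) auto
          then show "0 < real n * real (q n ^ 2)" using qp by simp
          show "real (q n ^ 2) \<le> real n" using q2(1)[of n] by (simp only: of_nat_le_iff)
        qed auto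
        also have "\<dots> \<le> (\<bar>S (q n ^ 2) \<omega>\<bar> + b * (2 * real (q n) + 1)) / real (q n ^ 2)"
          using * by (intro divide_right_mono) auto
        finally show "norm (S n \<omega> / real n) \<le> \<bar>S (q n ^ 2) \<omega>\<bar> / real (q n ^ 2) + b * ((2 * real (q n) + 1) / real (q n) ^ 2)"
          by (simp only: add_divide_distrib of_nat_power distrib_left times_divide_eq_right)
      qed
    qed
  qed
  show ?thesis using fin by (rule AE_mp) (use det in \<open>auto intro!: AE_I2 simp: S_def\<close>)
qed

end

section \<open>The Bernoulli shift: invariance and independence of blocks\<close>

context mixing begin

lemma coord_measurable: "(\<lambda>\<omega>. \<omega> i) \<in> measurable Q (measure_pmf p)"
  unfolding Q bernoulli_def by (rule measurable_component_singleton) simp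

lemma shift_measurable: "shift \<in> measurable Q Q"
proof -
  have "(\<lambda>\<omega> k. \<omega> (k + 1)) \<in> measurable Q (Pi\<^sub>M UNIV (\<lambda>_::int. measure_pmf p))"
    by (rule measurable_PiM_single') (auto intro: coord_measurable[simplified])
  then show ?thesis unfolding shift_def[abs_def] by (simp add: Q bernoulli_def)
qed

lemma shift_funpow_measurable: "(shift ^^ k) \<in> measurable Q Q"
proof (induction k)
  case (Suc k)
  show ?case using measurable_comp[OF Suc shift_measurable] by (simp add: o_def)
qed (simp add: id_def)

lemma distr_shift: "distr Q Q shift = Q"
proof -
  have "distr (Pi\<^sub>M UNIV (\<lambda>_::int. measure_pmf p)) (Pi\<^sub>M UNIV (\<lambda>_::int. measure_pmf p)) (\<lambda>\<omega>. \<lambda>n\<in>UNIV. \<omega> (n + 1)) = Pi\<^sub>M UNIV (\<lambda>_::int. measure_pmf p)"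
    by (rule distr_PiM_reindex[of UNIV "\<lambda>_::int. measure_pmf p" "\<lambda>n. n + 1" UNIV]) (auto simp: inj_def measure_pmf.prob_space_axioms)
  then show ?thesis by (simp add: Q bernoulli_def shift_def[abs_def] restrict_UNIV)
qed

lemma distr_shift_funpow: "distr Q Q (shift ^^ k) = Q"
proof (induction k)
  case 0 then show ?case by (simp add: id_def distr_id)
next
  case (Suc k)
  have "distr Q Q (shift ^^ Suc k) = distr (distr Q Q (shift ^^ k)) Q shift"
    by (subst distr_distr) (auto simp: shift_measurable shift_funpow_measurable)
  then show ?case using Suc distr_shift by (simp add: o_def)
qed

lemma integral_shift:
  fixes F :: "(int \<Rightarrow> 'y) \<Rightarrow> real"
  assumes "F \<in> borel_measurable Q" shows "(LINT \<omega>|Q. F ((shift ^^ k) \<omega>)) = (LINT \<omega>|Q. F \<omega>)"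
  using integral_distr[OF shift_funpow_measurable[of k] assms] by (simp add: distr_shift_funpow)

lemma AE_shift:
  assumes "AE \<omega> in Q. R \<omega>" shows "AE \<omega> in Q. \<forall>k. R ((shift ^^ k) \<omega>)"
proof (subst AE_all_countable, rule allI)
  fix k
  have "AE \<omega> in distr Q Q (shift ^^ k). R \<omega>" using assms by (subst distr_shift_funpow)
  then show "AE \<omega> in Q. R ((shift ^^ k) \<omega>)" by (rule AE_distrD[OF shift_funpow_measurable])
qed

text \<open>Over a finite alphabet a preimage is a finite union of cylinders, whatever the target
  space. So no measurability assumption on \<open>F\<close> is required.\<close>

lemma cylinder_function_measurable:
  assumes "\<And>\<omega> \<omega>'. (\<And>i. 1 \<le> i \<Longrightarrow> i \<le> int k \<Longrightarrow> \<omega> i = \<omega>' i) \<Longrightarrow> F \<omega> = F \<omega>'" and "\<And>\<omega>. F \<omega> \<in> space N"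
  shows "F \<in> measurable Q N"
proof (rule measurableI)
  fix A assume "A \<in> sets N"
  let ?W = "PiE {1..int k} (\<lambda>_. UNIV :: 'y set)"
  have "F -` A \<inter> space Q = (\<Union>w\<in>{w\<in>?W. F w \<in> A}. {\<omega>\<in>space Q. \<forall>i\<in>{1..int k}. \<omega> i \<in> {w i}})"
  proof (intro set_eqI iffI)
    fix \<omega> assume w: "\<omega> \<in> F -` A \<inter> space Q"
    have "F (restrict \<omega> {1..int k}) = F \<omega>" by (rule assms(1)) auto
    then show "\<omega> \<in> (\<Union>w\<in>{w\<in>?W. F w \<in> A}. {\<omega>\<in>space Q. \<forall>i\<in>{1..int k}. \<omega> i \<in> {w i}})"
      using w by (intro UN_I[of "restrict \<omega> {1..int k}"]) auto
  next
    fix \<omega> assume "\<omega> \<in> (\<Union>w\<in>{w\<in>?W. F w \<in> A}. {\<omega>\<in>space Q. \<forall>i\<in>{1..int k}. \<omega> i \<in> {w i}})"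
    then obtain w where w: "F w \<in> A" "\<forall>i\<in>{1..int k}. \<omega> i = w i" by auto
    have "F \<omega> = F w" by (rule assms(1)) (use w in auto)
    then show "\<omega> \<in> F -` A \<inter> space Q" using w by simp
  qed
  also have "\<dots> \<in> sets Q"
  proof (rule sets.finite_UN)
    show "finite {w\<in>?W. F w \<in> A}" by (rule finite_subset[of _ ?W]) (auto intro: finite_PiE)
    fix w
    have "{\<omega>\<in>space Q. \<forall>i\<in>{1..int k}. (\<lambda>\<omega>. \<omega> i) \<omega> \<in> {w i}} \<in> sets Q"
    proof (rule sets.sets_Collect_finite_All)
      fix i
      have "(\<lambda>\<omega>. \<omega> i) -` {w i} \<inter> space Q \<in> sets Q" using coord_measurable by (rule measurable_sets) simp
      moreover have "(\<lambda>\<omega>. \<omega> i) -` {w i} \<inter> space Q = {\<omega> \<in> space Q. \<omega> i \<in> {w i}}" by auto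
      ultimately show "{\<omega> \<in> space Q. \<omega> i \<in> {w i}} \<in> sets Q" by simp
    qed auto
    then show "{\<omega>\<in>space Q. \<forall>i\<in>{1..int k}. \<omega> i \<in> {w i}} \<in> sets Q" by simp
  qed
  finally show "F -` A \<inter> space Q \<in> sets Q" .
qed (rule assms(2))

lemma indep_coords: "Q.indep_vars (\<lambda>_. measure_pmf p) (\<lambda>i \<omega>. \<omega> i) UNIV"
proof (subst Q.indep_vars_iff_distr_eq_PiM)
  have "distr Q (Pi\<^sub>M UNIV (\<lambda>_::int. measure_pmf p)) (\<lambda>x. \<lambda>i\<in>UNIV. x i) = Q"
    by (simp add: restrict_UNIV Q bernoulli_def distr_id)
  moreover have "distr Q (measure_pmf p) (\<lambda>\<omega>. \<omega> i) = measure_pmf p" for i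
    unfolding Q bernoulli_def by (subst PP.PiM_component) auto
  ultimately show "distr Q (Pi\<^sub>M UNIV (\<lambda>_::int. measure_pmf p)) (\<lambda>x. \<lambda>i\<in>UNIV. x i) =
      Pi\<^sub>M UNIV (\<lambda>i. distr Q (measure_pmf p) (\<lambda>\<omega>. \<omega> i))"
    by (simp add: Q bernoulli_def)
qed (auto simp: coord_measurable[simplified])

text \<open>The two shifted functions read the coordinate blocks \<open>i + 1 .. i + k\<close> and
  \<open>j + 1 .. j + k\<close>, which are disjoint when \<open>i + k \<le> j\<close> and therefore
  independent.\<close>

lemma cylinder_functions_decorrelate:
  fixes F G :: "(int \<Rightarrow> 'y) \<Rightarrow> real"
  assumes F: "\<And>\<omega> \<omega>'. (\<And>i. 1 \<le> i \<Longrightarrow> i \<le> int k \<Longrightarrow> \<omega> i = \<omega>' i) \<Longrightarrow> F \<omega> = F \<omega>'"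
    and b: "\<And>\<omega>. \<bar>F \<omega>\<bar> \<le> b" and ij: "i + k \<le> j"
  shows "(LINT \<omega>|Q. F ((shift ^^ i) \<omega>) * F ((shift ^^ j) \<omega>)) = (LINT \<omega>|Q. F \<omega>) * (LINT \<omega>|Q. F \<omega>)"
proof -
  obtain y :: 'y where True by blast
  have Fm: "F \<in> borel_measurable Q" by (rule cylinder_function_measurable[OF F]) auto
  let ?K = "\<lambda>m. {int m + 1..int m + int k}"
  \<comment> \<open>\<open>F\<close> as a function of the window of length \<open>k\<close> that
    starts after \<open>m\<close>; the letter \<open>y\<close> outside the window is arbitrary and
    does not affect the value.\<close>
  define E where "E m x = F (\<lambda>i. if 1 \<le> i \<and> i \<le> int k then x (i + int m) else y)" for m :: nat and x
  have E: "E m (\<lambda>i\<in>?K m. \<omega> i) = F ((shift ^^ m) \<omega>)" for m \<omega>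
    unfolding E_def by (rule F) (auto simp: shift_funpow)
  have Em: "E m \<in> borel_measurable (Pi\<^sub>M (?K m) (\<lambda>_. measure_pmf p))" for m
  proof -
    have "(\<lambda>x i. if 1 \<le> i \<and> i \<le> int k then x (i + int m) else y) \<in> measurable (Pi\<^sub>M (?K m) (\<lambda>_. measure_pmf p)) (Pi\<^sub>M UNIV (\<lambda>_::int. measure_pmf p))"
    proof (rule measurable_PiM_single')
      fix i :: int
      show "(\<lambda>x. if 1 \<le> i \<and> i \<le> int k then x (i + int m) else y) \<in> measurable (Pi\<^sub>M (?K m) (\<lambda>_. measure_pmf p)) (measure_pmf p)"
        by (cases "1 \<le> i \<and> i \<le> int k") (auto intro!: measurable_component_singleton)
    qed auto
    then have "F \<circ> (\<lambda>x i. if 1 \<le> i \<and> i \<le> int k then x (i + int m) else y) \<in> borel_measurable (Pi\<^sub>M (?K m) (\<lambda>_. measure_pmf p))"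
      by (rule measurable_comp) (use Fm in \<open>simp add: Q bernoulli_def\<close>)
    then show ?thesis by (simp add: E_def[abs_def] o_def)
  qed
  have "Q.indep_var (Pi\<^sub>M (?K i) (\<lambda>_. measure_pmf p)) (\<lambda>\<omega>. \<lambda>t\<in>?K i. \<omega> t) (Pi\<^sub>M (?K j) (\<lambda>_. measure_pmf p)) (\<lambda>\<omega>. \<lambda>t\<in>?K j. \<omega> t)"
    by (rule Q.indep_var_restrict[OF indep_coords]) (use ij in auto)
  from Q.indep_var_compose[OF this Em Em]
  have "Q.indep_var borel (\<lambda>\<omega>. F ((shift ^^ i) \<omega>)) borel (\<lambda>\<omega>. F ((shift ^^ j) \<omega>))"
    by (simp add: o_def E)
  moreover have "integrable Q (\<lambda>\<omega>. F ((shift ^^ m) \<omega>))" for m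
    by (rule Q.integrable_const_bound[where B = b])
       (use b measurable_comp[OF shift_funpow_measurable Fm, of m] in \<open>auto simp: o_def\<close>)
  ultimately have "(LINT \<omega>|Q. F ((shift ^^ i) \<omega>) * F ((shift ^^ j) \<omega>)) = (LINT \<omega>|Q. F ((shift ^^ i) \<omega>)) * (LINT \<omega>|Q. F ((shift ^^ j) \<omega>))"
    by (intro Q.indep_var_lebesgue_integral)
  then show ?thesis by (simp add: integral_shift[OF Fm])
qed

theorem cylinder_slln:
  fixes F :: "(int \<Rightarrow> 'y) \<Rightarrow> real"
  assumes F: "\<And>\<omega> \<omega>'. (\<And>i. 1 \<le> i \<Longrightarrow> i \<le> int k \<Longrightarrow> \<omega> i = \<omega>' i) \<Longrightarrow> F \<omega> = F \<omega>'"
    and b: "\<And>\<omega>. \<bar>F \<omega>\<bar> \<le> b"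
  shows "AE \<omega> in Q. (\<lambda>n. (\<Sum>i<n. F ((shift ^^ i) \<omega>)) / real n) \<longlonglongrightarrow> (LINT \<omega>|Q. F \<omega>)"
proof -
  have Fm: "F \<in> borel_measurable Q" by (rule cylinder_function_measurable[OF F]) auto
  define e where "e = (LINT \<omega>|Q. F \<omega>)"
  have Fi: "integrable Q F" by (rule Q.integrable_const_bound[where B = b]) (use b Fm in auto)
  have eb: "\<bar>e\<bar> \<le> b"
  proof -
    have "\<bar>e\<bar> \<le> (LINT \<omega>|Q. \<bar>F \<omega>\<bar>)" unfolding e_def by (rule integral_abs_bound)
    also have "\<dots> \<le> (LINT \<omega>|Q. b)" using Fi b by (intro integral_mono) auto
    finally show ?thesis using Q.prob_space by simp
  qed
  have "AE \<omega> in Q. (\<lambda>n. (\<Sum>i<n. F ((shift ^^ i) \<omega>) - e) / real n) \<longlonglongrightarrow> 0"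
  proof (rule Q.weakly_dependent_slln[where b = "2 * b" and k = k])
    show "(\<lambda>\<omega>. F ((shift ^^ i) \<omega>) - e) \<in> borel_measurable Q" for i
      using measurable_comp[OF shift_funpow_measurable Fm, of i] by (auto simp: o_def)
    show "\<bar>F ((shift ^^ i) \<omega>) - e\<bar> \<le> 2 * b" for i \<omega> using b[of "(shift ^^ i) \<omega>"] eb by linarith
    fix i j assume ij: "i + k \<le> j"
    define F' where "F' \<omega> = F \<omega> - e" for \<omega>
    have "(LINT \<omega>|Q. F' ((shift ^^ i) \<omega>) * F' ((shift ^^ j) \<omega>)) = (LINT \<omega>|Q. F' \<omega>) * (LINT \<omega>|Q. F' \<omega>)"
    proof (rule cylinder_functions_decorrelate[OF _ _ ij])
      show "F' \<omega> = F' \<omega>'" if "\<And>i. 1 \<le> i \<Longrightarrow> i \<le> int k \<Longrightarrow> \<omega> i = \<omega>' i" for \<omega> \<omega>' using F[OF that] by (simp add: F'_def)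
      show "\<bar>F' \<omega>\<bar> \<le> 2 * b" for \<omega> using b[of \<omega>] eb unfolding F'_def by linarith
    qed
    moreover have "(LINT \<omega>|Q. F' \<omega>) = 0" using Fi Q.prob_space by (simp add: F'_def e_def)
    ultimately show "(LINT \<omega>|Q. (F ((shift ^^ i) \<omega>) - e) * (F ((shift ^^ j) \<omega>) - e)) = 0" by (simp add: F'_def)
  qed
  then show ?thesis
  proof (rule AE_mp, intro AE_I2 impI)
    fix \<omega> assume "(\<lambda>n. (\<Sum>i<n. F ((shift ^^ i) \<omega>) - e) / real n) \<longlonglongrightarrow> 0"
    then have "(\<lambda>n. (\<Sum>i<n. F ((shift ^^ i) \<omega>) - e) / real n + e) \<longlonglongrightarrow> 0 + e" by (intro tendsto_intros)
    moreover have "\<forall>\<^sub>F n in sequentially. (\<Sum>i<n. F ((shift ^^ i) \<omega>) - e) / real n + e = (\<Sum>i<n. F ((shift ^^ i) \<omega>)) / real n"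
      using eventually_gt_at_top[of 0] by eventually_elim (simp add: sum_subtractf field_simps)
    ultimately show "(\<lambda>n. (\<Sum>i<n. F ((shift ^^ i) \<omega>)) / real n) \<longlonglongrightarrow> (LINT \<omega>|Q. F \<omega>)"
      using Lim_transform_eventually by (fastforce simp: e_def)
  qed
qed

end

section \<open>The local density\<close>

locale fibred = mixing f l p Q for f :: "'y::finite \<Rightarrow> real \<Rightarrow> real" and l p Q +
  fixes h :: "(int \<Rightarrow> 'y) \<Rightarrow> real \<Rightarrow> real"
  assumes h: "equivariant_density Q f h"
begin

abbreviation H :: "(int \<Rightarrow> 'y) \<Rightarrow> nat \<Rightarrow> real \<Rightarrow> real" where "H \<omega> m \<equiv> h ((shift ^^ m) \<omega>)"

lemma h_joint: "(\<lambda>(\<omega>, x). h \<omega> x) \<in> borel_measurable (Q \<Otimes>\<^sub>M leb)"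
  using h unfolding equivariant_density_def by blast

lemma h_measurable: "h \<omega> \<in> borel_measurable leb"
  using measurable_Pair2[OF h_joint, of \<omega>] by simp

lemma h_nonneg: "x \<in> {0..1} \<Longrightarrow> 0 \<le> h \<omega> x"
  using h unfolding equivariant_density_def by blast

text \<open>Collects what holds almost surely along the whole forward orbit of one
  \<open>\<omega>\<close>. The estimates for a fixed good \<open>\<omega>\<close> are deterministic
  from here on.\<close>

definition good :: "real \<Rightarrow> (int \<Rightarrow> 'y) \<Rightarrow> bool" where
  "good C \<omega> \<longleftrightarrow> adm \<omega> \<and> (\<forall>m. aebv C (H \<omega> m) \<and> (LINT x|leb. H \<omega> m x) = 1 \<and>
      tr (fi ((shift ^^ m) \<omega>) 1) (H \<omega> m) (H \<omega> (Suc m)))"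

lemma AE_good: "\<exists>C>0. AE \<omega> in Q. good C \<omega>"
proof -
  obtain C :: real where C: "AE \<omega> in Q. norm_BV (h \<omega>) \<le> ereal C"
    using h unfolding equivariant_density_def by blast
  define D where "D = \<bar>C\<bar> + 1"
  have 1: "AE \<omega> in Q. aebv D (h \<omega>)"
    using C
  proof (rule AE_mp, intro AE_I2 impI)
    fix \<omega> assume a: "norm_BV (h \<omega>) \<le> ereal C"
    have "0 \<le> norm_L1 (h \<omega>)" unfolding norm_L1_def by (intro integral_nonneg_AE) auto
    then have "var (h \<omega>) \<le> norm_BV (h \<omega>)" unfolding norm_BV_def by (simp add: ereal_le_add_self)
    also have "\<dots> < ereal D" using a by (rule le_less_trans) (simp add: D_def)
    finally show "aebv D (h \<omega>)" by (rule aebv_if_var_less)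
  qed
  have 2: "AE \<omega> in Q. (LINT x|leb. h \<omega> x) = 1"
    using h unfolding equivariant_density_def by (auto elim: AE_mp)
  have 3: "AE \<omega> in Q. AE x in leb. transfer_op (fibre_map f \<omega>) (h \<omega>) x = h (shift \<omega>) x"
    using h unfolding equivariant_density_def by blast
  have 4: "AE \<omega> in Q. tr (fi \<omega> 1) (h \<omega>) (h (shift \<omega>))"
    using 1 3
  proof eventually_elim
    case (elim \<omega>)
    have "tr (f (\<omega> 1)) (h \<omega>) (transfer_op (f (\<omega> 1)) (h \<omega>))"
      using l1 by (intro transfer_op_tr[OF pw _ elim(1) h_measurable]) simp
    then have "tr (f (\<omega> 1)) (h \<omega>) (h (shift \<omega>))"
      by (rule tr_cong) (use elim(2) in \<open>auto simp: fibre_map_def h_measurable f_measurable\<close>)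
    then show ?case by (simp add: fibre_map_def)
  qed
  have "AE \<omega> in Q. adm \<omega> \<and> (\<forall>m. (aebv D (H \<omega> m) \<and> (LINT x|leb. H \<omega> m x) = 1 \<and>
      tr (fi ((shift ^^ m) \<omega>) 1) (H \<omega> m) (h (shift ((shift ^^ m) \<omega>)))))"
    using AE_adm AE_shift[where R = "\<lambda>\<omega>. aebv D (h \<omega>) \<and> (LINT x|leb. h \<omega> x) = 1 \<and> tr (fi \<omega> 1) (h \<omega>) (h (shift \<omega>))"] 1 2 4
    by simp
  then have "AE \<omega> in Q. good D \<omega>" unfolding good_def by simp
  then show ?thesis by (intro exI[of _ D]) (simp add: D_def)
qed

lemma good_adm: "good C \<omega> \<Longrightarrow> adm \<omega>" by (simp add: good_def)

lemma good_integrable: "good C \<omega> \<Longrightarrow> integrable leb (H \<omega> m)"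
  using trD(1) unfolding good_def by blast

lemma good_integral: "good C \<omega> \<Longrightarrow> (LINT x|leb. H \<omega> m x) = 1"
  unfolding good_def by blast

lemma good_tr: "good C \<omega> \<Longrightarrow> tr (fi ((shift ^^ m) \<omega>) k) (H \<omega> m) (H \<omega> (m + k))"
proof (induction k)
  case 0
  then show ?case using tr_id[OF good_integrable[OF 0, of m]] by (simp add: id_def)
next
  case (Suc k)
  have "tr (fi ((shift ^^ (m + k)) \<omega>) 1) (H \<omega> (m + k)) (H \<omega> (Suc (m + k)))" using Suc.prems by (simp add: good_def)
  then have "tr (fi ((shift ^^ k) ((shift ^^ m) \<omega>)) 1) (H \<omega> (m + k)) (H \<omega> (Suc (m + k)))" by (simp only: shift_funpow_add)
  from tr_comp[OF Suc.IH[OF Suc.prems] this fi_measurable]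
  have "tr (fi ((shift ^^ m) \<omega>) (k + 1)) (H \<omega> m) (H \<omega> (Suc (m + k)))" unfolding fibre_iter_add .
  then show ?case by (simp del: fibre_iter.simps funpow.simps)
qed

text \<open>Only the class of \<open>H \<omega> m\<close> is known to have bounded variation, so
  products with bumps are estimated on a representative. Its bound \<open>C + 1\<close> is the
  variation plus the unit mass.\<close>

lemma good_version:
  assumes "good C \<omega>"
  obtains h0 where "bvar C h0" "AE x in leb. H \<omega> m x = h0 x" "AE x in leb. 0 \<le> h0 x" "(LINT x|leb. h0 x) = 1"
    "AE x in leb. h0 x \<le> C + 1" "\<And>x. x \<in> {0..1} \<Longrightarrow> \<bar>h0 x\<bar> \<le> C + 1"
proof -
  obtain h0 where h0: "bvar C h0" "AE x in leb. H \<omega> m x = h0 x"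
    using assms unfolding good_def aebv_def by blast
  have pos: "AE x in leb. 0 \<le> h0 x"
    using h0(2)
  proof (rule AE_mp, intro AE_I2 impI)
    fix x assume "x \<in> space leb" "H \<omega> m x = h0 x"
    then show "0 \<le> h0 x" using h_nonneg[of x "(shift ^^ m) \<omega>"] by simp
  qed
  have i: "(LINT x|leb. h0 x) = (LINT x|leb. H \<omega> m x)"
    using h0 bvar_measurable[OF h0(1)] h_measurable by (intro integral_cong_AE) auto
  then have i1: "(LINT x|leb. h0 x) = 1" using good_integral[OF assms] by simp
  have "(LINT x|leb. \<bar>h0 x\<bar>) = (LINT x|leb. h0 x)"
    using pos bvar_measurable[OF h0(1)] by (intro integral_cong_AE) auto
  then have b: "\<bar>h0 x\<bar> \<le> C + 1" if "x \<in> {0..1}" for x using bvar_bound[OF h0(1) that] i1 by simp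
  then have "AE x in leb. h0 x \<le> C + 1" by (intro AE_I2) (force simp: abs_le_iff)
  then show ?thesis using that h0 pos i1 b by blast
qed

lemma good_le: "good C \<omega> \<Longrightarrow> AE x in leb. H \<omega> m x \<le> C + 1"
  by (erule good_version[where m = m]) (auto elim: AE_mp)

text \<open>The cone bound applied to the density at time 0; it will make the local density
  positive. The rate parameters passed to \<open>lower_bound_words\<close> are arbitrary, as only
  the lower bound at some time is wanted.\<close>

lemma good_lower: "\<exists>K c. 0 < c \<and> (\<forall>\<omega>. good C \<omega> \<longrightarrow> (AE x in leb. c \<le> H \<omega> K x))"
proof -
  have pr: "0 < \<bar>C\<bar> + 1" "(0::real) < 1" "(1/2::real) < 1" "(0::real) < 1/2" by auto
  from lower_bound_words[OF pr pr(2)]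
  obtain K c where K: "0 < c" and lb: "\<And>\<omega> \<phi>. adm \<omega> \<Longrightarrow> bvar (\<bar>C\<bar> + 1) \<phi> \<Longrightarrow> (AE x in leb. 0 \<le> \<phi> x) \<Longrightarrow> (LINT x|leb. \<phi> x) = 1 \<Longrightarrow>
        (AE x in leb. c / 2 \<le> transfer_iter f \<omega> K \<phi> x)" by blast
  have "AE x in leb. c / 2 \<le> H \<omega> K x" if g: "good C \<omega>" for \<omega>
  proof -
    obtain h0 where h0: "bvar C h0" "AE x in leb. H \<omega> 0 x = h0 x" "AE x in leb. 0 \<le> h0 x" "(LINT x|leb. h0 x) = 1"
      using good_version[OF g, of 0] by metis
    have "tr (fi \<omega> K) (H \<omega> 0) (H \<omega> K)" using good_tr[OF g, of 0 K] by simp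
    then have "tr (fi \<omega> K) h0 (H \<omega> K)"
      by (rule tr_cong) (use h0 bvar_measurable[OF h0(1)] h_measurable fi_measurable in auto)
    moreover have "tr (fi \<omega> K) h0 (transfer_iter f \<omega> K h0)"
      by (rule transfer_iter_tr[of C]) (use h0 bvar_measurable[OF h0(1)] in \<open>auto simp: aebv_def\<close>)
    ultimately have "AE x in leb. H \<omega> K x = transfer_iter f \<omega> K h0 x" by (rule fi_tr_unique)
    moreover have "AE x in leb. c / 2 \<le> transfer_iter f \<omega> K h0 x"
      by (rule lb[OF good_adm[OF g] _ h0(3,4)]) (use h0(1) in \<open>auto elim: bvar_mono\<close>)
    ultimately show ?thesis by (auto elim: AE_mp)
  qed
  then show ?thesis using K by (intro exI[of _ K] exI[of _ "c / 2"]) auto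
qed

text \<open>The density \<open>\<P>^k 1\<close>, in a version of bounded variation. The choice sees
  \<open>\<omega>\<close> only through the map \<open>fi \<omega> k\<close>, so it depends on the
  first \<open>k\<close> symbols and takes finitely many values.\<close>

definition dn :: "nat \<Rightarrow> (int \<Rightarrow> 'y) \<Rightarrow> real \<Rightarrow> real" where
  "dn k \<omega> = (SOME \<psi>. tr (fi \<omega> k) (\<lambda>_. 1) \<psi> \<and> (\<exists>V. bvar V \<psi>))"

lemma dn: "tr (fi \<omega> k) (\<lambda>_. 1) (dn k \<omega>)" "\<exists>V. bvar V (dn k \<omega>)"
proof -
  have "\<exists>\<psi>. tr (fi \<omega> k) (\<lambda>_. 1) \<psi> \<and> (\<exists>V. bvar V \<psi>)" using tr_exists[OF bvar_const[of 1 1]] by force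
  from someI_ex[OF this] show "tr (fi \<omega> k) (\<lambda>_. 1) (dn k \<omega>)" "\<exists>V. bvar V (dn k \<omega>)" unfolding dn_def by blast+
qed

lemma dn_cong: "(\<And>i. 1 \<le> i \<Longrightarrow> i \<le> int k \<Longrightarrow> \<omega> i = \<omega>' i) \<Longrightarrow> dn k \<omega> = dn k \<omega>'"
  unfolding dn_def using fibre_iter_cong[of k \<omega> \<omega>' f] by simp

lemma finite_dn: "finite (range (dn k))"
proof -
  have "range (dn k) = (\<lambda>T. SOME \<psi>. tr T (\<lambda>_. 1) \<psi> \<and> (\<exists>V. bvar V \<psi>)) ` range (\<lambda>\<omega>. fi \<omega> k)"
    unfolding dn_def by (simp add: image_image)
  then show ?thesis using finite_fibre_iters[of f k] by simp
qed

text \<open>The difference is the transfer over \<open>k\<close> steps of the density at time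
  \<open>m\<close> minus 1. This has mean 0 and variation at most \<open>|C| + 1\<close>, so it
  decays exponentially and uniformly in \<open>m\<close>.\<close>

lemma good_approx:
  "\<exists>D>0. \<exists>\<theta>>0. \<theta> < 1 \<and> (\<forall>\<omega> k m. good C \<omega> \<longrightarrow> (AE x in leb. \<bar>H \<omega> (m + k) x - dn k ((shift ^^ m) \<omega>) x\<bar> \<le> D * \<theta> ^ k))"
proof -
  obtain D \<theta> where D: "0 < D" "0 < \<theta>" "\<theta> < 1" and dec: "\<And>k \<omega> \<phi> V. adm \<omega> \<Longrightarrow> bvar V \<phi> \<Longrightarrow> (LINT x|leb. \<phi> x) = 0 \<Longrightarrow>
      (\<exists>\<psi>. tr (fi \<omega> k) \<phi> \<psi> \<and> bvar (D * \<theta> ^ k * V) \<psi> \<and> (\<forall>x\<in>{0..1}. \<bar>\<psi> x\<bar> \<le> D * \<theta> ^ k * V))"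
    using decay by blast
  have "AE x in leb. \<bar>H \<omega> (m + k) x - dn k ((shift ^^ m) \<omega>) x\<bar> \<le> (D * (\<bar>C\<bar> + 1)) * \<theta> ^ k" if g: "good C \<omega>" for \<omega> k m
  proof -
    let ?w = "(shift ^^ m) \<omega>"
    obtain h0 where h0: "bvar C h0" "AE x in leb. H \<omega> m x = h0 x" "AE x in leb. 0 \<le> h0 x" "(LINT x|leb. h0 x) = 1"
      using good_version[OF g, of m] by metis
    have "tr (fi ?w k) h0 (H \<omega> (m + k))"
      by (rule tr_cong[OF good_tr[OF g]]) (use h0 bvar_measurable[OF h0(1)] h_measurable fi_measurable in auto)
    from tr_lincomb[OF this dn(1) fi_measurable, of 1 "-1"]
    have t: "tr (fi ?w k) (\<lambda>x. h0 x - 1) (\<lambda>x. H \<omega> (m + k) x - dn k ?w x)" by simp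
    have bv: "bvar (\<bar>C\<bar> + 1) (\<lambda>x. h0 x - 1)" by (rule bvar_mono[OF bvar_diff[OF h0(1) bvar_const[of 1 1]]]) auto
    have z: "(LINT x|leb. h0 x - 1) = 0" using bvar_integrable[OF h0(1)] h0(4) leb.prob_space by simp
    obtain \<psi> where \<psi>: "tr (fi ?w k) (\<lambda>x. h0 x - 1) \<psi>" "\<forall>x\<in>{0..1}. \<bar>\<psi> x\<bar> \<le> D * \<theta> ^ k * (\<bar>C\<bar> + 1)"
      using dec[OF adm_shift[OF good_adm[OF g]] bv z] by blast
    have "AE x in leb. H \<omega> (m + k) x - dn k ?w x = \<psi> x" by (rule fi_tr_unique[OF t \<psi>(1)])
    then show ?thesis by (rule AE_mp) (use \<psi>(2) in \<open>auto intro!: AE_I2 simp: mult_ac\<close>)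
  qed
  then show ?thesis using D by (intro exI[of _ "D * (\<bar>C\<bar> + 1)"] conjI exI[of _ \<theta>]) auto
qed

lemma unit_integrable:
  assumes "\<xi> \<in> borel_measurable leb" "\<And>x. x \<in> {0..1} \<Longrightarrow> 0 \<le> \<xi> x \<and> \<xi> x \<le> (1::real)"
  shows "integrable leb \<xi>" "integrable leb u \<Longrightarrow> integrable leb (\<lambda>x. \<xi> x * u x)"
proof -
  have b: "\<bar>\<xi> x\<bar> \<le> 1" if "x \<in> {0..1}" for x using assms(2)[OF that] by simp
  show "integrable leb \<xi>" by (rule leb.integrable_const_bound[where B = 1, OF AE_I2 assms(1)]) (simp add: b)
  show "integrable leb u \<Longrightarrow> integrable leb (\<lambda>x. \<xi> x * u x)" by (rule integrable_bounded_mult[OF _ assms(1) b])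
qed

lemma integral_close:
  fixes u v \<xi> :: "real \<Rightarrow> real"
  assumes "AE x in leb. \<xi> x \<noteq> 0 \<longrightarrow> \<bar>u x - c\<bar> \<le> e" and \<xi>: "\<xi> \<in> borel_measurable leb" "\<And>x. x \<in> {0..1} \<Longrightarrow> 0 \<le> \<xi> x \<and> \<xi> x \<le> 1"
    and u: "integrable leb u"
  shows "\<bar>(LINT x|leb. \<xi> x * u x) - c * (LINT x|leb. \<xi> x)\<bar> \<le> e * (LINT x|leb. \<xi> x)"
proof -
  have i\<xi>: "integrable leb \<xi>" by (rule unit_integrable(1)[OF \<xi>])
  have iu: "integrable leb (\<lambda>x. \<xi> x * u x)" by (rule unit_integrable(2)[OF \<xi> u])
  have "\<bar>(LINT x|leb. \<xi> x * u x) - c * (LINT x|leb. \<xi> x)\<bar> = \<bar>LINT x|leb. \<xi> x * u x - c * \<xi> x\<bar>"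
    using i\<xi> iu by simp
  also have "\<dots> \<le> (LINT x|leb. \<bar>\<xi> x * u x - c * \<xi> x\<bar>)" by (rule integral_abs_bound)
  also have "\<dots> \<le> (LINT x|leb. e * \<xi> x)"
  proof (rule integral_mono_AE)
    show "AE x in leb. \<bar>\<xi> x * u x - c * \<xi> x\<bar> \<le> e * \<xi> x"
      using assms(1)
    proof (rule AE_mp, intro AE_I2 impI)
      fix x assume x: "x \<in> space leb" "\<xi> x \<noteq> 0 \<longrightarrow> \<bar>u x - c\<bar> \<le> e"
      have "\<xi> x * u x - c * \<xi> x = \<xi> x * (u x - c)" by (simp add: algebra_simps)
      then have "\<bar>\<xi> x * u x - c * \<xi> x\<bar> = \<xi> x * \<bar>u x - c\<bar>" using \<xi>(2)[of x] x(1) by (simp add: abs_mult)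
      also have "\<dots> \<le> \<xi> x * e" using \<xi>(2)[of x] x by (cases "\<xi> x = 0") (auto intro!: mult_left_mono)
      finally show "\<bar>\<xi> x * u x - c * \<xi> x\<bar> \<le> e * \<xi> x" by (simp add: mult.commute)
    qed
  qed (use i\<xi> iu in auto)
  also have "\<dots> = e * (LINT x|leb. \<xi> x)" by simp
  finally show ?thesis .
qed

text \<open>The common shape of the exceedance indicators and of the Laplace factors. The support
  condition uses the open ball, which matches a strict exceedance.\<close>

definition bump :: "real \<Rightarrow> real \<Rightarrow> (real \<Rightarrow> real) \<Rightarrow> bool" where
  "bump z \<delta> \<xi> \<longleftrightarrow> \<xi> \<in> borel_measurable leb \<and> (\<forall>x\<in>{0..1}. 0 \<le> \<xi> x \<and> \<xi> x \<le> 1) \<and> (\<forall>x\<in>{0..1}. \<delta> \<le> dist x z \<longrightarrow> \<xi> x = 0)"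

lemma bump_mono: "bump z \<delta> \<xi> \<Longrightarrow> \<delta> \<le> \<delta>' \<Longrightarrow> bump z \<delta>' \<xi>"
  unfolding bump_def by force

lemma fibre_integral_measurable:
  assumes "\<xi> \<in> borel_measurable leb" shows "(\<lambda>\<omega>. LINT x|leb. \<xi> x * h \<omega> x) \<in> borel_measurable Q"
proof -
  have "(\<lambda>(\<omega>, x). \<xi> x * h \<omega> x) \<in> borel_measurable (Q \<Otimes>\<^sub>M leb)"
    using h_joint assms by (simp add: split_beta') measurable
  then show ?thesis by (rule leb.borel_measurable_lebesgue_integral)
qed

lemma fibre_integral_bound:
  assumes "good C \<omega>" "bump z \<delta> \<xi>"
  shows "0 \<le> (LINT x|leb. \<xi> x * H \<omega> m x)" "(LINT x|leb. \<xi> x * H \<omega> m x) \<le> (C + 1) * (LINT x|leb. \<xi> x)"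
proof -
  have \<xi>: "\<xi> \<in> borel_measurable leb" "\<And>x. x \<in> {0..1} \<Longrightarrow> 0 \<le> \<xi> x \<and> \<xi> x \<le> 1" using assms(2) by (auto simp: bump_def)
  have i\<xi>: "integrable leb \<xi>" by (rule unit_integrable(1)[OF \<xi>])
  have iu: "integrable leb (\<lambda>x. \<xi> x * H \<omega> m x)"
    by (rule unit_integrable(2)[OF \<xi> good_integrable[OF assms(1)]])
  show "0 \<le> (LINT x|leb. \<xi> x * H \<omega> m x)"
  proof (intro integral_nonneg_AE AE_I2)
    fix x assume "x \<in> space leb"
    then show "0 \<le> \<xi> x * H \<omega> m x" using \<xi>(2)[of x] h_nonneg[of x "(shift ^^ m) \<omega>"] by simp
  qed
  have "(LINT x|leb. \<xi> x * H \<omega> m x) \<le> (LINT x|leb. (C + 1) * \<xi> x)"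
  proof (rule integral_mono_AE)
    show "AE x in leb. \<xi> x * H \<omega> m x \<le> (C + 1) * \<xi> x"
      using good_le[OF assms(1), of m]
    proof (rule AE_mp, intro AE_I2 impI)
      fix x assume "x \<in> space leb" "H \<omega> m x \<le> C + 1"
      then show "\<xi> x * H \<omega> m x \<le> (C + 1) * \<xi> x" using \<xi>(2)[of x] by (subst mult.commute) (intro mult_right_mono, auto)
    qed
  qed (use i\<xi> iu in auto)
  then show "(LINT x|leb. \<xi> x * H \<omega> m x) \<le> (C + 1) * (LINT x|leb. \<xi> x)" by simp
qed

definition regular :: "real \<Rightarrow> bool" where
  "regular z \<longleftrightarrow> z \<in> {0<..<1} \<and> (\<forall>k \<omega>. isCont (dn k \<omega>) z)"

text \<open>For each \<open>k\<close> only finitely many functions occur as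
  \<open>dn k \<omega>\<close>, each with countably many discontinuities, so the exceptional centres
  are countable.\<close>

lemma AE_regular: "AE z in leb. regular z"
proof -
  have c: "countable (\<Union>k. \<Union>\<psi>\<in>range (dn k). {x\<in>{0<..<1}. \<not> isCont \<psi> x})"
  proof (rule countable_UN[OF countableI_type], rule countable_UN[OF countable_finite[OF finite_dn]])
    fix k and \<psi> assume "\<psi> \<in> range (dn k)"
    then obtain \<omega> V where "\<psi> = dn k \<omega>" "bvar V (dn k \<omega>)" using dn(2) by blast
    then show "countable {x\<in>{0<..<1}. \<not> isCont \<psi> x}" using bvar_isCont by blast
  qed
  have "AE z in leb. z \<notin> (\<Union>k. \<Union>\<psi>\<in>range (dn k). {x\<in>{0<..<1}. \<not> isCont \<psi> x}) \<union> {0, 1}"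
    using c by (intro AE_leb_countable) auto
  then show ?thesis by (rule AE_mp) (auto intro!: AE_I2 simp: regular_def)
qed

text \<open>A minimum over the finite range of \<open>dn k\<close> makes \<open>\<delta>\<close>
  independent of \<open>\<omega>\<close>, hence of time along an orbit.\<close>

lemma uniform_continuity_dn:
  assumes "regular z" "0 < e"
  obtains \<delta> where "0 < \<delta>" "\<And>\<omega> x. dist x z < \<delta> \<Longrightarrow> \<bar>dn k \<omega> x - dn k \<omega> z\<bar> \<le> e"
proof -
  have "\<exists>d>0. \<forall>x. dist x z < d \<longrightarrow> dist (\<psi> x) (\<psi> z) < e" if "\<psi> \<in> range (dn k)" for \<psi>
  proof -
    have "isCont \<psi> z" using that assms(1) by (auto simp: regular_def)
    then show ?thesis using assms(2) unfolding continuous_at_eps_delta by blast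
  qed
  then obtain d where d: "\<And>\<psi>. \<psi> \<in> range (dn k) \<Longrightarrow> 0 < d \<psi> \<and> (\<forall>x. dist x z < d \<psi> \<longrightarrow> dist (\<psi> x) (\<psi> z) < e)" by metis
  define \<delta> where "\<delta> = Min (d ` range (dn k))"
  show ?thesis
  proof (rule that[of \<delta>])
    show "0 < \<delta>" unfolding \<delta>_def using d finite_dn by (subst Min_gr_iff) auto
    fix \<omega> x assume "dist x z < \<delta>"
    then have "dist x z < d (dn k \<omega>)" unfolding \<delta>_def using finite_dn by (subst (asm) Min_gr_iff) auto
    then show "\<bar>dn k \<omega> x - dn k \<omega> z\<bar> \<le> e" using d[of "dn k \<omega>"] by (auto simp: dist_real_def less_imp_le)
  qed
qed

section \<open>The density at the centre, in the mean and along orbits\<close>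

text \<open>\<open>\<rho>\<close> is the density of the mean measure at \<open>z\<close> in a strong
  sense: the error is relative to the integral of the bump and uniform over all bumps near
  \<open>z\<close>.\<close>

definition mean_density :: "real \<Rightarrow> real \<Rightarrow> bool" where
  "mean_density \<rho> z \<longleftrightarrow> (\<forall>\<epsilon>>0. \<exists>\<delta>>0. \<forall>\<xi>. bump z \<delta> \<xi> \<longrightarrow>
        \<bar>(LINT \<omega>|Q. LINT x|leb. \<xi> x * h \<omega> x) - \<rho> * (LINT x|leb. \<xi> x)\<bar> \<le> \<epsilon> * (LINT x|leb. \<xi> x))"

text \<open>The same along one orbit. Because \<open>\<delta>\<close> and \<open>n0\<close> are
  chosen before the bump, the bump may later shrink together with \<open>n\<close>.\<close>

definition orbit_density :: "real \<Rightarrow> real \<Rightarrow> (int \<Rightarrow> 'y) \<Rightarrow> bool" where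
  "orbit_density \<rho> z \<omega> \<longleftrightarrow> (\<forall>\<epsilon>>0. \<exists>\<delta>>0. \<exists>n0. \<forall>n\<ge>n0. \<forall>\<xi>. bump z \<delta> \<xi> \<longrightarrow>
        \<bar>(\<Sum>m<n. LINT x|leb. \<xi> x * H \<omega> m x) - real n * \<rho> * (LINT x|leb. \<xi> x)\<bar> \<le> \<epsilon> * real n * (LINT x|leb. \<xi> x))"

text \<open>\<open>\<rho>\<close> is the limit of the expectations \<open>E k\<close> of the
  approximating densities at \<open>z\<close>. For each \<open>k\<close> these are cylinder
  functions of \<open>\<omega>\<close> and obey the law of large numbers; the approximation error
  \<open>D * \<theta> ^ k\<close> is removed by choosing \<open>k\<close> large.\<close>

theorem local_density:
  assumes C: "0 < C" "AE \<omega> in Q. good C \<omega>" and z: "regular z"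
  shows "\<exists>\<rho>>0. mean_density \<rho> z \<and>
     (AE \<omega> in Q. orbit_density \<rho> z \<omega>)"
proof -
  obtain D \<theta> where D: "0 < D" "0 < \<theta>" "\<theta> < 1" and apx: "\<And>\<omega> k m. good C \<omega> \<Longrightarrow>
      AE x in leb. \<bar>H \<omega> (m + k) x - dn k ((shift ^^ m) \<omega>) x\<bar> \<le> D * \<theta> ^ k"
    using good_approx[of C] by blast
  have \<theta>0: "(\<lambda>k. D * \<theta> ^ k) \<longlonglongrightarrow> 0" using D by (intro tendsto_mult_right_zero LIMSEQ_realpow_zero) auto
  define F where "F k \<omega> = dn k \<omega> z" for k \<omega>
  have Fc: "F k \<omega> = F k \<omega>'" if "\<And>i. 1 \<le> i \<Longrightarrow> i \<le> int k \<Longrightarrow> \<omega> i = \<omega>' i" for k \<omega> \<omega>'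
    using dn_cong[OF that] by (simp add: F_def)
  have Fm: "F k \<in> borel_measurable Q" for k by (rule cylinder_function_measurable[OF Fc]) auto
  have "\<exists>b. \<forall>\<omega>. \<bar>F k \<omega>\<bar> \<le> b" for k
  proof -
    have "finite (range (F k))"
    proof -
      have "range (F k) = (\<lambda>\<psi>. \<psi> z) ` range (dn k)" by (auto simp: F_def)
      then show ?thesis using finite_dn by simp
    qed
    then show ?thesis
      by (intro exI[of _ "Max ((\<lambda>y. \<bar>y\<bar>) ` range (F k))"]) (auto intro!: Max_ge)
  qed
  then obtain b where Fb: "\<And>k \<omega>. \<bar>F k \<omega>\<bar> \<le> b k" by metis
  define E where "E k = (LINT \<omega>|Q. F k \<omega>)" for k
  have Fi: "integrable Q (F k)" for k by (rule Q.integrable_const_bound[where B = "b k"]) (use Fb Fm in auto)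
  \<comment> \<open>Close to \<open>z\<close> the density at time \<open>m + k\<close> is nearly the
    constant \<open>F k ((shift ^^ m) \<omega>)\<close>: loss of memory costs
    \<open>D * \<theta> ^ k\<close>, and continuity of \<open>dn k\<close> at \<open>z\<close> costs
    \<open>e\<close>.\<close>
  have star: "\<exists>\<delta>>0. \<forall>\<omega> m \<xi>. good C \<omega> \<longrightarrow> bump z \<delta> \<xi> \<longrightarrow>
      \<bar>(LINT x|leb. \<xi> x * H \<omega> (m + k) x) - F k ((shift ^^ m) \<omega>) * (LINT x|leb. \<xi> x)\<bar> \<le> (D * \<theta> ^ k + e) * (LINT x|leb. \<xi> x)"
    if e: "0 < e" for k e
  proof -
    obtain \<delta> where \<delta>: "0 < \<delta>" "\<And>\<omega> x. dist x z < \<delta> \<Longrightarrow> \<bar>dn k \<omega> x - dn k \<omega> z\<bar> \<le> e"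
      using uniform_continuity_dn[OF z e, of k] by metis
    show ?thesis
    proof (intro exI[of _ \<delta>] conjI allI impI \<delta>(1))
      fix \<omega> m \<xi> assume g: "good C \<omega>" and \<xi>: "bump z \<delta> \<xi>"
      show "\<bar>(LINT x|leb. \<xi> x * H \<omega> (m + k) x) - F k ((shift ^^ m) \<omega>) * (LINT x|leb. \<xi> x)\<bar> \<le> (D * \<theta> ^ k + e) * (LINT x|leb. \<xi> x)"
      proof (rule integral_close)
        show "AE x in leb. \<xi> x \<noteq> 0 \<longrightarrow> \<bar>H \<omega> (m + k) x - F k ((shift ^^ m) \<omega>)\<bar> \<le> D * \<theta> ^ k + e"
          using apx[OF g, of m k]
        proof (rule AE_mp, intro AE_I2 impI)
          fix x assume x: "x \<in> space leb" "\<bar>H \<omega> (m + k) x - dn k ((shift ^^ m) \<omega>) x\<bar> \<le> D * \<theta> ^ k" "\<xi> x \<noteq> 0"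
          then have "dist x z < \<delta>" using \<xi> unfolding bump_def by force
          from \<delta>(2)[OF this, of "(shift ^^ m) \<omega>"] x(2)
          show "\<bar>H \<omega> (m + k) x - F k ((shift ^^ m) \<omega>)\<bar> \<le> D * \<theta> ^ k + e" unfolding F_def by linarith
        qed
      qed (use \<xi> good_integrable[OF g] in \<open>auto simp: bump_def\<close>)
    qed
  qed
  \<comment> \<open>Stationarity moves the average over \<open>\<omega>\<close> to time
    \<open>k\<close>, where \<open>star\<close> applies with \<open>m = 0\<close>.\<close>
  have mean: "\<exists>\<delta>>0. \<forall>\<xi>. bump z \<delta> \<xi> \<longrightarrow>
      \<bar>(LINT \<omega>|Q. LINT x|leb. \<xi> x * h \<omega> x) - E k * (LINT x|leb. \<xi> x)\<bar> \<le> (D * \<theta> ^ k + e) * (LINT x|leb. \<xi> x)"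
    if e: "0 < e" for k e
  proof -
    obtain \<delta> where \<delta>: "0 < \<delta>" "\<And>\<omega> m \<xi>. good C \<omega> \<Longrightarrow> bump z \<delta> \<xi> \<Longrightarrow>
      \<bar>(LINT x|leb. \<xi> x * H \<omega> (m + k) x) - F k ((shift ^^ m) \<omega>) * (LINT x|leb. \<xi> x)\<bar> \<le> (D * \<theta> ^ k + e) * (LINT x|leb. \<xi> x)"
      using star[OF e, of k] by blast
    show ?thesis
    proof (intro exI[of _ \<delta>] conjI allI impI \<delta>(1))
      fix \<xi> assume \<xi>: "bump z \<delta> \<xi>"
      have m1: "(\<lambda>\<omega>. LINT x|leb. \<xi> x * h \<omega> x) \<in> borel_measurable Q"
        using \<xi> by (intro fibre_integral_measurable) (auto simp: bump_def)
      have m2: "(\<lambda>\<omega>. LINT x|leb. \<xi> x * H \<omega> k x) \<in> borel_measurable Q"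
        using measurable_comp[OF shift_funpow_measurable m1, of k] by (simp add: o_def)
      have i2: "integrable Q (\<lambda>\<omega>. LINT x|leb. \<xi> x * H \<omega> k x)"
        by (rule Q.integrable_const_bound[where B = "(C + 1) * (LINT x|leb. \<xi> x)", OF AE_mp[OF C(2)] m2])
           (auto intro!: AE_I2 fibre_integral_bound[OF _ \<xi>] simp: abs_of_nonneg[OF fibre_integral_bound(1)[OF _ \<xi>]])
      have "(LINT \<omega>|Q. LINT x|leb. \<xi> x * h \<omega> x) = (LINT \<omega>|Q. LINT x|leb. \<xi> x * H \<omega> k x)"
        by (rule integral_shift[OF m1, symmetric])
      then have "\<bar>(LINT \<omega>|Q. LINT x|leb. \<xi> x * h \<omega> x) - E k * (LINT x|leb. \<xi> x)\<bar>
        = \<bar>LINT \<omega>|Q. (LINT x|leb. \<xi> x * H \<omega> k x) - F k \<omega> * (LINT x|leb. \<xi> x)\<bar>"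
        using i2 Fi by (simp add: E_def)
      also have "\<dots> \<le> (LINT \<omega>|Q. \<bar>(LINT x|leb. \<xi> x * H \<omega> k x) - F k \<omega> * (LINT x|leb. \<xi> x)\<bar>)" by (rule integral_abs_bound)
      also have "\<dots> \<le> (LINT \<omega>|Q. (D * \<theta> ^ k + e) * (LINT x|leb. \<xi> x))"
      proof (rule integral_mono_AE)
        show "AE \<omega> in Q. \<bar>(LINT x|leb. \<xi> x * H \<omega> k x) - F k \<omega> * (LINT x|leb. \<xi> x)\<bar> \<le> (D * \<theta> ^ k + e) * (LINT x|leb. \<xi> x)"
          using C(2) by (rule AE_mp) (use \<delta>(2)[OF _ \<xi>, of _ 0] in \<open>auto intro!: AE_I2\<close>)
      qed (use i2 Fi in auto)
      also have "\<dots> = (D * \<theta> ^ k + e) * (LINT x|leb. \<xi> x)" using Q.prob_space by simp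
      finally show "\<bar>(LINT \<omega>|Q. LINT x|leb. \<xi> x * h \<omega> x) - E k * (LINT x|leb. \<xi> x)\<bar> \<le> (D * \<theta> ^ k + e) * (LINT x|leb. \<xi> x)" .
    qed
  qed
  have bump_ex: "\<exists>\<xi>. bump z \<delta> \<xi> \<and> 0 < (LINT x|leb. \<xi> x)" if \<delta>: "0 < \<delta>" for \<delta>
  proof -
    define r where "r = min \<delta> (min z (1 - z))"
    have z01: "0 < z" "z < 1" using z by (auto simp: regular_def)
    have r: "0 < r" "r \<le> \<delta>" "r \<le> z" "r \<le> 1 - z" using \<delta> z01 by (auto simp: r_def)
    let ?I = "{z - r<..<z + r}"
    have I: "?I \<in> sets leb" "?I \<inter> space leb = ?I" using r by (auto intro!: in_sets_leb)
    have "bump z \<delta> (indicator ?I)"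
      using r I unfolding bump_def by (auto simp: indicator_def dist_real_def)
    moreover have "measure leb ?I = 2 * r"
    proof -
      have "emeasure leb ?I = ennreal (2 * r)" using r I by (simp add: emeasure_leb)
      then show ?thesis using r by (simp add: measure_def)
    qed
    ultimately show ?thesis using r I by (intro exI[of _ "indicator ?I"]) simp
  qed
  \<comment> \<open>\<open>E k\<close> and \<open>E j\<close> both approximate the same integral
    against one bump of positive mass, which is then divided out.\<close>
  have cau: "\<bar>E k - E j\<bar> \<le> D * \<theta> ^ k + D * \<theta> ^ j" for k j
  proof (rule field_le_epsilon)
    fix e :: real assume e: "0 < e"
    obtain d1 where d1: "0 < d1" "\<And>\<xi>. bump z d1 \<xi> \<Longrightarrow>
      \<bar>(LINT \<omega>|Q. LINT x|leb. \<xi> x * h \<omega> x) - E k * (LINT x|leb. \<xi> x)\<bar> \<le> (D * \<theta> ^ k + e / 2) * (LINT x|leb. \<xi> x)"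
      using mean[of "e / 2" k] e by auto
    obtain d2 where d2: "0 < d2" "\<And>\<xi>. bump z d2 \<xi> \<Longrightarrow>
      \<bar>(LINT \<omega>|Q. LINT x|leb. \<xi> x * h \<omega> x) - E j * (LINT x|leb. \<xi> x)\<bar> \<le> (D * \<theta> ^ j + e / 2) * (LINT x|leb. \<xi> x)"
      using mean[of "e / 2" j] e by auto
    obtain \<xi> where \<xi>: "bump z (min d1 d2) \<xi>" "0 < (LINT x|leb. \<xi> x)" using bump_ex[of "min d1 d2"] d1 d2 by auto
    have "\<bar>E k - E j\<bar> * (LINT x|leb. \<xi> x) = \<bar>E k * (LINT x|leb. \<xi> x) - E j * (LINT x|leb. \<xi> x)\<bar>"
      using \<xi>(2) by (simp add: left_diff_distrib[symmetric] abs_mult)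
    also have "\<dots> \<le> (D * \<theta> ^ k + e / 2) * (LINT x|leb. \<xi> x) + (D * \<theta> ^ j + e / 2) * (LINT x|leb. \<xi> x)"
      using d1(2)[OF bump_mono[OF \<xi>(1)]] d2(2)[OF bump_mono[OF \<xi>(1)]] by auto
    also have "\<dots> = (D * \<theta> ^ k + D * \<theta> ^ j + e) * (LINT x|leb. \<xi> x)" by (simp add: algebra_simps)
    finally show "\<bar>E k - E j\<bar> \<le> D * \<theta> ^ k + D * \<theta> ^ j + e" using \<xi>(2) by (simp add: mult_le_cancel_right)
  qed
  have "Cauchy E"
  proof (rule metric_CauchyI)
    fix e :: real assume "0 < e"
    then obtain N where N: "\<And>k. N \<le> k \<Longrightarrow> D * \<theta> ^ k < e / 2"
      using order_tendstoD(2)[OF \<theta>0, of "e/2"] by (auto simp: eventually_sequentially)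
    show "\<exists>M. \<forall>m\<ge>M. \<forall>n\<ge>M. dist (E m) (E n) < e"
    proof (intro exI[of _ N] allI impI)
      fix m n assume "N \<le> m" "N \<le> n"
      then show "dist (E m) (E n) < e" using cau[of m n] N[of m] N[of n] by (simp add: dist_real_def)
    qed
  qed
  then obtain \<rho> where \<rho>: "E \<longlonglongrightarrow> \<rho>" by (auto simp: Cauchy_convergent_iff convergent_def)
  have \<rho>E: "\<bar>\<rho> - E k\<bar> \<le> D * \<theta> ^ k" for k
  proof (rule LIMSEQ_le)
    show "(\<lambda>j. \<bar>E j - E k\<bar>) \<longlonglongrightarrow> \<bar>\<rho> - E k\<bar>" by (intro tendsto_intros \<rho>)
    show "(\<lambda>j. D * \<theta> ^ j + D * \<theta> ^ k) \<longlonglongrightarrow> D * \<theta> ^ k" using tendsto_add[OF \<theta>0 tendsto_const] by simp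
    show "\<exists>N. \<forall>n\<ge>N. \<bar>E n - E k\<bar> \<le> D * \<theta> ^ n + D * \<theta> ^ k" using cau by blast
  qed
  have part1: "\<exists>\<delta>>0. \<forall>\<xi>. bump z \<delta> \<xi> \<longrightarrow>
        \<bar>(LINT \<omega>|Q. LINT x|leb. \<xi> x * h \<omega> x) - \<rho> * (LINT x|leb. \<xi> x)\<bar> \<le> \<epsilon> * (LINT x|leb. \<xi> x)" if \<epsilon>: "0 < \<epsilon>" for \<epsilon>
  proof -
    obtain k where k: "D * \<theta> ^ k < \<epsilon> / 4" using order_tendstoD(2)[OF \<theta>0, of "\<epsilon>/4"] \<epsilon> by (auto simp: eventually_sequentially)
    obtain \<delta> where \<delta>: "0 < \<delta>" "\<And>\<xi>. bump z \<delta> \<xi> \<Longrightarrow>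
      \<bar>(LINT \<omega>|Q. LINT x|leb. \<xi> x * h \<omega> x) - E k * (LINT x|leb. \<xi> x)\<bar> \<le> (D * \<theta> ^ k + \<epsilon> / 4) * (LINT x|leb. \<xi> x)"
      using mean[of "\<epsilon> / 4" k] \<epsilon> by auto
    show ?thesis
    proof (intro exI[of _ \<delta>] conjI allI impI \<delta>(1))
      fix \<xi> assume \<xi>: "bump z \<delta> \<xi>"
      have n: "0 \<le> (LINT x|leb. \<xi> x)" using \<xi> by (intro integral_nonneg_AE AE_I2) (auto simp: bump_def)
      have "\<bar>E k * (LINT x|leb. \<xi> x) - \<rho> * (LINT x|leb. \<xi> x)\<bar> = \<bar>\<rho> - E k\<bar> * (LINT x|leb. \<xi> x)"
        using n by (simp add: left_diff_distrib[symmetric] abs_mult abs_minus_commute)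
      also have "\<dots> \<le> (D * \<theta> ^ k) * (LINT x|leb. \<xi> x)" by (intro mult_right_mono \<rho>E n)
      finally have "\<bar>(LINT \<omega>|Q. LINT x|leb. \<xi> x * h \<omega> x) - \<rho> * (LINT x|leb. \<xi> x)\<bar> \<le> (D * \<theta> ^ k + \<epsilon> / 4) * (LINT x|leb. \<xi> x) + (D * \<theta> ^ k) * (LINT x|leb. \<xi> x)"
        using \<delta>(2)[OF \<xi>] by linarith
      also have "\<dots> = (D * \<theta> ^ k + \<epsilon> / 4 + D * \<theta> ^ k) * (LINT x|leb. \<xi> x)" by (simp add: algebra_simps)
      also have "\<dots> \<le> \<epsilon> * (LINT x|leb. \<xi> x)"
      proof (rule mult_right_mono[OF _ n])
        show "D * \<theta> ^ k + \<epsilon> / 4 + D * \<theta> ^ k \<le> \<epsilon>" using k \<epsilon> by linarith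
      qed
      finally show "\<bar>(LINT \<omega>|Q. LINT x|leb. \<xi> x * h \<omega> x) - \<rho> * (LINT x|leb. \<xi> x)\<bar> \<le> \<epsilon> * (LINT x|leb. \<xi> x)" .
    qed
  qed
  \<comment> \<open>By stationarity the mean integral can be read at the time \<open>K\<close> of
    \<open>good_lower\<close>, where the density is at least \<open>c\<close>; comparing with
    \<open>\<rho>\<close> up to an error \<open>c / 2\<close> leaves a positive amount.\<close>
  have pos: "0 < \<rho>"
  proof -
    obtain K c where c: "0 < c" "\<And>\<omega>. good C \<omega> \<Longrightarrow> (AE x in leb. c \<le> H \<omega> K x)" using good_lower[of C] by blast
    obtain \<delta> where \<delta>: "0 < \<delta>" "\<And>\<xi>. bump z \<delta> \<xi> \<Longrightarrow>
      \<bar>(LINT \<omega>|Q. LINT x|leb. \<xi> x * h \<omega> x) - \<rho> * (LINT x|leb. \<xi> x)\<bar> \<le> (c / 2) * (LINT x|leb. \<xi> x)" using part1[of "c / 2"] c by auto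
    obtain \<xi> where \<xi>: "bump z \<delta> \<xi>" "0 < (LINT x|leb. \<xi> x)" using bump_ex[OF \<delta>(1)] by blast
    have \<xi>': "\<xi> \<in> borel_measurable leb" "\<And>x. x \<in> {0..1} \<Longrightarrow> 0 \<le> \<xi> x \<and> \<xi> x \<le> 1" using \<xi>(1) by (auto simp: bump_def)
    have i\<xi>: "integrable leb \<xi>" by (rule unit_integrable(1)[OF \<xi>'])
    have m1: "(\<lambda>\<omega>. LINT x|leb. \<xi> x * h \<omega> x) \<in> borel_measurable Q" by (intro fibre_integral_measurable \<xi>')
    have m2: "(\<lambda>\<omega>. LINT x|leb. \<xi> x * H \<omega> K x) \<in> borel_measurable Q"
      using measurable_comp[OF shift_funpow_measurable m1, of K] by (simp add: o_def)
    have i2: "integrable Q (\<lambda>\<omega>. LINT x|leb. \<xi> x * H \<omega> K x)"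
      by (rule Q.integrable_const_bound[where B = "(C + 1) * (LINT x|leb. \<xi> x)", OF AE_mp[OF C(2)] m2])
         (auto intro!: AE_I2 fibre_integral_bound[OF _ \<xi>(1)] simp: abs_of_nonneg[OF fibre_integral_bound(1)[OF _ \<xi>(1)]])
    have "c * (LINT x|leb. \<xi> x) = (LINT \<omega>|Q. c * (LINT x|leb. \<xi> x))" using Q.prob_space by simp
    also have "\<dots> \<le> (LINT \<omega>|Q. LINT x|leb. \<xi> x * H \<omega> K x)"
    proof (rule integral_mono_AE)
      show "AE \<omega> in Q. c * (LINT x|leb. \<xi> x) \<le> (LINT x|leb. \<xi> x * H \<omega> K x)"
        using C(2)
      proof (rule AE_mp, intro AE_I2 impI)
        fix \<omega> assume g: "good C \<omega>"
        have "(LINT x|leb. c * \<xi> x) \<le> (LINT x|leb. \<xi> x * H \<omega> K x)"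
        proof (rule integral_mono_AE)
          show "AE x in leb. c * \<xi> x \<le> \<xi> x * H \<omega> K x"
            using c(2)[OF g]
          proof (rule AE_mp, intro AE_I2 impI)
            fix x assume "x \<in> space leb" "c \<le> H \<omega> K x"
            then show "c * \<xi> x \<le> \<xi> x * H \<omega> K x" using \<xi>'(2)[of x] by (subst mult.commute) (intro mult_left_mono, auto)
          qed
          show "integrable leb (\<lambda>x. \<xi> x * H \<omega> K x)"
            by (rule unit_integrable(2)[OF \<xi>' good_integrable[OF g]])
        qed (use i\<xi> in auto)
        then show "c * (LINT x|leb. \<xi> x) \<le> (LINT x|leb. \<xi> x * H \<omega> K x)" by simp
      qed
    qed (use i2 in auto)
    also have "\<dots> = (LINT \<omega>|Q. LINT x|leb. \<xi> x * h \<omega> x)" by (rule integral_shift[OF m1])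
    finally have "c * (LINT x|leb. \<xi> x) \<le> (c / 2) * (LINT x|leb. \<xi> x) + \<rho> * (LINT x|leb. \<xi> x)" using \<delta>(2)[OF \<xi>(1)] by linarith
    then have "0 < \<rho> * (LINT x|leb. \<xi> x)" using mult_pos_pos[OF c(1) \<xi>(2)] by linarith
    then show ?thesis using \<xi>(2) by (simp add: zero_less_mult_iff)
  qed
  have "AE \<omega> in Q. \<forall>k. (\<lambda>n. (\<Sum>i<n. F k ((shift ^^ i) \<omega>)) / real n) \<longlonglongrightarrow> E k"
    unfolding E_def by (subst AE_all_countable, intro allI cylinder_slln[OF Fc Fb])
  \<comment> \<open>The order of choices is \<open>k\<close> from \<open>\<epsilon>\<close>, then
    \<open>\<delta>\<close> from \<open>k\<close>, then \<open>n0\<close> from the law of large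
    numbers for this \<open>k\<close>. The first \<open>k\<close> times, which \<open>star\<close>
    does not reach, and the change from \<open>N\<close> to \<open>n = N + k\<close> are absorbed in
    \<open>R\<close>, small against \<open>n\<close>.\<close>
  with C(2) have part2: "AE \<omega> in Q. \<forall>\<epsilon>>0. \<exists>\<delta>>0. \<exists>n0. \<forall>n\<ge>n0. \<forall>\<xi>. bump z \<delta> \<xi> \<longrightarrow>
        \<bar>(\<Sum>m<n. LINT x|leb. \<xi> x * H \<omega> m x) - real n * \<rho> * (LINT x|leb. \<xi> x)\<bar> \<le> \<epsilon> * real n * (LINT x|leb. \<xi> x)"
  proof (eventually_elim, intro allI impI)
    fix \<omega> and \<epsilon> :: real assume g: "good C \<omega>" and lln: "\<forall>k. (\<lambda>n. (\<Sum>i<n. F k ((shift ^^ i) \<omega>)) / real n) \<longlonglongrightarrow> E k" and \<epsilon>: "0 < \<epsilon>"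
    obtain k where k: "D * \<theta> ^ k < \<epsilon> / 8" using order_tendstoD(2)[OF \<theta>0, of "\<epsilon>/8"] \<epsilon> by (auto simp: eventually_sequentially)
    obtain \<delta> where \<delta>: "0 < \<delta>" "\<And>\<omega> m \<xi>. good C \<omega> \<Longrightarrow> bump z \<delta> \<xi> \<Longrightarrow>
      \<bar>(LINT x|leb. \<xi> x * H \<omega> (m + k) x) - F k ((shift ^^ m) \<omega>) * (LINT x|leb. \<xi> x)\<bar> \<le> (D * \<theta> ^ k + \<epsilon> / 8) * (LINT x|leb. \<xi> x)"
      using star[of "\<epsilon> / 8" k] \<epsilon> by auto
    have "\<forall>\<^sub>F n in sequentially. dist ((\<Sum>i<n. F k ((shift ^^ i) \<omega>)) / real n) (E k) < \<epsilon> / 8"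
      using lln \<epsilon> by (intro tendstoD) auto
    then obtain n1 where n1: "\<And>n. n1 \<le> n \<Longrightarrow> \<bar>(\<Sum>i<n. F k ((shift ^^ i) \<omega>)) / real n - E k\<bar> < \<epsilon> / 8"
      by (auto simp: eventually_sequentially dist_real_def)
    define R where "R = real k * (C + 1 + \<bar>\<rho>\<bar>)"
    obtain n2 :: nat where n2: "R / (\<epsilon> / 8) \<le> real n2" using real_arch_simple by blast
    show "\<exists>\<delta>>0. \<exists>n0. \<forall>n\<ge>n0. \<forall>\<xi>. bump z \<delta> \<xi> \<longrightarrow>
        \<bar>(\<Sum>m<n. LINT x|leb. \<xi> x * H \<omega> m x) - real n * \<rho> * (LINT x|leb. \<xi> x)\<bar> \<le> \<epsilon> * real n * (LINT x|leb. \<xi> x)"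
    proof (intro exI[of _ \<delta>] conjI exI[of _ "max (n1 + k + 1) n2"] allI impI \<delta>(1))
      fix n \<xi> assume n: "max (n1 + k + 1) n2 \<le> n" and \<xi>: "bump z \<delta> \<xi>"
      define L where "L = (LINT x|leb. \<xi> x)"
      have L0: "0 \<le> L" unfolding L_def using \<xi> by (intro integral_nonneg_AE AE_I2) (auto simp: bump_def)
      define a where "a m = (LINT x|leb. \<xi> x * H \<omega> m x)" for m
      have a0: "0 \<le> a m" "a m \<le> (C + 1) * L" for m unfolding a_def L_def by (rule fibre_integral_bound[OF g \<xi>])+
      obtain N where N: "n = N + k" "n1 \<le> N" "0 < N" using n by (intro that[of "n - k"]) auto
      have split: "(\<Sum>m<n. a m) = (\<Sum>m<k. a m) + (\<Sum>m<N. a (m + k))"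
        unfolding N(1) by (induction N) (simp_all add: algebra_simps)
      have s1: "\<bar>\<Sum>m<k. a m\<bar> \<le> real k * (C + 1) * L"
      proof -
        have "\<bar>\<Sum>m<k. a m\<bar> \<le> (\<Sum>m<k. (C + 1) * L)" using a0 by (intro order_trans[OF sum_abs] sum_mono) auto
        then show ?thesis by simp
      qed
      have s2: "\<bar>(\<Sum>m<N. a (m + k)) - (\<Sum>m<N. F k ((shift ^^ m) \<omega>)) * L\<bar> \<le> real N * (\<epsilon> / 4) * L"
      proof -
        have "(\<Sum>m<N. a (m + k)) - (\<Sum>m<N. F k ((shift ^^ m) \<omega>)) * L = (\<Sum>m<N. a (m + k) - F k ((shift ^^ m) \<omega>) * L)"
          by (simp add: sum_subtractf sum_distrib_right)
        also have "\<bar>\<dots>\<bar> \<le> (\<Sum>m<N. (\<epsilon> / 4) * L)"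
        proof (intro order_trans[OF sum_abs] sum_mono)
          fix m
          have "(D * \<theta> ^ k + \<epsilon> / 8) * L \<le> (\<epsilon> / 4) * L" using k L0 by (intro mult_right_mono) auto
          then show "\<bar>a (m + k) - F k ((shift ^^ m) \<omega>) * L\<bar> \<le> (\<epsilon> / 4) * L"
            using \<delta>(2)[OF g \<xi>, of m] unfolding a_def L_def by linarith
        qed
        finally show ?thesis by (simp add: mult_ac)
      qed
      have s3: "\<bar>(\<Sum>m<N. F k ((shift ^^ m) \<omega>)) - real N * E k\<bar> \<le> real N * (\<epsilon> / 8)"
      proof -
        have "(\<Sum>m<N. F k ((shift ^^ m) \<omega>)) - real N * E k = real N * ((\<Sum>m<N. F k ((shift ^^ m) \<omega>)) / real N - E k)"
          using N(3) by (simp add: field_simps)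
        also have "\<bar>\<dots>\<bar> \<le> real N * (\<epsilon> / 8)" unfolding abs_mult using n1[OF N(2)] by (intro mult_mono) auto
        finally show ?thesis .
      qed
      have s4: "\<bar>real N * E k - real N * \<rho>\<bar> \<le> real N * (\<epsilon> / 8)"
      proof -
        have "\<bar>real N * E k - real N * \<rho>\<bar> = real N * \<bar>\<rho> - E k\<bar>" by (simp add: right_diff_distrib[symmetric] abs_mult abs_minus_commute)
        also have "\<dots> \<le> real N * (\<epsilon> / 8)" using \<rho>E[of k] k by (intro mult_left_mono) auto
        finally show ?thesis .
      qed
      have s5: "\<bar>(\<Sum>m<N. F k ((shift ^^ m) \<omega>)) * L - real N * \<rho> * L\<bar> \<le> real N * (\<epsilon> / 4) * L"
      proof -
        have "\<bar>(\<Sum>m<N. F k ((shift ^^ m) \<omega>)) - real N * \<rho>\<bar> \<le> real N * (\<epsilon> / 4)" using s3 s4 by linarith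
        then have "\<bar>(\<Sum>m<N. F k ((shift ^^ m) \<omega>)) - real N * \<rho>\<bar> * L \<le> real N * (\<epsilon> / 4) * L" using L0 by (rule mult_right_mono)
        then show ?thesis using L0 by (simp add: left_diff_distrib[symmetric] abs_mult)
      qed
      have s6: "\<bar>real N * \<rho> * L - real n * \<rho> * L\<bar> \<le> real k * \<bar>\<rho>\<bar> * L"
        using L0 unfolding N(1) by (simp add: left_diff_distrib[symmetric] abs_mult algebra_simps)
      have "R \<le> real n * (\<epsilon> / 8)"
      proof -
        have "real n2 \<le> real n" using n by simp
        then have "R / (\<epsilon> / 8) \<le> real n" using n2 by linarith
        then show ?thesis using \<epsilon> by (simp add: field_simps)
      qed
      then have s7: "R * L \<le> real n * (\<epsilon> / 8) * L" using L0 by (rule mult_right_mono)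
      have s8: "real N * (\<epsilon> / 4) * L \<le> real n * (\<epsilon> / 4) * L" using \<epsilon> L0 unfolding N(1) by (intro mult_right_mono) auto
      have "\<bar>(\<Sum>m<n. a m) - real n * \<rho> * L\<bar> \<le> real k * (C + 1) * L + real k * \<bar>\<rho>\<bar> * L + 2 * (real n * (\<epsilon> / 4) * L)"
        using split s1 s2 s5 s6 s8 by linarith
      also have "real k * (C + 1) * L + real k * \<bar>\<rho>\<bar> * L = R * L" by (simp add: R_def algebra_simps)
      also have "R * L + 2 * (real n * (\<epsilon> / 4) * L) \<le> \<epsilon> * real n * L"
      proof -
        have "0 \<le> \<epsilon> * real n * L" using \<epsilon> L0 by simp
        moreover have "real n * (\<epsilon> / 8) * L = (\<epsilon> * real n * L) / 8" "real n * (\<epsilon> / 4) * L = (\<epsilon> * real n * L) / 4" by auto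
        ultimately show ?thesis using s7 by linarith
      qed
      finally show "\<bar>(\<Sum>m<n. LINT x|leb. \<xi> x * H \<omega> m x) - real n * \<rho> * (LINT x|leb. \<xi> x)\<bar> \<le> \<epsilon> * real n * (LINT x|leb. \<xi> x)"
        unfolding a_def L_def .
    qed
  qed
  show ?thesis unfolding mean_density_def orbit_density_def using pos part1 part2 by blast
qed

end

section \<open>Short returns and decoupling\<close>

text \<open>The smaller product lies in \<open>[0,1]\<close>, and the missing factors multiply to at
  least one minus the sum of the \<open>a i\<close>, the Weierstrass product inequality.\<close>

lemma prod_diff_le_sum:
  fixes a :: "nat \<Rightarrow> real"
  assumes "finite B" "A \<subseteq> B" "\<And>i. i \<in> B \<Longrightarrow> 0 \<le> a i \<and> a i \<le> 1"
  shows "\<bar>(\<Prod>i\<in>A. 1 - a i) - (\<Prod>i\<in>B. 1 - a i)\<bar> \<le> (\<Sum>i\<in>B - A. a i)"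
proof -
  have w: "1 - (\<Sum>i\<in>B - A. a i) \<le> (\<Prod>i\<in>B - A. 1 - a i)"
  proof -
    have "norm ((\<Prod>i\<in>B - A. 1 - a i) - (\<Prod>i\<in>B - A. 1)) \<le> (\<Sum>i\<in>B - A. norm ((1 - a i) - 1))"
      by (rule norm_prod_diff) (use assms(3) in \<open>auto simp: abs_le_iff\<close>)
    also have "\<dots> = (\<Sum>i\<in>B - A. a i)" using assms(3) by (intro sum.cong) auto
    finally show ?thesis by simp
  qed
  have u: "(\<Prod>i\<in>B - A. 1 - a i) \<le> 1" "0 \<le> (\<Prod>i\<in>A. 1 - a i)" "(\<Prod>i\<in>A. 1 - a i) \<le> 1"
    using assms by (auto intro!: prod_le_1 prod_nonneg)
  have "(\<Prod>i\<in>B. 1 - a i) = (\<Prod>i\<in>B - A. 1 - a i) * (\<Prod>i\<in>A. 1 - a i)" by (rule prod.subset_diff[OF assms(2,1)])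
  then have "(\<Prod>i\<in>A. 1 - a i) - (\<Prod>i\<in>B. 1 - a i) = (\<Prod>i\<in>A. 1 - a i) * (1 - (\<Prod>i\<in>B - A. 1 - a i))" by (simp add: algebra_simps)
  also have "\<bar>\<dots>\<bar> \<le> 1 * (\<Sum>i\<in>B - A. a i)" unfolding abs_mult using u w by (intro mult_mono) auto
  finally show ?thesis by simp
qed

context expanding begin

definition aperiodic :: "real \<Rightarrow> bool" where
  "aperiodic z \<longleftrightarrow> (\<forall>k\<ge>1. \<forall>\<omega>. isCont (fi \<omega> k) z \<and> fi \<omega> k z \<noteq> z)"

text \<open>The map minus the identity has derivative at least \<open>l ^ k - 1 > 0\<close> in
  absolute value off a finite set, so each word has finitely many fixed points, and there are
  countably many words.\<close>

lemma AE_aperiodic: "AE z in leb. aperiodic z"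
proof -
  define N where "N T = {x\<in>{0..1}. \<not> isCont T x \<or> T x = x}" for T :: "real \<Rightarrow> real"
  have fin: "finite (N (fi \<omega> k))" if k: "1 \<le> k" for k \<omega>
  proof -
    have lk: "1 < l ^ k" using l1 k by simp
    have "pwx (l ^ k) (fi \<omega> k)" using fi_pwx k by simp
    then obtain P T' where P: "finite P" "0 \<in> P" "1 \<in> P" "P \<subseteq> {0..1}"
      and der: "\<And>x. x \<in> {0..1} - P \<Longrightarrow> (fi \<omega> k has_real_derivative T' x) (at x) \<and> l ^ k \<le> \<bar>T' x\<bar>"
      unfolding pwx_def by (elim exE conjE) blast
    have "finite {x\<in>{0..1}. fi \<omega> k x - x = 0}"
    proof (rule finite_level_set[OF P, where S' = "\<lambda>x. T' x - 1"])
      fix x assume "x \<in> {0..1} - P"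
      from der[OF this] show "((\<lambda>x. fi \<omega> k x - x) has_real_derivative T' x - 1) (at x) \<and> T' x - 1 \<noteq> 0"
        using lk by (auto intro!: derivative_eq_intros)
    qed
    moreover have "N (fi \<omega> k) \<subseteq> {x\<in>{0..1}. fi \<omega> k x - x = 0} \<union> P"
      using der DERIV_isCont by (force simp: N_def)
    ultimately show ?thesis using P(1) by (meson finite_UnI finite_subset)
  qed
  have "countable (\<Union>k\<in>{1..}. \<Union>T\<in>range (\<lambda>\<omega>. fi \<omega> k). N T)"
  proof (rule countable_UN, simp, rule countable_UN[OF countable_finite[OF finite_fibre_iters]])
    fix k :: nat and T assume "k \<in> {1..}" "T \<in> range (\<lambda>\<omega>. fi \<omega> k)"
    then show "countable (N T)" using fin by (auto intro: countable_finite)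
  qed
  then have "AE z in leb. z \<notin> (\<Union>k\<in>{1..}. \<Union>T\<in>range (\<lambda>\<omega>. fi \<omega> k). N T)" by (rule AE_leb_countable)
  then show ?thesis by (rule AE_mp) (auto intro!: AE_I2 simp: aperiodic_def N_def)
qed

text \<open>Continuity at \<open>z\<close> and \<open>T z \<noteq> z\<close> keep a small ball away
  from itself; finitely many words are shorter than \<open>J\<close>, so one bound on the radius
  serves all \<open>\<omega>\<close>. The same \<open>r\<close> on both sides makes two bumps of
  radius \<open>r\<close> never nonzero together at such times.\<close>

lemma no_short_returns:
  assumes "aperiodic z"
  shows "\<exists>d>0. \<forall>r\<le>d. \<forall>\<omega> j x. 1 \<le> j \<longrightarrow> j < J \<longrightarrow> dist x z < r \<longrightarrow> r \<le> dist (fi \<omega> j x) z"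
proof -
  have ex: "\<exists>d>0. \<forall>x. dist x z < d \<longrightarrow> d \<le> dist (T x) z" if T: "isCont T z" "T z \<noteq> z" for T :: "real \<Rightarrow> real"
  proof -
    define e where "e = dist (T z) z / 2"
    have e0: "0 < e" using T(2) by (simp add: e_def)
    obtain d where d: "d > 0" "\<And>x. dist x z < d \<Longrightarrow> dist (T x) (T z) < e" using T(1) e0 unfolding continuous_at_eps_delta by blast
    show ?thesis
    proof (intro exI[of _ "min d e"] conjI allI impI)
      fix x assume "dist x z < min d e"
      then have "dist (T x) (T z) < e" using d(2) by simp
      moreover have "dist (T z) z \<le> dist (T x) (T z) + dist (T x) z" by (metis dist_commute dist_triangle)
      ultimately show "min d e \<le> dist (T x) z" unfolding e_def by linarith
    qed (use d e0 in simp)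
  qed
  let ?X = "\<Union>j\<in>{1..<J}. range (\<lambda>\<omega>. fi \<omega> j)"
  have finX: "finite ?X" using finite_fibre_iters by blast
  have "\<exists>d>0. \<forall>x. dist x z < d \<longrightarrow> d \<le> dist (T x) z" if "T \<in> ?X" for T
    using that assms by (intro ex) (auto simp: aperiodic_def)
  then obtain d where d: "\<And>T. T \<in> ?X \<Longrightarrow> 0 < d T \<and> (\<forall>x. dist x z < d T \<longrightarrow> d T \<le> dist (T x) z)" by metis
  define r0 where "r0 = Min (insert 1 (d ` ?X))"
  have r0: "0 < r0" "\<And>T. T \<in> ?X \<Longrightarrow> r0 \<le> d T" unfolding r0_def using finX d by auto
  show ?thesis
  proof (intro exI[of _ r0] conjI allI impI r0(1))
    fix r \<omega> j x assume *: "r \<le> r0" "1 \<le> j" "j < J" "dist x z < r"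
    have T: "fi \<omega> j \<in> ?X" using *(2,3) by (intro UN_I[of j]) auto
    have "r \<le> d (fi \<omega> j)" using r0(2)[OF T] *(1) by linarith
    then show "r \<le> dist (fi \<omega> j x) z" using d[OF T] *(4) by (meson less_le_trans order_trans)
  qed
qed

end

context fibred begin

lemma bump_L1:
  assumes "bump z r \<xi>" "0 < r" shows "0 \<le> (LINT x|leb. \<xi> x)" "(LINT x|leb. \<xi> x) \<le> 2 * r"
proof -
  have \<xi>: "\<xi> \<in> borel_measurable leb" "\<And>x. x \<in> {0..1} \<Longrightarrow> 0 \<le> \<xi> x \<and> \<xi> x \<le> 1" "\<And>x. x \<in> {0..1} \<Longrightarrow> r \<le> dist x z \<Longrightarrow> \<xi> x = 0"
    using assms by (auto simp: bump_def)
  show "0 \<le> (LINT x|leb. \<xi> x)" using \<xi>(2) by (intro integral_nonneg_AE AE_I2) auto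
  let ?I = "{0..1} \<inter> {z - r<..<z + r}"
  have I: "?I \<in> sets leb" by (auto intro!: in_sets_leb)
  have "emeasure leb ?I \<le> emeasure lborel {z - r<..<z + r}"
    unfolding emeasure_leb[OF I] by (intro emeasure_mono) auto
  also have "\<dots> = ennreal (2 * r)" using assms(2) by simp
  finally have m: "measure leb ?I \<le> 2 * r" using assms(2) by (simp add: measure_def enn2real_leI)
  have "(LINT x|leb. \<xi> x) \<le> (LINT x|leb. indicator ?I x)"
  proof (rule integral_mono)
    show "integrable leb \<xi>" by (rule unit_integrable(1)[OF \<xi>(1,2)])
    show "integrable leb (indicator ?I :: real \<Rightarrow> real)"
      by (intro integrable_real_indicator I) (simp add: leb.emeasure_finite less_top[symmetric])
    fix x assume "x \<in> space leb"
    then have x: "x \<in> {0..1}" by simp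
    show "\<xi> x \<le> indicator ?I x"
    proof (cases "dist x z < r")
      case True then show ?thesis using \<xi>(2)[OF x] x by (auto simp: indicator_def dist_real_def)
    next
      case False then show ?thesis using \<xi>(3)[OF x] by simp
    qed
  qed
  also have "\<dots> = measure leb ?I" using I by (simp add: Int_absorb2)
  finally show "(LINT x|leb. \<xi> x) \<le> 2 * r" using m by simp
qed

text \<open>The first factor is split off repeatedly: up to the gap \<open>t\<close> the later factors are dropped at the cost
  of the joint probability of two exceedances, and after the gap the decay of correlations decouples.\<close>

theorem product_expectation:
  assumes C: "0 < C"
  shows "\<exists>K>0. \<exists>\<theta>>0. \<theta> < 1 \<and> (\<forall>\<omega> z r L t J \<xi>. good C \<omega> \<longrightarrow> 0 < r \<longrightarrow> (\<forall>i<L. bump z r (\<xi> i) \<and> bvar 4 (\<xi> i)) \<longrightarrow>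
     (\<forall>\<omega> j x. 1 \<le> j \<longrightarrow> j < J \<longrightarrow> dist x z < r \<longrightarrow> r \<le> dist (fi \<omega> j x) z) \<longrightarrow> 1 \<le> t \<longrightarrow>
     \<bar>(LINT x|leb. (\<Prod>i<L. 1 - \<xi> i (fi \<omega> i x)) * H \<omega> 0 x) - (\<Prod>m<L. 1 - (LINT x|leb. \<xi> m x * H \<omega> m x))\<bar>
       \<le> real L * (K * (r * \<theta> ^ J + real t * r\<^sup>2 + \<theta> ^ t)))"
proof -
  obtain A B u where AB: "0 < A" "0 < B" "0 < u" "u < 1" and ly: "\<And>k \<omega> \<phi> V. bvar V \<phi> \<Longrightarrow>
     (\<exists>\<psi>. tr (fi \<omega> k) \<phi> \<psi> \<and> bvar (A * u ^ k * V + B * (LINT x|leb. \<bar>\<phi> x\<bar>)) \<psi>)"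
    using ly_uniform by blast
  obtain D v where D: "0 < D" "0 < v" "v < 1" and dec: "\<And>k \<omega> \<phi> V. adm \<omega> \<Longrightarrow> bvar V \<phi> \<Longrightarrow> (LINT x|leb. \<phi> x) = 0 \<Longrightarrow>
      (\<exists>\<psi>. tr (fi \<omega> k) \<phi> \<psi> \<and> bvar (D * v ^ k * V) \<psi> \<and> (\<forall>x\<in>{0..1}. \<bar>\<psi> x\<bar> \<le> D * v ^ k * V))"
    using decay by blast
  define \<theta> where "\<theta> = max u v"
  have \<theta>: "0 < \<theta>" "\<theta> < 1" "u \<le> \<theta>" "v \<le> \<theta>" using AB D by (auto simp: \<theta>_def)
  \<comment> \<open>Bounds the variation of \<open>(a m - e m) * h0\<close>:
    \<open>4 * (C + 1) + C\<close> from the product with a bump of variation 4, and at most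
    \<open>C\<close> from the multiple of \<open>h0\<close>.\<close>
  define V where "V = 6 * (C + 1)"
  \<comment> \<open>In this order the summands pay for overlaps at times at least \<open>J\<close>,
    for the part of the overlaps quadratic in \<open>r\<close>, for the products
    \<open>e m * e (m + j)\<close>, and for the decoupling across the gap.\<close>
  define K where "K = (C + 1) * 8 * A / (1 - \<theta>) + 4 * (C + 1) * (B + 1) + 4 * (C + 1)\<^sup>2 + D * V"
  have K0: "0 < K" unfolding K_def V_def using C AB D \<theta> by (intro add_pos_pos mult_pos_pos divide_pos_pos) auto
  have main: "\<bar>(LINT x|leb. (\<Prod>i<L. 1 - \<xi> i (fi \<omega> i x)) * H \<omega> 0 x) - (\<Prod>m<L. 1 - (LINT x|leb. \<xi> m x * H \<omega> m x))\<bar>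
       \<le> real L * (K * (r * \<theta> ^ J + real t * r\<^sup>2 + \<theta> ^ t))"
    if g: "good C \<omega>" and r: "0 < r" and \<xi>: "\<And>i. i < L \<Longrightarrow> bump z r (\<xi> i) \<and> bvar 4 (\<xi> i)"
      and nsr: "\<And>\<omega> j x. 1 \<le> j \<Longrightarrow> j < J \<Longrightarrow> dist x z < r \<Longrightarrow> r \<le> dist (fi \<omega> j x) z" and t: "1 \<le> t"
    for \<omega> z r L t J \<xi>
  proof -
    \<comment> \<open>Extended by 0 beyond \<open>L\<close>, so that sums over \<open>m + j\<close>
      need no range condition.\<close>
    define a where "a i = (if i < L then \<xi> i else (\<lambda>_. 0))" for i
    have bump: "bump z r (a i)" and bv: "bvar 4 (a i)" for i
      using \<xi> by (auto simp: a_def bump_def)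
    have am: "a i \<in> borel_measurable leb" "x \<in> {0..1} \<Longrightarrow> 0 \<le> a i x \<and> a i x \<le> 1"
      "x \<in> {0..1} \<Longrightarrow> r \<le> dist x z \<Longrightarrow> a i x = 0" for i x using bump[of i] by (auto simp: bump_def)
    let ?w = "\<lambda>m. (shift ^^ m) \<omega>"
    have afm: "(\<lambda>x. a i (fi w k x)) \<in> borel_measurable leb" for i w k
      using measurable_comp[OF fi_measurable[of w k] am(1)[of i]] by (simp add: o_def)
    have af01: "0 \<le> a i (fi w k x) \<and> a i (fi w k x) \<le> 1" if "x \<in> {0..1}" for i w k x
      by (rule am(2)[OF fi_range[OF that]])
    define e where "e m = (LINT x|leb. a m x * H \<omega> m x)" for m
    \<comment> \<open>The factors from time \<open>m + s\<close> on, seen from time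
      \<open>m\<close>. By \<open>Pshift\<close> this is a function of the state at time
      \<open>m + s\<close>, so its integral against the density at time \<open>m\<close> is the tail
      expectation \<open>F (m + s)\<close>.\<close>
    define P where "P m s x = (\<Prod>i\<in>{m + s..<L}. 1 - a i (fi (?w m) (i - m) x))" for m s x
    have Pm: "P m s \<in> borel_measurable leb" for m s unfolding P_def using afm by measurable
    have P01: "0 \<le> P m s x" "P m s x \<le> 1" if "x \<in> {0..1}" for m s x
      unfolding P_def using af01[OF that] by (auto intro!: prod_nonneg prod_le_1)
    have P01': "0 \<le> P m s x \<and> P m s x \<le> 1" if "x \<in> {0..1}" for m s x using P01[OF that] by blast
    define F where "F m = (LINT x|leb. P m 0 x * H \<omega> m x)" for m
    have Pshift: "P m s x = P (m + s) 0 (fi (?w m) s x)" for m s x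
      unfolding P_def
    proof (rule prod.cong, simp)
      fix i assume "i \<in> {m + s + 0..<L}"
      then obtain k where k: "i = m + s + k" using le_Suc_ex[of "m + s" i] by auto
      have "fi (?w m) (s + k) x = fi (?w (m + s)) k (fi (?w m) s x)"
        by (simp add: fibre_iter_add shift_funpow_add)
      then show "1 - a i (fi (?w m) (i - m) x) = 1 - a i (fi (?w (m + s)) (i - (m + s)) (fi (?w m) s x))"
        by (simp add: k)
    qed
    have FP: "(LINT x|leb. P m s x * H \<omega> m x) = F (m + s)" for m s
      unfolding F_def Pshift[of m s] using P01
      by (intro trD(3)[OF good_tr[OF g], symmetric, where b = 1] Pm) (simp add: abs_le_iff)
    have ie: "integrable leb (\<lambda>x. G x * H \<omega> m x)" if "G \<in> borel_measurable leb" "\<And>x. x \<in> {0..1} \<Longrightarrow> 0 \<le> G x \<and> G x \<le> 1" for G m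
      by (rule unit_integrable(2)[OF that good_integrable[OF g]])
    have ea: "(LINT x|leb. a (m + j) (fi (?w m) j x) * H \<omega> m x) = e (m + j)" for m j
      unfolding e_def using am(2)[of _ "m + j"]
      by (intro trD(3)[OF good_tr[OF g], symmetric, where b = 1] am(1)) (simp add: abs_le_iff)
    have aL1: "0 \<le> (LINT x|leb. a i x)" "(LINT x|leb. a i x) \<le> 2 * r" for i using bump_L1[OF bump r] by auto
    have e0: "0 \<le> e m" "e m \<le> (C + 1) * (2 * r)" "e m \<le> 1" for m
    proof -
      show "0 \<le> e m" unfolding e_def by (rule fibre_integral_bound[OF g bump])
      have "e m \<le> (C + 1) * (LINT x|leb. a m x)" unfolding e_def by (rule fibre_integral_bound[OF g bump])
      also have "\<dots> \<le> (C + 1) * (2 * r)" using aL1(2) C by (intro mult_left_mono) auto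
      finally show "e m \<le> (C + 1) * (2 * r)" .
      have "e m \<le> (LINT x|leb. H \<omega> m x)" unfolding e_def
      proof (rule integral_mono)
        show "integrable leb (\<lambda>x. a m x * H \<omega> m x)" by (rule ie[OF am(1,2)])
        show "integrable leb (H \<omega> m)" by (rule good_integrable[OF g])
        fix x assume "x \<in> space leb"
        then show "a m x * H \<omega> m x \<le> H \<omega> m x"
          using mult_right_mono[of "a m x" 1 "H \<omega> m x"] am(2)[of x m] h_nonneg[of x "?w m"] by simp
      qed
      then show "e m \<le> 1" using good_integral[OF g] by simp
    qed
    define q where "q m j = (LINT x|leb. (a m x * a (m + j) (fi (?w m) j x)) * H \<omega> m x)" for m j
    have aam: "(\<lambda>x. a m x * a (m + j) (fi (?w m) j x)) \<in> borel_measurable leb" for m j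
      using am(1) afm by measurable
    have aa01: "0 \<le> a m x * a (m + j) (fi (?w m) j x) \<and> a m x * a (m + j) (fi (?w m) j x) \<le> 1" if "x \<in> {0..1}" for m j x
      using am(2)[OF that, of m] af01[OF that, of "m + j" "?w m" j] by (auto intro: mult_le_one)
    have iaa: "integrable leb (\<lambda>x. (a m x * a (m + j) (fi (?w m) j x)) * H \<omega> m x)" for m j by (rule ie[OF aam aa01])
    have Pdiff: "\<bar>P m t x - P m 1 x\<bar> \<le> (\<Sum>j\<in>{1..<t}. a (m + j) (fi (?w m) j x))" if x: "x \<in> {0..1}" for m x
    proof -
      have "\<bar>P m t x - P m 1 x\<bar> \<le> (\<Sum>i\<in>{m + 1..<L} - {m + t..<L}. a i (fi (?w m) (i - m) x))"
        unfolding P_def by (rule prod_diff_le_sum) (use t af01[OF x] in auto)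
      also have "\<dots> \<le> (\<Sum>i\<in>{m + 1..<m + t}. a i (fi (?w m) (i - m) x))"
        by (rule sum_mono2) (use af01[OF x] in auto)
      also have "\<dots> = (\<Sum>j\<in>{1..<t}. a (m + j) (fi (?w m) j x))"
        by (rule sum.reindex_bij_witness[of _ "\<lambda>j. m + j" "\<lambda>i. i - m"]) auto
      finally show ?thesis .
    qed
    \<comment> \<open>One factor is split off. Besides dropping the factors inside the gap and
      decoupling, the dropped factors have to be put back, that is \<open>F (m + t)\<close> replaced
      by \<open>F (m + 1)\<close>; this costs the last sum.\<close>
    have step: "\<bar>F m - (1 - e m) * F (m + 1)\<bar> \<le> (\<Sum>j\<in>{1..<t}. q m j) + D * v ^ t * V + e m * (\<Sum>j\<in>{1..<t}. e (m + j))"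
      if m: "m < L" for m
    proof -
      have i1: "integrable leb (\<lambda>x. P m s x * H \<omega> m x)" for s by (rule ie[OF Pm P01'])
      have aPm: "(\<lambda>x. a m x * P m s x) \<in> borel_measurable leb" for s using am(1) Pm by measurable
      have aP01: "0 \<le> a m x * P m s x \<and> a m x * P m s x \<le> 1" if "x \<in> {0..1}" for s x
        using am(2)[OF that] P01'[OF that] by (auto intro: mult_le_one)
      have i2: "integrable leb (\<lambda>x. (a m x * P m s x) * H \<omega> m x)" for s by (rule ie[OF aPm aP01])
      have P0: "P m 0 x = (1 - a m x) * P m 1 x" for x
        unfolding P_def using m by (simp add: prod.atLeast_Suc_lessThan)
      have "P m 0 x * H \<omega> m x = P m 1 x * H \<omega> m x - (a m x * P m 1 x) * H \<omega> m x" for x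
        unfolding P0[of x] by algebra
      then have "F m = (LINT x|leb. P m 1 x * H \<omega> m x - (a m x * P m 1 x) * H \<omega> m x)"
        unfolding F_def by simp
      then have f1: "F m = F (m + 1) - (LINT x|leb. (a m x * P m 1 x) * H \<omega> m x)"
        using i1 i2 FP[of m 1] by simp
      have f2: "\<bar>(LINT x|leb. (a m x * P m t x) * H \<omega> m x) - (LINT x|leb. (a m x * P m 1 x) * H \<omega> m x)\<bar> \<le> (\<Sum>j\<in>{1..<t}. q m j)"
      proof -
        have "\<bar>(LINT x|leb. (a m x * P m t x) * H \<omega> m x) - (LINT x|leb. (a m x * P m 1 x) * H \<omega> m x)\<bar>
          \<le> (LINT x|leb. (\<Sum>j\<in>{1..<t}. (a m x * a (m + j) (fi (?w m) j x)) * H \<omega> m x))"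
        proof (rule abs_integral_diff_le[OF i2 i2 _ AE_I2])
          show "integrable leb (\<lambda>x. (\<Sum>j\<in>{1..<t}. (a m x * a (m + j) (fi (?w m) j x)) * H \<omega> m x))" using iaa by simp
          fix x assume "x \<in> space leb" then have x: "x \<in> {0..1}" by simp
          have "(a m x * P m t x) * H \<omega> m x - (a m x * P m 1 x) * H \<omega> m x = (a m x * H \<omega> m x) * (P m t x - P m 1 x)" by (simp add: algebra_simps)
          also have "\<bar>\<dots>\<bar> \<le> (a m x * H \<omega> m x) * (\<Sum>j\<in>{1..<t}. a (m + j) (fi (?w m) j x))"
            unfolding abs_mult[of "a m x * H \<omega> m x"] using Pdiff[OF x] am(2)[OF x, of m] h_nonneg[OF x, of "?w m"] by (intro mult_mono) auto
          also have "\<dots> = (\<Sum>j\<in>{1..<t}. (a m x * a (m + j) (fi (?w m) j x)) * H \<omega> m x)" by (simp add: sum_distrib_left mult_ac)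
          finally show "\<bar>(a m x * P m t x) * H \<omega> m x - (a m x * P m 1 x) * H \<omega> m x\<bar> \<le> \<dots>" .
        qed
        also have "\<dots> = (\<Sum>j\<in>{1..<t}. q m j)" unfolding q_def using iaa by (subst Bochner_Integration.integral_sum) auto
        finally show ?thesis .
      qed
      \<comment> \<open>\<open>(a m - e m) * h0\<close> has mean 0, and the rest of the product
        depends only on the state \<open>t\<close> steps later. Duality therefore pairs a function
        with values in \<open>[0,1]\<close> with a transfer that has decayed for \<open>t\<close>
        steps.\<close>
      have f3: "\<bar>(LINT x|leb. (a m x * P m t x) * H \<omega> m x) - e m * F (m + t)\<bar> \<le> D * v ^ t * V"
      proof -
        obtain h0 where h0: "bvar C h0" "AE x in leb. H \<omega> m x = h0 x" "AE x in leb. 0 \<le> h0 x" "(LINT x|leb. h0 x) = 1"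
          "AE x in leb. h0 x \<le> C + 1" "\<And>x. x \<in> {0..1} \<Longrightarrow> \<bar>h0 x\<bar> \<le> C + 1"
          by (rule good_version[OF g, of m]) blast
        note h0m = bvar_measurable[OF h0(1)]
        have b1: "bvar ((C + 1) * 4 + 1 * C) (\<lambda>x. a m x * h0 x)"
          by (rule bvar_mult[OF bv h0(1) _ h0(6)]) (use am(2)[of _ m] in \<open>simp add: abs_le_iff\<close>)
        have b2: "bvar (\<bar>e m\<bar> * C) (\<lambda>x. e m * h0 x)" by (rule bvar_cmult[OF h0(1)])
        have b3: "bvar V (\<lambda>x. a m x * h0 x - e m * h0 x)"
        proof (rule bvar_mono[OF bvar_diff[OF b1 b2]])
          have "\<bar>e m\<bar> * C \<le> 1 * C" using e0[of m] C by (intro mult_right_mono) auto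
          then show "(C + 1) * 4 + 1 * C + \<bar>e m\<bar> * C \<le> V" unfolding V_def by simp
        qed
        have eh0: "e m = (LINT x|leb. a m x * h0 x)" unfolding e_def
          using h0(2) h0m h_measurable am(1) by (intro integral_cong_AE) (auto elim: AE_mp)
        have z0: "(LINT x|leb. a m x * h0 x - e m * h0 x) = 0"
          using eh0 h0(4) bvar_integrable[OF h0(1)] bvar_integrable[OF b1] by simp
        obtain \<psi> where \<psi>: "tr (fi (?w m) t) (\<lambda>x. a m x * h0 x - e m * h0 x) \<psi>" "\<forall>x\<in>{0..1}. \<bar>\<psi> x\<bar> \<le> D * v ^ t * V"
          using dec[OF adm_shift[OF good_adm[OF g]] b3 z0] by blast
        have iP: "integrable leb (\<lambda>x. P (m + t) 0 (fi (?w m) t x) * (a m x * h0 x))"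
          "integrable leb (\<lambda>x. P (m + t) 0 (fi (?w m) t x) * h0 x)"
          unfolding Pshift[symmetric] by (rule unit_integrable(2)[OF Pm P01' bvar_integrable[OF b1]], assumption,
            rule unit_integrable(2)[OF Pm P01' bvar_integrable[OF h0(1)]])
        have "(LINT x|leb. (a m x * P m t x) * H \<omega> m x) = (LINT x|leb. P (m + t) 0 (fi (?w m) t x) * (a m x * h0 x))"
          unfolding Pshift[symmetric]
          using h0(2) h0m h_measurable am(1) Pm by (intro integral_cong_AE) (auto elim: AE_mp)
        moreover have "F (m + t) = (LINT x|leb. P (m + t) 0 (fi (?w m) t x) * h0 x)"
          unfolding FP[symmetric] Pshift[symmetric]
          using h0(2) h0m h_measurable Pm by (intro integral_cong_AE) (auto elim: AE_mp)
        ultimately have "(LINT x|leb. (a m x * P m t x) * H \<omega> m x) - e m * F (m + t)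
          = (LINT x|leb. P (m + t) 0 (fi (?w m) t x) * (a m x * h0 x) - e m * (P (m + t) 0 (fi (?w m) t x) * h0 x))"
          using iP by simp
        also have "\<dots> = (LINT x|leb. P (m + t) 0 (fi (?w m) t x) * (a m x * h0 x - e m * h0 x))"
          by (simp add: algebra_simps)
        also have "\<dots> = (LINT x|leb. P (m + t) 0 x * \<psi> x)"
          using P01 by (intro trD(3)[OF \<psi>(1), symmetric, where b = 1] Pm) (simp add: abs_le_iff)
        also have "\<bar>\<dots>\<bar> \<le> (LINT x|leb. \<bar>P (m + t) 0 x * \<psi> x\<bar>)" by (rule integral_abs_bound)
        also have "\<dots> \<le> (LINT x|leb. D * v ^ t * V)"
        proof (rule integral_mono)
          show "integrable leb (\<lambda>x. \<bar>P (m + t) 0 x * \<psi> x\<bar>)" using unit_integrable(2)[OF Pm P01' trD(2)[OF \<psi>(1)]] by simp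
          fix x assume "x \<in> space leb" then have x: "x \<in> {0..1}" by simp
          have "\<bar>P (m + t) 0 x * \<psi> x\<bar> \<le> 1 * (D * v ^ t * V)"
            unfolding abs_mult using P01[OF x] \<psi>(2) x by (intro mult_mono) auto
          then show "\<bar>P (m + t) 0 x * \<psi> x\<bar> \<le> D * v ^ t * V" by simp
        qed simp
        also have "\<dots> = D * v ^ t * V" using leb.prob_space by simp
        finally show ?thesis .
      qed
      have f4: "\<bar>F (m + t) - F (m + 1)\<bar> \<le> (\<Sum>j\<in>{1..<t}. e (m + j))"
      proof -
        have "\<bar>F (m + t) - F (m + 1)\<bar> \<le> (LINT x|leb. (\<Sum>j\<in>{1..<t}. a (m + j) (fi (?w m) j x) * H \<omega> m x))"
          unfolding FP[symmetric]
        proof (rule abs_integral_diff_le[OF i1 i1 _ AE_I2])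
          show "integrable leb (\<lambda>x. (\<Sum>j\<in>{1..<t}. a (m + j) (fi (?w m) j x) * H \<omega> m x))" using ie[OF afm af01] by simp
          fix x assume "x \<in> space leb" then have x: "x \<in> {0..1}" by simp
          have "P m t x * H \<omega> m x - P m 1 x * H \<omega> m x = H \<omega> m x * (P m t x - P m 1 x)" by (simp add: algebra_simps)
          also have "\<bar>\<dots>\<bar> \<le> H \<omega> m x * (\<Sum>j\<in>{1..<t}. a (m + j) (fi (?w m) j x))"
            unfolding abs_mult[of "H \<omega> m x"] using Pdiff[OF x] h_nonneg[OF x, of "?w m"] by (intro mult_mono) auto
          also have "\<dots> = (\<Sum>j\<in>{1..<t}. a (m + j) (fi (?w m) j x) * H \<omega> m x)" by (simp add: sum_distrib_left mult_ac)
          finally show "\<bar>P m t x * H \<omega> m x - P m 1 x * H \<omega> m x\<bar> \<le> \<dots>" .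
        qed
        also have "\<dots> = (\<Sum>j\<in>{1..<t}. e (m + j))" unfolding ea[symmetric] using ie[OF afm af01] by (subst Bochner_Integration.integral_sum) auto
        finally show ?thesis .
      qed
      have f5: "\<bar>e m * F (m + t) - e m * F (m + 1)\<bar> \<le> e m * (\<Sum>j\<in>{1..<t}. e (m + j))"
        unfolding right_diff_distrib[symmetric] abs_mult using f4 e0[of m] by (intro mult_mono) auto
      have "F m - (1 - e m) * F (m + 1) = e m * F (m + 1) - (LINT x|leb. (a m x * P m 1 x) * H \<omega> m x)"
        using f1 by (simp add: algebra_simps)
      then show ?thesis using f2 f3 f5 by linarith
    qed
    \<comment> \<open>The transfer of a bump over \<open>j\<close> steps is bounded by its variation
      plus its \<open>L^1\<close> norm, hence by a term in \<open>u ^ j\<close> plus a multiple of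
      \<open>r\<close>. Pairing with the second bump supplies another factor
      \<open>2 * r\<close>.\<close>
    have qb: "q m j \<le> (C + 1) * (4 * A * u ^ j + (B + 1) * (2 * r)) * (2 * r)" for m j
    proof -
      have aL: "(LINT x|leb. \<bar>a m x\<bar>) = (LINT x|leb. a m x)" using am(2) by (intro Bochner_Integration.integral_cong) auto
      obtain \<psi> where \<psi>: "tr (fi (?w m) j) (a m) \<psi>" "bvar (A * u ^ j * 4 + B * (LINT x|leb. \<bar>a m x\<bar>)) \<psi>" using ly[OF bv] by blast
      have \<psi>b: "\<bar>\<psi> x\<bar> \<le> 4 * A * u ^ j + (B + 1) * (2 * r)" if "x \<in> {0..1}" for x
      proof -
        have "\<bar>\<psi> x\<bar> \<le> A * u ^ j * 4 + B * (LINT x|leb. \<bar>a m x\<bar>) + (LINT x|leb. \<bar>\<psi> x\<bar>)" by (rule bvar_bound[OF \<psi>(2) that])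
        also have "(LINT x|leb. \<bar>\<psi> x\<bar>) \<le> (LINT x|leb. \<bar>a m x\<bar>)" by (rule tr_measurable_L1[OF \<psi>(1)])
        also have "A * u ^ j * 4 + B * (LINT x|leb. \<bar>a m x\<bar>) + (LINT x|leb. \<bar>a m x\<bar>) = 4 * A * u ^ j + (B + 1) * (LINT x|leb. a m x)"
          unfolding aL by (simp add: algebra_simps)
        also have "\<dots> \<le> 4 * A * u ^ j + (B + 1) * (2 * r)" using aL1(2)[of m] AB by (intro add_left_mono mult_left_mono) auto
        finally show ?thesis by simp
      qed
      have b0: "0 \<le> 4 * A * u ^ j + (B + 1) * (2 * r)" using AB r by auto
      have "q m j \<le> (C + 1) * (LINT x|leb. a m x * a (m + j) (fi (?w m) j x))" unfolding q_def
        by (rule fibre_integral_bound(2)[OF g, where z = z and \<delta> = r])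
           (use aam aa01 am(3)[of _ m] in \<open>auto simp: bump_def\<close>)
      also have "(LINT x|leb. a m x * a (m + j) (fi (?w m) j x)) = (LINT x|leb. a (m + j) x * \<psi> x)"
      proof -
        have "(LINT x|leb. a (m + j) x * \<psi> x) = (LINT x|leb. a (m + j) (fi (?w m) j x) * a m x)"
          using am(2)[of _ "m + j"] by (intro trD(3)[OF \<psi>(1), where b = 1] am(1)) (simp add: abs_le_iff)
        then show ?thesis by (simp add: mult.commute)
      qed
      also have "(LINT x|leb. a (m + j) x * \<psi> x) \<le> (LINT x|leb. (4 * A * u ^ j + (B + 1) * (2 * r)) * a (m + j) x)"
      proof (rule integral_mono)
        show "integrable leb (\<lambda>x. a (m + j) x * \<psi> x)" by (rule unit_integrable(2)[OF am(1,2) trD(2)[OF \<psi>(1)]])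
        show "integrable leb (\<lambda>x. (4 * A * u ^ j + (B + 1) * (2 * r)) * a (m + j) x)" using unit_integrable(1)[OF am(1,2)] by simp
        fix x assume "x \<in> space leb" then have x: "x \<in> {0..1}" by simp
        have "\<psi> x \<le> 4 * A * u ^ j + (B + 1) * (2 * r)" using \<psi>b[OF x] by linarith
        then show "a (m + j) x * \<psi> x \<le> (4 * A * u ^ j + (B + 1) * (2 * r)) * a (m + j) x"
          using am(2)[OF x, of "m + j"] by (subst mult.commute) (intro mult_right_mono, auto)
      qed
      also have "(LINT x|leb. (4 * A * u ^ j + (B + 1) * (2 * r)) * a (m + j) x) = (4 * A * u ^ j + (B + 1) * (2 * r)) * (LINT x|leb. a (m + j) x)" by simp
      also have "\<dots> \<le> (4 * A * u ^ j + (B + 1) * (2 * r)) * (2 * r)" using b0 aL1(2) by (intro mult_left_mono) auto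
      finally show ?thesis using C by (simp add: mult.assoc mult_left_mono)
    qed
    have q0: "q m j = 0" if j: "1 \<le> j" "j < J" for m j
    proof -
      have "(a m x * a (m + j) (fi (?w m) j x)) * H \<omega> m x = 0" if x: "x \<in> {0..1}" for x
      proof (cases "dist x z < r")
        case True
        then have "a (m + j) (fi (?w m) j x) = 0" using am(3)[OF fi_range[OF x]] nsr[OF j] by blast
        then show ?thesis by simp
      next
        case False
        then show ?thesis using am(3)[OF x, of m] by simp
      qed
      then have "q m j = (LINT x|leb. 0)" unfolding q_def by (intro Bochner_Integration.integral_cong refl) simp
      then show ?thesis by simp
    qed
    have qsum: "(\<Sum>j\<in>{1..<t}. q m j) \<le> (C + 1) * 8 * A / (1 - \<theta>) * (r * \<theta> ^ J) + 4 * (C + 1) * (B + 1) * (real t * r\<^sup>2)" for m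
    proof -
      have "(\<Sum>j\<in>{1..<t}. q m j) \<le> (\<Sum>j\<in>{1..<t}. (C + 1) * 8 * A * r * (if J \<le> j then \<theta> ^ j else 0) + 4 * (C + 1) * (B + 1) * r\<^sup>2)"
      proof (rule sum_mono)
        fix j assume j: "j \<in> {1..<t}"
        have n2: "0 \<le> 4 * (C + 1) * (B + 1) * r\<^sup>2" using C AB by simp
        show "q m j \<le> (C + 1) * 8 * A * r * (if J \<le> j then \<theta> ^ j else 0) + 4 * (C + 1) * (B + 1) * r\<^sup>2"
        proof (cases "J \<le> j")
          case True
          have "u ^ j \<le> \<theta> ^ j" using \<theta> AB by (intro power_mono) auto
          then have "(C + 1) * 8 * A * r * u ^ j \<le> (C + 1) * 8 * A * r * \<theta> ^ j" using C AB r by (intro mult_left_mono) auto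
          moreover have "(C + 1) * (4 * A * u ^ j + (B + 1) * (2 * r)) * (2 * r) = (C + 1) * 8 * A * r * u ^ j + 4 * (C + 1) * (B + 1) * r\<^sup>2"
            by (simp add: algebra_simps power2_eq_square)
          ultimately show ?thesis using qb[of m j] True by simp
        next
          case False
          then show ?thesis using q0[of j m] j n2 by simp
        qed
      qed
      also have "\<dots> = (C + 1) * 8 * A * r * (\<Sum>j\<in>{1..<t}. if J \<le> j then \<theta> ^ j else 0) + real (t - 1) * (4 * (C + 1) * (B + 1) * r\<^sup>2)"
        by (simp add: sum.distrib sum_distrib_left)
      also have "\<dots> \<le> (C + 1) * 8 * A * r * (\<theta> ^ J / (1 - \<theta>)) + real t * (4 * (C + 1) * (B + 1) * r\<^sup>2)"
      proof (intro add_mono mult_left_mono mult_right_mono)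
        have "(\<Sum>j\<in>{1..<t}. if J \<le> j then \<theta> ^ j else 0) \<le> (\<Sum>j\<in>{J..<J + t}. \<theta> ^ j)"
          unfolding sum.inter_filter[symmetric, OF finite_atLeastLessThan] by (rule sum_mono2) (use \<theta> in auto)
        also have "\<dots> = (\<Sum>j<t. \<theta> ^ J * \<theta> ^ j)"
          by (rule sum.reindex_bij_witness[of _ "\<lambda>j. J + j" "\<lambda>i. i - J"]) (auto simp: power_add[symmetric])
        also have "\<dots> = \<theta> ^ J * ((1 - \<theta> ^ t) / (1 - \<theta>))"
          using \<theta> by (simp add: sum_distrib_left[symmetric] sum_gp_strict)
        also have "\<dots> \<le> \<theta> ^ J * (1 / (1 - \<theta>))" using \<theta> by (intro mult_left_mono divide_right_mono) auto
        finally show "(\<Sum>j\<in>{1..<t}. if J \<le> j then \<theta> ^ j else 0) \<le> \<theta> ^ J / (1 - \<theta>)" by simp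
      qed (use C AB r in auto)
      also have "\<dots> = (C + 1) * 8 * A / (1 - \<theta>) * (r * \<theta> ^ J) + 4 * (C + 1) * (B + 1) * (real t * r\<^sup>2)"
        by (simp add: mult.commute mult.left_commute)
      finally show ?thesis .
    qed
    have esum: "e m * (\<Sum>j\<in>{1..<t}. e (m + j)) \<le> 4 * (C + 1)\<^sup>2 * (real t * r\<^sup>2)" for m
    proof -
      have "(\<Sum>j\<in>{1..<t}. e (m + j)) \<le> (\<Sum>j\<in>{1..<t}. (C + 1) * (2 * r))" by (intro sum_mono e0)
      also have "\<dots> \<le> real t * ((C + 1) * (2 * r))" using C r by (simp add: mult_right_mono)
      finally have "e m * (\<Sum>j\<in>{1..<t}. e (m + j)) \<le> ((C + 1) * (2 * r)) * (real t * ((C + 1) * (2 * r)))"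
        using e0 C r by (intro mult_mono sum_nonneg) auto
      then show ?thesis by (simp add: power2_eq_square algebra_simps)
    qed
    define \<delta> where "\<delta> = K * (r * \<theta> ^ J + real t * r\<^sup>2 + \<theta> ^ t)"
    have step': "\<bar>F m - (1 - e m) * F (m + 1)\<bar> \<le> \<delta>" if m: "m < L" for m
    proof -
      let ?x = "r * \<theta> ^ J" and ?y = "real t * r\<^sup>2" and ?s = "\<theta> ^ t"
      have nn: "0 \<le> ?x" "0 \<le> ?y" "0 \<le> ?s" using r \<theta> by auto
      define k1 where "k1 = (C + 1) * 8 * A / (1 - \<theta>)"
      define k2 where "k2 = 4 * (C + 1) * (B + 1)"
      define k3 where "k3 = 4 * (C + 1)\<^sup>2"
      define k4 where "k4 = D * V"
      have kk: "0 \<le> k1" "0 \<le> k2" "0 \<le> k3" "0 \<le> k4" "K = k1 + k2 + k3 + k4"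
        using C AB D \<theta> by (auto simp: k1_def k2_def k3_def k4_def K_def V_def)
      have "v ^ t \<le> \<theta> ^ t" using \<theta> D by (intro power_mono) auto
      then have "D * v ^ t * V \<le> k4 * ?s" unfolding k4_def using D C by (simp add: V_def mult_right_mono mult_left_mono)
      then have "\<bar>F m - (1 - e m) * F (m + 1)\<bar> \<le> k1 * ?x + k2 * ?y + k4 * ?s + k3 * ?y"
        using step[OF m] qsum[of m] esum[of m] unfolding k1_def k2_def k3_def by linarith
      also have "\<dots> \<le> K * ?x + (k2 + k3) * ?y + K * ?s"
      proof -
        have "k1 * ?x \<le> K * ?x" "k4 * ?s \<le> K * ?s" using kk nn by (auto intro!: mult_right_mono)
        then show ?thesis by (simp add: algebra_simps)
      qed
      also have "\<dots> \<le> K * ?x + K * ?y + K * ?s"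
      proof -
        have "(k2 + k3) * ?y \<le> K * ?y" using kk nn by (intro mult_right_mono) auto
        then show ?thesis by simp
      qed
      finally show ?thesis unfolding \<delta>_def by (simp add: algebra_simps)
    qed
    have FL: "F L = 1" unfolding F_def P_def using good_integral[OF g] by simp
    \<comment> \<open>Backward induction from \<open>F L = 1\<close>: the one-step errors merely add
      up, because each is multiplied by factors \<open>1 - e m\<close> in
      \<open>[0,1]\<close>.\<close>
    have "\<bar>F (L - k) - (\<Prod>m\<in>{L - k..<L}. 1 - e m)\<bar> \<le> real k * \<delta>" if "k \<le> L" for k
      using that
    proof (induction k)
      case 0 then show ?case using FL by simp
    next
      case (Suc k)
      define m where "m = L - Suc k"
      have m: "m < L" "m + 1 = L - k" using Suc.prems by (auto simp: m_def)
      have IH: "\<bar>F (m + 1) - (\<Prod>i\<in>{m + 1..<L}. 1 - e i)\<bar> \<le> real k * \<delta>" using Suc m by simp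
      have "(\<Prod>i\<in>{m..<L}. 1 - e i) = (1 - e m) * (\<Prod>i\<in>{m + 1..<L}. 1 - e i)" using m(1) by (simp add: prod.atLeast_Suc_lessThan)
      then have "F m - (\<Prod>i\<in>{m..<L}. 1 - e i) = (F m - (1 - e m) * F (m + 1)) + (1 - e m) * (F (m + 1) - (\<Prod>i\<in>{m + 1..<L}. 1 - e i))"
        by (simp add: algebra_simps)
      moreover have "\<bar>(1 - e m) * (F (m + 1) - (\<Prod>i\<in>{m + 1..<L}. 1 - e i))\<bar> \<le> 1 * (real k * \<delta>)"
        unfolding abs_mult using IH e0[of m] by (intro mult_mono) auto
      ultimately have "\<bar>F m - (\<Prod>i\<in>{m..<L}. 1 - e i)\<bar> \<le> \<delta> + real k * \<delta>" using step'[OF m(1)] by linarith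
      then show ?case by (simp add: m_def algebra_simps)
    qed
    from this[of L] have fin: "\<bar>F 0 - (\<Prod>m<L. 1 - e m)\<bar> \<le> real L * \<delta>" by (simp add: lessThan_atLeast0)
    have "F 0 = (LINT x|leb. (\<Prod>i<L. 1 - \<xi> i (fi \<omega> i x)) * H \<omega> 0 x)"
      unfolding F_def P_def by (simp add: a_def lessThan_atLeast0)
    moreover have "(\<Prod>m<L. 1 - e m) = (\<Prod>m<L. 1 - (LINT x|leb. \<xi> m x * H \<omega> m x))"
      by (intro prod.cong) (auto simp: e_def a_def)
    ultimately show ?thesis using fin unfolding \<delta>_def by simp
  qed
  show ?thesis
  proof (rule exI[of _ K], intro conjI K0, rule exI[of _ \<theta>], intro conjI \<theta>(1,2) allI impI)
    fix \<omega> and z r :: real and L t J :: nat and \<xi> :: "nat \<Rightarrow> real \<Rightarrow> real"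
    assume "good C \<omega>" "0 < r" "\<forall>i<L. bump z r (\<xi> i) \<and> bvar 4 (\<xi> i)"
     "\<forall>\<omega> j x. 1 \<le> j \<longrightarrow> j < J \<longrightarrow> dist x z < r \<longrightarrow> r \<le> dist (fi \<omega> j x) z" "1 \<le> t"
    then show "\<bar>(LINT x|leb. (\<Prod>i<L. 1 - \<xi> i (fi \<omega> i x)) * H \<omega> 0 x) - (\<Prod>m<L. 1 - (LINT x|leb. \<xi> m x * H \<omega> m x))\<bar>
       \<le> real L * (K * (r * \<theta> ^ J + real t * r\<^sup>2 + \<theta> ^ t))"
      by (intro main) auto
  qed
qed

end

section \<open>The Laplace functional of the compound Poisson process\<close>

text \<open>Splits off the first coordinate of an i.i.d. sequence, which is the conditioning behind
  the renewal equation.\<close>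

lemma (in sequence_space) nn_integral_S_iter:
  assumes G[measurable]: "G \<in> borel_measurable S"
  shows "(\<integral>\<^sup>+\<omega>. G \<omega> \<partial>S) = (\<integral>\<^sup>+v. \<integral>\<^sup>+\<omega>. G (case_nat v \<omega>) \<partial>S \<partial>M)"
proof -
  have "(\<integral>\<^sup>+\<omega>. G \<omega> \<partial>S) = (\<integral>\<^sup>+\<omega>. G \<omega> \<partial>(distr (M \<Otimes>\<^sub>M S) S (\<lambda>(s, \<omega>). case_nat s \<omega>)))" by (simp only: PiM_iter)
  also have "\<dots> = (\<integral>\<^sup>+z. G (case z of (s, \<omega>) \<Rightarrow> case_nat s \<omega>) \<partial>(M \<Otimes>\<^sub>M S))"
    by (rule nn_integral_distr) auto
  also have "\<dots> = (\<integral>\<^sup>+v. \<integral>\<^sup>+\<omega>. G (case_nat v \<omega>) \<partial>S \<partial>M)"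
    by (subst P.nn_integral_fst[symmetric]) auto
  finally show ?thesis .
qed

abbreviation expo :: "real measure" where
  "expo \<equiv> density lborel (\<lambda>x. ennreal (exponential_density 1 x))"

lemma prob_space_expo: "prob_space expo"
  using prob_space_exponential_density[of 1] by simp

lemma nn_integral_expo:
  assumes "G \<in> borel_measurable borel"
  shows "(\<integral>\<^sup>+v. G v \<partial>expo) = (\<integral>\<^sup>+v. ennreal (exp (- v)) * G v * indicator {0..} v \<partial>lborel)"
  using assms by (subst nn_integral_density)
    (auto simp: exponential_density_def indicator_def intro!: nn_integral_cong)

lemma AE_expo_nonneg: "AE v in expo. 0 \<le> v"
  by (subst AE_density) (auto simp: exponential_density_def intro!: AE_I2)

lemma expo_tail: "0 \<le> b \<Longrightarrow> emeasure expo {b..} = ennreal (exp (- b))"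
proof -
  assume b: "0 \<le> b"
  have "emeasure expo {b..} = (\<integral>\<^sup>+v. indicator {b..} v \<partial>expo)" by simp
  also have "\<dots> = (\<integral>\<^sup>+v. ennreal (exp (- v)) * indicator {b..} v * indicator {0..} v \<partial>lborel)"
    by (rule nn_integral_expo) auto
  also have "\<dots> = (\<integral>\<^sup>+v. ennreal (exp (- v)) * indicator {b..} v \<partial>lborel)"
    using b by (intro nn_integral_cong) (auto simp: indicator_def)
  also have "\<dots> = ennreal (exp (- b))"
    using has_integral_exp_minus_to_infinity[of 1 b] by (intro nn_integral_has_integral_lebesgue') auto
  finally show ?thesis .
qed

lemma expo_lessThan: "0 \<le> b \<Longrightarrow> \<exists>r. 0 \<le> r \<and> r < 1 \<and> emeasure expo {..<b} = ennreal r"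
proof -
  assume b: "0 \<le> b"
  interpret prob_space expo by (rule prob_space_expo)
  have "prob {b..} = exp (- b)" using expo_tail[OF b] by (simp add: measure_def)
  moreover have "prob (space expo - {b..}) = 1 - prob {b..}" by (rule prob_compl) simp
  moreover have "space expo - {b..} = {..<b}" by auto
  ultimately have "prob {..<b} = 1 - exp (- b)" by simp
  then have "emeasure expo {..<b} = ennreal (1 - exp (- b))" by (simp add: emeasure_eq_measure)
  then show ?thesis using b by (intro exI[of _ "1 - exp (- b)"]) auto
qed

locale renewal_marks =
  fixes D :: "real measure"
  assumes D: "prob_space D" "sets D = sets borel" "AE d in D. 0 \<le> d"
begin

sublocale D: prob_space D by (rule D)
sublocale E: prob_space expo by (rule prob_space_expo)
sublocale SE: sequence_space expo ..
sublocale SD: sequence_space D ..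

abbreviation W :: "((nat \<Rightarrow> real) \<times> (nat \<Rightarrow> real)) measure" where "W \<equiv> SE.S \<Otimes>\<^sub>M SD.S"

sublocale PSF: pair_sigma_finite SE.S SD.S ..

sublocale WW: prob_space W by (rule prob_space_pair) unfold_locales

lemma space_D [simp]: "space D = UNIV" using sets_eq_imp_space_eq[OF D(2)] by simp

lemma meas_e[measurable]: "(\<lambda>e. e i) \<in> borel_measurable SE.S"
  using measurable_component_singleton[of i UNIV "\<lambda>_. expo"] by simp

lemma meas_d[measurable]: "(\<lambda>d. d i) \<in> borel_measurable SD.S"
  using measurable_component_singleton[of i UNIV "\<lambda>_. D"] measurable_cong_sets[OF refl D(2)] by blast

text \<open>The marks of the first \<open>N\<close> points of the renewal process started at
  \<open>x\<close>, weighted by \<open>s\<close> at their positions. Truncation makes the sum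
  finite, and the free starting point makes it recursive.\<close>

definition T :: "(real \<Rightarrow> real) \<Rightarrow> nat \<Rightarrow> real \<Rightarrow> (nat \<Rightarrow> real) \<Rightarrow> (nat \<Rightarrow> real) \<Rightarrow> real" where
  "T s N x e d = (\<Sum>i<N. d i * s (x + (\<Sum>k\<le>i. e k)))"

lemma T_Suc: "T s (Suc N) x (case_nat v e) (case_nat c d) = c * s (x + v) + T s N (x + v) e d"
proof -
  have "(\<Sum>k\<le>Suc i. case_nat v e k) = v + (\<Sum>k\<le>i. e k)" for i by (subst sum.atMost_Suc_shift) simp
  then show ?thesis unfolding T_def sum.lessThan_Suc_shift by (simp add: add.assoc del: sum.atMost_Suc)
qed

definition Phi :: "(real \<Rightarrow> real) \<Rightarrow> nat \<Rightarrow> real \<Rightarrow> ennreal" where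
  "Phi s N x = (\<integral>\<^sup>+e. \<integral>\<^sup>+d. ennreal (exp (- T s N x e d)) \<partial>SD.S \<partial>SE.S)"

lemma Phi_meas[measurable]:
  assumes [measurable]: "s \<in> borel_measurable borel"
  shows "Phi s N \<in> borel_measurable borel"
proof -
  have 1: "(\<lambda>z. ennreal (exp (- T s N (fst (fst z)) (snd (fst z)) (snd z)))) \<in> borel_measurable ((borel \<Otimes>\<^sub>M SE.S) \<Otimes>\<^sub>M SD.S)"
    unfolding T_def by measurable
  have 2: "(\<lambda>y. \<integral>\<^sup>+d. ennreal (exp (- T s N (fst y) (snd y) d)) \<partial>SD.S) \<in> borel_measurable (borel \<Otimes>\<^sub>M SE.S)"
    by (rule SD.P.borel_measurable_nn_integral) (use 1 in \<open>simp add: split_beta'\<close>)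
  show ?thesis unfolding Phi_def[abs_def]
    by (rule SE.P.borel_measurable_nn_integral) (use 2 in \<open>simp add: split_beta'\<close>)
qed

definition lap :: "real \<Rightarrow> real" where "lap t = (LINT d|D. exp (- t * d))"

lemma lap_bounds: assumes "0 \<le> t" shows "0 \<le> lap t" "lap t \<le> 1" "(\<integral>\<^sup>+c. ennreal (exp (- (c * t))) \<partial>D) = ennreal (lap t)"
proof -
  have [measurable]: "(\<lambda>d. exp (- t * d)) \<in> borel_measurable D"
    by (subst measurable_cong_sets[OF D(2) refl]) measurable
  then have m': "(\<lambda>d. exp (- (t * d))) \<in> borel_measurable D" by simp
  have ae: "AE d in D. exp (- t * d) \<le> 1"
    using D(3) by (rule AE_mp) (use assms in \<open>auto intro!: AE_I2\<close>)
  have i: "integrable D (\<lambda>d. exp (- t * d))"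
    by (rule D.integrable_const_bound[where B = 1]) (use ae m' in auto)
  show "0 \<le> lap t" unfolding lap_def by (intro integral_nonneg_AE) auto
  have "lap t \<le> (LINT d|D. 1)" unfolding lap_def using i ae by (intro integral_mono_AE) auto
  then show "lap t \<le> 1" using D.prob_space by simp
  show "(\<integral>\<^sup>+c. ennreal (exp (- (c * t))) \<partial>D) = ennreal (lap t)"
    using nn_integral_eq_integral[OF i] by (simp add: lap_def mult.commute)
qed

text \<open>The renewal equation: condition on the first waiting time \<open>v\<close> and the first
  mark. The mark integrates to \<open>lap\<close>, and the remaining points form a process started
  at \<open>x + v\<close>.\<close>

lemma Phi_Suc:
  assumes s[measurable]: "s \<in> borel_measurable borel" and s0: "\<And>u. 0 \<le> s u"
  shows "Phi s (Suc N) x = (\<integral>\<^sup>+v. ennreal (lap (s (x + v))) * Phi s N (x + v) \<partial>expo)"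
proof -
  have m[measurable]: "(\<lambda>(e, d). T s n y e d) \<in> borel_measurable (SE.S \<Otimes>\<^sub>M SD.S)" for n y
    unfolding T_def split_beta' by measurable
  have m2[measurable]: "(\<lambda>d. T s n y e d) \<in> borel_measurable SD.S" for n y e
    unfolding T_def by measurable
  have inner: "(\<integral>\<^sup>+d. ennreal (exp (- T s (Suc N) x (case_nat v e) d)) \<partial>SD.S)
     = ennreal (lap (s (x + v))) * (\<integral>\<^sup>+d. ennreal (exp (- T s N (x + v) e d)) \<partial>SD.S)" for v e
  proof -
    have "(\<integral>\<^sup>+d. ennreal (exp (- T s (Suc N) x (case_nat v e) d)) \<partial>SD.S)
      = (\<integral>\<^sup>+c. \<integral>\<^sup>+d. ennreal (exp (- T s (Suc N) x (case_nat v e) (case_nat c d))) \<partial>SD.S \<partial>D)"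
      by (rule SD.nn_integral_S_iter) measurable
    also have "\<dots> = (\<integral>\<^sup>+c. \<integral>\<^sup>+d. ennreal (exp (- (c * s (x + v)))) * ennreal (exp (- T s N (x + v) e d)) \<partial>SD.S \<partial>D)"
      by (simp add: T_Suc exp_add[symmetric] exp_diff[symmetric] ennreal_mult'[symmetric])
    also have "\<dots> = (\<integral>\<^sup>+c. ennreal (exp (- (c * s (x + v)))) * (\<integral>\<^sup>+d. ennreal (exp (- T s N (x + v) e d)) \<partial>SD.S) \<partial>D)"
      by (intro nn_integral_cong nn_integral_cmult) measurable
    also have "\<dots> = (\<integral>\<^sup>+c. ennreal (exp (- (c * s (x + v)))) \<partial>D) * (\<integral>\<^sup>+d. ennreal (exp (- T s N (x + v) e d)) \<partial>SD.S)"
    proof (rule nn_integral_multc)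
      show "(\<lambda>c. ennreal (exp (- (c * s (x + v))))) \<in> borel_measurable D"
        by (subst measurable_cong_sets[OF D(2) refl]) measurable
    qed
    finally show ?thesis using lap_bounds(3)[OF s0] by simp
  qed
  have "Phi s (Suc N) x = (\<integral>\<^sup>+v. \<integral>\<^sup>+e. \<integral>\<^sup>+d. ennreal (exp (- T s (Suc N) x (case_nat v e) d)) \<partial>SD.S \<partial>SE.S \<partial>expo)"
    unfolding Phi_def by (rule SE.nn_integral_S_iter) measurable
  also have "\<dots> = (\<integral>\<^sup>+v. ennreal (lap (s (x + v))) * Phi s N (x + v) \<partial>expo)"
    unfolding inner Phi_def by (intro nn_integral_cong nn_integral_cmult) measurable
  finally show ?thesis .
qed

lemma Phi_0: "Phi s 0 x = 1"
  by (simp add: Phi_def T_def SD.P.emeasure_space_1 SE.P.emeasure_space_1)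

lemma Phi_beyond:
  assumes s: "\<And>u. b \<le> u \<Longrightarrow> s u = 0" and x: "b \<le> x"
  shows "Phi s N x = 1"
proof -
  have "AE e in SE.S. \<forall>i. 0 \<le> e i"
  proof (subst AE_all_countable, rule allI)
    fix i
    have "AE v in distr SE.S expo (\<lambda>e. e i). 0 \<le> v" unfolding SE.PiM_component[OF UNIV_I] by (rule AE_expo_nonneg)
    then show "AE e in SE.S. 0 \<le> e i" by (subst (asm) AE_distr_iff) (auto intro: measurable_component_singleton)
  qed
  then have "Phi s N x = (\<integral>\<^sup>+e. 1 \<partial>SE.S)" unfolding Phi_def
  proof (intro nn_integral_cong_AE, elim AE_mp, intro AE_I2 impI)
    fix e :: "nat \<Rightarrow> real" assume e: "\<forall>i. 0 \<le> e i"
    have "s (x + (\<Sum>k\<le>i. e k)) = 0" for i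
      using x sum_nonneg[of "{..i}" e] e by (intro s) (auto intro: add_increasing2)
    then have "T s N x e d = 0" for d by (simp add: T_def)
    then show "(\<integral>\<^sup>+d. ennreal (exp (- T s N x e d)) \<partial>SD.S) = 1" by (simp add: SD.P.emeasure_space_1)
  qed
  then show ?thesis by (simp add: SE.P.emeasure_space_1)
qed

text \<open>The difference between \<open>Phi s N\<close> and a fixed point lives on
  \<open>x < b\<close>. To survive one further step it needs a waiting time below \<open>b\<close>,
  whose probability is \<open>r < 1\<close>, so it shrinks like \<open>r ^ N\<close>.\<close>

lemma fixpoint_sandwich:
  assumes s[measurable]: "s \<in> borel_measurable borel" and s0: "\<And>u. 0 \<le> s u" and sb: "\<And>u. b \<le> u \<Longrightarrow> s u = 0" and b: "0 \<le> b"
    and \<Psi>[measurable]: "\<Psi> \<in> borel_measurable borel" and \<Psi>01: "\<And>u. 0 \<le> \<Psi> u" "\<And>u. \<Psi> u \<le> 1" and \<Psi>b: "\<And>u. b \<le> u \<Longrightarrow> \<Psi> u = 1"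
    and fp: "\<And>x. 0 \<le> x \<Longrightarrow> (\<integral>\<^sup>+v. ennreal (lap (s (x + v))) * ennreal (\<Psi> (x + v)) \<partial>expo) = ennreal (\<Psi> x)"
    and x: "0 \<le> x"
  shows "(\<lambda>N. Phi s N x) \<longlonglongrightarrow> ennreal (\<Psi> x)"
proof -
  obtain r where r: "0 \<le> r" "r < 1" "emeasure expo {..<b} = ennreal r" using expo_lessThan[OF b] by blast
  have lapm[measurable]: "(\<lambda>u. lap (s u)) \<in> borel_measurable borel"
  proof -
    have "(\<lambda>(u, d). exp (- (s u) * d)) \<in> borel_measurable (borel \<Otimes>\<^sub>M D)"
      by (subst measurable_cong_sets[OF sets_pair_measure_cong[OF refl D(2)] refl]) measurable
    from D.borel_measurable_lebesgue_integral[OF this] show ?thesis by (simp add: lap_def)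
  qed
  have sand: "ennreal (\<Psi> x) \<le> Phi s N x \<and> Phi s N x \<le> ennreal (\<Psi> x) + ennreal (r ^ N) * indicator {..<b} x" if "0 \<le> x" for N x
    using that
  proof (induction N arbitrary: x)
    case 0
    have "ennreal (\<Psi> x) \<le> 1" using \<Psi>01 by simp
    then show ?case using \<Psi>b[of x] by (cases "x < b") (auto simp: Phi_0 add_increasing)
  next
    case (Suc N)
    have lower: "ennreal (\<Psi> x) \<le> Phi s (Suc N) x"
    proof -
      have "ennreal (\<Psi> x) = (\<integral>\<^sup>+v. ennreal (lap (s (x + v))) * ennreal (\<Psi> (x + v)) \<partial>expo)" using fp[OF Suc.prems] by simp
      also have "\<dots> \<le> (\<integral>\<^sup>+v. ennreal (lap (s (x + v))) * Phi s N (x + v) \<partial>expo)"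
        by (rule nn_integral_mono_AE, rule AE_mp[OF AE_expo_nonneg]) (use Suc in \<open>auto intro!: AE_I2 mult_left_mono\<close>)
      finally show ?thesis by (simp add: Phi_Suc[OF s s0])
    qed
    have upper: "Phi s (Suc N) x \<le> ennreal (\<Psi> x) + ennreal (r ^ Suc N) * indicator {..<b} x"
    proof (cases "x < b")
      case False
      then show ?thesis using Phi_beyond[OF sb, where x = x and N = "Suc N"] \<Psi>b[of x] by simp
    next
      case True
      have "Phi s (Suc N) x \<le> (\<integral>\<^sup>+v. ennreal (lap (s (x + v))) * ennreal (\<Psi> (x + v)) + ennreal (r ^ N) * indicator {..<b} v \<partial>expo)"
        unfolding Phi_Suc[OF s s0]
      proof (rule nn_integral_mono_AE, rule AE_mp[OF AE_expo_nonneg], intro AE_I2 impI)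
        fix v :: real assume v: "0 \<le> v"
        have l1: "ennreal (lap (s (x + v))) \<le> 1" using lap_bounds(2)[OF s0] by simp
        have "ennreal (lap (s (x + v))) * Phi s N (x + v) \<le> ennreal (lap (s (x + v))) * (ennreal (\<Psi> (x + v)) + ennreal (r ^ N) * indicator {..<b} (x + v))"
          using Suc.IH[of "x + v"] Suc.prems v by (intro mult_left_mono) auto
        also have "\<dots> = ennreal (lap (s (x + v))) * ennreal (\<Psi> (x + v)) + ennreal (lap (s (x + v))) * (ennreal (r ^ N) * indicator {..<b} (x + v))"
          by (simp add: distrib_left)
        also have "\<dots> \<le> ennreal (lap (s (x + v))) * ennreal (\<Psi> (x + v)) + 1 * (ennreal (r ^ N) * indicator {..<b} v)"
          using l1 Suc.prems by (intro add_left_mono mult_mono) (auto simp: indicator_def)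
        finally show "ennreal (lap (s (x + v))) * Phi s N (x + v) \<le> ennreal (lap (s (x + v))) * ennreal (\<Psi> (x + v)) + ennreal (r ^ N) * indicator {..<b} v" by simp
      qed
      also have "\<dots> = (\<integral>\<^sup>+v. ennreal (lap (s (x + v))) * ennreal (\<Psi> (x + v)) \<partial>expo) + (\<integral>\<^sup>+v. ennreal (r ^ N) * indicator {..<b} v \<partial>expo)"
      proof (rule nn_integral_add)
        have "(\<lambda>v. lap (s (x + v))) \<in> borel_measurable borel" by (rule measurable_compose[OF _ lapm]) simp
        moreover have "(\<lambda>v. \<Psi> (x + v)) \<in> borel_measurable borel" by (rule measurable_compose[OF _ \<Psi>]) simp
        ultimately show "(\<lambda>v. ennreal (lap (s (x + v))) * ennreal (\<Psi> (x + v))) \<in> borel_measurable expo" by simp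
      qed simp
      also have "(\<integral>\<^sup>+v. ennreal (r ^ N) * indicator {..<b} v \<partial>expo) = ennreal (r ^ N) * emeasure expo {..<b}"
        by (rule nn_integral_cmult_indicator) simp
      also have "\<dots> = ennreal (r ^ Suc N)" using r by (simp add: ennreal_mult''[symmetric] mult.commute)
      finally show ?thesis using fp[OF Suc.prems] True by simp
    qed
    show ?case using lower upper by simp
  qed
  show ?thesis
  proof (rule tendsto_sandwich)
    show "\<forall>\<^sub>F N in sequentially. ennreal (\<Psi> x) \<le> Phi s N x" using sand[OF x] by simp
    show "\<forall>\<^sub>F N in sequentially. Phi s N x \<le> ennreal (\<Psi> x + r ^ N)"
    proof (intro always_eventually allI)
      fix N
      have "Phi s N x \<le> ennreal (\<Psi> x) + ennreal (r ^ N) * indicator {..<b} x" using sand[OF x] by simp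
      also have "\<dots> \<le> ennreal (\<Psi> x) + ennreal (r ^ N) * 1" by (intro add_left_mono mult_left_mono) (auto simp: indicator_def)
      also have "\<dots> = ennreal (\<Psi> x + r ^ N)" using r \<Psi>01 by simp
      finally show "Phi s N x \<le> ennreal (\<Psi> x + r ^ N)" .
    qed
    have "(\<lambda>N. \<Psi> x + r ^ N) \<longlonglongrightarrow> \<Psi> x + 0" using r by (intro tendsto_intros LIMSEQ_realpow_zero) auto
    then show "(\<lambda>N. ennreal (\<Psi> x + r ^ N)) \<longlonglongrightarrow> ennreal (\<Psi> x)" by (intro tendsto_ennrealI) simp
  qed simp
qed

text \<open>One waiting time of length at least \<open>b\<close> suffices, and all of the first
  \<open>n\<close> stay below it with probability \<open>r ^ n\<close> only.\<close>

lemma AE_renewal_passes: "AE e in SE.S. (\<forall>i. 0 \<le> e i) \<and> (\<exists>n. \<forall>i\<ge>n. b \<le> (\<Sum>k\<le>i. e k))"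
proof -
  define c where "c = max 0 b"
  obtain r where r: "0 \<le> r" "r < 1" "emeasure expo {..<c} = ennreal r" using expo_lessThan[of c] by (auto simp: c_def)
  have 1: "AE e in SE.S. \<forall>i. 0 \<le> e i"
  proof (subst AE_all_countable, rule allI)
    fix i
    have "AE v in distr SE.S expo (\<lambda>e. e i). 0 \<le> v" unfolding SE.PiM_component[OF UNIV_I] by (rule AE_expo_nonneg)
    then show "AE e in SE.S. 0 \<le> e i" by (subst (asm) AE_distr_iff) (auto intro: measurable_component_singleton)
  qed
  define A where "A = {e \<in> space SE.S. \<forall>i. e i \<in> {..<c}}"
  have Am: "A \<in> sets SE.S" unfolding A_def by measurable
  have "emeasure SE.S A \<le> ennreal (r ^ n)" for n
  proof -
    have "emeasure SE.S A \<le> emeasure SE.S {e \<in> space SE.S. \<forall>i\<in>{..<n}. e i \<in> {..<c}}"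
      unfolding A_def by (rule emeasure_mono) (auto, measurable)
    also have "\<dots> = (\<Prod>i\<in>{..<n}. emeasure expo {..<c})" by (rule SE.emeasure_PiM_Collect) auto
    also have "\<dots> = ennreal (r ^ n)" using r by (simp add: ennreal_power)
    finally show ?thesis .
  qed
  moreover have "(\<lambda>n. ennreal (r ^ n)) \<longlonglongrightarrow> ennreal 0" using r by (intro tendsto_ennrealI LIMSEQ_realpow_zero) auto
  ultimately have "emeasure SE.S A \<le> 0" by (intro LIMSEQ_le_const[of "\<lambda>n. ennreal (r ^ n)"]) auto
  then have "AE e in SE.S. e \<notin> A" using Am by (intro AE_not_in) (auto simp: null_sets_def)
  with 1 show ?thesis
  proof eventually_elim
    case (elim e)
    then have "e \<notin> A" by blast
    then obtain n where n: "c \<le> e n" unfolding A_def by (auto simp: space_PiM not_less)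
    have "b \<le> (\<Sum>k\<le>i. e k)" if "n \<le> i" for i
    proof -
      have "e n \<le> (\<Sum>k\<le>i. e k)" using elim(1) that by (intro member_le_sum) auto
      then show ?thesis using n by (simp add: c_def)
    qed
    then show ?case using elim(1) by blast
  qed
qed

lemma AE_marks_nonneg: "AE d in SD.S. \<forall>i. 0 \<le> d i"
proof (subst AE_all_countable, rule allI)
  fix i
  have "AE v in distr SD.S D (\<lambda>d. d i). 0 \<le> v" unfolding SD.PiM_component[OF UNIV_I] by (rule D(3))
  then show "AE d in SD.S. 0 \<le> d i" by (subst (asm) AE_distr_iff) (auto intro: measurable_component_singleton simp: D(2) pred_def)
qed

lemma cpp_measurable:
  assumes [measurable]: "J \<in> sets borel" shows "cpp J \<in> borel_measurable W"
  unfolding cpp_def split_beta' by measurable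

lemma AE_cpp_regular: "AE w in W. (\<forall>i. 0 \<le> fst w i \<and> 0 \<le> snd w i) \<and> (\<exists>n. \<forall>i\<ge>n. b \<le> (\<Sum>k\<le>i. fst w k))"
proof -
  have "AE w in W. (\<forall>i. 0 \<le> fst w i) \<and> (\<exists>n. \<forall>i\<ge>n. b \<le> (\<Sum>k\<le>i. fst w k))"
  proof (rule PSF.AE_pair_measure)
    show "{w \<in> space W. (\<forall>i. 0 \<le> fst w i) \<and> (\<exists>n. \<forall>i\<ge>n. b \<le> (\<Sum>k\<le>i. fst w k))} \<in> sets W" by measurable
    show "AE e in SE.S. AE d in SD.S. (\<forall>i. 0 \<le> fst (e, d) i) \<and> (\<exists>n. \<forall>i\<ge>n. b \<le> (\<Sum>k\<le>i. fst (e, d) k))"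
      using AE_renewal_passes[of b] by eventually_elim simp
  qed
  moreover have "AE w in W. \<forall>i. 0 \<le> snd w i"
  proof (rule PSF.AE_pair_measure)
    show "{w \<in> space W. \<forall>i. 0 \<le> snd w i} \<in> sets W" by measurable
    show "AE e in SE.S. AE d in SD.S. \<forall>i. 0 \<le> snd (e, d) i" using AE_marks_nonneg by simp
  qed
  ultimately show ?thesis by eventually_elim auto
qed

text \<open>The candidate fixed point is \<open>\<Psi> = exp (- I)\<close>, where \<open>I u\<close>
  integrates \<open>1 - lap (s w)\<close> over \<open>w \<ge> u\<close>. The derivative of
  \<open>- exp (- v) * \<Psi> (x + v)\<close> in \<open>v\<close> is
  \<open>exp (- v) * lap (s (x + v)) * \<Psi> (x + v)\<close>, so integrating it is exactly the
  renewal equation. The formula is its value at 0.\<close>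

theorem cpp_laplace:
  fixes a b t :: "nat \<Rightarrow> real"
  assumes ab: "\<And>j. j < k \<Longrightarrow> 0 \<le> a j \<and> a j < b j" and dj: "disjoint_family_on (\<lambda>j. {a j..<b j}) {..<k}"
    and t: "\<And>j. j < k \<Longrightarrow> 0 \<le> t j"
  shows "(LINT w|W. exp (- (\<Sum>j<k. t j * cpp {a j..<b j} w))) = exp (- (\<Sum>j<k. (b j - a j) * (1 - lap (t j))))"
    and "AE w in W. \<forall>j<k. 0 \<le> cpp {a j..<b j} w"
proof -
  define s where "s u = (\<Sum>j<k. t j * indicator {a j..<b j} u)" for u
  have sm[measurable]: "s \<in> borel_measurable borel" unfolding s_def by measurable
  have s0: "0 \<le> s u" for u unfolding s_def using t by (intro sum_nonneg) auto
  define c where "c = (\<Sum>j<k. b j)"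
  have bc: "b j \<le> c" if "j < k" for j unfolding c_def using that ab by (intro member_le_sum) (auto intro: less_imp_le order_trans)
  have c0: "0 \<le> c" unfolding c_def using ab by (intro sum_nonneg) (auto intro: less_imp_le order_trans)
  have sc: "s u = 0" if "c \<le> u" for u unfolding s_def using that bc by (intro sum.neutral) (force simp: indicator_def)
  have lap0: "lap 0 = 1" using D.prob_space by (simp add: lap_def)
  have laps: "lap (s u) = 1 - (\<Sum>j<k. (1 - lap (t j)) * indicator {a j..<b j} u)" for u
  proof (cases "\<exists>i<k. u \<in> {a i..<b i}")
    case True
    then obtain i where i: "i < k" "u \<in> {a i..<b i}" by blast
    have o: "u \<notin> {a j..<b j}" if "j < k" "j \<noteq> i" for j using dj i that unfolding disjoint_family_on_def by blast
    have sing: "(\<Sum>j<k. g j * indicator {a j..<b j} u) = g i" for g :: "nat \<Rightarrow> real"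
    proof -
      have "(\<Sum>j<k. g j * indicator {a j..<b j} u) = (\<Sum>j\<in>{..<k}. if j = i then g i else 0)"
        using i o by (intro sum.cong) (auto simp: indicator_def)
      then show ?thesis using i by simp
    qed
    show ?thesis unfolding s_def sing by simp
  next
    case False
    then have "(\<Sum>j<k. g j * indicator {a j..<b j} u) = 0" for g :: "nat \<Rightarrow> real" by (intro sum.neutral) (auto simp: indicator_def)
    then show ?thesis unfolding s_def by (simp add: lap0)
  qed
  \<comment> \<open>\<open>max (b j) u - max (a j) u\<close> is the length of the part of the
    interval \<open>j\<close> to the right of \<open>u\<close>.\<close>
  define I where "I u = (\<Sum>j<k. (1 - lap (t j)) * (max (b j) u - max (a j) u))" for u
  define \<Psi> where "\<Psi> u = exp (- I u)" for u
  have q: "0 \<le> 1 - lap (t j)" if "j < k" for j using lap_bounds(2)[OF t[OF that]] by simp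
  have I0: "0 \<le> I u" for u unfolding I_def using q ab by (intro sum_nonneg mult_nonneg_nonneg) (force simp: max_def)+
  have Ic: "I u = 0" if "c \<le> u" for u unfolding I_def
    using that bc ab by (intro sum.neutral) (force simp: max_def)
  have contI: "continuous_on UNIV I" unfolding I_def by (intro continuous_intros)
  have cont\<Psi>: "continuous_on UNIV \<Psi>" unfolding \<Psi>_def by (intro continuous_intros contI)
  have \<Psi>m: "\<Psi> \<in> borel_measurable borel" using cont\<Psi> by (rule borel_measurable_continuous_onI)
  have derI: "(I has_real_derivative - (\<Sum>j<k. (1 - lap (t j)) * indicator {a j..<b j} u)) (at u)"
    if u: "u \<notin> a ` {..<k} \<union> b ` {..<k}" for u
  proof -
    have dmax: "((\<lambda>u. max c u) has_real_derivative (if c < u then 1 else 0)) (at u)" if "u \<noteq> c" for c u :: real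
    proof (cases "c < u")
      case True
      have "((\<lambda>u. u) has_real_derivative 1) (at u)" by (auto intro!: derivative_eq_intros)
      then have "((\<lambda>u. max c u) has_real_derivative 1) (at u)"
        by (rule has_field_derivative_transform_within_open[of _ _ _ "{c<..}"]) (use True in auto)
      then show ?thesis using True by simp
    next
      case False
      have "((\<lambda>u. c) has_real_derivative 0) (at u)" by (auto intro!: derivative_eq_intros)
      then have "((\<lambda>u. max c u) has_real_derivative 0) (at u)"
        by (rule has_field_derivative_transform_within_open[of _ _ _ "{..<c}"]) (use False that in auto)
      then show ?thesis using False by simp
    qed
    have d1: "((\<lambda>u. (1 - lap (t j)) * (max (b j) u - max (a j) u)) has_real_derivative
        - ((1 - lap (t j)) * indicator {a j..<b j} u)) (at u)" if j: "j < k" for j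
    proof -
      have "u \<noteq> a j" "u \<noteq> b j" using u j by auto
      from DERIV_cmult[OF DERIV_diff[OF dmax[OF this(2)] dmax[OF this(1)]], of "1 - lap (t j)"]
      show ?thesis
        by (rule DERIV_cong) (use \<open>u \<noteq> a j\<close> \<open>u \<noteq> b j\<close> ab[OF j] in \<open>auto simp: indicator_def\<close>)
    qed
    show ?thesis unfolding I_def sum_negf[symmetric] by (rule DERIV_sum) (use d1 in auto)
  qed
  have fp: "(\<integral>\<^sup>+v. ennreal (lap (s (x + v))) * ennreal (\<Psi> (x + v)) \<partial>expo) = ennreal (\<Psi> x)" if x: "0 \<le> x" for x
  proof -
    have lapm[measurable]: "(\<lambda>u. lap (s u)) \<in> borel_measurable borel" unfolding laps by measurable
    note [measurable] = \<Psi>m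
    \<comment> \<open>From \<open>v = M\<close> on, \<open>x + v\<close> has passed all intervals,
      so \<open>lap (s (x + v))\<close> and \<open>\<Psi> (x + v)\<close> are 1 and the integrand is
      plainly \<open>exp (- v)\<close>.\<close>
    define M where "M = max 0 (c - x)"
    define g where "g v = exp (- v) * (lap (s (x + v)) * \<Psi> (x + v))" for v
    have g0: "0 \<le> g v" for v unfolding g_def \<Psi>_def using lap_bounds(1)[OF s0] by simp
    have "(g has_integral (- exp (- M) * \<Psi> (x + M)) - (- exp (- 0) * \<Psi> (x + 0))) {0..M}"
    proof (rule fundamental_theorem_of_calculus_interior_strong[where S = "(\<lambda>u. u - x) ` (a ` {..<k} \<union> b ` {..<k})"])
      show "continuous_on {0..M} (\<lambda>v. - exp (- v) * \<Psi> (x + v))"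
        by (intro continuous_intros continuous_on_compose2[OF cont\<Psi>]) auto
      fix v assume v: "v \<in> {0<..<M} - (\<lambda>u. u - x) ` (a ` {..<k} \<union> b ` {..<k})"
      have nin: "x + v \<notin> a ` {..<k} \<union> b ` {..<k}"
      proof
        assume "x + v \<in> a ` {..<k} \<union> b ` {..<k}"
        then have "(x + v) - x \<in> (\<lambda>u. u - x) ` (a ` {..<k} \<union> b ` {..<k})" by (rule imageI)
        then show False using v by simp
      qed
      have dI: "((\<lambda>v. I (x + v)) has_real_derivative - (\<Sum>j<k. (1 - lap (t j)) * indicator {a j..<b j} (x + v))) (at v)"
        using derI[OF nin] by (simp add: DERIV_shift[of I _ v x, symmetric] add.commute)
      have "((\<lambda>v. - exp (- v) * \<Psi> (x + v)) has_real_derivative g v) (at v)"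
        unfolding \<Psi>_def g_def laps
        by (rule derivative_eq_intros dI refl | simp)+ (simp add: algebra_simps)
      then show "((\<lambda>v. - exp (- v) * \<Psi> (x + v)) has_vector_derivative g v) (at v)"
        by (simp add: has_real_derivative_iff_has_vector_derivative)
    qed (auto simp: M_def)
    moreover have "(g has_integral exp (- M)) {M..}"
    proof (rule has_integral_eq[of _ "\<lambda>v. exp (- 1 * v)"])
      show "((\<lambda>v. exp (- 1 * v)) has_integral exp (- M)) {M..}" using has_integral_exp_minus_to_infinity[of 1 M] by simp
      fix v assume "v \<in> {M..}"
      then have "c \<le> x + v" by (auto simp: M_def)
      then show "exp (- 1 * v) = g v" using sc Ic by (simp add: g_def \<Psi>_def lap0)
    qed
    ultimately have "(g has_integral ((- exp (- M) * \<Psi> (x + M)) - (- exp (- 0) * \<Psi> (x + 0))) + exp (- M)) ({0..M} \<union> {M..})"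
    proof (rule has_integral_Un)
      have "{0..M} \<inter> {M..} = {M}" by (auto simp: M_def)
      then show "negligible ({0..M} \<inter> {M..})" by simp
    qed
    moreover have "{0..M} \<union> {M..} = {0..}" by (auto simp: M_def)
    moreover have "\<Psi> (x + M) = 1"
    proof -
      have "c \<le> x + M" by (auto simp: M_def)
      then show ?thesis using Ic by (simp add: \<Psi>_def)
    qed
    ultimately have gi: "(g has_integral \<Psi> x) {0..}" by simp
    have "(\<integral>\<^sup>+v. ennreal (lap (s (x + v))) * ennreal (\<Psi> (x + v)) \<partial>expo)
       = (\<integral>\<^sup>+v. ennreal (exp (- v)) * (ennreal (lap (s (x + v))) * ennreal (\<Psi> (x + v))) * indicator {0..} v \<partial>lborel)"
      by (rule nn_integral_expo) measurable
    also have "\<dots> = (\<integral>\<^sup>+v. ennreal (g v) * indicator {0..} v \<partial>lborel)"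
      using lap_bounds(1)[OF s0] by (intro nn_integral_cong) (simp add: g_def \<Psi>_def ennreal_mult)
    also have "\<dots> = ennreal (\<Psi> x)" by (rule nn_integral_has_integral_lebesgue'[OF g0 gi])
    finally show ?thesis .
  qed
  have lim1: "(\<lambda>N. Phi s N 0) \<longlonglongrightarrow> ennreal (\<Psi> 0)"
    by (rule fixpoint_sandwich[OF sm s0 sc c0 \<Psi>m _ _ _ fp]) (auto simp: \<Psi>_def I0 Ic)
  have Tm: "(\<lambda>w. T s N 0 (fst w) (snd w)) \<in> borel_measurable W" for N
    unfolding T_def by measurable
  have T0: "AE w in W. 0 \<le> T s N 0 (fst w) (snd w)" for N
    using AE_cpp_regular[of c] by (rule AE_mp) (auto intro!: AE_I2 sum_nonneg mult_nonneg_nonneg s0 simp: T_def)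
  have iT: "integrable W (\<lambda>w. exp (- T s N 0 (fst w) (snd w)))" for N
    by (rule WW.integrable_const_bound[where B = 1, OF AE_mp[OF T0[of N]]]) (use Tm in \<open>auto intro!: AE_I2\<close>)
  have PhiW: "Phi s N 0 = ennreal (LINT w|W. exp (- T s N 0 (fst w) (snd w)))" for N
  proof -
    have "Phi s N 0 = (\<integral>\<^sup>+w. ennreal (exp (- T s N 0 (fst w) (snd w))) \<partial>W)"
      unfolding Phi_def using Tm[of N] by (subst SD.P.nn_integral_fst[symmetric]) auto
    then show ?thesis using nn_integral_eq_integral[OF iT] by simp
  qed
  \<comment> \<open>Almost surely all points below \<open>c\<close> are among finitely many; from
    there on the truncation is exact and the infinite sum in \<open>cpp\<close> is finite.\<close>
  have key: "\<exists>n. \<forall>N\<ge>n. T s N 0 (fst w) (snd w) = (\<Sum>j<k. t j * cpp {a j..<b j} w)" "\<forall>j<k. 0 \<le> cpp {a j..<b j} w"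
    if w: "(\<forall>i. 0 \<le> fst w i \<and> 0 \<le> snd w i) \<and> (\<exists>n. \<forall>i\<ge>n. c \<le> (\<Sum>k\<le>i. fst w k))" for w
  proof -
    obtain n where n: "\<And>i. n \<le> i \<Longrightarrow> c \<le> (\<Sum>k\<le>i. fst w k)" using w by blast
    let ?S = "\<lambda>i. \<Sum>k\<le>i. fst w k"
    have cppN: "cpp {a j..<b j} w = (\<Sum>i<N. snd w i * indicator {a j..<b j} (?S i))" if "j < k" "n \<le> N" for j N
    proof -
      have "(\<lambda>i. snd w i * indicator {a j..<b j} (?S i)) sums (\<Sum>i<N. snd w i * indicator {a j..<b j} (?S i))"
      proof (rule sums_finite)
        fix i assume "i \<notin> {..<N}"
        then have "c \<le> ?S i" using n that by auto
        then have "?S i \<notin> {a j..<b j}" using bc[OF that(1)] by auto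
        then show "snd w i * indicator {a j..<b j} (?S i) = 0" by simp
      qed simp
      then show ?thesis unfolding cpp_def split_beta by (simp add: sums_iff)
    qed
    show "\<forall>j<k. 0 \<le> cpp {a j..<b j} w" using cppN[OF _ order.refl] w by (auto intro!: sum_nonneg)
    show "\<exists>n. \<forall>N\<ge>n. T s N 0 (fst w) (snd w) = (\<Sum>j<k. t j * cpp {a j..<b j} w)"
    proof (intro exI[of _ n] allI impI)
      fix N assume "n \<le> N"
      then have "(\<Sum>j<k. t j * cpp {a j..<b j} w) = (\<Sum>j<k. \<Sum>i<N. t j * (snd w i * indicator {a j..<b j} (?S i)))"
      proof (intro sum.cong refl)
        fix j assume "j \<in> {..<k}"
        then have "j < k" by simp
        from cppN[OF this \<open>n \<le> N\<close>]
        show "t j * cpp {a j..<b j} w = (\<Sum>i<N. t j * (snd w i * indicator {a j..<b j} (?S i)))"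
          by (simp only: sum_distrib_left)
      qed
      also have "\<dots> = (\<Sum>i<N. \<Sum>j<k. t j * (snd w i * indicator {a j..<b j} (?S i)))" by (rule sum.swap)
      also have "\<dots> = T s N 0 (fst w) (snd w)"
        unfolding T_def s_def by (intro sum.cong refl) (simp only: sum_distrib_left mult.left_commute add_0)
      finally show "T s N 0 (fst w) (snd w) = (\<Sum>j<k. t j * cpp {a j..<b j} w)" by simp
    qed
  qed
  show "AE w in W. \<forall>j<k. 0 \<le> cpp {a j..<b j} w"
    using AE_cpp_regular[of c] by (rule AE_mp) (use key(2) in \<open>auto intro!: AE_I2\<close>)
  have lim2: "(\<lambda>N. LINT w|W. exp (- T s N 0 (fst w) (snd w))) \<longlonglongrightarrow> (LINT w|W. exp (- (\<Sum>j<k. t j * cpp {a j..<b j} w)))"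
  proof (rule integral_dominated_convergence[where w = "\<lambda>_. 1"])
    show "(\<lambda>w. exp (- (\<Sum>j<k. t j * cpp {a j..<b j} w))) \<in> borel_measurable W"
    proof -
      have [measurable]: "cpp {a j..<b j} \<in> borel_measurable W" for j by (rule cpp_measurable) simp
      show ?thesis by measurable
    qed
    show "AE w in W. (\<lambda>N. exp (- T s N 0 (fst w) (snd w))) \<longlonglongrightarrow> exp (- (\<Sum>j<k. t j * cpp {a j..<b j} w))"
      using AE_cpp_regular[of c]
    proof (rule AE_mp, intro AE_I2 impI)
      fix w :: "(nat \<Rightarrow> real) \<times> (nat \<Rightarrow> real)"
      assume "(\<forall>i. 0 \<le> fst w i \<and> 0 \<le> snd w i) \<and> (\<exists>n. \<forall>i\<ge>n. c \<le> (\<Sum>k\<le>i. fst w k))"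
      from key(1)[OF this] show "(\<lambda>N. exp (- T s N 0 (fst w) (snd w))) \<longlonglongrightarrow> exp (- (\<Sum>j<k. t j * cpp {a j..<b j} w))"
        by (intro tendsto_eventually) (auto simp: eventually_sequentially)
    qed
    show "AE w in W. norm (exp (- T s N 0 (fst w) (snd w))) \<le> 1" for N
      using T0[of N] by (rule AE_mp) (auto intro!: AE_I2)
  qed (use Tm in auto)
  have "(\<lambda>N. LINT w|W. exp (- T s N 0 (fst w) (snd w))) \<longlonglongrightarrow> \<Psi> 0"
  proof -
    have "(\<lambda>N. enn2real (Phi s N 0)) \<longlonglongrightarrow> \<Psi> 0" by (rule tendsto_enn2real[OF lim1]) (simp add: \<Psi>_def)
    then show ?thesis by (simp add: PhiW)
  qed
  from LIMSEQ_unique[OF lim2 this] have "(LINT w|W. exp (- (\<Sum>j<k. t j * cpp {a j..<b j} w))) = \<Psi> 0" .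
  moreover have "I 0 = (\<Sum>j<k. (b j - a j) * (1 - lap (t j)))"
    unfolding I_def
  proof (rule sum.cong, simp)
    fix j assume "j \<in> {..<k}"
    then have "0 \<le> a j" "0 \<le> b j" using ab[of j] by auto
    then show "(1 - lap (t j)) * (max (b j) 0 - max (a j) 0) = (b j - a j) * (1 - lap (t j))" by (simp add: max_def)
  qed
  ultimately show "(LINT w|W. exp (- (\<Sum>j<k. t j * cpp {a j..<b j} w))) = exp (- (\<Sum>j<k. (b j - a j) * (1 - lap (t j))))"
    by (simp add: \<Psi>_def)
qed

end

section \<open>Convergence in distribution from Laplace transforms\<close>

text \<open>The algebra generated by the coordinates, in the inductive form that fits both the
  Stone--Weierstrass locale and the induction over polynomials below.\<close>

inductive_set coord_polys :: "nat \<Rightarrow> ((nat \<Rightarrow> real) \<Rightarrow> real) set" for k where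
  const: "(\<lambda>_. c) \<in> coord_polys k"
| coord: "j < k \<Longrightarrow> (\<lambda>y. y j) \<in> coord_polys k"
| add: "f \<in> coord_polys k \<Longrightarrow> g \<in> coord_polys k \<Longrightarrow> (\<lambda>y. f y + g y) \<in> coord_polys k"
| mult: "f \<in> coord_polys k \<Longrightarrow> g \<in> coord_polys k \<Longrightarrow> (\<lambda>y. f y * g y) \<in> coord_polys k"

lemma coord_polys_continuous: "f \<in> coord_polys k \<Longrightarrow> continuous_on UNIV f"
  by (induction rule: coord_polys.induct) (auto intro!: continuous_intros)

text \<open>The image of nonnegative vectors under \<open>exp (- x)\<close> lies here. Coordinates
  from \<open>k\<close> on are pinned to \<open>1 = exp 0\<close>, as the vectors vanish there; this
  keeps the set compact and lets the first \<open>k\<close> coordinates separate points.\<close>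

definition cube :: "nat \<Rightarrow> (nat \<Rightarrow> real) set" where
  "cube k = PiE UNIV (\<lambda>j. if j < k then {0..1} else {1})"

lemma compact_cube: "compact (cube k)"
proof -
  have "compactin (product_topology (\<lambda>i. euclidean) UNIV) (cube k)"
    unfolding cube_def by (subst compactin_PiE) auto
  then show ?thesis by (simp add: euclidean_product_topology)
qed

interpretation cube_ring: function_ring_on "coord_polys k" "cube k" for k
proof
  show "compact (cube k)" by (rule compact_cube)
  show "continuous_on (cube k) f" if "f \<in> coord_polys k" for f
    using coord_polys_continuous[OF that] continuous_on_subset by blast
  fix x y assume xy: "x \<in> cube k" "y \<in> cube k" "x \<noteq> y"
  then obtain j where j: "x j \<noteq> y j" by auto
  have "j < k"
  proof (rule ccontr)
    assume nk: "\<not> j < k"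
    have "z j = 1" if "z \<in> cube k" for z
      using PiE_mem[OF that[unfolded cube_def], of j] nk by simp
    then show False using xy j by metis
  qed
  then show "\<exists>f\<in>coord_polys k. f x \<noteq> f y" using j by (intro bexI[of _ "\<lambda>y. y j"]) (auto intro: coord_polys.coord)
qed (auto intro: coord_polys.intros)

lemma cube_memI: "(\<And>j. j < k \<Longrightarrow> 0 \<le> y j \<and> y j \<le> 1) \<Longrightarrow> (\<And>j. k \<le> j \<Longrightarrow> y j = 1) \<Longrightarrow> y \<in> cube k"
  by (auto simp: cube_def PiE_iff not_less)

text \<open>Under \<open>y = exp (- x)\<close> the Laplace transforms at integer arguments become
  moments on a compact cube, where polynomials are dense. A bounded continuous function of
  \<open>x\<close> need not extend to the faces \<open>y j = 0\<close>, so it is cut off there, and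
  the error is controlled through the limit law; this replaces a separate tightness
  argument.\<close>

theorem conv_in_distr_of_laplace:
  fixes X :: "nat \<Rightarrow> 'a \<Rightarrow> nat \<Rightarrow> real" and Y :: "'b \<Rightarrow> nat \<Rightarrow> real"
  assumes M: "prob_space M" and N: "prob_space N"
    and Xm: "\<And>n j. (\<lambda>x. X n x j) \<in> borel_measurable M" and Ym: "\<And>j. (\<lambda>w. Y w j) \<in> borel_measurable N"
    and Xp: "\<And>n. AE x in M. \<forall>j<k. 0 \<le> X n x j" and Yp: "AE w in N. \<forall>j<k. 0 \<le> Y w j"
    and X0: "\<And>n x j. k \<le> j \<Longrightarrow> X n x j = 0" and Y0: "\<And>w j. k \<le> j \<Longrightarrow> Y w j = 0"
    and lap: "\<And>t::nat \<Rightarrow> nat. (\<lambda>n. LINT x|M. exp (- (\<Sum>j<k. real (t j) * X n x j))) \<longlonglongrightarrow> (LINT w|N. exp (- (\<Sum>j<k. real (t j) * Y w j)))"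
  shows "conv_in_distr M X N Y"
proof -
  interpret M: prob_space M by (rule M)
  interpret N: prob_space N by (rule N)
  define ee where "ee v = (\<lambda>j. exp (- v j))" for v :: "nat \<Rightarrow> real"
  have eX: "AE x in M. ee (X n x) \<in> cube k" for n
    using Xp[of n] by (rule AE_mp) (auto intro!: AE_I2 cube_memI simp: ee_def X0)
  have eY: "AE w in N. ee (Y w) \<in> cube k"
    using Yp by (rule AE_mp) (auto intro!: AE_I2 cube_memI simp: ee_def Y0)
  have eXm: "(\<lambda>x. ee (X n x)) \<in> borel_measurable M" for n
    unfolding ee_def by (rule measurable_coordinatewise_then_product) (use Xm in measurable)
  have eYm: "(\<lambda>w. ee (Y w)) \<in> borel_measurable N"
    unfolding ee_def by (rule measurable_coordinatewise_then_product) (use Ym in measurable)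
  have bnd: "\<exists>B. \<forall>y\<in>cube k. \<bar>\<phi> y\<bar> \<le> B" if "continuous_on UNIV \<phi>" for \<phi> :: "(nat \<Rightarrow> real) \<Rightarrow> real"
  proof -
    have "compact (\<phi> ` cube k)" using that by (intro compact_continuous_image compact_cube continuous_on_subset[OF that]) auto
    then have "bounded (\<phi> ` cube k)" by (rule compact_imp_bounded)
    then show ?thesis by (auto simp: bounded_iff)
  qed
  have phim: "\<phi> \<in> borel_measurable borel" if "continuous_on UNIV \<phi>" for \<phi> :: "(nat \<Rightarrow> real) \<Rightarrow> real"
    using that by (rule borel_measurable_continuous_onI)
  have iX: "integrable M (\<lambda>x. \<phi> (ee (X n x)))" if c: "continuous_on UNIV \<phi>" for \<phi> :: "(nat \<Rightarrow> real) \<Rightarrow> real" and n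
  proof -
    obtain B where B: "\<forall>y\<in>cube k. \<bar>\<phi> y\<bar> \<le> B" using bnd[OF c] by blast
    show ?thesis
      by (rule M.integrable_const_bound[where B = B, OF AE_mp[OF eX[of n]]])
         (use B measurable_compose[OF eXm phim[OF c]] in \<open>auto intro!: AE_I2\<close>)
  qed
  have iY: "integrable N (\<lambda>w. \<phi> (ee (Y w)))" if c: "continuous_on UNIV \<phi>" for \<phi> :: "(nat \<Rightarrow> real) \<Rightarrow> real"
  proof -
    obtain B where B: "\<forall>y\<in>cube k. \<bar>\<phi> y\<bar> \<le> B" using bnd[OF c] by blast
    show ?thesis
      by (rule N.integrable_const_bound[where B = B, OF AE_mp[OF eY]])
         (use B measurable_compose[OF eYm phim[OF c]] in \<open>auto intro!: AE_I2\<close>)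
  qed
  define cv where "cv \<phi> \<longleftrightarrow> (\<lambda>n. LINT x|M. \<phi> (ee (X n x))) \<longlonglongrightarrow> (LINT w|N. \<phi> (ee (Y w)))" for \<phi> :: "(nat \<Rightarrow> real) \<Rightarrow> real"
  define mono where "mono t y = (\<Prod>j<k. y j ^ t j)" for t :: "nat \<Rightarrow> nat" and y :: "nat \<Rightarrow> real"
  have mc: "continuous_on UNIV (mono t)" for t unfolding mono_def by (intro continuous_intros) auto
  have mono_ee: "mono t (ee v) = exp (- (\<Sum>j<k. real (t j) * v j))" for t v
    unfolding mono_def ee_def by (simp add: sum_negf[symmetric] exp_sum exp_of_nat_mult[symmetric])
  have cv_mono: "cv (mono t)" for t unfolding cv_def mono_ee by (rule lap)
  \<comment> \<open>Asking for all monomials \<open>mono t\<close> at once is stable under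
    multiplication by a coordinate, and quantifying over \<open>\<phi>\<close> makes the product
    case a composition of the two induction hypotheses.\<close>
  have poly: "\<forall>\<phi>. continuous_on UNIV \<phi> \<longrightarrow> (\<forall>t. cv (\<lambda>y. mono t y * \<phi> y)) \<longrightarrow> (\<forall>t. cv (\<lambda>y. mono t y * (f y * \<phi> y)))"
    if "f \<in> coord_polys k" for f
    using that
  proof (induction rule: coord_polys.induct)
    case (const c)
    show ?case
    proof (intro allI impI)
      fix \<phi> t assume "continuous_on UNIV \<phi>" and a: "\<forall>t. cv (\<lambda>y. mono t y * \<phi> y)"
      have "(\<lambda>n. c * (LINT x|M. mono t (ee (X n x)) * \<phi> (ee (X n x)))) \<longlonglongrightarrow> c * (LINT w|N. mono t (ee (Y w)) * \<phi> (ee (Y w)))"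
        using a unfolding cv_def by (intro tendsto_mult_left) auto
      then show "cv (\<lambda>y. mono t y * (c * \<phi> y))" unfolding cv_def by (simp add: mult.left_commute[of _ c])
    qed
  next
    case (coord j)
    show ?case
    proof (intro allI impI)
      fix \<phi> t assume "continuous_on UNIV \<phi>" and a: "\<forall>t. cv (\<lambda>y. mono t y * \<phi> y)"
      have "mono (t(j := Suc (t j))) y = mono t y * y j" for y
      proof -
        have "mono (t(j := Suc (t j))) y = y j ^ Suc (t j) * (\<Prod>i\<in>{..<k} - {j}. y i ^ t i)"
          unfolding mono_def using coord by (subst prod.remove[of _ j]) (auto intro!: prod.cong)
        also have "y j ^ t j * (\<Prod>i\<in>{..<k} - {j}. y i ^ t i) = mono t y"
          unfolding mono_def using coord by (subst prod.remove[of _ j]) auto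
        then have "y j ^ Suc (t j) * (\<Prod>i\<in>{..<k} - {j}. y i ^ t i) = mono t y * y j" by (simp add: mult_ac)
        finally show ?thesis .
      qed
      then have "(\<lambda>y. mono t y * (y j * \<phi> y)) = (\<lambda>y. mono (t(j := Suc (t j))) y * \<phi> y)" by (simp add: mult.assoc)
      then show "cv (\<lambda>y. mono t y * (y j * \<phi> y))" using a by simp
    qed
  next
    case (add f g)
    show ?case
    proof (intro allI impI)
      fix \<phi> t assume c: "continuous_on UNIV \<phi>" and a: "\<forall>t. cv (\<lambda>y. mono t y * \<phi> y)"
      have 1: "cv (\<lambda>y. mono t y * (f y * \<phi> y))" "cv (\<lambda>y. mono t y * (g y * \<phi> y))" using add.IH c a by blast+
      have cc: "continuous_on UNIV (\<lambda>y. mono t y * (f y * \<phi> y))" "continuous_on UNIV (\<lambda>y. mono t y * (g y * \<phi> y))"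
        by (intro continuous_on_mult mc c coord_polys_continuous[OF add.hyps(1)] coord_polys_continuous[OF add.hyps(2)])+
      have eq: "mono t y * ((f y + g y) * \<phi> y) = mono t y * (f y * \<phi> y) + mono t y * (g y * \<phi> y)" for y by (simp add: algebra_simps)
      show "cv (\<lambda>y. mono t y * ((f y + g y) * \<phi> y))"
        using tendsto_add[OF 1[unfolded cv_def]] unfolding cv_def eq
        by (simp add: Bochner_Integration.integral_add[OF iX[OF cc(1)] iX[OF cc(2)]] Bochner_Integration.integral_add[OF iY[OF cc(1)] iY[OF cc(2)]])
    qed
  next
    case (mult f g)
    show ?case
    proof (intro allI impI)
      fix \<phi> t assume c: "continuous_on UNIV \<phi>" and a: "\<forall>t. cv (\<lambda>y. mono t y * \<phi> y)"
      have "\<forall>t. cv (\<lambda>y. mono t y * (g y * \<phi> y))" using mult.IH(2) c a by blast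
      moreover have "continuous_on UNIV (\<lambda>y. g y * \<phi> y)" by (intro continuous_on_mult c coord_polys_continuous[OF mult.hyps(2)])
      ultimately have "cv (\<lambda>y. mono t y * (f y * (g y * \<phi> y)))" using mult.IH(1) by blast
      then show "cv (\<lambda>y. mono t y * ((f y * g y) * \<phi> y))" by (simp add: mult.assoc)
    qed
  qed
  have cv_poly: "cv f" if f: "f \<in> coord_polys k" for f
  proof -
    have m0: "mono (\<lambda>_. 0) y = 1" for y by (simp add: mono_def)
    have "\<forall>t. cv (\<lambda>y. mono t y * f y)"
      using poly[OF f, THEN spec, of "\<lambda>_. 1"] cv_mono by simp
    then have "cv (\<lambda>y. mono (\<lambda>_. 0) y * f y)" by blast
    then show ?thesis by (simp add: m0)
  qed
  have cv_cont: "cv F" if F: "continuous_on UNIV F" for F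
    unfolding cv_def
  proof (rule LIMSEQ_I)
    fix e :: real assume e: "0 < e"
    obtain f where f: "f \<in> coord_polys k" "\<forall>x\<in>cube k. \<bar>F x - f x\<bar> < e / 3"
      using cube_ring.Stone_Weierstrass_basic[of k F "e/3"] continuous_on_subset[OF F] e by auto
    note fc = coord_polys_continuous[OF f(1)]
    have dX: "\<bar>(LINT x|M. F (ee (X n x))) - (LINT x|M. f (ee (X n x)))\<bar> \<le> e / 3" for n
      using abs_integral_diff_le[OF iX[OF F] iX[OF fc], of "\<lambda>_. e / 3" n n] M.prob_space
        AE_mp[OF eX[of n], of "\<lambda>x. \<bar>F (ee (X n x)) - f (ee (X n x))\<bar> \<le> e / 3"] f(2) by (auto simp: less_imp_le)
    have dY: "\<bar>(LINT w|N. F (ee (Y w))) - (LINT w|N. f (ee (Y w)))\<bar> \<le> e / 3"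
      using abs_integral_diff_le[OF iY[OF F] iY[OF fc], of "\<lambda>_. e / 3"] N.prob_space
        AE_mp[OF eY, of "\<lambda>w. \<bar>F (ee (Y w)) - f (ee (Y w))\<bar> \<le> e / 3"] f(2) by (auto simp: less_imp_le)
    obtain n0 where n0: "\<And>n. n0 \<le> n \<Longrightarrow> \<bar>(LINT x|M. f (ee (X n x))) - (LINT w|N. f (ee (Y w)))\<bar> < e / 3"
      using LIMSEQ_D[OF cv_poly[OF f(1), unfolded cv_def], of "e/3"] e by auto
    show "\<exists>n0. \<forall>n\<ge>n0. norm ((LINT x|M. F (ee (X n x))) - (LINT w|N. F (ee (Y w)))) < e"
    proof (intro exI[of _ n0] allI impI)
      fix n assume "n0 \<le> n"
      then show "norm ((LINT x|M. F (ee (X n x))) - (LINT w|N. F (ee (Y w)))) < e"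
        using n0[of n] dX[of n] dY unfolding real_norm_def by linarith
    qed
  qed
  show ?thesis unfolding conv_in_distr_def
  proof (intro allI impI, elim conjE)
    fix F :: "(nat \<Rightarrow> real) \<Rightarrow> real" assume F: "continuous_on UNIV F" "bounded (range F)"
    obtain B where B: "\<And>x. \<bar>F x\<bar> \<le> B" using F(2) by (auto simp: bounded_iff)
    have B0: "0 \<le> B" using B[of undefined] by linarith
    have Xv: "(\<lambda>x. X n x) \<in> borel_measurable M" for n by (rule measurable_coordinatewise_then_product) (rule Xm)
    have Yv: "Y \<in> borel_measurable N" by (rule measurable_coordinatewise_then_product) (rule Ym)
    have iFX: "integrable M (\<lambda>x. F (X n x))" for n
      by (rule M.integrable_const_bound[where B = B]) (use B measurable_compose[OF Xv phim[OF F(1)]] in auto)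
    have iFY: "integrable N (\<lambda>x. F (Y x))"
      by (rule N.integrable_const_bound[where B = B]) (use B measurable_compose[OF Yv phim[OF F(1)]] in auto)
    \<comment> \<open>A continuous detector of small coordinates: a summand is 1 for
      \<open>y j \<le> d\<close> and 0 for \<open>y j \<ge> 2 * d\<close>. It dominates the error of
      replacing \<open>F\<close> by the cut-off function \<open>G d\<close>.\<close>
    define \<kappa> where "\<kappa> d y = (\<Sum>j<k. max 0 (min 1 (2 - y j / d)))" for d :: real and y :: "nat \<Rightarrow> real"
    define G where "G d y = F (\<lambda>j. if j < k then - ln (max (y j) d) else 0)" for d and y :: "nat \<Rightarrow> real"
    have \<kappa>c: "continuous_on UNIV (\<kappa> d)" if "0 < d" for d
      unfolding \<kappa>_def using that by (intro continuous_intros) auto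
    have Gc: "continuous_on UNIV (G d)" if d: "0 < d" for d
    proof -
      have "continuous_on UNIV (\<lambda>y::nat \<Rightarrow> real. (\<lambda>j. if j < k then - ln (max (y j) d) else 0))"
      proof (rule continuous_on_coordinatewise_then_product)
        fix j
        have "max (y j) d \<noteq> 0" for y :: "nat \<Rightarrow> real" using d by (auto simp: max_def)
        then have "continuous_on UNIV (\<lambda>y::nat \<Rightarrow> real. - ln (max (y j) d))"
          by (intro continuous_intros) auto
        then show "continuous_on UNIV (\<lambda>y::nat \<Rightarrow> real. if j < k then - ln (max (y j) d) else 0)" by (cases "j < k") auto
      qed
      then show ?thesis unfolding G_def using continuous_on_compose2[OF F(1)] by auto
    qed
    have close: "\<bar>F v - G d (ee v)\<bar> \<le> 2 * B * \<kappa> d (ee v)" if d: "0 < d" and v: "\<And>j. k \<le> j \<Longrightarrow> v j = 0" for v d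
    proof (cases "\<forall>j<k. d \<le> ee v j")
      case True
      have "(\<lambda>j. if j < k then - ln (max (ee v j) d) else 0) = v"
      proof
        fix j show "(if j < k then - ln (max (ee v j) d) else 0) = v j"
        proof (cases "j < k")
          case True
          then have "max (ee v j) d = ee v j" using \<open>\<forall>j<k. d \<le> ee v j\<close> by (simp add: max_absorb1)
          then show ?thesis using True by (simp add: ee_def)
        next
          case False then show ?thesis using v[of j] by simp
        qed
      qed
      then have "F v = G d (ee v)" by (simp add: G_def)
      moreover have "0 \<le> \<kappa> d (ee v)" unfolding \<kappa>_def by (intro sum_nonneg) auto
      ultimately show ?thesis using B0 by simp
    next
      case False
      then obtain j where j: "j < k" "ee v j < d" by auto
      have "1 \<le> max 0 (min 1 (2 - ee v j / d))" using j d by (simp add: field_simps)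
      also have "\<dots> \<le> \<kappa> d (ee v)" unfolding \<kappa>_def by (rule member_le_sum) (use j in auto)
      finally have "2 * B * 1 \<le> 2 * B * \<kappa> d (ee v)" using B0 by (intro mult_left_mono) auto
      moreover have "\<bar>F v - G d (ee v)\<bar> \<le> 2 * B" using B[of v] B[of "\<lambda>j. if j < k then - ln (max (ee v j) d) else 0"] unfolding G_def by linarith
      ultimately show ?thesis by linarith
    qed
    \<comment> \<open>The limit has finite coordinates, so \<open>exp (- Y)\<close> is positive and
      the detector vanishes for small \<open>d\<close>. Being continuous on the cube, it then has
      nearly the same small integral under \<open>X n\<close>.\<close>
    have \<kappa>0: "(\<lambda>m. LINT w|N. \<kappa> (1 / real (Suc m)) (ee (Y w))) \<longlonglongrightarrow> (LINT w|N. 0)"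
    proof (rule integral_dominated_convergence[where w = "\<lambda>_. real k"])
      show "(\<lambda>w. \<kappa> (1 / real (Suc m)) (ee (Y w))) \<in> borel_measurable N" for m
        using measurable_compose[OF eYm phim[OF \<kappa>c]] by simp
      show "AE w in N. norm (\<kappa> (1 / real (Suc m)) (ee (Y w))) \<le> real k" for m
      proof (rule AE_I2)
        fix w
        have "\<kappa> (1 / real (Suc m)) (ee (Y w)) \<le> (\<Sum>j<k. 1)" unfolding \<kappa>_def by (intro sum_mono) auto
        moreover have "0 \<le> \<kappa> (1 / real (Suc m)) (ee (Y w))" unfolding \<kappa>_def by (intro sum_nonneg) auto
        ultimately show "norm (\<kappa> (1 / real (Suc m)) (ee (Y w))) \<le> real k" by simp
      qed
      show "AE w in N. (\<lambda>m. \<kappa> (1 / real (Suc m)) (ee (Y w))) \<longlonglongrightarrow> 0"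
      proof (rule AE_I2)
        fix w
        have "(\<lambda>m. max 0 (min 1 (2 - ee (Y w) j / (1 / real (Suc m))))) \<longlonglongrightarrow> 0" for j
        proof (rule tendsto_eventually)
          have p: "0 < ee (Y w) j" by (simp add: ee_def)
          obtain m0 :: nat where m0: "2 / ee (Y w) j \<le> real m0" using real_arch_simple by blast
          show "\<forall>\<^sub>F m in sequentially. max 0 (min 1 (2 - ee (Y w) j / (1 / real (Suc m)))) = 0"
            using eventually_ge_at_top[of m0]
          proof eventually_elim
            case (elim m)
            then have "2 / ee (Y w) j \<le> real (Suc m)" using m0 by linarith
            then show ?case using p by (simp add: field_simps max_def min_def)
          qed
        qed
        then have "(\<lambda>m. \<kappa> (1 / real (Suc m)) (ee (Y w))) \<longlonglongrightarrow> (\<Sum>j<k. 0)" unfolding \<kappa>_def by (intro tendsto_sum)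
        then show "(\<lambda>m. \<kappa> (1 / real (Suc m)) (ee (Y w))) \<longlonglongrightarrow> 0" by simp
      qed
    qed auto
    show "(\<lambda>n. LINT x|M. F (X n x)) \<longlonglongrightarrow> (LINT w|N. F (Y w))"
    proof (rule LIMSEQ_I)
      fix e :: real assume e: "0 < e"
      have "\<forall>\<^sub>F m in sequentially. (LINT w|N. \<kappa> (1 / real (Suc m)) (ee (Y w))) < e / (8 * (B + 1))"
        using \<kappa>0 e B0 by (intro order_tendstoD(2)) auto
      then obtain m where m: "(LINT w|N. \<kappa> (1 / real (Suc m)) (ee (Y w))) < e / (8 * (B + 1))" by (auto simp: eventually_sequentially)
      define d where "d = 1 / real (Suc m)"
      have d: "0 < d" by (simp add: d_def)
      define a where "a = (LINT w|N. \<kappa> d (ee (Y w)))"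
      have a: "2 * B * a \<le> e / 4"
      proof -
        have "a * (8 * (B + 1)) < e" using m B0 unfolding a_def d_def by (simp add: field_simps)
        moreover have "0 \<le> a" unfolding a_def \<kappa>_def by (intro integral_nonneg_AE AE_I2 sum_nonneg) auto
        ultimately show ?thesis by (simp add: algebra_simps)
      qed
      have dY: "\<bar>(LINT w|N. F (Y w)) - (LINT w|N. G d (ee (Y w)))\<bar> \<le> 2 * B * a"
        using abs_integral_diff_le[OF iFY iY[OF Gc[OF d]], of "\<lambda>w. 2 * B * \<kappa> d (ee (Y w))"]
          iY[OF \<kappa>c[OF d]] close[OF d Y0] by (simp add: a_def)
      have dX: "\<bar>(LINT x|M. F (X n x)) - (LINT x|M. G d (ee (X n x)))\<bar> \<le> 2 * B * (LINT x|M. \<kappa> d (ee (X n x)))" for n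
        using abs_integral_diff_le[OF iFX iX[OF Gc[OF d]], of "\<lambda>x. 2 * B * \<kappa> d (ee (X n x))" n n]
          iX[OF \<kappa>c[OF d]] close[OF d X0] by simp
      have "(\<lambda>n. 2 * B * (LINT x|M. \<kappa> d (ee (X n x)))) \<longlonglongrightarrow> 2 * B * a"
        using cv_cont[OF \<kappa>c[OF d]] unfolding cv_def a_def by (intro tendsto_mult_left)
      then obtain n1 where n1: "\<And>n. n1 \<le> n \<Longrightarrow> \<bar>2 * B * (LINT x|M. \<kappa> d (ee (X n x))) - 2 * B * a\<bar> < e / 4"
        using LIMSEQ_D[of _ _ "e/4"] e by (metis divide_pos_pos real_norm_def zero_less_numeral)
      obtain n2 where n2: "\<And>n. n2 \<le> n \<Longrightarrow> \<bar>(LINT x|M. G d (ee (X n x))) - (LINT w|N. G d (ee (Y w)))\<bar> < e / 4"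
        using LIMSEQ_D[OF cv_cont[OF Gc[OF d], unfolded cv_def], of "e/4"] e by auto
      show "\<exists>n0. \<forall>n\<ge>n0. norm ((LINT x|M. F (X n x)) - (LINT w|N. F (Y w))) < e"
      proof (intro exI[of _ "max n1 n2"] allI impI)
        fix n assume "max n1 n2 \<le> n"
        then show "norm ((LINT x|M. F (X n x)) - (LINT w|N. F (Y w))) < e"
          using n1[of n] n2[of n] dX[of n] dY a unfolding real_norm_def by linarith
      qed
    qed
  qed
qed

section \<open>Geometry of the observable\<close>

locale observable =
  fixes g :: "real \<Rightarrow> ereal" and V :: "real set" and W :: "ereal set"
  assumes shape: "observable_shape g V W"
begin

abbreviation ginv :: "ereal \<Rightarrow> real" where "ginv \<equiv> inv_into V g"

abbreviation gr :: "real \<Rightarrow> real" where "gr x \<equiv> real_of_ereal (g x)"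

definition near :: "real \<Rightarrow> bool" where
  "near \<delta> \<longleftrightarrow> 0 < \<delta> \<and> {0..<\<delta>} \<subseteq> V"

lemma near_ex: "\<exists>\<delta>. near \<delta>"
  using shape unfolding observable_shape_def near_def by blast

lemma g_facts: "0 \<le> x \<Longrightarrow> g x \<noteq> -\<infinity>" "0 \<le> x \<Longrightarrow> g x \<le> g 0" "continuous_on V g" "g ` V = W"
  "x \<in> V \<Longrightarrow> y \<in> V \<Longrightarrow> x < y \<Longrightarrow> g y < g x" "0 \<le> x \<Longrightarrow> x \<notin> V \<Longrightarrow> g x \<notin> W"
proof -
  note S = shape[unfolded observable_shape_def]
  show "0 \<le> x \<Longrightarrow> g x \<noteq> -\<infinity>" "0 \<le> x \<Longrightarrow> g x \<le> g 0" using S by blast+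
  show "continuous_on V g" "g ` V = W" using S by (auto simp: homeomorphism_def)
  show "x \<in> V \<Longrightarrow> y \<in> V \<Longrightarrow> x < y \<Longrightarrow> g y < g x" using S by blast
  show "0 \<le> x \<Longrightarrow> x \<notin> V \<Longrightarrow> g x \<notin> W" using S by blast
qed

lemma g_inj: "inj_on g V"
proof (rule linorder_inj_onI')
  fix i j assume "i \<in> V" "j \<in> V" "i < j"
  then show "g i \<noteq> g j" using g_facts(5)[of i j] by auto
qed

lemma g_ivt:
  assumes "near \<delta>" "0 \<le> r" "r < \<delta>" "g r \<le> s" "s \<le> g 0"
  shows "\<exists>x\<in>{0..r}. g x = s"
proof -
  have "{0..r} \<subseteq> V" using assms by (auto simp: near_def)
  then have "connected (g ` {0..r})" by (intro connected_continuous_image continuous_on_subset[OF g_facts(3)]) auto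
  then have "s \<in> g ` {0..r}" by (rule connectedD_interval) (use assms in auto)
  then show ?thesis by force
qed

text \<open>Every level between \<open>g r\<close> and \<open>g 0\<close> is attained in
  \<open>[0,r]\<close> by the intermediate value theorem, hence lies in \<open>W\<close>, and so
  cannot be attained outside \<open>V\<close>. Exceeding \<open>g r\<close> thus means being closer
  than \<open>r\<close>, whatever \<open>g\<close> does far from 0.\<close>

lemma g_gt_iff:
  assumes "near \<delta>" "0 \<le> r" "r < \<delta>" "0 \<le> x"
  shows "g r < g x \<longleftrightarrow> x < r"
proof
  have rV: "r \<in> V" using assms by (auto simp: near_def)
  show "x < r \<Longrightarrow> g r < g x" using assms rV by (intro g_facts(5)) (auto simp: near_def)
  assume gt: "g r < g x"
  show "x < r"
  proof (rule ccontr)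
    assume "\<not> x < r"
    then have "r < x" using gt by (cases "r = x") auto
    then have "x \<notin> V" using g_facts(5)[OF rV] gt by (meson less_asym)
    then have "g x \<notin> W" using g_facts(6) assms by blast
    moreover obtain y where "y \<in> {0..r}" "g y = g x"
      using g_ivt[OF assms(1-3) less_imp_le[OF gt] g_facts(2)[OF assms(4)]] by blast
    moreover from this have "y \<in> V" using assms by (auto simp: near_def)
    ultimately show False using g_facts(4) by (metis imageI)
  qed
qed

lemma ginv_facts:
  assumes "near \<delta>" "0 \<le> r" "r < \<delta>" "g r \<le> s" "s \<le> g 0"
  shows "s \<in> W" "0 \<le> ginv s" "ginv s \<le> r" "g (ginv s) = s" "0 \<le> x \<Longrightarrow> s < g x \<longleftrightarrow> x < ginv s"
proof -
  obtain y where y: "y \<in> {0..r}" "g y = s" using g_ivt[OF assms] by blast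
  have yV: "y \<in> V" using y assms by (auto simp: near_def)
  have eq: "ginv s = y" using inv_into_f_f[OF g_inj yV] y(2) by simp
  show "s \<in> W" using yV y(2) g_facts(4) by blast
  show "0 \<le> ginv s" "ginv s \<le> r" "g (ginv s) = s" using y eq by auto
  show "0 \<le> x \<Longrightarrow> s < g x \<longleftrightarrow> x < ginv s" using g_gt_iff[OF assms(1), of y x] y assms eq by auto
qed

lemma ginv_g: "near \<delta> \<Longrightarrow> 0 \<le> r \<Longrightarrow> r < \<delta> \<Longrightarrow> ginv (g r) = r"
  by (rule inv_into_f_f[OF g_inj]) (auto simp: near_def)

lemma g_finite:
  assumes "near \<delta>" "0 < r" "r < \<delta>"
  shows "g r < g 0" "ereal (gr r) = g r"
proof -
  show lt: "g r < g 0" using g_gt_iff[OF assms(1) _ assms(3), of 0] assms by auto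
  then have "g r \<noteq> \<infinity>" by auto
  then show "ereal (gr r) = g r" using g_facts(1)[of r] assms by (auto simp: ereal_real)
qed

lemma g_tendsto:
  assumes "near \<delta>" "\<forall>\<^sub>F n in sequentially. 0 < r n" "r \<longlonglongrightarrow> 0"
  shows "filterlim (\<lambda>n. g (r n)) (at_left (g 0)) sequentially"
proof -
  have lt: "\<forall>\<^sub>F n in sequentially. 0 < r n \<and> r n < \<delta>"
    using assms(2) order_tendstoD(2)[OF assms(3), of \<delta>] assms(1) by (auto simp: near_def eventually_conj)
  have "(\<lambda>n. g (r n)) \<longlonglongrightarrow> g 0"
  proof (rule continuous_on_tendsto_compose[OF g_facts(3) assms(3)])
    show "0 \<in> V" using assms(1) by (auto simp: near_def)
    show "\<forall>\<^sub>F n in sequentially. r n \<in> V" using lt by eventually_elim (use assms(1) in \<open>auto simp: near_def\<close>)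
  qed
  moreover have "\<forall>\<^sub>F n in sequentially. g (r n) < g 0" using lt by eventually_elim (use g_finite[OF assms(1)] in blast)
  ultimately show ?thesis unfolding filterlim_at by (auto elim: eventually_mono)
qed

definition exc :: "real \<Rightarrow> real \<Rightarrow> real \<Rightarrow> real" where
  "exc c u x = c * real_of_ereal (max 0 (g x - ereal u))"

context
  fixes \<delta> r c u :: real
  assumes \<delta>: "near \<delta>" and r: "0 < r" "r < \<delta>" and c: "0 < c" and u: "ereal u = g r"
begin

lemma exc_nonneg: "0 \<le> exc c u x"
  unfolding exc_def using c by (intro mult_nonneg_nonneg real_of_ereal_pos) auto

lemma exc_far: "r \<le> x \<Longrightarrow> exc c u x = 0"
proof -
  assume x: "r \<le> x"
  then have "g x \<le> ereal u" using g_gt_iff[OF \<delta> _ r(2), of x] r u by (metis leD leI less_imp_le order_trans)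
  then have "g x - ereal u \<le> 0" by (cases "g x") auto
  then show ?thesis by (simp add: exc_def max_absorb1)
qed

lemma exc_close:
  assumes "0 < x" "x < r"
  shows "exc c u x = c * (gr x - u)" "u < gr x" "ereal (gr x) = g x"
proof -
  show e: "ereal (gr x) = g x" using g_finite(2)[OF \<delta> assms(1)] assms r by simp
  have "g r < g x" using g_gt_iff[OF \<delta> _ r(2), of x] assms r by auto
  then have "ereal u < ereal (gr x)" using e u by simp
  then show lt: "u < gr x" by simp
  have "g x - ereal u = ereal (gr x - u)" by (subst e[symmetric]) simp
  then have "max 0 (g x - ereal u) = ereal (gr x - u)" using lt by (simp add: max_def)
  then show "exc c u x = c * (gr x - u)" by (simp add: exc_def)
qed

lemma exc_antimono: "0 < x \<Longrightarrow> x \<le> y \<Longrightarrow> exc c u y \<le> exc c u x"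
proof (cases "y < r")
  case True
  assume xy: "0 < x" "x \<le> y"
  have "g y \<le> g x" using g_gt_iff[OF \<delta>, of x y] xy True r by auto
  then have "ereal (gr y) \<le> ereal (gr x)" using exc_close(3)[of x] exc_close(3)[of y] xy True by simp
  then show ?thesis using exc_close(1)[of x] exc_close(1)[of y] xy True c by simp
next
  case False
  then show ?thesis using exc_far[of y] exc_nonneg[of x] by simp
qed

lemma exc_gt_iff:
  assumes y: "0 \<le> y" and s: "ereal (u + y / c) \<le> g 0" and x: "0 < x"
  shows "y < exc c u x \<longleftrightarrow> x < ginv (ereal (u + y / c))" "0 \<le> ginv (ereal (u + y / c))" "ginv (ereal (u + y / c)) \<le> r"
proof -
  have "ereal u \<le> ereal (u + y / c)" using y c by simp
  then have gs: "g r \<le> ereal (u + y / c)" using u by simp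
  note gi = ginv_facts[OF \<delta> less_imp_le[OF r(1)] r(2) gs s]
  show "0 \<le> ginv (ereal (u + y / c))" "ginv (ereal (u + y / c)) \<le> r" using gi by auto
  show "y < exc c u x \<longleftrightarrow> x < ginv (ereal (u + y / c))"
  proof (cases "x < r")
    case True
    have "y < exc c u x \<longleftrightarrow> u + y / c < gr x"
      unfolding exc_close(1)[OF x True] using pos_divide_less_eq[OF c, of y "gr x - u"] by (auto simp: mult.commute)
    also have "\<dots> \<longleftrightarrow> ereal (u + y / c) < ereal (gr x)" by simp
    also have "\<dots> \<longleftrightarrow> x < ginv (ereal (u + y / c))" using exc_close(3)[OF x True] gi(5)[of x] x by simp
    finally show ?thesis .
  next
    case False
    then show ?thesis using exc_far[of x] y gi(3) by auto
  qed
qed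

lemma exc_le_bounded:
  assumes y: "0 \<le> y" and s: "g 0 \<le> ereal (u + y / c)" and x: "0 < x"
  shows "exc c u x \<le> y"
proof (cases "x < r")
  case True
  have "ereal (gr x) \<le> ereal (u + y / c)" using exc_close(3)[OF x True] g_facts(2)[of x] s x by auto
  then have "gr x - u \<le> y / c" by simp
  then have "c * (gr x - u) \<le> c * (y / c)" using c by (intro mult_left_mono) auto
  then show ?thesis using exc_close(1)[OF x True] c by simp
next
  case False
  then show ?thesis using exc_far[of x] y by simp
qed

end

text \<open>The excess at distance \<open>0\<close> is excluded, where an infinite value of \<open>g\<close> is turned into \<open>0\<close>.\<close>

definition tails :: "(real \<Rightarrow> real) \<Rightarrow> (real \<Rightarrow> real) \<Rightarrow> bool" where
  "tails sc \<pi> \<longleftrightarrow> (\<forall>r. (\<forall>\<^sub>F n in sequentially. 0 < r n) \<longrightarrow> r \<longlonglongrightarrow> 0 \<longrightarrow>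
     (\<forall>\<^sub>F n in sequentially. 0 < sc (gr (r n))) \<and>
     (\<forall>y\<ge>0. \<exists>\<rho>. (\<forall>\<^sub>F n in sequentially. 0 \<le> \<rho> n \<and> \<rho> n \<le> r n \<and>
          (\<forall>x>0. y < exc (sc (gr (r n))) (gr (r n)) x \<longleftrightarrow> x < \<rho> n)) \<and>
        (\<lambda>n. \<rho> n / r n) \<longlonglongrightarrow> 1 - \<pi> y))"

text \<open>Two situations occur. Either the raised level does not exceed the maximum
  \<open>g 0\<close>, and the inverse of \<open>g\<close> gives the radius where the rescaled excess
  is above \<open>y\<close>; or it has reached the maximum, the excess never exceeds
  \<open>y\<close>, and the radius is 0.\<close>

lemma tailsI:
  assumes "\<And>r. \<forall>\<^sub>F n in sequentially. 0 < r n \<Longrightarrow> r \<longlonglongrightarrow> 0 \<Longrightarrow> \<forall>\<^sub>F n in sequentially. 0 < sc (gr (r n))"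
    and "\<And>r y. \<forall>\<^sub>F n in sequentially. 0 < r n \<Longrightarrow> r \<longlonglongrightarrow> 0 \<Longrightarrow> 0 \<le> y \<Longrightarrow>
      (\<forall>\<^sub>F n in sequentially. ereal (gr (r n) + y / sc (gr (r n))) \<le> g 0) \<and>
      (\<lambda>n. ginv (ereal (gr (r n) + y / sc (gr (r n)))) / r n) \<longlonglongrightarrow> 1 - \<pi> y \<or>
      (\<forall>\<^sub>F n in sequentially. g 0 \<le> ereal (gr (r n) + y / sc (gr (r n)))) \<and> \<pi> y = 1"
  shows "tails sc \<pi>"
  unfolding tails_def
proof (intro allI impI conjI)
  fix r :: "nat \<Rightarrow> real" assume r: "\<forall>\<^sub>F n in sequentially. 0 < r n" "r \<longlonglongrightarrow> 0"
  let ?u = "\<lambda>n. gr (r n)"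
  show scp: "\<forall>\<^sub>F n in sequentially. 0 < sc (?u n)" by (rule assms(1)[OF r])
  obtain \<delta> where \<delta>: "near \<delta>" using near_ex by blast
  have rd: "\<forall>\<^sub>F n in sequentially. 0 < r n \<and> r n < \<delta>"
    using r(1) order_tendstoD(2)[OF r(2), of \<delta>] \<delta> by (auto simp: near_def eventually_conj)
  fix y :: real assume y: "0 \<le> y"
  let ?s = "\<lambda>n. ereal (?u n + y / sc (?u n))"
  show "\<exists>\<rho>. (\<forall>\<^sub>F n in sequentially. 0 \<le> \<rho> n \<and> \<rho> n \<le> r n \<and> (\<forall>x>0. y < exc (sc (?u n)) (?u n) x \<longleftrightarrow> x < \<rho> n)) \<and>
        (\<lambda>n. \<rho> n / r n) \<longlonglongrightarrow> 1 - \<pi> y"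
    using assms(2)[OF r y]
  proof (elim disjE conjE)
    assume a: "\<forall>\<^sub>F n in sequentially. ?s n \<le> g 0" and lim: "(\<lambda>n. ginv (?s n) / r n) \<longlonglongrightarrow> 1 - \<pi> y"
    show ?thesis
    proof (intro exI[of _ "\<lambda>n. ginv (?s n)"] conjI lim)
      show "\<forall>\<^sub>F n in sequentially. 0 \<le> ginv (?s n) \<and> ginv (?s n) \<le> r n \<and> (\<forall>x>0. y < exc (sc (?u n)) (?u n) x \<longleftrightarrow> x < ginv (?s n))"
        using a scp rd
      proof eventually_elim
        case (elim n)
        then have e: "ereal (?u n) = g (r n)" using g_finite(2)[OF \<delta>, of "r n"] by auto
        note E = exc_gt_iff[OF \<delta> _ _ elim(2) e y elim(1)]
        show ?case using E elim(3) by (auto intro: zero_less_one)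
      qed
    qed
  next
    assume a: "\<forall>\<^sub>F n in sequentially. g 0 \<le> ?s n" and p: "\<pi> y = 1"
    show ?thesis
    proof (intro exI[of _ "\<lambda>n. 0"] conjI)
      show "\<forall>\<^sub>F n in sequentially. 0 \<le> (0::real) \<and> 0 \<le> r n \<and> (\<forall>x>0. y < exc (sc (?u n)) (?u n) x \<longleftrightarrow> x < 0)"
        using a scp rd
      proof eventually_elim
        case (elim n)
        then have e: "ereal (?u n) = g (r n)" using g_finite(2)[OF \<delta>, of "r n"] by auto
        show ?case using exc_le_bounded[OF \<delta> _ _ elim(2) e y elim(1)] elim(3) by (auto simp: not_less[symmetric])
      qed
    qed (simp add: p)
  qed
qed

text \<open>Put \<open>s = g (r n)\<close>. Then the raised level is \<open>s + y \<eta>(s)\<close>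
  and \<open>ginv s = r n\<close>, so the ratio of radii is the very quotient in the definition of
  the type.\<close>

lemma tails_type1:
  assumes "obs_type1 g V W \<eta>"
  shows "tails (\<lambda>u. inverse (\<eta> (ereal u))) (\<lambda>x. if x < 0 then 0 else 1 - exp (- x))"
proof (rule tailsI)
  obtain \<delta> where \<delta>: "near \<delta>" using near_ex by blast
  fix r :: "nat \<Rightarrow> real" assume r: "\<forall>\<^sub>F n in sequentially. 0 < r n" "r \<longlonglongrightarrow> 0"
  have rd: "\<forall>\<^sub>F n in sequentially. 0 < r n \<and> r n < \<delta>"
    using r(1) order_tendstoD(2)[OF r(2), of \<delta>] \<delta> by (auto simp: near_def eventually_conj)
  then show "\<forall>\<^sub>F n in sequentially. 0 < inverse (\<eta> (ereal (gr (r n))))"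
  proof eventually_elim
    case (elim n)
    then have "r n \<in> V" using \<delta> by (auto simp: near_def)
    then have "g (r n) \<in> W" using g_facts(4) by blast
    then have "0 < \<eta> (g (r n))" using assms by (auto simp: obs_type1_def)
    then show ?case using g_finite(2)[OF \<delta>, of "r n"] elim by simp
  qed
  fix y :: real assume y: "0 \<le> y"
  let ?s = "\<lambda>n. ereal (gr (r n) + y / inverse (\<eta> (ereal (gr (r n)))))"
  have fl: "filterlim (\<lambda>n. g (r n)) (at_left (g 0)) sequentially" by (rule g_tendsto[OF \<delta> r])
  have e1: "\<forall>\<^sub>F n in sequentially. g (r n) + ereal (y * \<eta> (g (r n))) \<in> W"
    by (rule eventually_compose_filterlim[OF _ fl]) (use assms in \<open>auto simp: obs_type1_def\<close>)
  have l1: "(\<lambda>n. ginv (g (r n) + ereal (y * \<eta> (g (r n)))) / ginv (g (r n))) \<longlonglongrightarrow> exp (- y)"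
    by (rule filterlim_compose[OF _ fl]) (use assms in \<open>auto simp: obs_type1_def\<close>)
  have eq: "\<forall>\<^sub>F n in sequentially. g (r n) + ereal (y * \<eta> (g (r n))) =
     ?s n \<and> ginv (g (r n)) = r n"
    using rd
  proof eventually_elim
    case (elim n)
    have e: "ereal (gr (r n)) = g (r n)" using g_finite(2)[OF \<delta>, of "r n"] elim by auto
    show ?case using ginv_g[OF \<delta>, of "r n"] elim by (simp add: e plus_ereal.simps(1)[symmetric] divide_inverse del: plus_ereal.simps)
  qed
  have "\<forall>\<^sub>F n in sequentially. ?s n \<le> g 0"
    using e1 eq
  proof eventually_elim
    case (elim n)
    then have "?s n \<in> W" by simp
    then obtain v where "v \<in> V" "g v = ?s n"
      using g_facts(4) by (metis imageE)
    moreover from this have "0 \<le> v" using shape by (auto simp: observable_shape_def)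
    ultimately show ?case using g_facts(2)[of v] by simp
  qed
  moreover have "(\<lambda>n. ginv (?s n) / r n) \<longlonglongrightarrow> exp (- y)"
    by (rule Lim_transform_eventually[OF l1]) (use eq in \<open>auto elim: eventually_mono\<close>)
  ultimately show "(\<forall>\<^sub>F n in sequentially. ?s n \<le> g 0) \<and>
      (\<lambda>n. ginv (?s n) / r n) \<longlonglongrightarrow> 1 - (if y < 0 then 0 else 1 - exp (- y)) \<or>
      (\<forall>\<^sub>F n in sequentially. g 0 \<le> ?s n) \<and> (if y < 0 then 0 else 1 - exp (- y)) = 1"
    using y by simp
qed

text \<open>Scaling by \<open>inverse u\<close> raises the level to
  \<open>u + y u = u (1 + y)\<close>, so the limit is the defining one at \<open>1 + y\<close>; this
  is where the shift by 1 in the Pareto law comes from.\<close>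

lemma tails_type2:
  assumes "obs_type2 g V \<beta>"
  shows "tails inverse (\<lambda>x. if x < 0 then 0 else 1 - (1 + x) powr (- \<beta>))"
proof (rule tailsI)
  obtain \<delta> where \<delta>: "near \<delta>" using near_ex by blast
  have g0: "g 0 = \<infinity>" using assms by (simp add: obs_type2_def)
  fix r :: "nat \<Rightarrow> real" assume r: "\<forall>\<^sub>F n in sequentially. 0 < r n" "r \<longlonglongrightarrow> 0"
  have rd: "\<forall>\<^sub>F n in sequentially. 0 < r n \<and> r n < \<delta>"
    using r(1) order_tendstoD(2)[OF r(2), of \<delta>] \<delta> by (auto simp: near_def eventually_conj)
  have "(\<lambda>n. g (r n)) \<longlonglongrightarrow> \<infinity>" using g_tendsto[OF \<delta> r] g0 by (auto simp: filterlim_at)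
  then have "(\<lambda>n. ereal (gr (r n))) \<longlonglongrightarrow> \<infinity>"
    by (rule Lim_transform_eventually) (use rd in \<open>auto elim!: eventually_mono simp: g_finite(2)[OF \<delta>]\<close>)
  then have fl: "filterlim (\<lambda>n. gr (r n)) at_top sequentially"
    by (simp add: tendsto_PInfty_eq_at_top)
  have "\<forall>\<^sub>F n in sequentially. 0 < gr (r n)" using fl by (simp add: filterlim_at_top_dense)
  then show "\<forall>\<^sub>F n in sequentially. 0 < inverse (gr (r n))" by eventually_elim simp
  fix y :: real assume y: "0 \<le> y"
  let ?s = "\<lambda>n. ereal (gr (r n) + y / inverse (gr (r n)))"
  have l1: "(\<lambda>n. ginv (ereal (gr (r n) * (1 + y))) / ginv (ereal (gr (r n)))) \<longlonglongrightarrow> (1 + y) powr (- \<beta>)"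
    by (rule filterlim_compose[OF _ fl]) (use assms y in \<open>auto simp: obs_type2_def\<close>)
  have "(\<lambda>n. ginv (?s n) / r n) \<longlonglongrightarrow> (1 + y) powr (- \<beta>)"
  proof (rule Lim_transform_eventually[OF l1])
    show "\<forall>\<^sub>F n in sequentially. ginv (ereal (gr (r n) * (1 + y))) / ginv (ereal (gr (r n))) =
       ginv (?s n) / r n"
      using rd
    proof eventually_elim
      case (elim n)
      have e: "ereal (gr (r n)) = g (r n)" using g_finite(2)[OF \<delta>, of "r n"] elim by auto
      show ?case unfolding e using ginv_g[OF \<delta>, of "r n"] elim by (simp add: algebra_simps divide_inverse)
    qed
  qed
  then show "(\<forall>\<^sub>F n in sequentially. ?s n \<le> g 0) \<and>
      (\<lambda>n. ginv (?s n) / r n) \<longlonglongrightarrow> 1 - (if y < 0 then 0 else 1 - (1 + y) powr (- \<beta>)) \<or>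
      (\<forall>\<^sub>F n in sequentially. g 0 \<le> ?s n) \<and> (if y < 0 then 0 else 1 - (1 + y) powr (- \<beta>)) = 1"
    using y g0 by simp
qed

text \<open>Here \<open>u + y (D - u) = D - (D - u) (1 - y)\<close>, so the defining limit is used
  at \<open>1 - y\<close>. For \<open>y \<ge> 1\<close> the level reaches the maximum
  \<open>D\<close>, which explains why the law ends at 1.\<close>

lemma tails_type3:
  assumes "obs_type3 g V D \<gamma>"
  shows "tails (\<lambda>u. inverse (D - u)) (\<lambda>x. if x < 0 then 0 else if x < 1 then 1 - (1 - x) powr \<gamma> else 1)"
proof (rule tailsI)
  obtain \<delta> where \<delta>: "near \<delta>" using near_ex by blast
  have g0: "g 0 = ereal D" using assms by (simp add: obs_type3_def)
  fix r :: "nat \<Rightarrow> real" assume r: "\<forall>\<^sub>F n in sequentially. 0 < r n" "r \<longlonglongrightarrow> 0"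
  have rd: "\<forall>\<^sub>F n in sequentially. 0 < r n \<and> r n < \<delta>"
    using r(1) order_tendstoD(2)[OF r(2), of \<delta>] \<delta> by (auto simp: near_def eventually_conj)
  let ?u = "\<lambda>n. gr (r n)"
  have uD: "\<forall>\<^sub>F n in sequentially. ?u n < D"
    using rd
  proof eventually_elim
    case (elim n)
    have "ereal (?u n) < ereal D" using g_finite[OF \<delta>, of "r n"] elim g0 by simp
    then show ?case by simp
  qed
  then show "\<forall>\<^sub>F n in sequentially. 0 < inverse (D - ?u n)" by eventually_elim simp
  have "(\<lambda>n. g (r n)) \<longlonglongrightarrow> ereal D" using g_tendsto[OF \<delta> r] unfolding g0 filterlim_at by blast
  moreover have "\<forall>\<^sub>F n in sequentially. g (r n) = ereal (?u n)"
    using rd by eventually_elim (use g_finite(2)[OF \<delta>] in auto)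
  ultimately have "((\<lambda>n. ereal (?u n)) \<longlongrightarrow> ereal D) sequentially" by (rule Lim_transform_eventually)
  then have "?u \<longlonglongrightarrow> D" unfolding lim_ereal .
  then have "(\<lambda>n. D - ?u n) \<longlonglongrightarrow> D - D" by (rule tendsto_diff[OF tendsto_const])
  then have fl: "filterlim (\<lambda>n. D - ?u n) (at_right 0) sequentially"
    using uD by (auto simp: filterlim_at elim: eventually_mono)
  fix y :: real assume y: "0 \<le> y"
  show "(\<forall>\<^sub>F n in sequentially. ereal (?u n + y / inverse (D - ?u n)) \<le> g 0) \<and>
      (\<lambda>n. ginv (ereal (?u n + y / inverse (D - ?u n))) / r n) \<longlonglongrightarrow> 1 - (if y < 0 then 0 else if y < 1 then 1 - (1 - y) powr \<gamma> else 1) \<or>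
      (\<forall>\<^sub>F n in sequentially. g 0 \<le> ereal (?u n + y / inverse (D - ?u n))) \<and> (if y < 0 then 0 else if y < 1 then 1 - (1 - y) powr \<gamma> else 1) = 1"
  proof (cases "y < 1")
    case True
    have l1: "(\<lambda>n. ginv (ereal (D - (D - ?u n) * (1 - y))) / ginv (ereal (D - (D - ?u n)))) \<longlonglongrightarrow> (1 - y) powr \<gamma>"
      by (rule filterlim_compose[OF _ fl]) (use assms True in \<open>auto simp: obs_type3_def\<close>)
    have "(\<lambda>n. ginv (ereal (?u n + y / inverse (D - ?u n))) / r n) \<longlonglongrightarrow> (1 - y) powr \<gamma>"
    proof (rule Lim_transform_eventually[OF l1])
      show "\<forall>\<^sub>F n in sequentially. ginv (ereal (D - (D - ?u n) * (1 - y))) / ginv (ereal (D - (D - ?u n))) = ginv (ereal (?u n + y / inverse (D - ?u n))) / r n"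
        using rd
      proof eventually_elim
        case (elim n)
        have e: "ereal (?u n) = g (r n)" using g_finite(2)[OF \<delta>, of "r n"] elim by auto
        have "D - (D - ?u n) * (1 - y) = ?u n + y / inverse (D - ?u n)" by (simp add: algebra_simps divide_inverse)
        moreover have "ginv (ereal (D - (D - ?u n))) = r n" using ginv_g[OF \<delta>, of "r n"] elim e by simp
        ultimately show ?case by simp
      qed
    qed
    moreover have "\<forall>\<^sub>F n in sequentially. ereal (?u n + y / inverse (D - ?u n)) \<le> g 0"
      using uD
    proof eventually_elim
      case (elim n)
      have "y * (D - ?u n) \<le> 1 * (D - ?u n)" using True elim by (intro mult_right_mono) auto
      then show ?case using g0 by (simp add: divide_inverse)
    qed
    ultimately show ?thesis using y True by simp
  next
    case False
    have "\<forall>\<^sub>F n in sequentially. g 0 \<le> ereal (?u n + y / inverse (D - ?u n))"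
      using uD
    proof eventually_elim
      case (elim n)
      have "1 * (D - ?u n) \<le> y * (D - ?u n)" using False elim by (intro mult_right_mono) auto
      then show ?case using g0 by (simp add: divide_inverse)
    qed
    then show ?thesis using y False by simp
  qed
qed

end

section \<open>From tails to Laplace transforms\<close>

text \<open>Fubini for \<open>1 - exp (- t e)\<close>, written as the integral of
  \<open>t exp (- t y)\<close> over \<open>y\<close> from 0 to \<open>e\<close>. Used both for the
  excess under \<open>leb\<close> and for the law of the marks, so that only tails have to be
  compared.\<close>

lemma layer_cake:
  assumes fm: "finite_measure M" and e[measurable]: "e \<in> borel_measurable M" and e0: "AE x in M. 0 \<le> e x" and t: "0 < t"
  shows "(LINT x|M. 1 - exp (- (t * e x))) = (LINT y|lborel. indicator {0..} y * (t * exp (- (t * y))) * measure M {x \<in> space M. y < e x})"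
    and "(\<lambda>y. measure M {x \<in> space M. y < e x}) \<in> borel_measurable borel"
proof -
  interpret M: finite_measure M by (rule fm)
  interpret PM: pair_sigma_finite M "lborel :: real measure" ..
  let ?f = "\<lambda>x y. ennreal (t * exp (- (t * y))) * indicator {0..} y * indicator {y. y < e x} y"
  have fm2: "(\<lambda>(x, y). ?f x y) \<in> borel_measurable (M \<Otimes>\<^sub>M lborel)"
  proof -
    have "(\<lambda>(x, y). ?f x y) = (\<lambda>(x, y). ennreal (t * exp (- (t * y))) * indicator {0..} y * (if y < e x then 1 else 0))"
      by (auto simp: indicator_def)
    then show ?thesis by (simp add: split_beta') measurable
  qed
  have fm1: "(\<lambda>(y, x). (if y < e x then 1 else 0) :: ennreal) \<in> borel_measurable (lborel \<Otimes>\<^sub>M M)"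
    by (simp add: split_beta') measurable
  have em: "(\<integral>\<^sup>+x. (if y < e x then 1 else 0) \<partial>M) = emeasure M {x \<in> space M. y < e x}" for y
  proof -
    have "(\<integral>\<^sup>+x. (if y < e x then 1 else 0) \<partial>M) = (\<integral>\<^sup>+x. indicator {x \<in> space M. y < e x} x \<partial>M)"
      by (intro nn_integral_cong) (auto simp: indicator_def)
    also have "\<dots> = emeasure M {x \<in> space M. y < e x}" by (rule nn_integral_indicator) measurable
    finally show ?thesis .
  qed
  have "(\<lambda>y. \<integral>\<^sup>+x. (if y < e x then 1 else 0) \<partial>M) \<in> borel_measurable lborel"
    by (rule M.borel_measurable_nn_integral[OF fm1])
  then have "(\<lambda>y. emeasure M {x \<in> space M. y < e x}) \<in> borel_measurable borel" unfolding em by simp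
  then show mm[measurable]: "(\<lambda>y. measure M {x \<in> space M. y < e x}) \<in> borel_measurable borel"
    unfolding measure_def by (rule borel_measurable_enn2real)
  have inner: "(\<integral>\<^sup>+y. ?f x y \<partial>lborel) = ennreal (1 - exp (- (t * e x)))" if "0 \<le> e x" for x
  proof -
    have "((\<lambda>y. t * exp (- (t * y))) has_integral (- exp (- (t * e x))) - (- exp (- (t * 0)))) {0..e x}"
    proof (rule fundamental_theorem_of_calculus[OF that])
      fix y
      have "((\<lambda>y. - exp (- (t * y))) has_real_derivative t * exp (- (t * y))) (at y)"
        by (auto intro!: derivative_eq_intros)
      then show "((\<lambda>y. - exp (- (t * y))) has_vector_derivative t * exp (- (t * y))) (at y within {0..e x})"
        by (simp add: has_real_derivative_iff_has_vector_derivative has_vector_derivative_at_within)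
    qed
    then have "((\<lambda>y. t * exp (- (t * y))) has_integral (1 - exp (- (t * e x)))) {0..e x}" by simp
    then have "(\<integral>\<^sup>+y. ennreal (t * exp (- (t * y))) * indicator {0..e x} y \<partial>lborel) = ennreal (1 - exp (- (t * e x)))"
      using t by (intro nn_integral_has_integral_lebesgue') auto
    moreover have "(\<integral>\<^sup>+y. ?f x y \<partial>lborel) = (\<integral>\<^sup>+y. ennreal (t * exp (- (t * y))) * indicator {0..e x} y \<partial>lborel)"
    proof (rule nn_integral_cong_AE)
      show "AE y in lborel. ?f x y = ennreal (t * exp (- (t * y))) * indicator {0..e x} y"
        using AE_lborel_singleton[of "e x"] by eventually_elim (auto simp: indicator_def)
    qed
    ultimately show ?thesis by simp
  qed
  have b: "0 \<le> 1 - exp (- (t * e x))" if "0 \<le> e x" for x using mult_nonneg_nonneg[OF less_imp_le[OF t] that] by simp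
  have "(LINT x|M. 1 - exp (- (t * e x))) = enn2real (\<integral>\<^sup>+x. ennreal (1 - exp (- (t * e x))) \<partial>M)"
    by (rule integral_eq_nn_integral[OF _ AE_mp[OF e0]]) (use b in \<open>auto intro!: AE_I2\<close>)
  also have "(\<integral>\<^sup>+x. ennreal (1 - exp (- (t * e x))) \<partial>M) = (\<integral>\<^sup>+x. \<integral>\<^sup>+y. ?f x y \<partial>lborel \<partial>M)"
    by (rule nn_integral_cong_AE[OF AE_mp[OF e0]]) (use inner in \<open>auto intro!: AE_I2\<close>)
  also have "\<dots> = (\<integral>\<^sup>+y. \<integral>\<^sup>+x. ?f x y \<partial>M \<partial>lborel)" by (rule PM.Fubini'[OF fm2, symmetric])
  also have "\<dots> = (\<integral>\<^sup>+y. ennreal (indicator {0..} y * (t * exp (- (t * y))) * measure M {x \<in> space M. y < e x}) \<partial>lborel)"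
  proof (rule nn_integral_cong)
    fix y :: real
    have "(\<integral>\<^sup>+x. ?f x y \<partial>M) = (\<integral>\<^sup>+x. (ennreal (t * exp (- (t * y))) * indicator {0..} y) * (if y < e x then 1 else 0) \<partial>M)"
      by (intro nn_integral_cong) (auto simp: indicator_def)
    also have "\<dots> = (ennreal (t * exp (- (t * y))) * indicator {0..} y) * (\<integral>\<^sup>+x. (if y < e x then 1 else 0) \<partial>M)"
      by (rule nn_integral_cmult) measurable
    also have "\<dots> = (ennreal (t * exp (- (t * y))) * indicator {0..} y) * ennreal (measure M {x \<in> space M. y < e x})"
      unfolding em by (simp add: M.emeasure_eq_measure)
    also have "\<dots> = ennreal (indicator {0..} y * (t * exp (- (t * y))) * measure M {x \<in> space M. y < e x})"
      using t by (auto simp: indicator_def ennreal_mult)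
    finally show "(\<integral>\<^sup>+x. ?f x y \<partial>M) = \<dots>" .
  qed
  also have "enn2real \<dots> = (LINT y|lborel. indicator {0..} y * (t * exp (- (t * y))) * measure M {x \<in> space M. y < e x})"
    by (rule integral_eq_nn_integral[symmetric]) (use t in \<open>auto intro!: AE_I2\<close>)
  finally show "(LINT x|M. 1 - exp (- (t * e x))) = (LINT y|lborel. indicator {0..} y * (t * exp (- (t * y))) * measure M {x \<in> space M. y < e x})" .
qed

text \<open>For small \<open>e\<close>, \<open>ln (1 - e)\<close> lies between
  \<open>- e - 2 e^2\<close> and \<open>- e\<close>. As all \<open>e n m\<close> are at most
  \<open>d n\<close>, the quadratic terms add up to at most \<open>2 * d n\<close> times the
  sum.\<close>

lemma prod_tendsto_exp:
  fixes e :: "nat \<Rightarrow> nat \<Rightarrow> real"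
  assumes e: "\<forall>\<^sub>F n in sequentially. \<forall>m<N n. 0 \<le> e n m \<and> e n m \<le> d n" and d: "d \<longlonglongrightarrow> 0"
    and s: "(\<lambda>n. \<Sum>m<N n. e n m) \<longlonglongrightarrow> s"
  shows "(\<lambda>n. \<Prod>m<N n. 1 - e n m) \<longlonglongrightarrow> exp (- s)"
proof (rule tendsto_sandwich)
  have d2: "\<forall>\<^sub>F n in sequentially. d n < 1 / 2" by (rule order_tendstoD(2)[OF d]) simp
  show "\<forall>\<^sub>F n in sequentially. exp (- ((1 + 2 * d n) * (\<Sum>m<N n. e n m))) \<le> (\<Prod>m<N n. 1 - e n m)"
    using e d2
  proof eventually_elim
    case (elim n)
    have "exp (- ((1 + 2 * d n) * (\<Sum>m<N n. e n m))) = (\<Prod>m<N n. exp (- ((1 + 2 * d n) * e n m)))"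
      by (simp add: exp_sum[symmetric] sum_distrib_left sum_negf)
    also have "\<dots> \<le> (\<Prod>m<N n. 1 - e n m)"
    proof (intro prod_mono conjI)
      fix m assume "m \<in> {..<N n}"
      then have em: "0 \<le> e n m" "e n m \<le> d n" using elim by auto
      have "- e n m - 2 * (e n m)\<^sup>2 \<le> ln (1 - e n m)" using em elim by (intro ln_one_minus_pos_lower_bound) auto
      moreover have "(e n m)\<^sup>2 \<le> d n * e n m" unfolding power2_eq_square using em by (intro mult_right_mono) auto
      ultimately have "- ((1 + 2 * d n) * e n m) \<le> ln (1 - e n m)" by (simp add: algebra_simps)
      then have "exp (- ((1 + 2 * d n) * e n m)) \<le> exp (ln (1 - e n m))" by simp
      then show "exp (- ((1 + 2 * d n) * e n m)) \<le> 1 - e n m" using em elim by simp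
    qed simp
    finally show ?case .
  qed
  show "\<forall>\<^sub>F n in sequentially. (\<Prod>m<N n. 1 - e n m) \<le> exp (- (\<Sum>m<N n. e n m))"
    using e d2
  proof eventually_elim
    case (elim n)
    have "(\<Prod>m<N n. 1 - e n m) \<le> (\<Prod>m<N n. exp (- e n m))"
    proof (intro prod_mono conjI)
      fix m assume "m \<in> {..<N n}"
      then show "0 \<le> 1 - e n m" using elim by force
      show "1 - e n m \<le> exp (- e n m)" using exp_ge_add_one_self[of "- e n m"] by simp
    qed
    then show ?case by (simp add: exp_sum[symmetric] sum_negf)
  qed
  have "(\<lambda>n. exp (- ((1 + 2 * d n) * (\<Sum>m<N n. e n m)))) \<longlonglongrightarrow> exp (- ((1 + 2 * 0) * s))"
    by (intro tendsto_intros d s)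
  then show "(\<lambda>n. exp (- ((1 + 2 * d n) * (\<Sum>m<N n. e n m)))) \<longlonglongrightarrow> exp (- s)" by simp
  show "(\<lambda>n. exp (- (\<Sum>m<N n. e n m))) \<longlonglongrightarrow> exp (- s)" by (intro tendsto_intros s)
qed

text \<open>What the three limit laws share. It makes \<open>\<pi>\<close> the distribution function
  of a probability measure on the positive reals, as the renewal argument requires.\<close>

definition mark_law :: "(real \<Rightarrow> real) \<Rightarrow> bool" where
  "mark_law \<pi> \<longleftrightarrow> mono \<pi> \<and> (\<forall>x. isCont \<pi> x) \<and> (\<forall>x\<le>0. \<pi> x = 0) \<and> (\<pi> \<longlongrightarrow> 1) at_top"

lemma mark_law_facts:
  assumes "mark_law \<pi>"
  shows "renewal_marks (interval_measure \<pi>)" "measure (interval_measure \<pi>) {d. y < d} = 1 - \<pi> y"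
proof -
  have m: "\<And>x y. x \<le> y \<Longrightarrow> \<pi> x \<le> \<pi> y" using assms by (auto simp: mark_law_def mono_def)
  have c: "continuous (at_right a) \<pi>" for a using assms by (auto simp: mark_law_def intro: continuous_at_imp_continuous_within)
  have b: "(\<pi> \<longlongrightarrow> 0) at_bot"
    by (rule tendsto_eventually, rule eventually_mono[OF eventually_le_at_bot[of 0]]) (use assms in \<open>auto simp: mark_law_def\<close>)
  interpret D: real_distribution "interval_measure \<pi>"
    by (rule real_distribution_interval_measure) (use m c b assms in \<open>auto simp: mark_law_def\<close>)
  have cdf: "measure (interval_measure \<pi>) {..y} = \<pi> y" for y
    using fun_cong[OF cdf_interval_measure[OF m c b], of y] by (simp add: cdf_def)
  have "measure (interval_measure \<pi>) (space (interval_measure \<pi>) - {..y}) = 1 - \<pi> y"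
    by (subst D.prob_compl) (auto simp: cdf)
  moreover have "space (interval_measure \<pi>) - {..y} = {d. y < d}" by auto
  ultimately show "measure (interval_measure \<pi>) {d. y < d} = 1 - \<pi> y" by simp
  have "measure (interval_measure \<pi>) {..0} = 0" unfolding cdf using assms by (simp add: mark_law_def)
  then have "AE d in interval_measure \<pi>. d \<notin> {..0}" by (intro AE_not_in) (simp add: D.emeasure_eq_measure null_sets_def)
  then have "AE d in interval_measure \<pi>. 0 \<le> d" by (rule AE_mp) (auto intro!: AE_I2)
  then show "renewal_marks (interval_measure \<pi>)" by unfold_locales auto
qed

lemma mark_law_type1: "mark_law (\<lambda>x. if x < 0 then 0 else 1 - exp (- x))"
proof -
  \<comment> \<open>Writing the case distinction with \<open>max\<close> makes monotonicity and
    continuity follow by composition; the other two types use the same device.\<close>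
  have eq: "(\<lambda>x. if x < 0 then 0 else 1 - exp (- x)) = (\<lambda>x::real. 1 - exp (- max 0 x))" by (auto simp: max_def)
  have "((\<lambda>x::real. exp (- x)) \<longlongrightarrow> 0) at_top" by (rule filterlim_compose[OF exp_at_bot filterlim_uminus_at_bot_at_top])
  then have "((\<lambda>x::real. 1 - exp (- x)) \<longlongrightarrow> 1 - 0) at_top" by (intro tendsto_intros)
  then have "((\<lambda>x::real. 1 - exp (- max 0 x)) \<longlongrightarrow> 1) at_top"
    by (simp, elim Lim_transform_eventually) (auto intro: eventually_mono[OF eventually_ge_at_top[of 0]])
  then show ?thesis unfolding mark_law_def eq by (auto simp: mono_def max_absorb1 max.coboundedI2 intro!: continuous_intros)
qed

lemma mark_law_type2:
  assumes "0 < \<beta>" shows "mark_law (\<lambda>x. if x < 0 then 0 else 1 - (1 + x) powr (- \<beta>))"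
proof -
  have eq: "(\<lambda>x. if x < 0 then 0 else 1 - (1 + x) powr (- \<beta>)) = (\<lambda>x::real. 1 - (1 + max 0 x) powr (- \<beta>))" by (auto simp: max_def)
  have "((\<lambda>x::real. (1 + x) powr (- \<beta>)) \<longlongrightarrow> 0) at_top"
    using assms by (intro tendsto_neg_powr filterlim_tendsto_add_at_top[OF tendsto_const] filterlim_ident) auto
  then have "((\<lambda>x::real. 1 - (1 + x) powr (- \<beta>)) \<longlongrightarrow> 1 - 0) at_top" by (intro tendsto_intros)
  then have l: "((\<lambda>x::real. 1 - (1 + max 0 x) powr (- \<beta>)) \<longlongrightarrow> 1 - 0) at_top"
    by (rule Lim_transform_eventually) (auto intro: eventually_mono[OF eventually_ge_at_top[of 0]])
  have m: "(1 + max 0 y) powr (- \<beta>) \<le> (1 + max 0 x) powr (- \<beta>)" if "x \<le> y" for x y :: real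
    using assms that by (intro powr_mono2') auto
  have c: "isCont (\<lambda>x. 1 - (1 + max 0 x) powr (- \<beta>)) x" for x :: real
    by (intro continuous_intros) (simp add: add_pos_nonneg[THEN less_imp_neq, symmetric])
  show ?thesis unfolding mark_law_def eq using l m c by (auto simp: mono_def max_absorb1)
qed

lemma mark_law_type3:
  assumes "0 < \<gamma>" shows "mark_law (\<lambda>x. if x < 0 then 0 else if x < 1 then 1 - (1 - x) powr \<gamma> else 1)"
proof -
  have eq: "(\<lambda>x. if x < 0 then 0 else if x < 1 then 1 - (1 - x) powr \<gamma> else 1) = (\<lambda>x::real. 1 - (max 0 (1 - max 0 x)) powr \<gamma>)"
    by (auto simp: max_def fun_eq_iff)
  have l: "((\<lambda>x::real. 1 - (max 0 (1 - max 0 x)) powr \<gamma>) \<longlongrightarrow> 1) at_top"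
    by (rule tendsto_eventually, rule eventually_mono[OF eventually_ge_at_top[of 1]]) (auto simp: max_def)
  have m: "(max 0 (1 - max 0 y)) powr \<gamma> \<le> (max 0 (1 - max 0 x)) powr \<gamma>" if "x \<le> y" for x y :: real
    using assms that by (intro powr_mono2) auto
  have "continuous_on UNIV (\<lambda>x::real. 1 - (max 0 (1 - max 0 x)) powr \<gamma>)"
    using assms by (intro continuous_intros continuous_on_powr') auto
  then have c: "isCont (\<lambda>x. 1 - (max 0 (1 - max 0 x)) powr \<gamma>) x" for x :: real by (simp add: continuous_on_eq_continuous_at)
  show ?thesis unfolding mark_law_def eq using l m c by (auto simp: mono_def max_absorb1)
qed

section \<open>Laplace factors of the rescaled excess\<close>

locale extremes = fibred f l p Q h + observable g V W
  for f :: "'y::finite \<Rightarrow> real \<Rightarrow> real" and l p Q h and g :: "real \<Rightarrow> ereal" and V W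
begin

definition xi :: "real \<Rightarrow> real \<Rightarrow> real \<Rightarrow> real \<Rightarrow> real \<Rightarrow> real" where
  "xi c u z t x = 1 - exp (- (t * exc c u (dist x z)))"

text \<open>The excess is monotone in the distance on either side of \<open>z\<close> and vanishes
  beyond \<open>r\<close>. So the variation is bounded by a universal constant, however small
  \<open>r\<close> and however large the scale \<open>c\<close>.\<close>

lemma xi_bump:
  assumes \<delta>: "near \<delta>" "0 < r" "r < \<delta>" "0 < c" "ereal u = g r" and t: "0 \<le> t"
  shows "bump z r (xi c u z t)" "bvar 4 (xi c u z t)" "(\<lambda>x. exc c u (dist x z)) \<in> borel_measurable leb"
proof -
  note E = exc_nonneg[OF \<delta>] exc_antimono[OF \<delta>] exc_far[OF \<delta>]
  have n: "0 \<le> xi c u z t x \<and> xi c u z t x \<le> 1" if "0 \<le> t" for x t using E(1) that by (simp add: xi_def)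
  have bv: "bvar 4 (xi c u z t)" if t: "0 \<le> t" for t
  proof (rule bvar_unimodal[where z = z])
    fix x y :: real
    show "0 \<le> xi c u z t x \<and> xi c u z t x \<le> 1" using n[OF t] .
    assume "x \<le> y" "y < z"
    then show "xi c u z t x \<le> xi c u z t y" unfolding xi_def using t
      by (simp, intro mult_left_mono E(2)) (auto simp: dist_real_def)
  next
    fix x y :: real
    assume "z < x" "x \<le> y"
    then show "xi c u z t y \<le> xi c u z t x" unfolding xi_def using t
      by (simp, intro mult_left_mono E(2)) (auto simp: dist_real_def)
  qed
  show "bvar 4 (xi c u z t)" by (rule bv[OF t])
  show "bump z r (xi c u z t)"
    unfolding bump_def using n[OF t] bvar_measurable[OF bv[OF t]] E(3) by (auto simp: xi_def)
  \<comment> \<open>Nothing is assumed on the measurability of \<open>g\<close>. The factor with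
    \<open>t = 1\<close> is measurable as a function of bounded variation, and its logarithm
    recovers the excess.\<close>
  have [measurable]: "xi c u z 1 \<in> borel_measurable leb" by (rule bvar_measurable[OF bv]) simp
  have "(\<lambda>x. exc c u (dist x z)) = (\<lambda>x. - ln (1 - xi c u z 1 x))" by (simp add: xi_def)
  then show "(\<lambda>x. exc c u (dist x z)) \<in> borel_measurable leb" by simp
qed

lemma ball_leb:
  assumes "z \<in> {0<..<1}" "0 \<le> r" "r \<le> z" "r \<le> 1 - z"
  shows "{x \<in> {0..1}. dist x z < r} \<in> sets leb" "measure leb {x \<in> {0..1}. dist x z < r} = 2 * r"
proof -
  have eq: "{x \<in> {0..1}. dist x z < r} = {z - r<..<z + r}" using assms by (auto simp: dist_real_def)
  show s: "{x \<in> {0..1}. dist x z < r} \<in> sets leb" unfolding eq using assms by (intro in_sets_leb) auto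
  show "measure leb {x \<in> {0..1}. dist x z < r} = 2 * r"
    unfolding measure_def emeasure_leb[OF s] unfolding eq using assms by simp
qed

text \<open>By \<open>layer_cake\<close> the integral is an average of lengths of sets where the
  excess is above \<open>y\<close>. Up to the point \<open>z\<close> these are balls, and their
  length relative to \<open>2 * r n\<close> tends to \<open>1 - \<pi> y\<close>. Averaging the
  latter in the same way gives \<open>1 - lap\<close>.\<close>

lemma tail_integral:
  assumes tl: "tails sc \<pi>" and ml: "mark_law \<pi>" and z: "z \<in> {0<..<1}"
    and r: "\<forall>\<^sub>F n in sequentially. 0 < r n" "r \<longlonglongrightarrow> 0" and t: "0 < t"
    and u: "\<And>n. u n = gr (r n)"
  shows "(\<lambda>n. (LINT x|leb. xi (sc (u n)) (u n) z t x) / (2 * r n)) \<longlonglongrightarrow> 1 - renewal_marks.lap (interval_measure \<pi>) t"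
proof -
  interpret R: renewal_marks "interval_measure \<pi>" by (rule mark_law_facts(1)[OF ml])
  obtain \<delta> where \<delta>: "near \<delta>" using near_ex by blast
  have scp: "\<forall>\<^sub>F n in sequentially. 0 < sc (u n)" using tl r unfolding tails_def u by blast
  have "0 < \<delta>" "0 < z" "0 < 1 - z" using \<delta> z by (auto simp: near_def)
  then have "\<forall>\<^sub>F n in sequentially. 0 < r n \<and> r n < \<delta> \<and> r n < z \<and> r n < 1 - z \<and> 0 < sc (u n)"
    using r(1) order_tendstoD(2)[OF r(2)] scp by (auto simp: eventually_conj_iff)
  \<comment> \<open>From \<open>n0\<close> on the ball of radius \<open>r n\<close> lies inside the
    unit interval, so its length is exactly \<open>2 * r n\<close>; the sequence is shifted by
    \<open>n0\<close> for dominated convergence.\<close>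
  then obtain n0 where n0: "\<And>n. n \<ge> n0 \<Longrightarrow> 0 < r n \<and> r n < \<delta> \<and> r n < z \<and> r n < 1 - z \<and> 0 < sc (u n)"
    by (auto simp: eventually_sequentially)
  define e where "e n x = exc (sc (u n)) (u n) (dist x z)" for n x
  define K where "K y = indicator {0..} y * (t * exp (- (t * y)))" for y :: real
  have K0: "0 \<le> K y" for y using t by (simp add: K_def)
  define F where "F n = (\<lambda>y. measure leb {x \<in> space leb. y < e n x})" for n
  have un: "ereal (u n) = g (r n)" if "n \<ge> n0" for n using n0[OF that] g_finite(2)[OF \<delta>, of "r n"] by (simp add: u)
  have em: "e n \<in> borel_measurable leb" if "n \<ge> n0" for n
    unfolding e_def by (rule xi_bump(3)[OF \<delta> _ _ _ un[OF that], where t = 0]) (use n0[OF that] in auto)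
  have e0: "0 \<le> e n x" if "n \<ge> n0" for n x
    unfolding e_def by (rule exc_nonneg[OF \<delta> _ _ _ un[OF that]]) (use n0[OF that] in auto)
  have lc: "(LINT x|leb. xi (sc (u n)) (u n) z t x) = (LINT y|lborel. K y * F n y)" "F n \<in> borel_measurable borel" if "n \<ge> n0" for n
    using layer_cake[OF leb.finite_measure_axioms em[OF that] AE_I2[OF e0[OF that]] t] by (simp_all add: xi_def e_def K_def F_def)
  have Fle: "F n y \<le> 2 * r n" if "n \<ge> n0" "0 \<le> y" for n y
  proof -
    have "{x \<in> space leb. y < e n x} \<subseteq> {x \<in> {0..1}. dist x z < r n}"
      using exc_far[OF \<delta> _ _ _ un[OF that(1)]] n0[OF that(1)] that(2) by (force simp: e_def not_less[symmetric])
    then have "F n y \<le> measure leb {x \<in> {0..1}. dist x z < r n}"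
      unfolding F_def by (rule leb.finite_measure_mono) (rule ball_leb(1)[OF z], use n0[OF that(1)] in auto)
    then show ?thesis using ball_leb(2)[OF z, of "r n"] n0[OF that(1)] by simp
  qed
  have Flim: "(\<lambda>n. F n y / (2 * r n)) \<longlonglongrightarrow> 1 - \<pi> y" if y: "0 \<le> y" for y
  proof -
    obtain \<rho> where \<rho>: "\<forall>\<^sub>F n in sequentially. 0 \<le> \<rho> n \<and> \<rho> n \<le> r n \<and> (\<forall>x>0. y < exc (sc (u n)) (u n) x \<longleftrightarrow> x < \<rho> n)"
      and l: "(\<lambda>n. \<rho> n / r n) \<longlonglongrightarrow> 1 - \<pi> y"
      using tl r y unfolding tails_def u by blast
    show ?thesis
    proof (rule Lim_transform_eventually[OF l])
      show "\<forall>\<^sub>F n in sequentially. \<rho> n / r n = F n y / (2 * r n)"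
        using \<rho> eventually_ge_at_top[of n0]
      proof eventually_elim
        case (elim n)
        note nn = n0[OF elim(2)]
        have B: "{x \<in> {0..1}. dist x z < \<rho> n} \<in> sets leb" "measure leb {x \<in> {0..1}. dist x z < \<rho> n} = 2 * \<rho> n"
          using ball_leb[OF z, of "\<rho> n"] elim nn by auto
        have "F n y = measure leb {x \<in> {0..1}. dist x z < \<rho> n}"
          unfolding F_def
        proof (rule leb.finite_measure_eq_AE)
          show "AE x in leb. (x \<in> {x \<in> space leb. y < e n x}) = (x \<in> {x \<in> {0..1}. dist x z < \<rho> n})"
          proof (rule AE_mp[OF AE_leb_countable[of "{z}"]], simp, intro AE_I2 impI)
            fix x assume "x \<in> space leb" "x \<notin> {z}"
            then have "0 < dist x z" by simp
            then show "(x \<in> {x \<in> space leb. y < e n x}) = (x \<in> {x \<in> {0..1}. dist x z < \<rho> n})"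
              using elim(1) unfolding e_def by auto
          qed
          have [measurable]: "e n \<in> borel_measurable leb" by (rule em[OF elim(2)])
          show "{x \<in> space leb. y < e n x} \<in> sets leb" by measurable
        qed (rule B(1))
        then show ?case using B(2) nn by simp
      qed
    qed
  qed
  have Ki: "integrable lborel K"
  proof -
    have "integrable lborel (\<lambda>y. exponential_density t y)"
      using prob_space_exponential_density[OF t] t
      by (intro integrableI_nonneg) (auto simp: prob_space.emeasure_space_1 emeasure_density dest!: prob_space.emeasure_space_1)
    moreover have "exponential_density t = K" by (auto simp: exponential_density_def K_def fun_eq_iff)
    ultimately show ?thesis by simp
  qed
  have Dl: "1 - R.lap t = (LINT y|lborel. K y * (1 - \<pi> y))"
  proof -
    have "(LINT d|interval_measure \<pi>. 1 - exp (- (t * d))) = (LINT y|lborel. K y * measure (interval_measure \<pi>) {d \<in> space (interval_measure \<pi>). y < d})"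
      unfolding K_def by (rule layer_cake(1)[where e = "\<lambda>d. d", OF R.D.finite_measure_axioms measurable_ident_sets[OF R.D(2)] R.D(3) t])
    moreover have "(LINT d|interval_measure \<pi>. 1 - exp (- (t * d))) = 1 - R.lap t"
    proof -
      have "integrable (interval_measure \<pi>) (\<lambda>d. exp (- (t * d)))"
      proof (rule R.D.integrable_const_bound[where B = 1])
        show "AE x in interval_measure \<pi>. norm (exp (- (t * x))) \<le> 1" using R.D(3) by (rule AE_mp) (use t in \<open>auto intro!: AE_I2\<close>)
      qed (subst measurable_cong_sets[OF R.D(2) refl], measurable)
      then show ?thesis by (simp add: R.lap_def R.D.prob_space[simplified])
    qed
    ultimately show ?thesis using mark_law_facts(2)[OF ml] by simp
  qed
  have pm: "\<pi> \<in> borel_measurable borel" using ml by (intro borel_measurable_mono) (simp add: mark_law_def)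
  have Km: "K \<in> borel_measurable borel" unfolding K_def by measurable
  have "(\<lambda>n. LINT y|lborel. K y * (F (n + n0) y / (2 * r (n + n0)))) \<longlonglongrightarrow> (LINT y|lborel. K y * (1 - \<pi> y))"
  proof (rule integral_dominated_convergence[where w = K])
    show "(\<lambda>y. K y * (1 - \<pi> y)) \<in> borel_measurable lborel" using pm Km by simp
    show "(\<lambda>y. K y * (F (n + n0) y / (2 * r (n + n0)))) \<in> borel_measurable lborel" for n
      using lc(2)[of "n + n0"] Km by simp
    show "integrable lborel K" by (rule Ki)
    show "AE y in lborel. (\<lambda>n. K y * (F (n + n0) y / (2 * r (n + n0)))) \<longlonglongrightarrow> K y * (1 - \<pi> y)"
    proof (rule AE_I2)
      fix y :: real
      show "(\<lambda>n. K y * (F (n + n0) y / (2 * r (n + n0)))) \<longlonglongrightarrow> K y * (1 - \<pi> y)"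
      proof (cases "0 \<le> y")
        case True
        show ?thesis by (intro tendsto_mult tendsto_const LIMSEQ_ignore_initial_segment[OF Flim[OF True], of n0])
      qed (simp add: K_def)
    qed
    show "AE y in lborel. norm (K y * (F (n + n0) y / (2 * r (n + n0)))) \<le> K y" for n
    proof (rule AE_I2)
      fix y :: real
      show "norm (K y * (F (n + n0) y / (2 * r (n + n0)))) \<le> K y"
      proof (cases "0 \<le> y")
        case True
        have "F (n + n0) y / (2 * r (n + n0)) \<le> 1" "0 \<le> F (n + n0) y / (2 * r (n + n0))"
          using Fle[of "n + n0" y] True n0[of "n + n0"] by (auto simp: F_def divide_le_eq)
        then show ?thesis unfolding real_norm_def using K0[of y] by (subst abs_of_nonneg[OF mult_nonneg_nonneg]) (assumption | rule mult_left_le)+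
      qed (simp add: K_def)
    qed
  qed
  then have "(\<lambda>n. (LINT y|lborel. K y * F (n + n0) y) / (2 * r (n + n0))) \<longlonglongrightarrow> (LINT y|lborel. K y * (1 - \<pi> y))" by simp
  then have "(\<lambda>n. (LINT x|leb. xi (sc (u (n + n0))) (u (n + n0)) z t x) / (2 * r (n + n0))) \<longlonglongrightarrow> 1 - R.lap t"
    unfolding Dl using lc(1) by simp
  then show ?thesis by (rule LIMSEQ_offset)
qed

end

section \<open>Threshold and time scale\<close>

context extremes begin

lemma measure_fibre:
  assumes "B \<in> sets leb" shows "measure (fibre_measure h \<omega>) B = (LINT x|leb. indicator B x * h \<omega> x)"
proof -
  have "(LINT x|leb. indicator B x * h \<omega> x) = enn2real (\<integral>\<^sup>+x. ennreal (indicator B x * h \<omega> x) \<partial>leb)"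
    using h_measurable assms by (intro integral_eq_nn_integral) (auto intro!: AE_I2 mult_nonneg_nonneg h_nonneg)
  also have "(\<integral>\<^sup>+x. ennreal (indicator B x * h \<omega> x) \<partial>leb) = (\<integral>\<^sup>+x. ennreal (h \<omega> x) * indicator B x \<partial>leb)"
    by (intro nn_integral_cong) (auto simp: indicator_def)
  also have "\<dots> = emeasure (fibre_measure h \<omega>) B"
    unfolding fibre_measure_def using h_measurable assms by (subst emeasure_density) auto
  finally show ?thesis by (simp add: measure_def)
qed

lemma indicator_bump:
  assumes "B \<in> sets leb" "\<And>x. x \<in> B \<Longrightarrow> dist x z < r" shows "bump z r (indicator B)"
  using assms unfolding bump_def by (force simp: indicator_def)

lemma mean_measure_integral:
  assumes "B \<in> sets leb" shows "mean_measure Q h B = (LINT \<omega>|Q. LINT x|leb. indicator B x * h \<omega> x)"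
  unfolding mean_measure_def measure_fibre[OF assms] ..

text \<open>\<open>mean_measure\<close> is a bare integral rather than a measure, so the few
  properties that the threshold needs are derived by hand from those of the fibre measures.\<close>

lemma mean_measure_facts:
  assumes C: "AE \<omega> in Q. good C \<omega>" "0 < C" and B: "B \<in> sets leb"
  shows "0 \<le> mean_measure Q h B" "mean_measure Q h B \<le> (C + 1) * measure leb B"
    "A \<in> sets leb \<Longrightarrow> A \<subseteq> B \<Longrightarrow> mean_measure Q h B = mean_measure Q h A + mean_measure Q h (B - A)"
    "mean_measure Q h {0..1} = 1"
proof -
  define I where "I B \<omega> = (LINT x|leb. indicator B x * h \<omega> x)" for B \<omega>
  have bd: "0 \<le> I B \<omega> \<and> I B \<omega> \<le> (C + 1) * measure leb B" if "good C \<omega>" "B \<in> sets leb" for B \<omega>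
  proof -
    have BI: "B \<subseteq> {0..1}" using sets.sets_into_space[OF that(2)] by simp
    have "bump 0 2 (indicator B)" by (rule indicator_bump[OF that(2)]) (use BI in force)
    from fibre_integral_bound[OF that(1) this, of 0] show ?thesis
      using BI by (simp add: I_def Int_absorb2)
  qed
  have im: "I B \<in> borel_measurable Q" if "B \<in> sets leb" for B
    unfolding I_def using that by (intro fibre_integral_measurable) auto
  have ii: "integrable Q (I B)" if "B \<in> sets leb" for B
  proof (rule Q.integrable_const_bound[where B = "(C + 1) * measure leb B"])
    show "AE \<omega> in Q. norm (I B \<omega>) \<le> (C + 1) * measure leb B"
      using C(1) by (rule AE_mp) (use bd[OF _ that] in \<open>auto intro!: AE_I2\<close>)
  qed (rule im[OF that])
  have mm: "mean_measure Q h B = (LINT \<omega>|Q. I B \<omega>)" if "B \<in> sets leb" for B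
    unfolding mean_measure_integral[OF that] I_def ..
  show "0 \<le> mean_measure Q h B" unfolding mm[OF B]
    by (rule integral_nonneg_AE, rule AE_mp[OF C(1)]) (use bd[OF _ B] in \<open>auto intro!: AE_I2\<close>)
  have "(LINT \<omega>|Q. I B \<omega>) \<le> (LINT \<omega>|Q. (C + 1) * measure leb B)"
    by (rule integral_mono_AE[OF ii[OF B]], simp, rule AE_mp[OF C(1)]) (use bd[OF _ B] in \<open>auto intro!: AE_I2\<close>)
  then show "mean_measure Q h B \<le> (C + 1) * measure leb B" unfolding mm[OF B] by (simp add: Q.prob_space[simplified])
  show "mean_measure Q h B = mean_measure Q h A + mean_measure Q h (B - A)" if A: "A \<in> sets leb" "A \<subseteq> B"
  proof -
    have BA: "B - A \<in> sets leb" using A B by auto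
    have "(LINT \<omega>|Q. I B \<omega>) = (LINT \<omega>|Q. I A \<omega> + I (B - A) \<omega>)"
    proof (rule integral_cong_AE)
      show "AE \<omega> in Q. I B \<omega> = I A \<omega> + I (B - A) \<omega>"
        using C(1)
      proof (rule AE_mp, intro AE_I2 impI)
        fix \<omega> assume G: "good C \<omega>"
        have hi: "integrable leb (h \<omega>)" using good_integrable[OF G, of 0] by simp
        have "integrable leb (\<lambda>x. indicator S x * h \<omega> x)" if "S \<in> sets leb" for S
          using that by (intro unit_integrable(2)[OF _ _ hi]) auto
        then have "I A \<omega> + I (B - A) \<omega> = (LINT x|leb. indicator A x * h \<omega> x + indicator (B - A) x * h \<omega> x)"
          unfolding I_def using A BA by simp
        also have "\<dots> = I B \<omega>" unfolding I_def using A
          by (intro Bochner_Integration.integral_cong) (auto simp: indicator_def)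
        finally show "I B \<omega> = I A \<omega> + I (B - A) \<omega>" ..
      qed
    qed (use im[OF A(1)] im[OF B] im[OF BA] in auto)
    then show ?thesis unfolding mm[OF B] mm[OF A(1)] mm[OF BA] using ii[OF A(1)] ii[OF BA] by simp
  qed
  have s01: "{0..1} \<in> sets leb" by (intro in_sets_leb) auto
  have "(LINT \<omega>|Q. I {0..1} \<omega>) = (LINT \<omega>|Q. 1)"
  proof (rule integral_cong_AE)
    show "AE \<omega> in Q. I {0..1} \<omega> = 1"
      using C(1)
    proof (rule AE_mp, intro AE_I2 impI)
      fix \<omega> assume G: "good C \<omega>"
      have "I {0..1} \<omega> = (LINT x|leb. h \<omega> x)" unfolding I_def by (intro Bochner_Integration.integral_cong) auto
      then show "I {0..1} \<omega> = 1" using good_integral[OF G, of 0] by simp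
    qed
  qed (use im[OF s01] in auto)
  then show "mean_measure Q h {0..1} = 1" unfolding mm[OF s01] by (simp add: Q.prob_space[simplified])
qed

text \<open>Near 0 the mean measure of a ball is Lipschitz in the radius and increases at rate at
  least \<open>\<rho>\<close>. So a radius of mass exactly \<open>\<tau> / n\<close> exists, the
  quantile is \<open>g\<close> at this radius, and the density at \<open>z\<close> gives its
  asymptotics.\<close>

lemma threshold_radius:
  assumes C: "AE \<omega> in Q. good C \<omega>" "0 < C" and z: "z \<in> {0<..<1}" and \<rho>: "0 < \<rho>" and \<tau>: "0 < \<tau>"
    and dens: "mean_density \<rho> z"
  shows "\<exists>r. (\<forall>\<^sub>F n in sequentially. 0 < r n \<and> threshold Q h g \<tau> z n = gr (r n)) \<and>
      r \<longlonglongrightarrow> 0 \<and> (\<lambda>n. real n * (2 * r n)) \<longlonglongrightarrow> \<tau> / \<rho>"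
proof -
  obtain \<delta> where \<delta>: "near \<delta>" using near_ex by blast
  obtain d where d: "d > 0" "\<And>\<xi>. bump z d \<xi> \<Longrightarrow>
        \<bar>(LINT \<omega>|Q. LINT x|leb. \<xi> x * h \<omega> x) - \<rho> * (LINT x|leb. \<xi> x)\<bar> \<le> \<rho> / 2 * (LINT x|leb. \<xi> x)"
    using dens \<rho> unfolding mean_density_def by (metis half_gt_zero)
  define rs where "rs = min (min (\<delta> / 2) d) (min z (1 - z))"
  have rs: "0 < rs" "rs < \<delta>" "rs \<le> d" "rs \<le> z" "rs \<le> 1 - z" using \<delta> d z by (auto simp: rs_def near_def)
  define B where "B r = {x \<in> {0..1}. dist x z < r}" for r
  define m where "m r = mean_measure Q h (B r)" for r
  have B: "B r \<in> sets leb" "measure leb (B r) = 2 * r" if "0 \<le> r" "r \<le> rs" for r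
    using ball_leb[OF z, of r] rs that by (auto simp: B_def)
  have step: "m a + \<rho> * (b - a) \<le> m b" "m b \<le> m a + (C + 1) * (2 * (b - a))" if ab: "0 \<le> a" "a \<le> b" "b \<le> rs" for a b
  proof -
    have Ba: "B a \<in> sets leb" "measure leb (B a) = 2 * a" using B[of a] ab by auto
    have Bb: "B b \<in> sets leb" "measure leb (B b) = 2 * b" using B[of b] ab by auto
    have s: "B a \<subseteq> B b" using ab by (auto simp: B_def)
    have A: "B b - B a \<in> sets leb" using Ba Bb by auto
    have lA: "measure leb (B b - B a) = 2 * (b - a)" using leb.finite_measure_Diff[OF Bb(1) Ba(1) s] Ba Bb by simp
    have AI: "B b - B a \<subseteq> {0..1}" by (auto simp: B_def)
    have bm: "bump z d (indicator (B b - B a))" using ab rs by (intro indicator_bump[OF A]) (auto simp: B_def)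
    have "\<bar>mean_measure Q h (B b - B a) - \<rho> * (2 * (b - a))\<bar> \<le> \<rho> / 2 * (2 * (b - a))"
      using d(2)[OF bm] AI unfolding mean_measure_integral[OF A] by (simp add: Int_absorb2 lA)
    moreover have "\<rho> * (2 * (b - a)) = 2 * (\<rho> * (b - a))" "\<rho> / 2 * (2 * (b - a)) = \<rho> * (b - a)" by simp_all
    ultimately have "\<rho> * (b - a) \<le> mean_measure Q h (B b - B a)" by linarith
    moreover have "m b = m a + mean_measure Q h (B b - B a)"
      unfolding m_def by (rule mean_measure_facts(3)[OF C Bb(1) Ba(1) s])
    ultimately show "m a + \<rho> * (b - a) \<le> m b" "m b \<le> m a + (C + 1) * (2 * (b - a))"
      using mean_measure_facts(2)[OF C A] by (simp_all add: lA)
  qed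
  have m0: "m 0 = 0" using mean_measure_facts(1,2)[OF C, of "B 0"] B[of 0] rs by (simp add: m_def)
  have mrs: "0 < m rs" using step(1)[of 0 rs] rs m0 mult_pos_pos[OF \<rho> rs(1)] by (simp del: mult_pos_pos zero_less_mult_iff)
  have mc: "continuous_on {0..rs} m"
  proof (rule lipschitz_on_continuous_on)
    show "(2 * (C + 1))-lipschitz_on {0..rs} m"
    proof (rule lipschitz_on_leI)
      fix x y assume xy: "x \<in> {0..rs}" "y \<in> {0..rs}" "x \<le> y"
      have "0 \<le> \<rho> * (y - x)" using \<rho> xy by (intro mult_nonneg_nonneg) auto
      moreover have "m x + \<rho> * (y - x) \<le> m y" "m y \<le> m x + (C + 1) * (2 * (y - x))"
        by (rule step; use xy in simp)+
      ultimately have "m x \<le> m y" "m y \<le> m x + (C + 1) * (2 * (y - x))" by linarith+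
      then show "dist (m x) (m y) \<le> 2 * (C + 1) * dist x y" using xy by (simp add: dist_real_def algebra_simps)
    qed (use C in simp)
  qed
  have "\<exists>r. 0 < r \<and> r < rs \<and> m r = \<tau> / real n" if n: "\<tau> / m rs < real n" for n
  proof -
    have n0: "0 < real n" using n \<tau> mrs by (meson divide_pos_pos order_less_trans)
    have lt: "\<tau> / real n < m rs" using n n0 mrs by (simp add: field_simps)
    have pos: "0 < \<tau> / real n" using \<tau> n0 by simp
    obtain r where r: "0 \<le> r" "r \<le> rs" "m r = \<tau> / real n"
      using IVT'[of m 0 "\<tau> / real n" rs] m0 lt pos mc rs by auto
    moreover have "r \<noteq> 0" "r \<noteq> rs" using r(3) m0 lt pos by auto
    ultimately show ?thesis by (intro exI[of _ r]) auto
  qed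
  then obtain r where r: "\<And>n. \<tau> / m rs < real n \<Longrightarrow> 0 < r n \<and> r n < rs \<and> m (r n) = \<tau> / real n" by metis
  have ev: "\<forall>\<^sub>F n in sequentially. \<tau> / m rs < real n \<and> \<tau> < real n"
    by (intro eventually_conj) (use filterlim_real_sequentially in \<open>auto simp: filterlim_at_top_dense\<close>)
  have th: "threshold Q h g \<tau> z n = gr (r n)" if n: "\<tau> / m rs < real n" "\<tau> < real n" for n
  proof -
    have rn: "0 < r n" "r n < rs" "m (r n) = \<tau> / real n" using r[OF n(1)] by auto
    have rd: "r n < \<delta>" using rn rs by simp
    have fin: "ereal (gr (r n)) = g (r n)" by (rule g_finite(2)[OF \<delta> rn(1) rd])
    have s01: "{0..1} \<in> sets leb" by (intro in_sets_leb) auto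
    have BI: "B a \<subseteq> {0..1}" for a by (auto simp: B_def)
    have comp: "mean_measure Q h ({0..1} - B a) = 1 - m a" if "0 \<le> a" "a \<le> rs" for a
      using mean_measure_facts(3)[OF C s01 B(1)[OF that], OF BI] mean_measure_facts(4)[OF C s01] by (simp add: m_def)
    \<comment> \<open>Not just the infimum but the whole set of admissible levels is identified,
      namely the half-line from \<open>g (r n)\<close>; in particular the infimum is
      attained.\<close>
    have iff: "mean_measure Q h {x \<in> {0..1}. g (dist x z) \<le> ereal u} \<ge> 1 - \<tau> / real n \<longleftrightarrow> g (r n) \<le> ereal u" for u :: real
    proof (cases "g (r n) \<le> ereal u")
      case True
      show ?thesis
      proof (cases "ereal u \<le> g 0")
        case le: True
        note gi = ginv_facts[OF \<delta> less_imp_le[OF rn(1)] rd True le]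
        have E: "{x \<in> {0..1}. g (dist x z) \<le> ereal u} = {0..1} - B (ginv (ereal u))"
          using gi(5)[OF zero_le_dist] by (force simp: B_def not_less[symmetric])
        have "0 \<le> \<rho> * (r n - ginv (ereal u))" using \<rho> gi(3) by (intro mult_nonneg_nonneg) auto
        then have "m (ginv (ereal u)) \<le> m (r n)"
          using step(1)[OF gi(2,3) less_imp_le[OF rn(2)]] by linarith
        then show ?thesis using comp[OF gi(2)] gi(3) rn True unfolding E by simp
      next
        case False
        then have "g (dist x z) \<le> ereal u" for x
          using g_facts(2)[OF zero_le_dist, of x z] by (meson order_trans linear)
        then have "{x \<in> {0..1}. g (dist x z) \<le> ereal u} = {0..1}" by auto
        then show ?thesis using mean_measure_facts(4)[OF C s01] True \<tau> by simp
      qed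
    next
      case False
      then have lt: "ereal u < g (r n)" by simp
      let ?E = "{x \<in> {0..1}. g (dist x z) \<le> ereal u}"
      \<comment> \<open>A level below \<open>g (r n)\<close> is exceeded up to some distance
        \<open>r' > r n\<close>, so the sublevel set misses a ball of mass at least
        \<open>\<tau> / n + \<rho> (r' - r n)\<close>.\<close>
      obtain r' where r': "r n < r'" "r' \<le> rs" "\<And>x. 0 \<le> x \<Longrightarrow> x < r' \<Longrightarrow> ereal u < g x"
      proof (cases "g rs \<le> ereal u")
        case True
        have "ereal u \<le> g 0" using lt g_facts(2)[of "r n"] rn by (meson less_imp_le order_trans)
        note gi = ginv_facts[OF \<delta> less_imp_le[OF rs(1)] rs(2) True this]
        show ?thesis
        proof (rule that[of "ginv (ereal u)"])
          show "r n < ginv (ereal u)" using gi(5)[of "r n"] lt rn by simp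
        qed (use gi(3,5) in auto)
      next
        case False
        show ?thesis
        proof (rule that[of rs])
          fix x assume "0 \<le> x" "x < rs"
          then have "g rs < g x" using g_gt_iff[OF \<delta> less_imp_le[OF rs(1)] rs(2)] by simp
          then show "ereal u < g x" using False by (meson leI less_trans)
        qed (use rn in auto)
      qed
      have "mean_measure Q h ?E < 1 - \<tau> / real n"
      proof (cases "?E \<in> sets leb")
        case True
        have "?E \<subseteq> {0..1} - B r'" using r'(3)[OF zero_le_dist] by (force simp: B_def not_less[symmetric])
        moreover have cs: "{0..1} - B r' \<in> sets leb" using B[of r'] r' rn s01 by auto
        ultimately have "mean_measure Q h ?E \<le> mean_measure Q h ({0..1} - B r')"
          using mean_measure_facts(3)[OF C cs True] mean_measure_facts(1)[OF C, of "({0..1} - B r') - ?E"] cs True by auto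
        also have "\<dots> = 1 - m r'" using comp[of r'] r' rn by simp
        also have "m r' \<ge> m (r n) + \<rho> * (r' - r n)" using step(1)[of "r n" r'] rn r' by simp
        moreover have "0 < \<rho> * (r' - r n)" using \<rho> r' by simp
        ultimately show ?thesis using rn by simp
      next
        \<comment> \<open>Far from 0 the function \<open>g\<close> is arbitrary, so the sublevel set
          need not be measurable. It then has measure 0 by convention, which is below
          \<open>1 - \<tau> / n\<close> because \<open>n > \<tau>\<close>.\<close>
        case False
        then have "mean_measure Q h ?E = 0"
          unfolding mean_measure_def by (simp add: measure_notin_sets fibre_measure_def)
        then show ?thesis using n \<tau> by (simp add: divide_less_eq)
      qed
      then show ?thesis using False by simp
    qed
    have "{u::real. mean_measure Q h {x \<in> {0..1}. g (dist x z) \<le> ereal u} \<ge> 1 - \<tau> / real n} = {gr (r n)..}"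
      unfolding iff by (subst fin[symmetric]) auto
    then show ?thesis unfolding threshold_def by simp
  qed
  have up: "r n \<le> \<tau> / \<rho> * inverse (real n)" "0 < r n" "r n < rs" "m (r n) = \<tau> / real n" if "\<tau> / m rs < real n" for n
  proof -
    note rn = r[OF that]
    have "\<rho> * r n \<le> \<tau> / real n" using step(1)[of 0 "r n"] rn m0 by simp
    then have "r n * \<rho> \<le> \<tau> / real n" by (simp only: mult.commute)
    then have "r n \<le> \<tau> / real n / \<rho>" by (rule iffD2[OF pos_le_divide_eq[OF \<rho>]])
    also have "\<tau> / real n / \<rho> = \<tau> / \<rho> * inverse (real n)" by (simp add: divide_inverse)
    finally show "r n \<le> \<tau> / \<rho> * inverse (real n)" .
    show "0 < r n" "r n < rs" "m (r n) = \<tau> / real n" using rn by auto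
  qed
  have r0: "r \<longlonglongrightarrow> 0"
  proof (rule tendsto_sandwich[OF _ _ tendsto_const])
    show "\<forall>\<^sub>F n in sequentially. 0 \<le> r n" using ev by eventually_elim (use up(2) in force)
    show "\<forall>\<^sub>F n in sequentially. r n \<le> \<tau> / \<rho> * inverse (real n)" using ev by eventually_elim (use up(1) in blast)
    show "(\<lambda>n. \<tau> / \<rho> * inverse (real n)) \<longlonglongrightarrow> 0" by (intro tendsto_mult_right_zero lim_inverse_n)
  qed
  have lim: "(\<lambda>n. real n * (2 * r n)) \<longlonglongrightarrow> \<tau> / \<rho>"
  proof (rule tendstoI)
    fix e :: real assume e: "0 < e"
    \<comment> \<open>Chosen so that \<open>\<epsilon> * 2 * r n\<close>, with
      \<open>r n \<le> \<tau> / (\<rho> n)\<close>, becomes \<open>e / 2\<close> after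
      multiplication by \<open>n / \<rho>\<close>.\<close>
    define \<epsilon> where "\<epsilon> = e * \<rho>\<^sup>2 / (4 * \<tau>)"
    have \<epsilon>0: "0 < \<epsilon>" using e \<rho> \<tau> by (simp add: \<epsilon>_def)
    obtain d' where d': "d' > 0" "\<And>\<xi>. bump z d' \<xi> \<Longrightarrow>
        \<bar>(LINT \<omega>|Q. LINT x|leb. \<xi> x * h \<omega> x) - \<rho> * (LINT x|leb. \<xi> x)\<bar> \<le> \<epsilon> * (LINT x|leb. \<xi> x)"
      using dens \<epsilon>0 unfolding mean_density_def by blast
    show "\<forall>\<^sub>F n in sequentially. dist (real n * (2 * r n)) (\<tau> / \<rho>) < e"
      using ev order_tendstoD(2)[OF r0 d'(1)]
    proof eventually_elim
      case (elim n)
      have n0: "0 < real n" using elim \<tau> by linarith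
      note rn = up[OF conjunct1[OF elim(1)]]
      have Bn: "B (r n) \<in> sets leb" "measure leb (B (r n)) = 2 * r n" using B[of "r n"] rn by auto
      have BI: "B (r n) \<subseteq> {0..1}" by (auto simp: B_def)
      have bm: "bump z d' (indicator (B (r n)))" using elim by (intro indicator_bump[OF Bn(1)]) (auto simp: B_def)
      have "\<bar>\<tau> / real n - \<rho> * (2 * r n)\<bar> \<le> \<epsilon> * (2 * r n)"
        using d'(2)[OF bm] BI rn(4) unfolding m_def mean_measure_integral[OF Bn(1)] by (simp add: Int_absorb2 Bn(2))
      also have "\<dots> \<le> \<epsilon> * (2 * (\<tau> / \<rho> * inverse (real n)))" using rn(1) \<epsilon>0 by (intro mult_left_mono) auto
      finally have "\<bar>\<tau> / real n - \<rho> * (2 * r n)\<bar> \<le> e * \<rho> / 2 * inverse (real n)"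
        using \<tau> \<rho> by (simp add: \<epsilon>_def power2_eq_square field_simps)
      then have "real n / \<rho> * \<bar>\<tau> / real n - \<rho> * (2 * r n)\<bar> \<le> real n / \<rho> * (e * \<rho> / 2 * inverse (real n))"
        using \<rho> by (intro mult_left_mono) auto
      also have "\<dots> = e / 2" using n0 \<rho> by simp
      finally have "\<bar>real n / \<rho> * (\<tau> / real n - \<rho> * (2 * r n))\<bar> \<le> e / 2" using \<rho> by (simp add: abs_mult)
      also have "real n / \<rho> * (\<tau> / real n - \<rho> * (2 * r n)) = \<tau> / \<rho> - real n * (2 * r n)"
        using n0 \<rho> by (simp add: field_simps)
      finally show ?case using e by (simp add: dist_real_def abs_minus_commute)
    qed
  qed
  show ?thesis
  proof (intro exI[of _ r] conjI r0 lim)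
    show "\<forall>\<^sub>F n in sequentially. 0 < r n \<and> threshold Q h g \<tau> z n = gr (r n)"
      using ev by eventually_elim (use up(2) th in blast)
  qed
qed

text \<open>\<open>orbit_density\<close> is uniform over bumps, so it may be applied at time
  \<open>N n\<close> to the bump \<open>\<xi> n\<close>. The sum is then about
  \<open>N n * \<rho>\<close> times the integral of \<open>\<xi> n\<close>, and the two given limits
  combine.\<close>

lemma fibre_sum_limit:
  assumes G: "good C \<omega>" "0 < C"
    and dens: "orbit_density \<rho> z \<omega>"
    and \<rho>: "0 < \<rho>" and b: "\<forall>\<^sub>F n in sequentially. 0 < r n \<and> bump z (r n) (\<xi> n)" and r: "r \<longlonglongrightarrow> 0"
    and L: "(\<lambda>n. real n * (LINT x|leb. \<xi> n x)) \<longlonglongrightarrow> L" and N: "(\<lambda>n. real (N n) / real n) \<longlonglongrightarrow> \<kappa>"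
  shows "(\<lambda>n. \<Sum>m<N n. LINT x|leb. \<xi> n x * H \<omega> m x) \<longlonglongrightarrow> \<kappa> * \<rho> * L"
proof -
  define I where "I n = (LINT x|leb. \<xi> n x)" for n
  define S where "S n = (\<Sum>m<N n. LINT x|leb. \<xi> n x * H \<omega> m x)" for n
  have "(\<lambda>n. real n * I n * inverse (real n)) \<longlonglongrightarrow> L * 0"
    using L unfolding I_def by (intro tendsto_mult lim_inverse_n)
  then have I0: "I \<longlonglongrightarrow> 0"
    by (simp, elim Lim_transform_eventually) (auto intro!: eventually_mono[OF eventually_gt_at_top[of 0]])
  have NI: "(\<lambda>n. real (N n) * I n) \<longlonglongrightarrow> \<kappa> * L"
  proof (rule Lim_transform_eventually)
    show "(\<lambda>n. real (N n) / real n * (real n * I n)) \<longlonglongrightarrow> \<kappa> * L" using L N unfolding I_def by (intro tendsto_mult)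
    show "\<forall>\<^sub>F n in sequentially. real (N n) / real n * (real n * I n) = real (N n) * I n"
      by (rule eventually_mono[OF eventually_gt_at_top[of 0]]) simp
  qed
  have "(\<lambda>n. S n - real (N n) * \<rho> * I n) \<longlonglongrightarrow> 0"
  proof (rule tendstoI)
    fix e :: real assume e: "0 < e"
    define M where "M = \<kappa> * L + 1"
    have "\<forall>\<^sub>F n in sequentially. real (N n) * I n < M" by (rule order_tendstoD(2)[OF NI]) (simp add: M_def)
    define \<epsilon> where "\<epsilon> = e / (2 * (\<bar>M\<bar> + 1))"
    have \<epsilon>0: "0 < \<epsilon>" using e by (simp add: \<epsilon>_def)
    obtain d n0 where d: "d > 0" "\<And>n \<xi>. n \<ge> n0 \<Longrightarrow> bump z d \<xi> \<Longrightarrow>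
        \<bar>(\<Sum>m<n. LINT x|leb. \<xi> x * H \<omega> m x) - real n * \<rho> * (LINT x|leb. \<xi> x)\<bar> \<le> \<epsilon> * real n * (LINT x|leb. \<xi> x)"
      using dens \<epsilon>0 unfolding orbit_density_def by meson
    have "(\<lambda>n. real n0 * (C + 1 + \<rho>) * I n) \<longlonglongrightarrow> 0" by (intro tendsto_mult_right_zero I0)
    then have small: "\<forall>\<^sub>F n in sequentially. real n0 * (C + 1 + \<rho>) * I n < e" by (rule order_tendstoD(2)) (rule e)
    show "\<forall>\<^sub>F n in sequentially. dist (S n - real (N n) * \<rho> * I n) 0 < e"
      using small \<open>\<forall>\<^sub>F n in sequentially. real (N n) * I n < M\<close> b order_tendstoD(2)[OF r d(1)]
    proof eventually_elim
      case (elim n)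
      have bn: "bump z (r n) (\<xi> n)" using elim by simp
      have bd: "bump z d (\<xi> n)" using elim by (intro bump_mono[OF bn]) simp
      have I0: "0 \<le> I n" unfolding I_def by (rule bump_L1(1)[OF bn]) (use elim in simp)
      show ?case
      proof (cases "n0 \<le> N n")
        case True
        have "\<bar>S n - real (N n) * \<rho> * I n\<bar> \<le> \<epsilon> * (real (N n) * I n)"
          using d(2)[OF True bd] by (simp add: S_def I_def mult.assoc)
        also have "\<dots> \<le> \<epsilon> * (\<bar>M\<bar> + 1)" using elim \<epsilon>0 by (intro mult_left_mono) auto
        also have "\<dots> = e / 2" unfolding \<epsilon>_def by (simp add: field_simps add_nonneg_eq_0_iff)
        finally show ?thesis using e by simp
      next
        \<comment> \<open>If \<open>\<kappa> = 0\<close>, as for an interval that starts at 0,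
          \<open>N n\<close> may stay below \<open>n0\<close>. Then both sides consist of at most
          \<open>n0\<close> terms proportional to the vanishing integral \<open>I n\<close>.\<close>
        case False
        have S1: "0 \<le> S n" unfolding S_def by (intro sum_nonneg fibre_integral_bound(1)[OF G(1) bn])
        have "S n \<le> (\<Sum>m<N n. (C + 1) * I n)" unfolding S_def I_def by (intro sum_mono fibre_integral_bound(2)[OF G(1) bn])
        also have "\<dots> = real (N n) * ((C + 1) * I n)" by simp
        finally have S2: "S n \<le> real n0 * ((C + 1) * I n)"
          using mult_right_mono[of "real (N n)" "real n0" "(C + 1) * I n"] False mult_nonneg_nonneg[of "C + 1" "I n"] G(2) I0 by linarith
        have "real (N n) * (\<rho> * I n) \<le> real n0 * (\<rho> * I n)" using False \<rho> I0 by (intro mult_right_mono) auto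
        moreover have "0 \<le> real (N n) * (\<rho> * I n)" "0 \<le> real n0 * (\<rho> * I n)" "0 \<le> real n0 * ((C + 1) * I n)"
          using \<rho> I0 G(2) by auto
        moreover have "real n0 * (C + 1 + \<rho>) * I n = real n0 * ((C + 1) * I n) + real n0 * (\<rho> * I n)"
          by (simp add: algebra_simps)
        ultimately have "\<bar>S n - real (N n) * (\<rho> * I n)\<bar> < e" using S1 S2 elim(1) by linarith
        then show ?thesis by (simp add: mult.assoc)
      qed
    qed
  qed
  from tendsto_add[OF this tendsto_mult[OF tendsto_const[of \<rho>] NI]] show ?thesis
    by (simp add: S_def algebra_simps)
qed

text \<open>An exceedance at time \<open>i\<close> is the preimage of a ball under
  \<open>fi \<omega> i\<close>; equivariance moves the computation to the density at time
  \<open>i\<close>.\<close>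

lemma exceedance_measure:
  assumes G: "good C \<omega>" and \<delta>: "near \<delta>" "0 < r" "r < \<delta>" and u: "ereal u = g r"
  shows "measure (fibre_measure h \<omega>) {x \<in> {0..1}. obs_process f g z \<omega> i x > ereal u} =
    (LINT x|leb. indicator {x \<in> {0..1}. dist x z < r} x * H \<omega> i x)"
proof -
  let ?B = "{x \<in> {0..1}. dist x z < r}"
  have "?B = {0..1} \<inter> ball z r" by (auto simp: dist_commute)
  then have B: "?B \<in> sets leb" by (intro in_sets_leb) auto
  have eq: "{x \<in> {0..1}. obs_process f g z \<omega> i x > ereal u} = fi \<omega> i -` ?B \<inter> space leb"
    using g_gt_iff[OF \<delta>(1) less_imp_le[OF \<delta>(2)] \<delta>(3) zero_le_dist] fi_range by (auto simp: obs_process_def u)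
  have E: "fi \<omega> i -` ?B \<inter> space leb \<in> sets leb" by (rule measurable_sets[OF fi_measurable B])
  have "measure (fibre_measure h \<omega>) (fi \<omega> i -` ?B \<inter> space leb) = (LINT x|leb. indicator (fi \<omega> i -` ?B \<inter> space leb) x * h \<omega> x)"
    by (rule measure_fibre[OF E])
  also have "\<dots> = (LINT x|leb. indicator ?B (fi \<omega> i x) * H \<omega> 0 x)"
    by (intro Bochner_Integration.integral_cong) (auto simp: indicator_def)
  also have "\<dots> = (LINT x|leb. indicator ?B x * H \<omega> i x)"
    using trD(3)[OF good_tr[OF G, of 0 i], of "indicator ?B" 1] B by (simp add: indicator_def)
  finally show ?thesis unfolding eq .
qed

end

section \<open>Convergence of the marked processes\<close>

lemma real_mem_scaled_interval:
  assumes "0 < v" "0 \<le> (a::real)"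
  shows "{i::nat. real i \<in> (\<lambda>t. v * t) ` {a..<b}} = {nat \<lceil>v * a\<rceil>..<nat \<lceil>v * b\<rceil>}"
    and "i \<in> {nat \<lceil>v * a\<rceil>..<nat \<lceil>v * b\<rceil>} \<longleftrightarrow> real i / v \<in> {a..<b}"
proof -
  have 2: "i \<in> {nat \<lceil>v * a\<rceil>..<nat \<lceil>v * b\<rceil>} \<longleftrightarrow> real i / v \<in> {a..<b}" for i
    using assms(1) by (simp add: nat_le_iff zless_nat_eq_int_zless ceiling_le_iff less_ceiling_iff field_simps)
  show "i \<in> {nat \<lceil>v * a\<rceil>..<nat \<lceil>v * b\<rceil>} \<longleftrightarrow> real i / v \<in> {a..<b}" by (rule 2)
  have "real i \<in> (\<lambda>t. v * t) ` {a..<b} \<longleftrightarrow> real i / v \<in> {a..<b}" for i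
  proof
    assume "real i / v \<in> {a..<b}"
    then show "real i \<in> (\<lambda>t. v * t) ` {a..<b}" using assms(1) by (intro image_eqI[of _ _ "real i / v"]) auto
  qed (use assms(1) in auto)
  then show "{i::nat. real i \<in> (\<lambda>t. v * t) ` {a..<b}} = {nat \<lceil>v * a\<rceil>..<nat \<lceil>v * b\<rceil>}"
    using 2 by blast
qed

lemma ceiling_ratio_tendsto:
  assumes v: "(\<lambda>n. v n / real n) \<longlonglongrightarrow> \<kappa>" "\<forall>\<^sub>F n in sequentially. 0 < v n" and a: "0 \<le> a"
  shows "(\<lambda>n. real (nat \<lceil>v n * a\<rceil>) / real n) \<longlonglongrightarrow> \<kappa> * a"
proof (rule tendsto_sandwich)
  show "\<forall>\<^sub>F n in sequentially. v n / real n * a \<le> real (nat \<lceil>v n * a\<rceil>) / real n"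
    using v(2) eventually_gt_at_top[of 0]
  proof eventually_elim
    case (elim n)
    have "v n * a / real n \<le> real (nat \<lceil>v n * a\<rceil>) / real n" by (intro divide_right_mono real_nat_ceiling_ge) simp
    then show ?case by simp
  qed
  show "\<forall>\<^sub>F n in sequentially. real (nat \<lceil>v n * a\<rceil>) / real n \<le> v n / real n * a + inverse (real n)"
    using v(2) eventually_gt_at_top[of 0]
  proof eventually_elim
    case (elim n)
    have "real (nat \<lceil>v n * a\<rceil>) \<le> v n * a + 1" using mult_nonneg_nonneg[of "v n" a] elim a by linarith
    then have "real (nat \<lceil>v n * a\<rceil>) / real n \<le> (v n * a + 1) / real n" by (intro divide_right_mono) auto
    then show ?case by (simp add: add_divide_distrib inverse_eq_divide)
  qed
  show "(\<lambda>n. v n / real n * a) \<longlonglongrightarrow> \<kappa> * a" by (intro tendsto_intros v)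
  have "(\<lambda>n. v n / real n * a + inverse (real n)) \<longlonglongrightarrow> \<kappa> * a + 0" by (intro tendsto_add tendsto_mult v tendsto_const lim_inverse_n)
  then show "(\<lambda>n. v n / real n * a + inverse (real n)) \<longlonglongrightarrow> \<kappa> * a" by simp
qed

text \<open>The gap \<open>\<lceil>\<surd>n\<rceil>\<close> makes both \<open>n t / n\<^sup>2\<close> and \<open>n \<theta>\<^sup>t\<close> vanish.\<close>

lemma decoupling_error_tendsto:
  assumes L: "(\<lambda>n. real (L n) / real n) \<longlonglongrightarrow> \<Lambda>" and r: "(\<lambda>n. real n * r n) \<longlonglongrightarrow> R" and \<theta>: "0 < \<theta>" "\<theta> < 1"
  shows "(\<lambda>n. real (L n) * (K * (r n * \<theta> ^ J + real (nat \<lceil>sqrt (real n)\<rceil>) * (r n)\<^sup>2 + \<theta> ^ nat \<lceil>sqrt (real n)\<rceil>))) \<longlonglongrightarrow> \<Lambda> * K * (R * \<theta> ^ J)"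
proof -
  define t where "t n = nat \<lceil>sqrt (real n)\<rceil>" for n
  have tge: "sqrt (real n) \<le> real (t n)" for n unfolding t_def by (rule real_nat_ceiling_ge)
  have sq: "filterlim (\<lambda>n. sqrt (real n)) at_top sequentially" by (rule filterlim_compose[OF sqrt_at_top filterlim_real_sequentially])
  have "filterlim (\<lambda>n. real (t n)) at_top sequentially"
    by (rule filterlim_at_top_mono[OF sq]) (use tge in simp)
  then have tt: "filterlim t sequentially sequentially" by (simp add: filterlim_sequentially_iff_filterlim_real)
  have tn: "(\<lambda>n. real (t n) / real n) \<longlonglongrightarrow> 0"
  proof (rule tendsto_sandwich[OF _ _ tendsto_const])
    show "\<forall>\<^sub>F n in sequentially. real (t n) / real n \<le> inverse (sqrt (real n)) + inverse (real n)"
      using eventually_gt_at_top[of 0]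
    proof eventually_elim
      case (elim n)
      have "real (t n) \<le> sqrt (real n) + 1" unfolding t_def using real_sqrt_ge_zero[of "real n"] by linarith
      then have "real (t n) / real n \<le> (sqrt (real n) + 1) / real n" by (intro divide_right_mono) auto
      also have "\<dots> = inverse (sqrt (real n)) + inverse (real n)"
        by (simp add: add_divide_distrib sqrt_divide_self_eq inverse_eq_divide[of "real n"])
      finally show ?case .
    qed
    have "(\<lambda>n. inverse (sqrt (real n)) + inverse (real n)) \<longlonglongrightarrow> 0 + 0"
      by (intro tendsto_add lim_inverse_n tendsto_inverse_0_at_top sq)
    then show "(\<lambda>n. inverse (sqrt (real n)) + inverse (real n)) \<longlonglongrightarrow> 0" by simp
  qed simp
  \<comment> \<open>Since \<open>n \<le> t^2\<close>, the term is at most the square of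
    \<open>t * sqrt \<theta> ^ t\<close>, which tends to 0.\<close>
  have nt: "(\<lambda>n. real n * \<theta> ^ t n) \<longlonglongrightarrow> 0"
  proof (rule tendsto_sandwich[OF _ _ tendsto_const])
    show "\<forall>\<^sub>F n in sequentially. real n * \<theta> ^ t n \<le> (real (t n) * sqrt \<theta> ^ t n)\<^sup>2"
    proof (intro always_eventually allI)
      fix n
      have "real n \<le> (real (t n))\<^sup>2" using power_mono[OF tge[of n], of 2] by simp
      moreover have "(sqrt \<theta> ^ t n)\<^sup>2 = \<theta> ^ t n" using \<theta> by (simp add: power_mult[symmetric] mult.commute[of _ 2]) (simp add: power_mult)
      ultimately show "real n * \<theta> ^ t n \<le> (real (t n) * sqrt \<theta> ^ t n)\<^sup>2"
        using \<theta> by (simp add: power_mult_distrib mult_right_mono)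
    qed
    have "(\<lambda>n. real n * sqrt \<theta> ^ n) \<longlonglongrightarrow> 0" using \<theta> by (intro powser_times_n_limit_0) simp
    from filterlim_compose[OF this tt] have "(\<lambda>n. real (t n) * sqrt \<theta> ^ t n) \<longlonglongrightarrow> 0" .
    from tendsto_power[OF this, of 2] show "(\<lambda>n. (real (t n) * sqrt \<theta> ^ t n)\<^sup>2) \<longlonglongrightarrow> 0" by simp
  qed (use \<theta> in simp)
  have "(\<lambda>n. real (L n) / real n * K * (real n * r n * \<theta> ^ J + (real n * r n) * (real n * r n) * (real (t n) / real n) + real n * \<theta> ^ t n))
      \<longlonglongrightarrow> \<Lambda> * K * (R * \<theta> ^ J + R * R * 0 + 0)"
    by (intro tendsto_mult tendsto_add tendsto_const L r tn nt)
  then have l: "(\<lambda>n. real (L n) / real n * K * (real n * r n * \<theta> ^ J + (real n * r n) * (real n * r n) * (real (t n) / real n) + real n * \<theta> ^ t n))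
      \<longlonglongrightarrow> \<Lambda> * K * (R * \<theta> ^ J)" by simp
  show ?thesis
  proof (rule Lim_transform_eventually[OF l], rule eventually_mono[OF eventually_gt_at_top[of 0]])
    fix n :: nat assume n: "0 < n"
    have "(real n * r n) * (real n * r n) * (real (t n) / real n) = real n * (real (t n) * (r n)\<^sup>2)"
      using n by (simp add: power2_eq_square)
    then have "real n * r n * \<theta> ^ J + (real n * r n) * (real n * r n) * (real (t n) / real n) + real n * \<theta> ^ t n =
        real n * (r n * \<theta> ^ J + real (t n) * (r n)\<^sup>2 + \<theta> ^ t n)" by (simp add: distrib_left)
    then show "real (L n) / real n * K * (real n * r n * \<theta> ^ J + (real n * r n) * (real n * r n) * (real (t n) / real n) + real n * \<theta> ^ t n) =
        real (L n) * (K * (r n * \<theta> ^ J + real (nat \<lceil>sqrt (real n)\<rceil>) * (r n)\<^sup>2 + \<theta> ^ nat \<lceil>sqrt (real n)\<rceil>))"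
      using n by (simp add: t_def[symmetric])
  qed
qed

context extremes begin

lemma prob_space_fibre: assumes "good C \<omega>" shows "prob_space (fibre_measure h \<omega>)"
proof (rule prob_spaceI)
  have hi: "integrable leb (h \<omega>)" "(LINT x|leb. h \<omega> x) = 1" using good_integrable[OF assms, of 0] good_integral[OF assms, of 0] by simp_all
  have "emeasure (fibre_measure h \<omega>) (space leb) = (\<integral>\<^sup>+x. ennreal (h \<omega> x) \<partial>leb)"
    unfolding fibre_measure_def using h_measurable by (subst emeasure_density) (auto intro!: nn_integral_cong in_sets_leb)
  also have "\<dots> = ennreal 1" unfolding hi(2)[symmetric] by (rule nn_integral_eq_integral[OF hi(1)]) (auto intro!: AE_I2 h_nonneg)
  finally show "emeasure (fibre_measure h \<omega>) (space (fibre_measure h \<omega>)) = 1" by (simp add: fibre_measure_def)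
qed

lemma integral_fibre:
  fixes F :: "real \<Rightarrow> real"
  assumes "F \<in> borel_measurable leb" shows "(LINT x|fibre_measure h \<omega>. F x) = (LINT x|leb. F x * H \<omega> 0 x)"
  unfolding fibre_measure_def
  by (subst integral_density[OF assms h_measurable]) (auto intro!: AE_I2 h_nonneg simp: mult.commute)

lemma marked_process_exc:
  "c * marked_process M (obs_process f g z \<omega>) u n J x =
    (\<Sum>i | real i \<in> (\<lambda>t. time_scale M (obs_process f g z \<omega>) u n * t) ` J. exc c (u n) (dist (fi \<omega> i x) z))"
  by (simp add: marked_process_def obs_process_def exc_def sum_distrib_left)

lemma exc_iter_measurable:
  assumes "near \<delta>" "0 < r" "r < \<delta>" "0 < c" "ereal u = g r"
  shows "(\<lambda>x. exc c u (dist (fi \<omega> i x) z)) \<in> borel_measurable leb"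
  by (rule measurable_compose[OF fi_measurable xi_bump(3)[OF assms order_refl]])

text \<open>The denominator is the orbit sum over balls of radius \<open>r n\<close>, close to
  \<open>n * \<rho> * 2 * r n\<close>, and this tends to \<open>\<tau>\<close>. The unknown density
  \<open>\<rho>\<close> at the centre cancels here.\<close>

lemma time_scale_tendsto:
  assumes G: "good C \<omega>" "0 < C"
    and dens: "orbit_density \<rho> z \<omega>"
    and \<rho>: "0 < \<rho>" and z: "z \<in> {0<..<1}" and \<tau>: "0 < \<tau>"
    and r: "\<forall>\<^sub>F n in sequentially. 0 < r n" "r \<longlonglongrightarrow> 0" "(\<lambda>n. real n * (2 * r n)) \<longlonglongrightarrow> \<tau> / \<rho>"
    and u: "\<And>n. u n = gr (r n)"
  shows "(\<lambda>n. time_scale (fibre_measure h \<omega>) (obs_process f g z \<omega>) u n / real n) \<longlonglongrightarrow> inverse \<tau>"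
proof -
  obtain \<delta> where \<delta>: "near \<delta>" using near_ex by blast
  have "0 < \<delta>" "0 < z" "0 < 1 - z" using \<delta> z by (auto simp: near_def)
  then have ev: "\<forall>\<^sub>F n in sequentially. 0 < r n \<and> r n < \<delta> \<and> r n < z \<and> r n < 1 - z"
    using r(1) order_tendstoD(2)[OF r(2)] by (auto simp: eventually_conj_iff)
  define B where "B n = {x \<in> {0..1}. dist x z < r n}" for n
  have "(\<lambda>n. \<Sum>m<n. LINT x|leb. indicator (B n) x * H \<omega> m x) \<longlonglongrightarrow> 1 * \<rho> * (\<tau> / \<rho>)"
  proof (rule fibre_sum_limit[OF G dens \<rho> _ r(2)])
    show "\<forall>\<^sub>F n in sequentially. 0 < r n \<and> bump z (r n) (indicator (B n))"
      using ev by eventually_elim (use ball_leb(1)[OF z] in \<open>auto intro!: indicator_bump simp: B_def\<close>)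
    show "(\<lambda>n. real n * (LINT x|leb. indicator (B n) x)) \<longlonglongrightarrow> \<tau> / \<rho>"
    proof (rule Lim_transform_eventually[OF r(3)])
      show "\<forall>\<^sub>F n in sequentially. real n * (2 * r n) = real n * (LINT x|leb. indicator (B n) x)"
        using ev
      proof eventually_elim
        case (elim n)
        have "B n \<subseteq> {0..1}" by (auto simp: B_def)
        then have "(LINT x|leb. indicator (B n) x) = measure leb (B n)" by (simp add: Int_absorb2)
        also have "\<dots> = 2 * r n" unfolding B_def by (rule ball_leb(2)[OF z]) (use elim in auto)
        finally show ?case by simp
      qed
    qed
    show "(\<lambda>n. real n / real n) \<longlonglongrightarrow> 1"
      by (rule tendsto_eventually, rule eventually_mono[OF eventually_gt_at_top[of 0]]) simp
  qed
  then have S: "(\<lambda>n. \<Sum>m<n. LINT x|leb. indicator (B n) x * H \<omega> m x) \<longlonglongrightarrow> \<tau>" using \<rho> by simp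
  have "(\<lambda>n. inverse (\<Sum>m<n. LINT x|leb. indicator (B n) x * H \<omega> m x)) \<longlonglongrightarrow> inverse \<tau>"
    by (rule tendsto_inverse[OF S]) (use \<tau> in simp)
  then show ?thesis
  proof (rule Lim_transform_eventually)
    show "\<forall>\<^sub>F n in sequentially. inverse (\<Sum>m<n. LINT x|leb. indicator (B n) x * H \<omega> m x) =
        time_scale (fibre_measure h \<omega>) (obs_process f g z \<omega>) u n / real n"
      using ev eventually_gt_at_top[of 0]
    proof eventually_elim
      case (elim n)
      have un: "ereal (u n) = g (r n)" using g_finite(2)[OF \<delta>, of "r n"] elim by (simp add: u)
      have "measure (fibre_measure h \<omega>) {x \<in> {0..1}. obs_process f g z \<omega> i x > ereal (u n)} = (LINT x|leb. indicator (B n) x * H \<omega> i x)" for i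
        unfolding B_def by (rule exceedance_measure[OF G(1) \<delta> _ _ un]) (use elim in auto)
      then show ?case using elim unfolding time_scale_def by (simp add: field_simps)
    qed
  qed
qed

end

context extremes begin

text \<open>Regrouped by time, the exponent gives one Laplace factor per time \<open>i\<close>, with
  argument \<open>t j\<close> when \<open>i\<close> lies in the rescaled interval \<open>j\<close>
  and 0 otherwise. Their fibre integrals sum to the exponent of the limit, \<open>\<tau>\<close> and
  \<open>\<rho>\<close> cancelling; \<open>product_expectation\<close> and
  \<open>prod_tendsto_exp\<close> do the rest.\<close>

lemma laplace_limit:
  fixes a b t :: "nat \<Rightarrow> real"
  assumes C: "0 < C" and G: "good C \<omega>"
    and dens: "orbit_density \<rho> z \<omega>"
    and \<rho>: "0 < \<rho>" and z: "z \<in> {0<..<1}" "aperiodic z" and \<tau>: "0 < \<tau>"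
    and r: "\<forall>\<^sub>F n in sequentially. 0 < r n" "r \<longlonglongrightarrow> 0" "(\<lambda>n. real n * (2 * r n)) \<longlonglongrightarrow> \<tau> / \<rho>"
    and u: "\<And>n. u n = gr (r n)"
    and tl: "tails sc \<pi>" and ml: "mark_law \<pi>"
    and ab: "\<And>j. j < k \<Longrightarrow> 0 \<le> a j \<and> a j < b j" and dj: "disjoint_family_on (\<lambda>j. {a j..<b j}) {..<k}"
    and t: "\<And>j. j < k \<Longrightarrow> 0 \<le> t j"
  shows "(\<lambda>n. LINT x|fibre_measure h \<omega>. exp (- (\<Sum>j<k. t j * (sc (u n) *
      marked_process (fibre_measure h \<omega>) (obs_process f g z \<omega>) u n {a j..<b j} x))))
    \<longlonglongrightarrow> exp (- (\<Sum>j<k. (b j - a j) * (1 - renewal_marks.lap (interval_measure \<pi>) (t j))))"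
proof -
  interpret R: renewal_marks "interval_measure \<pi>" by (rule mark_law_facts(1)[OF ml])
  obtain \<delta> where \<delta>: "near \<delta>" using near_ex by blast
  define v where "v = time_scale (fibre_measure h \<omega>) (obs_process f g z \<omega>) u"
  have vlim: "(\<lambda>n. v n / real n) \<longlonglongrightarrow> inverse \<tau>"
    unfolding v_def by (rule time_scale_tendsto[OF G C dens \<rho> z(1) \<tau> r u])
  have "\<forall>\<^sub>F n in sequentially. 0 < v n / real n" by (rule order_tendstoD(1)[OF vlim]) (use \<tau> in simp)
  then have vp: "\<forall>\<^sub>F n in sequentially. 0 < v n" by (rule eventually_mono) (auto simp: zero_less_divide_iff)
  have scp: "\<forall>\<^sub>F n in sequentially. 0 < sc (u n)" using tl r unfolding tails_def u by blast
  have "0 < \<delta>" using \<delta> by (simp add: near_def)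
  then have ev: "\<forall>\<^sub>F n in sequentially. 0 < r n \<and> r n < \<delta> \<and> 0 < sc (u n) \<and> 0 < v n"
    using r(1) order_tendstoD(2)[OF r(2)] scp vp by (auto simp: eventually_conj_iff)
  have un: "ereal (u n) = g (r n)" if "0 < r n" "r n < \<delta>" for n using g_finite(2)[OF \<delta> that] by (simp add: u)
  define X where "X s n = xi (sc (u n)) (u n) z s" for s n
  have Xb: "bump z (r n) (X s n)" "bvar 4 (X s n)" if "0 < r n \<and> r n < \<delta> \<and> 0 < sc (u n) \<and> 0 < v n" "0 \<le> s" for s n
    unfolding X_def by (rule xi_bump[OF \<delta> _ _ _ un]; use that in blast)+
  have X0: "X 0 n x = 0" for n x by (simp add: X_def xi_def)
  define lo where "lo n j = nat \<lceil>v n * a j\<rceil>" for n j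
  define hi where "hi n j = nat \<lceil>v n * b j\<rceil>" for n j
  \<comment> \<open>A common horizon beyond all intervals. Summing the upper ends instead of taking
    their maximum keeps it of order \<open>n\<close> and makes its limit immediate.\<close>
  define L where "L n = (\<Sum>j<k. hi n j)" for n
  \<comment> \<open>By disjointness at most one summand is nonzero, so this is the Laplace argument
    in force at time \<open>i\<close>; outside all intervals it is 0 and the factor is 1.\<close>
  define T where "T n i = (\<Sum>j<k. if i \<in> {lo n j..<hi n j} then t j else 0)" for n i
  have T0: "0 \<le> T n i" for n i unfolding T_def by (intro sum_nonneg) (use t in auto)
  define e where "e n m = (LINT x|leb. X (T n m) n x * H \<omega> m x)" for n m
  have loI: "(i \<in> {lo n j..<hi n j}) = (real i / v n \<in> {a j..<b j})" if "0 < v n" "j < k" for n i j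
    unfolding lo_def hi_def by (rule real_mem_scaled_interval(2)) (use that ab in auto)
  have hiL: "hi n j \<le> L n" if "j < k" for n j unfolding L_def using that by (intro member_le_sum) auto
  have ab0: "0 \<le> a j" "0 \<le> b j" "a j \<le> b j" if "j < k" for j using ab[OF that] by auto
  have hilim: "(\<lambda>n. real (hi n j) / real n) \<longlonglongrightarrow> inverse \<tau> * b j" if "j < k" for j
    unfolding hi_def by (rule ceiling_ratio_tendsto[OF vlim vp ab0(2)[OF that]])
  have lolim: "(\<lambda>n. real (lo n j) / real n) \<longlonglongrightarrow> inverse \<tau> * a j" if "j < k" for j
    unfolding lo_def by (rule ceiling_ratio_tendsto[OF vlim vp ab0(1)[OF that]])
  have "(\<lambda>n. \<Sum>j<k. real (hi n j) / real n) \<longlonglongrightarrow> (\<Sum>j<k. inverse \<tau> * b j)" by (intro tendsto_sum hilim) auto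
  then have Llim: "(\<lambda>n. real (L n) / real n) \<longlonglongrightarrow> (\<Sum>j<k. inverse \<tau> * b j)" by (simp add: L_def sum_divide_distrib)
  have Xlim: "(\<lambda>n. real n * (LINT x|leb. X s n x)) \<longlonglongrightarrow> \<tau> / \<rho> * (1 - R.lap s)" if s: "0 \<le> s" for s
  proof (cases "s = 0")
    case True
    then show ?thesis by (simp add: X0 R.lap_def R.D.prob_space[simplified])
  next
    case False
    then have s0: "0 < s" using s by simp
    have "(\<lambda>n. real n * (2 * r n) * ((LINT x|leb. X s n x) / (2 * r n))) \<longlonglongrightarrow> \<tau> / \<rho> * (1 - R.lap s)"
      unfolding X_def by (intro tendsto_mult r(3) tail_integral[OF tl ml z(1) r(1,2) s0 u])
    then show ?thesis
      by (rule Lim_transform_eventually) (rule eventually_mono[OF r(1)], simp)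
  qed
  have Slim: "(\<lambda>n. \<Sum>m<N n. LINT x|leb. X s n x * H \<omega> m x) \<longlonglongrightarrow> \<kappa> * \<rho> * (\<tau> / \<rho> * (1 - R.lap s))"
    if "0 \<le> s" "(\<lambda>n. real (N n) / real n) \<longlonglongrightarrow> \<kappa>" for s N \<kappa>
  proof (rule fibre_sum_limit[OF G C dens \<rho> _ r(2) Xlim[OF that(1)] that(2)])
    show "\<forall>\<^sub>F n in sequentially. 0 < r n \<and> bump z (r n) (X s n)"
      using ev by eventually_elim (use Xb(1) that in blast)
  qed
  \<comment> \<open>The law along the orbit controls sums that start at time 0, so the sum over each
    interval is written as a difference of two of them.\<close>
  have esum: "(\<Sum>m<L n. e n m) = (\<Sum>j<k. (\<Sum>m<hi n j. LINT x|leb. X (t j) n x * H \<omega> m x) - (\<Sum>m<lo n j. LINT x|leb. X (t j) n x * H \<omega> m x))"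
    if vn: "0 < v n" for n
  proof -
    let ?E = "\<lambda>j m. LINT x|leb. X (t j) n x * H \<omega> m x"
    have em: "e n m = (\<Sum>j<k. if m \<in> {lo n j..<hi n j} then ?E j m else 0)" for m
    proof (cases "\<exists>j<k. m \<in> {lo n j..<hi n j}")
      case True
      then obtain i where i: "i < k" "m \<in> {lo n i..<hi n i}" by blast
      have one: "m \<in> {lo n j..<hi n j} \<longleftrightarrow> j = i" if "j < k" for j
      proof
        assume "m \<in> {lo n j..<hi n j}"
        then have "real m / v n \<in> {a j..<b j} \<inter> {a i..<b i}" using i loI[OF vn that] loI[OF vn i(1)] by blast
        then show "j = i" using dj that i(1) unfolding disjoint_family_on_def by blast
      qed (use i in simp)
      have "(\<Sum>j<k. if m \<in> {lo n j..<hi n j} then w j else 0) = w i" for w :: "nat \<Rightarrow> real"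
      proof -
        have "(\<Sum>j<k. if m \<in> {lo n j..<hi n j} then w j else 0) = (\<Sum>j<k. if j = i then w j else 0)"
          by (intro sum.cong refl) (simp only: one lessThan_iff)
        then show ?thesis using i(1) by simp
      qed
      then show ?thesis unfolding e_def T_def by simp
    next
      case False
      then have "T n m = 0" "(\<Sum>j<k. if m \<in> {lo n j..<hi n j} then ?E j m else 0) = 0"
        unfolding T_def by (intro sum.neutral; auto)+
      then show ?thesis unfolding e_def by (simp only: X0) simp
    qed
    have "(\<Sum>m<L n. e n m) = (\<Sum>j<k. \<Sum>m<L n. if m \<in> {lo n j..<hi n j} then ?E j m else 0)"
      unfolding em by (rule sum.swap)
    also have "\<dots> = (\<Sum>j<k. (\<Sum>m<hi n j. ?E j m) - (\<Sum>m<lo n j. ?E j m))"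
    proof (intro sum.cong refl)
      fix j assume "j \<in> {..<k}"
      then have j: "j < k" by simp
      have "(\<Sum>m<L n. if m \<in> {lo n j..<hi n j} then ?E j m else 0) = (\<Sum>m\<in>{..<L n} \<inter> {lo n j..<hi n j}. ?E j m)"
        by (simp add: sum.inter_restrict)
      also have "{..<L n} \<inter> {lo n j..<hi n j} = {lo n j..<hi n j}" using hiL[OF j, of n] by auto
      finally have 1: "(\<Sum>m<L n. if m \<in> {lo n j..<hi n j} then ?E j m else 0) = (\<Sum>m\<in>{lo n j..<hi n j}. ?E j m)" .
      have "lo n j \<le> hi n j" unfolding lo_def hi_def using vn ab0(3)[OF j] by (intro nat_mono ceiling_mono mult_left_mono) auto
      then have "(\<Sum>m\<in>{0..<lo n j}. ?E j m) + (\<Sum>m\<in>{lo n j..<hi n j}. ?E j m) = (\<Sum>m\<in>{0..<hi n j}. ?E j m)"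
        by (intro sum.atLeastLessThan_concat) auto
      then show "(\<Sum>m<L n. if m \<in> {lo n j..<hi n j} then ?E j m else 0) = (\<Sum>m<hi n j. ?E j m) - (\<Sum>m<lo n j. ?E j m)"
        unfolding 1 by (simp add: lessThan_atLeast0)
    qed
    finally show ?thesis .
  qed
  have "(\<lambda>n. \<Sum>j<k. (\<Sum>m<hi n j. LINT x|leb. X (t j) n x * H \<omega> m x) - (\<Sum>m<lo n j. LINT x|leb. X (t j) n x * H \<omega> m x))
    \<longlonglongrightarrow> (\<Sum>j<k. inverse \<tau> * b j * \<rho> * (\<tau> / \<rho> * (1 - R.lap (t j))) - inverse \<tau> * a j * \<rho> * (\<tau> / \<rho> * (1 - R.lap (t j))))"
    by (intro tendsto_sum tendsto_diff Slim t hilim lolim) auto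
  also have "(\<Sum>j<k. inverse \<tau> * b j * \<rho> * (\<tau> / \<rho> * (1 - R.lap (t j))) - inverse \<tau> * a j * \<rho> * (\<tau> / \<rho> * (1 - R.lap (t j))))
     = (\<Sum>j<k. (b j - a j) * (1 - R.lap (t j)))"
  proof -
    have "inverse \<tau> * c * \<rho> * (\<tau> / \<rho> * w) = c * w" for c w using \<rho> \<tau> by (simp add: field_simps)
    then show ?thesis by (simp only: left_diff_distrib)
  qed
  finally have "(\<lambda>n. \<Sum>m<L n. e n m) \<longlonglongrightarrow> (\<Sum>j<k. (b j - a j) * (1 - R.lap (t j)))"
    by (rule Lim_transform_eventually) (rule eventually_mono[OF vp], rule esum[symmetric])
  then have plim: "(\<lambda>n. \<Prod>m<L n. 1 - e n m) \<longlonglongrightarrow> exp (- (\<Sum>j<k. (b j - a j) * (1 - R.lap (t j))))"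
  proof (rule prod_tendsto_exp[rotated 2])
    show "\<forall>\<^sub>F n in sequentially. \<forall>m<L n. 0 \<le> e n m \<and> e n m \<le> (C + 1) * (2 * r n)"
      using ev
    proof eventually_elim
      case (elim n)
      show ?case
      proof (intro allI impI conjI)
        fix m
        note bm = Xb(1)[OF elim T0[of n m]]
        show "0 \<le> e n m" unfolding e_def by (rule fibre_integral_bound(1)[OF G bm])
        have "e n m \<le> (C + 1) * (LINT x|leb. X (T n m) n x)" unfolding e_def by (rule fibre_integral_bound(2)[OF G bm])
        also have "\<dots> \<le> (C + 1) * (2 * r n)" using bump_L1(2)[OF bm] elim C by (intro mult_left_mono) auto
        finally show "e n m \<le> (C + 1) * (2 * r n)" .
      qed
    qed
    show "(\<lambda>n. (C + 1) * (2 * r n)) \<longlonglongrightarrow> 0" by (intro tendsto_mult_right_zero r(2))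
  qed
  define A where "A n x = (\<Sum>j<k. t j * (sc (u n) * marked_process (fibre_measure h \<omega>) (obs_process f g z \<omega>) u n {a j..<b j} x))" for n x
  have Aeq: "exp (- A n x) = (\<Prod>i<L n. 1 - X (T n i) n (fi \<omega> i x))" if vn: "0 < v n" for n x
  proof -
    let ?E = "\<lambda>i. exc (sc (u n)) (u n) (dist (fi \<omega> i x) z)"
    have "A n x = (\<Sum>j<k. t j * (\<Sum>i\<in>{lo n j..<hi n j}. ?E i))"
      unfolding A_def marked_process_exc v_def[symmetric] lo_def hi_def
      by (intro sum.cong refl) (use ab0 in \<open>simp add: real_mem_scaled_interval(1)[OF vn]\<close>)
    also have "\<dots> = (\<Sum>j<k. \<Sum>i<L n. (if i \<in> {lo n j..<hi n j} then t j else 0) * ?E i)"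
    proof (intro sum.cong refl)
      fix j assume "j \<in> {..<k}"
      then have "{..<L n} \<inter> {lo n j..<hi n j} = {lo n j..<hi n j}" using hiL[of j n] by auto
      then have "t j * (\<Sum>i\<in>{lo n j..<hi n j}. ?E i) = (\<Sum>i\<in>{..<L n} \<inter> {lo n j..<hi n j}. t j * ?E i)" by (simp add: sum_distrib_left)
      also have "\<dots> = (\<Sum>i<L n. if i \<in> {lo n j..<hi n j} then t j * ?E i else 0)" by (rule sum.inter_restrict) simp
      also have "\<dots> = (\<Sum>i<L n. (if i \<in> {lo n j..<hi n j} then t j else 0) * ?E i)" by (intro sum.cong) auto
      finally show "t j * (\<Sum>i\<in>{lo n j..<hi n j}. ?E i) = (\<Sum>i<L n. (if i \<in> {lo n j..<hi n j} then t j else 0) * ?E i)" .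
    qed
    also have "\<dots> = (\<Sum>i<L n. T n i * ?E i)" unfolding T_def sum_distrib_right by (rule sum.swap)
    finally show ?thesis by (simp add: exp_sum[symmetric] sum_negf X_def xi_def)
  qed
  obtain K \<theta> where K: "0 < K" "0 < \<theta>" "\<theta> < 1" and pe: "\<And>\<omega> z r L t J \<xi>. good C \<omega> \<Longrightarrow> 0 < r \<Longrightarrow> (\<forall>i<L. bump z r (\<xi> i) \<and> bvar 4 (\<xi> i)) \<Longrightarrow>
     (\<forall>\<omega> j x. 1 \<le> j \<longrightarrow> j < J \<longrightarrow> dist x z < r \<longrightarrow> r \<le> dist (fi \<omega> j x) z) \<Longrightarrow> 1 \<le> t \<Longrightarrow>
     \<bar>(LINT x|leb. (\<Prod>i<L. 1 - \<xi> i (fi \<omega> i x)) * H \<omega> 0 x) - (\<Prod>m<L. 1 - (LINT x|leb. \<xi> m x * H \<omega> m x))\<bar>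
       \<le> real L * (K * (r * \<theta> ^ J + real t * r\<^sup>2 + \<theta> ^ t))"
    using product_expectation[OF C] by blast
  define E where "E n = (LINT x|leb. (\<Prod>i<L n. 1 - X (T n i) n (fi \<omega> i x)) * H \<omega> 0 x)" for n
  have Eeq: "(LINT x|fibre_measure h \<omega>. exp (- A n x)) = E n" if "0 < r n \<and> r n < \<delta> \<and> 0 < sc (u n) \<and> 0 < v n" for n
  proof -
    have [measurable]: "(\<lambda>x. X s n (fi \<omega> i x)) \<in> borel_measurable leb" if "0 \<le> s" for s i
      by (rule measurable_compose[OF fi_measurable bvar_measurable[OF Xb(2)]]) (use that \<open>0 < r n \<and> _\<close> in blast)+
    have "(\<lambda>x. \<Prod>i<L n. 1 - X (T n i) n (fi \<omega> i x)) \<in> borel_measurable leb"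
      by (intro borel_measurable_prod borel_measurable_diff) (use T0 in auto)
    then show ?thesis unfolding E_def using that Aeq[of n] by (simp add: integral_fibre)
  qed
  have "(\<lambda>n. E n - (\<Prod>m<L n. 1 - e n m)) \<longlonglongrightarrow> 0"
  proof (rule tendstoI)
    fix \<epsilon> :: real assume \<epsilon>: "0 < \<epsilon>"
    have rlim: "(\<lambda>n. real n * r n) \<longlonglongrightarrow> \<tau> / \<rho> / 2" using tendsto_divide[OF r(3) tendsto_const[of 2]] by simp
    let ?\<Lambda> = "\<Sum>j<k. inverse \<tau> * b j"
    \<comment> \<open>For fixed \<open>J\<close> the error bound tends to this limit as
      \<open>n\<close> grows, so \<open>J\<close> is chosen first to bring it below
      \<open>\<epsilon>\<close>; then \<open>d\<close> excludes returns before \<open>J\<close>, and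
      only then is \<open>n\<close> taken large.\<close>
    have "(\<lambda>J. ?\<Lambda> * K * (\<tau> / \<rho> / 2 * \<theta> ^ J)) \<longlonglongrightarrow> 0"
      by (intro tendsto_mult_right_zero LIMSEQ_realpow_zero) (use K in auto)
    then obtain J where J: "?\<Lambda> * K * (\<tau> / \<rho> / 2 * \<theta> ^ J) < \<epsilon>"
      using order_tendstoD(2)[OF _ \<epsilon>] eventually_happens'[OF sequentially_bot] by blast
    obtain d where d: "0 < d" "\<And>r \<omega> j x. r \<le> d \<Longrightarrow> 1 \<le> j \<Longrightarrow> j < J \<Longrightarrow> dist x z < r \<Longrightarrow> r \<le> dist (fi \<omega> j x) z"
      using no_short_returns[OF z(2), of J] by blast
    show "\<forall>\<^sub>F n in sequentially. dist (E n - (\<Prod>m<L n. 1 - e n m)) 0 < \<epsilon>"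
      using ev order_tendstoD(2)[OF r(2) d(1)] eventually_gt_at_top[of 0]
        order_tendstoD(2)[OF decoupling_error_tendsto[OF Llim rlim K(2,3), of K J] J]
    proof eventually_elim
      case (elim n)
      have t1: "1 \<le> nat \<lceil>sqrt (real n)\<rceil>" using elim(3) by (simp add: Suc_le_eq)
      have "\<bar>E n - (\<Prod>m<L n. 1 - e n m)\<bar> \<le> real (L n) * (K * (r n * \<theta> ^ J + real (nat \<lceil>sqrt (real n)\<rceil>) * (r n)\<^sup>2 + \<theta> ^ nat \<lceil>sqrt (real n)\<rceil>))"
        unfolding E_def e_def
      proof (rule pe[OF G _ _ _ t1])
        show "\<forall>i<L n. bump z (r n) (X (T n i) n) \<and> bvar 4 (X (T n i) n)" using Xb[OF elim(1) T0] by blast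
        show "\<forall>\<omega> j x. 1 \<le> j \<longrightarrow> j < J \<longrightarrow> dist x z < r n \<longrightarrow> r n \<le> dist (fi \<omega> j x) z"
          using d(2)[of "r n"] elim(2) by (meson less_imp_le)
      qed (use elim in simp)
      then show ?case using elim(4) by simp
    qed
  qed
  from tendsto_add[OF this plim] have "E \<longlonglongrightarrow> exp (- (\<Sum>j<k. (b j - a j) * (1 - R.lap (t j))))" by simp
  then show ?thesis
    unfolding A_def[symmetric] by (rule Lim_transform_eventually) (rule eventually_mono[OF ev], rule Eeq[symmetric])
qed

text \<open>Finitely many \<open>n\<close>, for which the threshold is not yet given by a small
  radius, carry no information on measurability or sign. They are discarded by an index shift, which
  convergence in distribution tolerates.\<close>

lemma process_limit:
  assumes C: "0 < C" and G: "good C \<omega>"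
    and dens: "orbit_density \<rho> z \<omega>"
    and \<rho>: "0 < \<rho>" and z: "z \<in> {0<..<1}" "aperiodic z" and \<tau>: "0 < \<tau>"
    and r: "\<forall>\<^sub>F n in sequentially. 0 < r n \<and> u n = gr (r n)" "r \<longlonglongrightarrow> 0" "(\<lambda>n. real n * (2 * r n)) \<longlonglongrightarrow> \<tau> / \<rho>"
    and tl: "tails sc \<pi>" and ml: "mark_law \<pi>"
  shows "process_converges (fibre_measure h \<omega>)
    (\<lambda>n J x. sc (u n) * marked_process (fibre_measure h \<omega>) (obs_process f g z \<omega>) u n J x) (cpp_space 1 \<pi>) cpp"
  unfolding process_converges_def
proof (intro allI impI)
  fix k and a b :: "nat \<Rightarrow> real"
  assume "(\<forall>j<k. 0 \<le> a j \<and> a j < b j) \<and> disjoint_family_on (\<lambda>j. {a j..<b j}) {..<k}"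
  then have ab: "\<And>j. j < k \<Longrightarrow> 0 \<le> a j \<and> a j < b j" and dj: "disjoint_family_on (\<lambda>j. {a j..<b j}) {..<k}" by blast+
  interpret R: renewal_marks "interval_measure \<pi>" by (rule mark_law_facts(1)[OF ml])
  let ?M = "fibre_measure h \<omega>"
  let ?A = "\<lambda>u n J x. sc (u n) * marked_process ?M (obs_process f g z \<omega>) u n J x"
  \<comment> \<open>\<open>laplace_limit\<close> wants thresholds given by radii for every
    \<open>n\<close>; \<open>u0\<close> is such a sequence and agrees with \<open>u\<close> from
    \<open>n0\<close> on. The processes at time \<open>n\<close> depend on the threshold at
    \<open>n\<close> only.\<close>
  define u0 where "u0 n = gr (r n)" for n
  have cong: "?A u n = ?A u0 n" if "u n = u0 n" for n using that by (simp add: marked_process_def time_scale_def)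
  obtain \<delta> where \<delta>: "near \<delta>" using near_ex by blast
  have r1: "\<forall>\<^sub>F n in sequentially. 0 < r n" using r(1) by eventually_elim simp
  have "\<forall>\<^sub>F n in sequentially. 0 < sc (u0 n)" using tl r1 r(2) unfolding tails_def u0_def by blast
  moreover have "0 < \<delta>" using \<delta> by (simp add: near_def)
  ultimately have "\<forall>\<^sub>F n in sequentially. 0 < r n \<and> u n = u0 n \<and> r n < \<delta> \<and> 0 < sc (u0 n)"
    using r(1) order_tendstoD(2)[OF r(2)] unfolding u0_def by (auto simp: eventually_conj_iff)
  then obtain n0 where n0: "\<And>n. n0 \<le> n \<Longrightarrow> 0 < r n \<and> u n = u0 n \<and> r n < \<delta> \<and> 0 < sc (u0 n)"
    by (auto simp: eventually_sequentially)
  have un: "ereal (u0 n) = g (r n)" if "n0 \<le> n" for n using g_finite(2)[OF \<delta>, of "r n"] n0[OF that] by (simp add: u0_def)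
  have ceq: "?A u (n + n0) J x = ?A u0 (n + n0) J x" for n J x
    using fun_cong[OF fun_cong[OF cong[of "n + n0"], of J], of x] n0[of "n + n0"] by simp
  let ?X = "\<lambda>n x j. if j < k then ?A u n {a j..<b j} x else 0"
  let ?Y = "\<lambda>w j. if j < k then cpp {a j..<b j} w else 0"
  have W: "cpp_space 1 \<pi> = R.W" by (simp add: cpp_space_def)
  have "conv_in_distr ?M (\<lambda>n. ?X (n + n0)) R.W ?Y"
  proof (rule conv_in_distr_of_laplace[where k = k])
    show "prob_space ?M" by (rule prob_space_fibre[OF G])
    show "prob_space R.W" by (rule R.WW.prob_space_axioms)
    show "(\<lambda>x. ?X (n + n0) x j) \<in> borel_measurable ?M" for n j
    proof -
      have "?A u0 (n + n0) {a j..<b j} \<in> borel_measurable leb"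
        unfolding marked_process_exc
        by (intro borel_measurable_sum exc_iter_measurable[OF \<delta> _ _ _ un]) (use n0[of "n + n0"] in auto)
      moreover have "(borel_measurable ?M :: (real \<Rightarrow> real) set) = borel_measurable leb" by (rule measurable_cong_sets) (simp_all add: fibre_measure_def)
      ultimately have "?A u0 (n + n0) {a j..<b j} \<in> borel_measurable ?M" by (simp only:)
      then show ?thesis by (cases "j < k") (simp_all add: ceq)
    qed
    show "(\<lambda>w. ?Y w j) \<in> borel_measurable R.W" for j using R.cpp_measurable[of "{a j..<b j}"] by simp
    show "AE x in ?M. \<forall>j<k. 0 \<le> ?X (n + n0) x j" for n
    proof (intro AE_I2 allI impI)
      fix x j assume "j < k"
      moreover have "0 \<le> ?A u0 (n + n0) {a j..<b j} x"
        unfolding marked_process_exc by (intro sum_nonneg exc_nonneg[OF \<delta> _ _ _ un]) (use n0[of "n + n0"] in auto)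
      ultimately show "0 \<le> ?X (n + n0) x j" by (simp add: ceq)
    qed
    show "AE w in R.W. \<forall>j<k. 0 \<le> ?Y w j"
      using R.cpp_laplace(2)[OF ab dj, of "\<lambda>_. 0"] by (rule AE_mp) (auto intro!: AE_I2)
    fix t :: "nat \<Rightarrow> nat"
    have "(\<lambda>n. LINT x|?M. exp (- (\<Sum>j<k. real (t j) * ?A u0 n {a j..<b j} x))) \<longlonglongrightarrow>
        exp (- (\<Sum>j<k. (b j - a j) * (1 - R.lap (real (t j)))))"
      by (rule laplace_limit[OF C G dens \<rho> z \<tau> r1 r(2,3) u0_def tl ml ab dj]) auto
    then have "(\<lambda>n. LINT x|?M. exp (- (\<Sum>j<k. real (t j) * ?A u0 (n + n0) {a j..<b j} x))) \<longlonglongrightarrow>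
        exp (- (\<Sum>j<k. (b j - a j) * (1 - R.lap (real (t j)))))" by (rule LIMSEQ_ignore_initial_segment)
    moreover have "(\<Sum>j<k. real (t j) * ?X (n + n0) x j) = (\<Sum>j<k. real (t j) * ?A u0 (n + n0) {a j..<b j} x)" for n x
      by (intro sum.cong refl) (simp add: ceq)
    moreover have "(LINT w|R.W. exp (- (\<Sum>j<k. real (t j) * ?Y w j))) = exp (- (\<Sum>j<k. (b j - a j) * (1 - R.lap (real (t j)))))"
      using R.cpp_laplace(1)[OF ab dj, of "\<lambda>j. real (t j)"] by simp
    ultimately show "(\<lambda>n. LINT x|?M. exp (- (\<Sum>j<k. real (t j) * ?X (n + n0) x j))) \<longlonglongrightarrow>
        (LINT w|R.W. exp (- (\<Sum>j<k. real (t j) * ?Y w j)))" by simp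
  qed auto
  then show "conv_in_distr ?M ?X (cpp_space 1 \<pi>) ?Y"
    unfolding W conv_in_distr_def by (blast intro: LIMSEQ_offset)
qed

text \<open>The exceptional centres, those not \<open>regular\<close> or not
  \<open>aperiodic\<close>, are determined by the maps alone. The exceptional null set of
  \<open>\<omega>\<close> may depend on the centre, through \<open>orbit_density\<close>.\<close>

theorem MREPP_limit:
  assumes \<tau>: "0 < \<tau>" and tl: "tails sc \<pi>" and ml: "mark_law \<pi>"
  shows "MREPP_converges Q f h g \<tau> sc 1 \<pi>"
proof -
  obtain C where C: "0 < C" "AE \<omega> in Q. good C \<omega>" using AE_good by blast
  have "AE z in leb. regular z \<and> aperiodic z" using AE_regular AE_aperiodic by (rule AE_conjI)
  moreover have "AE \<omega> in Q. process_converges (fibre_measure h \<omega>)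
        (\<lambda>n J x. sc (threshold Q h g \<tau> z n) * marked_process (fibre_measure h \<omega>) (obs_process f g z \<omega>) (threshold Q h g \<tau> z) n J x)
        (cpp_space 1 \<pi>) cpp" if z: "regular z \<and> aperiodic z" for z
  proof -
    from z have z01: "z \<in> {0<..<1}" by (simp add: regular_def)
    obtain \<rho> where \<rho>: "0 < \<rho>" and d1: "mean_density \<rho> z"
     and d2: "AE \<omega> in Q. orbit_density \<rho> z \<omega>"
      using local_density[OF C, of z] z by blast
    obtain r where r: "\<forall>\<^sub>F n in sequentially. 0 < r n \<and> threshold Q h g \<tau> z n = gr (r n)"
      "r \<longlonglongrightarrow> 0" "(\<lambda>n. real n * (2 * r n)) \<longlonglongrightarrow> \<tau> / \<rho>"
      using threshold_radius[OF C(2,1) z01 \<rho> \<tau> d1] by blast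
    show ?thesis
      by (rule eventually_mono[OF AE_conjI[OF C(2) d2]], elim conjE)
        (rule process_limit[OF C(1) _ _ \<rho> z01 conjunct2[OF z] \<tau> r tl ml])
  qed
  ultimately show ?thesis unfolding MREPP_converges_def Let_def by (rule eventually_mono)
qed

end

theorem proposition5p1:
  fixes p :: "'y::finite pmf"
    and Q :: "(int \<Rightarrow> 'y) measure"
    and f :: "'y \<Rightarrow> real \<Rightarrow> real"
    and h :: "(int \<Rightarrow> 'y) \<Rightarrow> real \<Rightarrow> real"
    and g :: "real \<Rightarrow> ereal" and V :: "real set" and W :: "ereal set"
    and \<tau> :: real
  assumes "Q = bernoulli p"
    and "nonatomic Q"
    and "\<And>y. f y ` {0..1} \<subseteq> {0..1}"
    and "\<And>y. piecewise_C2 (f y)"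
    and "(SUP \<omega>. num_monotone (fibre_map f \<omega>)) < \<infinity>"
    and "(INF \<omega>. essinf leb (\<lambda>x. ereal \<bar>deriv (fibre_map f \<omega>) x\<bar>)) > 1"
    and "(SUP \<omega>. esssup leb (\<lambda>x. ereal \<bar>deriv (deriv (fibre_map f \<omega>)) x\<bar>)) < \<infinity>"
    and "transfer_measurable Q f"
    and "covering Q f"
    and "cone_lower_bound Q f"
    and "equivariant_density Q f h"
    and "observable_shape g V W"
    and "0 < \<tau>"
  shows
    "(\<forall>\<eta>. obs_type1 g V W \<eta> \<longrightarrow>
        MREPP_converges Q f h g \<tau> (\<lambda>u. inverse (\<eta> (ereal u))) 1
          (\<lambda>x. if x < 0 then 0 else 1 - exp (- x))) \<and>
     (\<forall>\<beta>. obs_type2 g V \<beta> \<longrightarrow>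
        MREPP_converges Q f h g \<tau> (\<lambda>u. inverse u) 1
          (\<lambda>x. if x < 0 then 0 else 1 - (1 + x) powr (- \<beta>))) \<and>
     (\<forall>D \<gamma>. obs_type3 g V D \<gamma> \<longrightarrow>
        MREPP_converges Q f h g \<tau> (\<lambda>u. inverse (D - u)) 1
          (\<lambda>x. if x < 0 then 0 else if x < 1 then 1 - (1 - x) powr \<gamma> else 1))"
proof -
  let ?I = "INF \<omega>. essinf leb (\<lambda>x. ereal \<bar>deriv (fibre_map f \<omega>) x\<bar>)"
  let ?S = "SUP \<omega>. esssup leb (\<lambda>x. ereal \<bar>deriv (deriv (fibre_map f \<omega>)) x\<bar>)"
  \<comment> \<open>A real constant strictly between 1 and the infimum, as
    \<open>less_LiminfD\<close> turns a strict bound into one that holds almost everywhere.\<close>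
  obtain l :: real where l: "1 < l" "ereal l < ?I"
    using ereal_dense2[of 1 ?I] assms(6) by (auto simp: one_ereal_def)
  obtain K :: nat where K: "?S < ereal (real K)" using less_PInf_Ex_of_nat[of ?S] assms(7) by auto
  \<comment> \<open>Evaluated at constant sequences, the infimum and the supremum over
    \<open>\<omega>\<close> bound the derivatives of each single map \<open>f y\<close>.\<close>
  have fm: "fibre_map f (\<lambda>_. y) = f y" for y by (simp add: fibre_map_def)
  have "pwx l (f y)" for y
  proof (rule pwx_of_piecewise_C2[OF assms(4) assms(3)])
    have "?I \<le> essinf leb (\<lambda>x. ereal \<bar>deriv (fibre_map f (\<lambda>_. y)) x\<bar>)" by (rule INF_lower) simp
    with l(2) have "ereal l < essinf leb (\<lambda>x. ereal \<bar>deriv (f y) x\<bar>)" unfolding fm by (rule less_le_trans)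
    then have "\<forall>\<^sub>F x in ae_filter leb. ereal l < ereal \<bar>deriv (f y) x\<bar>" unfolding essinf_def by (rule less_LiminfD)
    then show "AE x in leb. l \<le> \<bar>deriv (f y) x\<bar>" by (rule eventually_mono) simp
    have "esssup leb (\<lambda>x. ereal \<bar>deriv (deriv (fibre_map f (\<lambda>_. y))) x\<bar>) \<le> ?S" by (rule SUP_upper) simp
    then have "esssup leb (\<lambda>x. ereal \<bar>deriv (deriv (f y)) x\<bar>) \<le> ereal (real K)"
      unfolding fm using less_imp_le[OF K] by (rule order_trans)
    then have "ereal \<bar>deriv (deriv (f y)) x\<bar> \<le> esssup leb (\<lambda>x. ereal \<bar>deriv (deriv (f y)) x\<bar>) \<Longrightarrow> \<bar>deriv (deriv (f y)) x\<bar> \<le> real K" for x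
      using order_trans[of "ereal \<bar>deriv (deriv (f y)) x\<bar>" _ "ereal (real K)"] by simp
    with esssup_AE show "AE x in leb. \<bar>deriv (deriv (f y)) x\<bar> \<le> real K" by (rule eventually_mono)
  qed
  then interpret extremes f l p Q h g V W by unfold_locales (use l assms in auto)
  show ?thesis
  proof (intro conjI allI impI)
    show "MREPP_converges Q f h g \<tau> (\<lambda>u. inverse (\<eta> (ereal u))) 1 (\<lambda>x. if x < 0 then 0 else 1 - exp (- x))"
      if "obs_type1 g V W \<eta>" for \<eta>
      by (rule MREPP_limit[OF assms(13) tails_type1[OF that] mark_law_type1])
    show "MREPP_converges Q f h g \<tau> (\<lambda>u. inverse u) 1 (\<lambda>x. if x < 0 then 0 else 1 - (1 + x) powr (- \<beta>))"
      if "obs_type2 g V \<beta>" for \<beta>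
      using that by (intro MREPP_limit[OF assms(13) tails_type2[OF that] mark_law_type2]) (simp add: obs_type2_def)
    show "MREPP_converges Q f h g \<tau> (\<lambda>u. inverse (D - u)) 1 (\<lambda>x. if x < 0 then 0 else if x < 1 then 1 - (1 - x) powr \<gamma> else 1)"
      if "obs_type3 g V D \<gamma>" for D \<gamma>
      using that by (intro MREPP_limit[OF assms(13) tails_type3[OF that] mark_law_type3]) (simp add: obs_type3_def)
  qed
qed

end
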